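(* Let $1<p,s<\infty$, $n\ge2$, let $\Omega\subseteq\mathbb{R}^n$ be a domain, let $a=(a_1,\dots,a_n)$ be a weight vector and $V\in M^q_{\mathrm{loc}}(p;\Omega)$ as in the context. Let $A:\Omega\to\mathbb{R}^{n\times n}$ be a measurable matrix function such that (1) $A(x)$ is symmetric for almost all $x\in\Omega$; (2) for every domain $\omega\Subset\Omega$ there exist positive constants $\theta_{1,\omega},\theta_{2,\omega}$ such that for almost all $x\in\omega$ and all $\xi\in\mathbb{R}^n$, $\theta_{1,\omega}|\xi|\le|\xi|_A:=\sqrt{A(x)\xi\cdot\xi}\le\theta_{2,\omega}|\xi|$. Let $H(x,\xi)=\left(|\xi|_{s,a}^p+|\xi|_A^p\right)^{1/p}$ and suppose that the associated functional $Q$ satisfies $Q\ge0$ on $C_c^\infty(\Omega)$. Fix a positive solution $u\in W^{1,p}_{\mathrm{loc}}(\Omega)\cap C(\Omega)$ of the equation $Q'[v]=0$ in $\Omega$. Then for all $g\in L^1_{\mathrm{loc}}(\Omega)$, $g\in\mathcal{H}(\Omega)$ if and only if $\|g\|_u<\infty$. Moreover, there exists a positive constant $C$, depending only on $p,s,n$ if $p>s$ and only on $p,s$ if $p\le s$, such that for all $g\in\mathcal{H}(\Omega)$, $$\|g\|_u\le\|g\|_{\mathcal{H}}\le C\|g\|_u.$$ Furthermore, $(\mathcal{H}(\Omega),\|\cdot\|_u)$ is a Banach space.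
   Context: $\omega\Subset\Omega$ means that the closure of $\omega$ is a compact subset of $\Omega$. $C_c(\Omega)$: continuous functions with compact support in $\Omega$. Weights: $a_1,\dots,a_n:\Omega\to(0,\infty)$ are Lebesgue measurable and for every domain $\omega\Subset\Omega$ there are constants $0<c_\omega\le C_\omega<\infty$ with $c_\omega\le a_i\le C_\omega$ a.e. in $\omega$. $|\xi|_{s,a}=(\sum_i a_i(x)|\xi_i|^s)^{1/s}$. Morrey space: for a domain $\omega\Subset\Omega$ and measurable $f$ on $\omega$: if $p<n$ and $q>n/p$, $\|f\|_{M^q(p;\omega)}=\sup_{y\in\omega,\,0<r<\mathrm{diam}(\omega)}r^{-n/q'}\int_{\omega\cap B_r(y)}|f|\,dx$ with $q'=q/(q-1)$; if $p=n$ and $q>n$, $\|f\|_{M^q(n;\omega)}=\sup_{y\in\omega,\,0<r<\mathrm{diam}(\omega)}(\log(\mathrm{diam}(\omega)/r))^{q/n'}\int_{\omega\cap B_r(y)}|f|\,dx$ with $n'=n/(n-1)$; in these cases $M^q(p;\omega)$ is the set of $f\in L^1_{\mathrm{loc}}(\omega)$ with finite norm. If $p>n$, $q=1$ and $M^q(p;\omega)=L^1(\omega)$. $M^q_{\mathrm{loc}}(p;\Omega)$ consists of functions lying in $M^q(p;\omega)$ for all domains $\omega\Subset\Omega$. Functional: $Q[\phi]=\int_\Omega(H(x,\nabla\phi)^p+V|\phi|^p)\,dx$. With $\mathcal{A}(x,\xi)=\nabla_\xi\left(\tfrac1pH(x,\xi)^p\right)$, a positive solution of $Q'[v]=0$ in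 $\Omega$ is a positive $v\in W^{1,p}_{\mathrm{loc}}(\Omega)$ with $\int_\Omega\mathcal{A}(x,\nabla v)\cdot\nabla\phi\,dx+\int_\Omega V|v|^{p-2}v\phi\,dx=0$ for all $\phi\in C_c^\infty(\Omega)$. Hardy-weights: $g\in L^1_{\mathrm{loc}}(\Omega)$ is a Hardy-weight of $Q$ in $\Omega$ if there is $C>0$ with $Q[\phi]\ge C\int_\Omega|g||\phi|^p\,dx$ for all $\phi\in C_c^\infty(\Omega)$; $\mathcal{H}(\Omega)$ is the linear space of all Hardy-weights. For measurable $g$, $S_g=\inf\{Q[\phi]/\int_\Omega|g||\phi|^p\,dx:\phi\in W^{1,p}(\Omega)\cap C_c(\Omega),\ \int_\Omega|g||\phi|^p\,dx>0\}$ and $\|g\|_{\mathcal{H}}=1/S_g$ (with $1/0=\infty$, $1/\infty=0$). Capacity: for compact $K\subseteq\Omega$, $\mathrm{Cap}(K,u)=\inf\{Q[\phi]:\phi\in W^{1,p}(\Omega)\cap C_c(\Omega),\ \phi|_K\ge u\}$. For $g\in L^1_{\mathrm{loc}}(\Omega)$, $\|g\|_u=\inf\{L\in[0,\infty):\int_K|g||u|^p\,dx\le L\,\mathrm{Cap}(K,u)\text{ for all compact }K\subseteq\Omega\}$ (possibly $\infty$). *)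

theory Defs
  imports "HOL-Analysis.Analysis"
begin

text \<open>
  The theorem contains a constant that, for \<open>p \<le> s\<close>, must not depend on the dimension, so the
  dimension \<open>n\<close> is a natural number and not a type. A point of \<open>n\<close>-space is an element of
  \<open>{..<n} \<rightarrow>\<^sub>E UNIV\<close>; coordinates are numbered from \<open>0\<close>. Functions on a set \<open>\<Omega>\<close> are total HOL
  functions whose values off \<open>\<Omega>\<close> are never used. Of a vector \<open>\<xi>\<close> (a gradient, say)
  only the components \<open>\<xi> i\<close> with \<open>i < n\<close> are used. The metric of the type
  \<^typ>\<open>nat \<Rightarrow> real\<close> is not the Euclidean one and is never used.
\<close>

type_synonym vec = "nat \<Rightarrow> real"

abbreviation Rn :: "nat \<Rightarrow> vec topology" where
  "Rn n \<equiv> powertop_real {..<n}"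

definition leb :: "nat \<Rightarrow> vec measure" where
  "leb n = completion (PiM {..<n} (\<lambda>_. lborel))"

definition enorm :: "nat \<Rightarrow> vec \<Rightarrow> real" where
  "enorm n \<xi> = L2_set \<xi> {..<n}"

definition ball_in :: "nat \<Rightarrow> vec set \<Rightarrow> vec \<Rightarrow> real \<Rightarrow> vec set" where
  "ball_in n \<omega> y r = {x \<in> \<omega>. enorm n (\<lambda>i. x i - y i) < r}"

definition diam :: "nat \<Rightarrow> vec set \<Rightarrow> real" where
  "diam n \<omega> = (SUP (x, y) \<in> \<omega> \<times> \<omega>. enorm n (\<lambda>i. x i - y i))"

definition is_domain :: "nat \<Rightarrow> vec set \<Rightarrow> bool" where
  "is_domain n \<Omega> \<longleftrightarrow> \<Omega> \<noteq> {} \<and> openin (Rn n) \<Omega> \<and> connectedin (Rn n) \<Omega>"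

definition compactly_inside :: "nat \<Rightarrow> vec set \<Rightarrow> vec set \<Rightarrow> bool" where
  "compactly_inside n \<omega> \<Omega> \<longleftrightarrow>
     compactin (Rn n) (Rn n closure_of \<omega>) \<and> Rn n closure_of \<omega> \<subseteq> \<Omega>"

definition cont :: "nat \<Rightarrow> vec set \<Rightarrow> (vec \<Rightarrow> real) \<Rightarrow> bool" where
  "cont n \<Omega> f \<longleftrightarrow> continuous_map (subtopology (Rn n) \<Omega>) euclideanreal f"

definition compactly_supported :: "nat \<Rightarrow> vec set \<Rightarrow> (vec \<Rightarrow> real) \<Rightarrow> bool" where
  "compactly_supported n \<Omega> f \<longleftrightarrow> compactly_inside n {x \<in> \<Omega>. f x \<noteq> 0} \<Omega>"

definition Cc :: "nat \<Rightarrow> vec set \<Rightarrow> (vec \<Rightarrow> real) set" where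
  "Cc n \<Omega> = {f. cont n \<Omega> f \<and> compactly_supported n \<Omega> f}"

definition partial :: "nat \<Rightarrow> (vec \<Rightarrow> real) \<Rightarrow> vec \<Rightarrow> real" where
  "partial i f x = deriv (\<lambda>t. f (x(i := t))) (x i)"

definition smooth :: "nat \<Rightarrow> vec set \<Rightarrow> (vec \<Rightarrow> real) \<Rightarrow> bool" where
  "smooth n \<Omega> f \<longleftrightarrow>
     (\<forall>js \<in> lists {..<n}.
        cont n \<Omega> (foldr partial js f) \<and>
        (\<forall>x\<in>\<Omega>. \<forall>i<n. (\<lambda>t. foldr partial js f (x(i := t))) differentiable at (x i)))"

definition Cc_smooth :: "nat \<Rightarrow> vec set \<Rightarrow> (vec \<Rightarrow> real) set" where
  "Cc_smooth n \<Omega> = {f. smooth n \<Omega> f \<and> compactly_supported n \<Omega> f}"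

definition L1_loc :: "nat \<Rightarrow> vec set \<Rightarrow> (vec \<Rightarrow> real) set" where
  "L1_loc n \<Omega> = {f. \<forall>K. compactin (Rn n) K \<and> K \<subseteq> \<Omega> \<longrightarrow> set_integrable (leb n) K f}"

definition Lp :: "nat \<Rightarrow> real \<Rightarrow> vec set \<Rightarrow> (vec \<Rightarrow> real) set" where
  "Lp n p \<Omega> = {f. set_borel_measurable (leb n) \<Omega> f \<and>
                  set_integrable (leb n) \<Omega> (\<lambda>x. \<bar>f x\<bar> powr p)}"

definition has_weak_grad :: "nat \<Rightarrow> vec set \<Rightarrow> (vec \<Rightarrow> real) \<Rightarrow> (vec \<Rightarrow> vec) \<Rightarrow> bool" where
  "has_weak_grad n \<Omega> f G \<longleftrightarrow>
     f \<in> L1_loc n \<Omega> \<and>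
     (\<forall>i<n. (\<lambda>x. G x i) \<in> L1_loc n \<Omega> \<and>
        (\<forall>\<phi> \<in> Cc_smooth n \<Omega>.
           (LINT x:\<Omega>|leb n. f x * partial i \<phi> x) = - (LINT x:\<Omega>|leb n. G x i * \<phi> x)))"

text \<open>Determined only up to null sets; it is used under integrals over \<open>\<Omega>\<close> only.\<close>

definition weak_grad :: "nat \<Rightarrow> vec set \<Rightarrow> (vec \<Rightarrow> real) \<Rightarrow> vec \<Rightarrow> vec" where
  "weak_grad n \<Omega> f = (SOME G. has_weak_grad n \<Omega> f G)"

definition W1p :: "nat \<Rightarrow> real \<Rightarrow> vec set \<Rightarrow> (vec \<Rightarrow> real) set" where
  "W1p n p \<Omega> = {f \<in> Lp n p \<Omega>. \<exists>G. has_weak_grad n \<Omega> f G \<and> (\<forall>i<n. (\<lambda>x. G x i) \<in> Lp n p \<Omega>)}"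

definition W1p_loc :: "nat \<Rightarrow> real \<Rightarrow> vec set \<Rightarrow> (vec \<Rightarrow> real) set" where
  "W1p_loc n p \<Omega> = {f. \<forall>\<omega>. is_domain n \<omega> \<and> compactly_inside n \<omega> \<Omega> \<longrightarrow> f \<in> W1p n p \<omega>}"


definition weight_vector :: "nat \<Rightarrow> vec set \<Rightarrow> (nat \<Rightarrow> vec \<Rightarrow> real) \<Rightarrow> bool" where
  "weight_vector n \<Omega> a \<longleftrightarrow>
     (\<forall>i<n. set_borel_measurable (leb n) \<Omega> (a i) \<and> (\<forall>x\<in>\<Omega>. 0 < a i x)) \<and>
     (\<forall>\<omega>. is_domain n \<omega> \<and> compactly_inside n \<omega> \<Omega> \<longrightarrow>
        (\<exists>c C. 0 < c \<and> c \<le> C \<and>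
           (\<forall>i<n. AE x in leb n. x \<in> \<omega> \<longrightarrow> c \<le> a i x \<and> a i x \<le> C)))"

definition norm_sa :: "nat \<Rightarrow> real \<Rightarrow> (nat \<Rightarrow> vec \<Rightarrow> real) \<Rightarrow> vec \<Rightarrow> vec \<Rightarrow> real" where
  "norm_sa n s a x \<xi> = (\<Sum>i<n. a i x * \<bar>\<xi> i\<bar> powr s) powr (1 / s)"

definition norm_A :: "nat \<Rightarrow> (vec \<Rightarrow> nat \<Rightarrow> nat \<Rightarrow> real) \<Rightarrow> vec \<Rightarrow> vec \<Rightarrow> real" where
  "norm_A n A x \<xi> = sqrt (\<Sum>i<n. (\<Sum>j<n. A x i j * \<xi> j) * \<xi> i)"

definition elliptic_matrix :: "nat \<Rightarrow> vec set \<Rightarrow> (vec \<Rightarrow> nat \<Rightarrow> nat \<Rightarrow> real) \<Rightarrow> bool" where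
  "elliptic_matrix n \<Omega> A \<longleftrightarrow>
     (\<forall>i<n. \<forall>j<n. set_borel_measurable (leb n) \<Omega> (\<lambda>x. A x i j)) \<and>
     (AE x in leb n. x \<in> \<Omega> \<longrightarrow> (\<forall>i<n. \<forall>j<n. A x i j = A x j i)) \<and>
     (\<forall>\<omega>. is_domain n \<omega> \<and> compactly_inside n \<omega> \<Omega> \<longrightarrow>
        (\<exists>\<theta>1 \<theta>2. 0 < \<theta>1 \<and> 0 < \<theta>2 \<and>
           (AE x in leb n. x \<in> \<omega> \<longrightarrow>
              (\<forall>\<xi>. \<theta>1 * enorm n \<xi> \<le> norm_A n A x \<xi> \<and> norm_A n A x \<xi> \<le> \<theta>2 * enorm n \<xi>))))"

definition H_fun :: "nat \<Rightarrow> real \<Rightarrow> real \<Rightarrow> (nat \<Rightarrow> vec \<Rightarrow> real) \<Rightarrow> (vec \<Rightarrow> nat \<Rightarrow> nat \<Rightarrow> real) \<Rightarrow>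
    vec \<Rightarrow> vec \<Rightarrow> real" where
  "H_fun n p s a A x \<xi> = (norm_sa n s a x \<xi> powr p + norm_A n A x \<xi> powr p) powr (1 / p)"


definition morrey_exponent :: "nat \<Rightarrow> real \<Rightarrow> real \<Rightarrow> bool" where
  "morrey_exponent n p q \<longleftrightarrow>
     (p < real n \<longrightarrow> q > real n / p) \<and> (p = real n \<longrightarrow> q > real n) \<and> (p > real n \<longrightarrow> q = 1)"

text \<open>Meaningful for \<open>p \<le> n\<close> only; \<open>q / (q - 1)\<close> and \<open>n / (n - 1)\<close> are the conjugate exponents.\<close>

definition morrey_norm :: "nat \<Rightarrow> real \<Rightarrow> real \<Rightarrow> vec set \<Rightarrow> (vec \<Rightarrow> real) \<Rightarrow> ennreal" where
  "morrey_norm n p q \<omega> f =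
     (SUP y\<in>\<omega>. SUP r\<in>{0<..<diam n \<omega>}.
        ennreal (if p < real n then r powr (- (real n / (q / (q - 1))))
                 else ln (diam n \<omega> / r) powr (q / (real n / (real n - 1)))) *
        (\<integral>\<^sup>+x\<in>ball_in n \<omega> y r. ennreal \<bar>f x\<bar> \<partial>leb n))"

definition morrey :: "nat \<Rightarrow> real \<Rightarrow> real \<Rightarrow> vec set \<Rightarrow> (vec \<Rightarrow> real) set" where
  "morrey n p q \<omega> =
     (if p > real n then {f. set_integrable (leb n) \<omega> f}
      else {f \<in> L1_loc n \<omega>. morrey_norm n p q \<omega> f < \<infinity>})"

definition morrey_loc :: "nat \<Rightarrow> real \<Rightarrow> real \<Rightarrow> vec set \<Rightarrow> (vec \<Rightarrow> real) set" where
  "morrey_loc n p q \<Omega> =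
     {f. \<forall>\<omega>. is_domain n \<omega> \<and> compactly_inside n \<omega> \<Omega> \<longrightarrow> f \<in> morrey n p q \<omega>}"


definition Q_fun :: "nat \<Rightarrow> real \<Rightarrow> (vec \<Rightarrow> vec \<Rightarrow> real) \<Rightarrow> (vec \<Rightarrow> real) \<Rightarrow> vec set \<Rightarrow>
    (vec \<Rightarrow> real) \<Rightarrow> real" where
  "Q_fun n p H V \<Omega> \<phi> =
     (LINT x:\<Omega>|leb n. H x (weak_grad n \<Omega> \<phi> x) powr p + V x * \<bar>\<phi> x\<bar> powr p)"

definition A_field :: "real \<Rightarrow> (vec \<Rightarrow> vec \<Rightarrow> real) \<Rightarrow> vec \<Rightarrow> vec \<Rightarrow> vec" where
  "A_field p H x \<xi> i = partial i (\<lambda>\<eta>. 1 / p * H x \<eta> powr p) \<xi>"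

definition positive_solution :: "nat \<Rightarrow> real \<Rightarrow> (vec \<Rightarrow> vec \<Rightarrow> real) \<Rightarrow> (vec \<Rightarrow> real) \<Rightarrow> vec set \<Rightarrow>
    (vec \<Rightarrow> real) \<Rightarrow> bool" where
  "positive_solution n p H V \<Omega> v \<longleftrightarrow>
     v \<in> W1p_loc n p \<Omega> \<and> (\<forall>x\<in>\<Omega>. 0 < v x) \<and>
     (\<forall>\<phi> \<in> Cc_smooth n \<Omega>.
        (LINT x:\<Omega>|leb n. \<Sum>i<n. A_field p H x (weak_grad n \<Omega> v x) i * partial i \<phi> x) +
        (LINT x:\<Omega>|leb n. V x * \<bar>v x\<bar> powr (p - 2) * v x * \<phi> x) = 0)"


definition mass :: "nat \<Rightarrow> real \<Rightarrow> vec set \<Rightarrow> (vec \<Rightarrow> real) \<Rightarrow> (vec \<Rightarrow> real) \<Rightarrow> ereal" where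
  "mass n p S g f = enn2ereal (\<integral>\<^sup>+x\<in>S. ennreal (\<bar>g x\<bar> * \<bar>f x\<bar> powr p) \<partial>leb n)"

definition hardy_space :: "nat \<Rightarrow> real \<Rightarrow> (vec \<Rightarrow> vec \<Rightarrow> real) \<Rightarrow> (vec \<Rightarrow> real) \<Rightarrow> vec set \<Rightarrow>
    (vec \<Rightarrow> real) set" where
  "hardy_space n p H V \<Omega> =
     {g \<in> L1_loc n \<Omega>. \<exists>C>0. \<forall>\<phi> \<in> Cc_smooth n \<Omega>.
        ereal (Q_fun n p H V \<Omega> \<phi>) \<ge> ereal C * mass n p \<Omega> g \<phi>}"

definition S_const :: "nat \<Rightarrow> real \<Rightarrow> (vec \<Rightarrow> vec \<Rightarrow> real) \<Rightarrow> (vec \<Rightarrow> real) \<Rightarrow> vec set \<Rightarrow>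
    (vec \<Rightarrow> real) \<Rightarrow> ereal" where
  "S_const n p H V \<Omega> g =
     (INF \<phi> \<in> {\<phi> \<in> W1p n p \<Omega> \<inter> Cc n \<Omega>. mass n p \<Omega> g \<phi> > 0}.
        ereal (Q_fun n p H V \<Omega> \<phi>) / mass n p \<Omega> g \<phi>)"

text \<open>In \<^typ>\<open>ereal\<close>, \<open>1 / 0 = \<infinity>\<close> and \<open>1 / \<infinity> = 0\<close>.\<close>

definition hardy_norm :: "nat \<Rightarrow> real \<Rightarrow> (vec \<Rightarrow> vec \<Rightarrow> real) \<Rightarrow> (vec \<Rightarrow> real) \<Rightarrow> vec set \<Rightarrow>
    (vec \<Rightarrow> real) \<Rightarrow> ereal" where
  "hardy_norm n p H V \<Omega> g = 1 / S_const n p H V \<Omega> g"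

definition Cap :: "nat \<Rightarrow> real \<Rightarrow> (vec \<Rightarrow> vec \<Rightarrow> real) \<Rightarrow> (vec \<Rightarrow> real) \<Rightarrow> vec set \<Rightarrow>
    vec set \<Rightarrow> (vec \<Rightarrow> real) \<Rightarrow> ereal" where
  "Cap n p H V \<Omega> K u =
     (INF \<phi> \<in> {\<phi> \<in> W1p n p \<Omega> \<inter> Cc n \<Omega>. \<forall>x\<in>K. \<phi> x \<ge> u x}. ereal (Q_fun n p H V \<Omega> \<phi>))"

definition u_norm :: "nat \<Rightarrow> real \<Rightarrow> (vec \<Rightarrow> vec \<Rightarrow> real) \<Rightarrow> (vec \<Rightarrow> real) \<Rightarrow> vec set \<Rightarrow>
    (vec \<Rightarrow> real) \<Rightarrow> (vec \<Rightarrow> real) \<Rightarrow> ereal" where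
  "u_norm n p H V \<Omega> u g =
     Inf {ereal L | L. 0 \<le> L \<and>
            (\<forall>K. compactin (Rn n) K \<and> K \<subseteq> \<Omega> \<longrightarrow>
               mass n p K g u \<le> ereal L * Cap n p H V \<Omega> K u)}"

text \<open>
  \<open>X\<close> with \<open>N\<close> is a Banach space of measurable functions on \<open>\<Omega>\<close>, where functions that agree
  almost everywhere on \<open>\<Omega>\<close> are identified. The conditions are stated for representatives; the
  fourth one says that \<open>X\<close> is saturated under the identification and \<open>N\<close> is well defined on the
  classes.
\<close>

definition is_banach_space :: "'x measure \<Rightarrow> 'x set \<Rightarrow> ('x \<Rightarrow> real) set \<Rightarrow>
    (('x \<Rightarrow> real) \<Rightarrow> ereal) \<Rightarrow> bool" where
  "is_banach_space M \<Omega> X N \<longleftrightarrow>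
     (\<lambda>x. 0) \<in> X \<and>
     (\<forall>f\<in>X. \<forall>g\<in>X. (\<lambda>x. f x + g x) \<in> X) \<and>
     (\<forall>c. \<forall>f\<in>X. (\<lambda>x. c * f x) \<in> X) \<and>
     (\<forall>f\<in>X. \<forall>g. (AE x in M. x \<in> \<Omega> \<longrightarrow> f x = g x) \<longrightarrow> g \<in> X \<and> N g = N f) \<and>
     (\<forall>f\<in>X. 0 \<le> N f \<and> N f < \<infinity>) \<and>
     (\<forall>f\<in>X. N f = 0 \<longleftrightarrow> (AE x in M. x \<in> \<Omega> \<longrightarrow> f x = 0)) \<and>
     (\<forall>c. \<forall>f\<in>X. N (\<lambda>x. c * f x) = ereal \<bar>c\<bar> * N f) \<and>
     (\<forall>f\<in>X. \<forall>g\<in>X. N (\<lambda>x. f x + g x) \<le> N f + N g) \<and>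
     (\<forall>F :: nat \<Rightarrow> 'x \<Rightarrow> real.
        (\<forall>k. F k \<in> X) \<and>
        (\<forall>\<epsilon>>0. \<exists>k0. \<forall>j\<ge>k0. \<forall>k\<ge>k0. N (\<lambda>x. F j x - F k x) < ereal \<epsilon>) \<longrightarrow>
        (\<exists>f\<in>X. (\<lambda>k. N (\<lambda>x. F k x - f x)) \<longlonglongrightarrow> 0))"

end

theory Submission
  imports Defs "HOL-Real_Asymp.Real_Asymp"
begin

text \<open>
 Let \<open>v = \<phi> / u\<close> for a test function \<open>\<phi>\<close>. Testing the equation of \<open>u\<close> with \<open>\<bar>\<phi>\<bar>\<^sup>p u\<^bsup>1-p\<^esup>\<close> gives
 Picone's identity: \<open>Q[\<phi>]\<close> is the integral of \<open>D(\<nabla>\<phi>, v \<nabla>u)\<close>, where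
 \<open>D(\<xi>, b) = F(\<xi>) + (p - 1) F(b) - p A(b) \<cdot> \<xi> \<ge> 0\<close> is the Bregman distance of \<open>F = H\<^sup>p\<close>. For \<open>T = 2\<^sup>j\<close> the
 truncations \<open>u \<psi>\<^sub>T(v)\<close> compete for the capacity of \<open>{v\<^sup>2 \<ge> 2 T}\<close>, and \<open>Q\<close> of such a truncation is at most
 \<open>C T\<^bsup>-p/2\<^esup>\<close> times the integral of \<open>D(\<nabla>\<phi>, v \<nabla>u)\<close> over the strip \<open>{T < v\<^sup>2 < 2 T}\<close>; the sum over \<open>j\<close>
 bounds the weighted mass of \<open>\<phi>\<close> by \<open>C \<parallel>g\<parallel>\<^sub>u Q[\<phi>]\<close>. The only property of \<open>D\<close> that enters is the
 doubling inequality \<open>D(b + 2 e, b) \<le> c D(b + e, b)\<close>. It is an inequality between real numbers for each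
 coordinate of the \<open>s\<close>-norm, it is trivial for a quadratic form, and it passes from the exponents \<open>s\<close> and
 \<open>2\<close> to \<open>p\<close>; hence \<open>C\<close> depends on \<open>p\<close> and \<open>s\<close> only. The norm \<open>\<parallel>\<cdot>\<parallel>\<^sub>u\<close> dominates weighted \<open>L\<^sup>1\<close> norms on
 compact sets, so completeness follows from Fatou's lemma.
\<close>

section \<open>Euclidean space and its compact sets\<close>

text \<open>Why doubling passes from \<open>s\<close> to \<open>p\<close>: as long as
  \<open>e\<close> is not large compared with \<open>b\<close>, the Bregman distances of
  \<open>\<nu>\<^sup>p\<close> and \<open>\<nu>\<^sup>s\<close> are comparable, for each is a gap of
  quadratic size in the norm plus a multiple of one common linear gap; when \<open>e\<close> is
  large, the distance is of the order of the p-th power of the norm of \<open>e\<close>.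
  \<open>D(b + e, b)\<close> is not homogeneous in \<open>e\<close>, so a factor in front of
  \<open>e\<close> is paid for by repeated doubling. The gradient of \<open>u \<psi>(v)\<close> is
  \<open>\<psi> \<nabla>u + \<psi>' (\<nabla>\<phi> - v \<nabla>u)\<close>; after rescaling it lies
  on the line through the two arguments of \<open>D\<close>, hence only the behaviour of
  \<open>D\<close> along such lines matters. Levels are measured by \<open>v\<^sup>2\<close>, which
  is smooth and even, so that \<open>\<phi>\<close> may change sign. If \<open>2\<^sup>m\<close>
  bounds the doubling constants, then \<open>C\<close> is
  \<open>2\<^sup>p (16 max(2, m))\<^sup>m\<close>. Neither Picone's test function nor the
  truncations are smooth, while the equation and the definition of Hardy weights speak of smooth
  functions; mollification and a chain rule for weak gradients close this gap.\<close>

definition En :: "nat => vec set" where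
 "En n = {..<n} \<rightarrow>\<^sub>E UNIV"

lemma topspace_Rn: "topspace (Rn n) = En n"
 by (simp add: En_def)

lemma in_En: "x \<in> En n \<longleftrightarrow> (\<forall>i\<ge>n. x i = undefined)"
 by (auto simp: En_def PiE_iff extensional_def)

lemma closed_En: "closed (En n)"
proof -
 have "En n = (\<Inter>i\<in>{n..}. {x. x i = undefined})"
  by (auto simp: in_En)
 moreover have "closed (\<Inter>i\<in>{n..}. {x::vec. x i = undefined})"
  by (intro closed_INT ballI closed_Collect_eq continuous_on_product_coordinates continuous_on_const)
 ultimately show ?thesis by simp
qed

text \<open>Restriction to \<open>{..<n}\<close> is continuous and fixes \<open>En n\<close>
  pointwise, and the inclusion is continuous because the coordinates from \<open>n\<close> on are
  constant there. Topological arguments can thus use \<open>compact\<close>, \<open>closure\<close>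
  and \<open>continuous_on\<close> of the ambient product space.\<close>

lemma Rn_eq: "Rn n = top_of_set (En n)"
proof (rule topology_eq[THEN iffD2], intro allI iffI)
 fix S assume S: "openin (Rn n) S"
 have c: "continuous_map euclidean (Rn n) (\<lambda>x. restrict x {..<n})"
  by (auto simp: continuous_map_componentwise intro: continuous_on_product_coordinates)
 have "openin euclidean {x \<in> topspace euclidean. restrict x {..<n} \<in> S}"
  by (rule openin_continuous_map_preimage[OF c S])
 hence "open {x. restrict x {..<n} \<in> S}" by simp
 moreover have "S = En n \<inter> {x. restrict x {..<n} \<in> S}"
  using openin_subset[OF S] by (auto simp: En_def PiE_restrict)
 ultimately show "openin (top_of_set (En n)) S"
  by (metis openin_open)
next
 fix S assume "openin (top_of_set (En n)) S"
 then obtain T where T: "open T" "S = En n \<inter> T" by (auto simp: openin_open)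
 have "continuous_map (Rn n) (product_topology (\<lambda>i. euclidean) UNIV) (\<lambda>x. x)"
  unfolding continuous_map_componentwise
 proof (intro conjI ballI)
  fix k :: nat
  show "continuous_map (Rn n) euclidean (\<lambda>x. x k)"
  proof (cases "k < n")
   case True thus ?thesis by (auto intro: continuous_map_product_projection)
  next
   case False
   have "continuous_map (Rn n) euclidean (\<lambda>x. undefined :: real)" by simp
   thus ?thesis
    by (rule continuous_map_eq) (use False in \<open>simp add: PiE_iff extensional_def\<close>)
  qed
 qed auto
 hence "continuous_map (Rn n) euclidean (\<lambda>x. x)" by (simp add: euclidean_product_topology)
 from openin_continuous_map_preimage[OF this, of T] T
 have "openin (Rn n) {x \<in> topspace (Rn n). x \<in> T}" by simp
 moreover have "{x \<in> topspace (Rn n). x \<in> T} = S" unfolding T(2) topspace_Rn by (rule Int_def[symmetric])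
 ultimately show "openin (Rn n) S" by (simp only:)
qed

lemma openin_Rn: "openin (Rn n) U \<longleftrightarrow> (\<exists>T. open T \<and> U = T \<inter> En n)"
 unfolding Rn_eq openin_open by (simp only: Int_commute)

lemma compactin_Rn: "compactin (Rn n) K \<longleftrightarrow> compact K \<and> K \<subseteq> En n"
 unfolding Rn_eq by (simp add: compactin_subtopology)

lemma openin_Rn_subset: "openin (Rn n) U ==> U \<subseteq> En n"
 unfolding openin_Rn by blast

lemma cont_iff: "U \<subseteq> En n ==> cont n U f \<longleftrightarrow> continuous_on U f"
 by (simp add: cont_def Rn_eq subtopology_subtopology Int_absorb1)

lemma closure_of_Rn: "S \<subseteq> En n ==> Rn n closure_of S = closure S"
 using closure_minimal[OF _ closed_En] unfolding Rn_eq by (simp add: closure_of_subtopology Int_absorb1)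

lemma compactly_inside_iff:
 assumes "S \<subseteq> En n"
 shows "compactly_inside n S U \<longleftrightarrow> compact (closure S) \<and> closure S \<subseteq> U"
 using closure_minimal[OF assms closed_En]
 unfolding compactly_inside_def closure_of_Rn[OF assms] compactin_Rn by simp

text \<open>Trades the closure for any compact set in between, which is the form in which supports
  are carried later.\<close>

lemma compactly_inside_iff_ex:
 assumes "S \<subseteq> En n" "U \<subseteq> En n"
 shows "compactly_inside n S U \<longleftrightarrow> (\<exists>K. compactin (Rn n) K \<and> K \<subseteq> U \<and> S \<subseteq> K)"
proof
 assume "compactly_inside n S U"
 thus "\<exists>K. compactin (Rn n) K \<and> K \<subseteq> U \<and> S \<subseteq> K"
  using assms closure_subset[of S] closure_minimal[OF assms(1) closed_En]
  unfolding compactly_inside_iff[OF assms(1)] compactin_Rn by blast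
next
 assume "\<exists>K. compactin (Rn n) K \<and> K \<subseteq> U \<and> S \<subseteq> K"
 then obtain K where K: "compact K" "K \<subseteq> U" "S \<subseteq> K" by (auto simp: compactin_Rn)
 hence "closure S \<subseteq> K" by (simp add: closure_minimal compact_imp_closed)
 with K show "compactly_inside n S U"
  unfolding compactly_inside_iff[OF assms(1)] using compact_Int_closed[OF K(1) closed_closure[of S]] by (simp add: Int_absorb1)
qed

text \<open>Cubes rather than balls, because the mollification kernel is a product of one-variable
  kernels and is supported in a cube.\<close>

definition nbox :: "nat => vec => real => vec set" where
 "nbox n x r = {y \<in> En n. \<forall>i<n. \<bar>y i - x i\<bar> < r}"

definition ncbox :: "nat => vec => real => vec set" where
 "ncbox n x r = {y \<in> En n. \<forall>i<n. \<bar>y i - x i\<bar> \<le> r}"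

lemma nbox_eq_PiE: "nbox n x r = (\<Pi>\<^sub>E i\<in>{..<n}. {x i - r <..< x i + r})"
 unfolding nbox_def En_def by (rule set_eqI) (simp add: PiE_iff abs_diff_less_iff Ball_def conj_commute)

lemma ncbox_eq_PiE: "ncbox n x r = (\<Pi>\<^sub>E i\<in>{..<n}. {x i - r .. x i + r})"
 unfolding ncbox_def En_def by (rule set_eqI) (simp add: PiE_iff abs_diff_le_iff Ball_def conj_commute)

lemma nbox_mono: "r \<le> r' ==> nbox n x r \<subseteq> nbox n x r'"
 by (force simp: nbox_def)

lemma nbox_subset_ncbox: "nbox n x r \<subseteq> ncbox n x r"
 by (force simp: nbox_def ncbox_def)

lemma nbox_centre: "x \<in> En n ==> 0 < r ==> x \<in> nbox n x r"
 by (auto simp: nbox_def)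

lemma openin_nbox: "openin (Rn n) (nbox n x r)"
 unfolding nbox_eq_PiE by (rule openin_PiE_gen[THEN iffD2]) auto

lemma connectedin_nbox: "connectedin (Rn n) (nbox n x r)"
 unfolding nbox_eq_PiE by (simp add: connectedin_PiE)

lemma compactin_ncbox: "compactin (Rn n) (ncbox n x r)"
 unfolding ncbox_eq_PiE by (simp add: compactin_PiE)

lemma openin_contains_nbox:
 assumes "openin (Rn n) U" "x \<in> U"
 obtains r where "r > 0" "ncbox n x r \<subseteq> U"
proof -
 from assms obtain V where V: "!!i. i < n ==> open (V i)" "x \<in> Pi\<^sub>E {..<n} V" "Pi\<^sub>E {..<n} V \<subseteq> U"
  unfolding openin_product_topology_alt by (auto simp: ) (metis lessThan_iff)
 have "\<forall>i\<in>{..<n}. \<exists>r>0. \<forall>t. \<bar>t - x i\<bar> \<le> r --> t \<in> V i"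
 proof
  fix i assume "i \<in> {..<n}"
  hence "open (V i)" "x i \<in> V i" using V by (auto simp: PiE_iff)
  then obtain e where "e > 0" "cball (x i) e \<subseteq> V i"
   using open_contains_cball[of "V i"] by blast
  thus "\<exists>r>0. \<forall>t. \<bar>t - x i\<bar> \<le> r --> t \<in> V i"
   by (intro exI[of _ e]) (auto simp: dist_real_def subset_iff abs_minus_commute)
 qed
 then obtain r where r: "!!i. i < n ==> r i > 0 \<and> (\<forall>t. \<bar>t - x i\<bar> \<le> r i --> t \<in> V i)"
  by (metis lessThan_iff)
 \<comment> \<open>The 1 keeps the set nonempty when \<open>n = 0\<close>.\<close>
 define d where "d = Min (insert 1 (r ` {..<n}))"
 have d: "d > 0" "!!i. i < n ==> d \<le> r i" unfolding d_def using r by auto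
 have "ncbox n x d \<subseteq> Pi\<^sub>E {..<n} V"
 proof
  fix y assume y: "y \<in> ncbox n x d"
  have "y i \<in> V i" if "i < n" for i
  proof -
   have "\<bar>y i - x i\<bar> \<le> r i" using y d(2)[OF that] that by (force simp: ncbox_def)
   thus ?thesis using r[OF that] by blast
  qed
  thus "y \<in> Pi\<^sub>E {..<n} V" using y by (simp add: ncbox_def PiE_iff En_def)
 qed
 thus ?thesis using V(3) by (intro that[OF d(1)]) (rule subset_trans)
qed

lemma compactin_nbox_cover:
 assumes "compactin (Rn n) K" "!!x. x \<in> K ==> r x > 0"
 obtains F where "finite F" "F \<subseteq> K" "K \<subseteq> (\<Union>x\<in>F. nbox n x (r x))"
proof -
 have sub: "K \<subseteq> En n" using assms(1) by (simp add: compactin_Rn)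
 have "K \<subseteq> \<Union>((\<lambda>x. nbox n x (r x)) ` K)"
  using sub assms(2) by (auto intro!: nbox_centre)
 moreover have "\<forall>U \<in> (\<lambda>x. nbox n x (r x)) ` K. openin (Rn n) U" by (auto simp: openin_nbox)
 ultimately obtain \<F> where "finite \<F>" "\<F> \<subseteq> (\<lambda>x. nbox n x (r x)) ` K" "K \<subseteq> \<Union>\<F>"
  using assms(1) unfolding compactin_def by meson
 then obtain F where "finite F" "F \<subseteq> K" "\<F> = (\<lambda>x. nbox n x (r x)) ` F"
  by (metis finite_subset_image)
 thus ?thesis using that \<open>K \<subseteq> \<Union>\<F>\<close> by blast
qed

text \<open>The Lebesgue number argument for any property inherited by subsets: finitely many cubes
  of half the local size cover \<open>K\<close>, and a cube of the smallest half size around a point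
  of \<open>K\<close> stays inside one of the full cubes.\<close>

lemma Lebesgue_number_nbox:
 assumes K: "compactin (Rn n) K"
  and ex: "!!x. x \<in> K ==> \<exists>r>0. P (nbox n x r)"
  and anti: "!!A B. P B ==> A \<subseteq> B ==> P A"
 obtains r where "r > 0" "!!x. x \<in> K ==> P (nbox n x r)"
proof -
 from ex obtain R where R: "!!x. x \<in> K ==> R x > 0 \<and> P (nbox n x (R x))" by metis
 obtain F where F: "finite F" "F \<subseteq> K" "K \<subseteq> (\<Union>x\<in>F. nbox n x (R x / 2))"
  using compactin_nbox_cover[OF K, of "\<lambda>x. R x / 2"] R by auto
 define r where "r = Min (insert 1 ((\<lambda>x. R x / 2) ` F))"
 have r: "r > 0" using F R unfolding r_def by auto
 have r2: "r \<le> R x / 2" if "x \<in> F" for x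
  unfolding r_def using F(1) that by (intro Min_le) auto
 have "P (nbox n x r)" if "x \<in> K" for x
 proof -
  obtain z where z: "z \<in> F" "x \<in> nbox n z (R z / 2)" using F \<open>x \<in> K\<close> by blast
  have "nbox n x r \<subseteq> nbox n z (R z)"
  proof
   fix y assume y: "y \<in> nbox n x r"
   have "\<bar>y i - z i\<bar> < R z" if "i < n" for i
   proof -
    have "\<bar>y i - x i\<bar> < r" "\<bar>x i - z i\<bar> < R z / 2" using y z that by (auto simp: nbox_def)
    thus ?thesis using r2[OF z(1)] by linarith
   qed
   thus "y \<in> nbox n z (R z)" using y by (auto simp: nbox_def)
  qed
  thus ?thesis using anti R z F by blast
 qed
 thus ?thesis by (rule that[OF r])
qed

text \<open>The margin \<open>r\<close> is room for mollification: at scales below \<open>r\<close>,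
  mollified values on \<open>K\<close> depend only on values on the compact set
  \<open>K'\<close>.\<close>

lemma compactin_thickening:
 assumes K: "compactin (Rn n) K" and U: "openin (Rn n) U" "K \<subseteq> U"
 obtains r K' where "r > 0" "compactin (Rn n) K'" "K' \<subseteq> U" "!!x. x \<in> K ==> nbox n x r \<subseteq> K'"
proof -
 have "\<exists>r>0. ncbox n x r \<subseteq> U" if "x \<in> K" for x
  using openin_contains_nbox[OF U(1), of x] that U(2) by blast
 then obtain R where R: "!!x. x \<in> K ==> R x > 0 \<and> ncbox n x (R x) \<subseteq> U" by metis
 obtain F where F: "finite F" "F \<subseteq> K" "K \<subseteq> (\<Union>x\<in>F. nbox n x (R x))"
  using compactin_nbox_cover[OF K, of R] R by auto
 define K' where "K' = (\<Union>x\<in>F. ncbox n x (R x))"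
 have K': "compactin (Rn n) K'" unfolding K'_def using F by (intro compactin_Union) (auto simp: compactin_ncbox)
 have ex: "\<exists>r>0. nbox n x r \<subseteq> K'" if x: "x \<in> K" for x
 proof -
  obtain z where z: "z \<in> F" "x \<in> nbox n z (R z)" using F x by blast
  obtain r where "r > 0" "ncbox n x r \<subseteq> nbox n z (R z)"
   using openin_contains_nbox[OF openin_nbox z(2)] by blast
  moreover have "nbox n z (R z) \<subseteq> K'"
   using z(1) nbox_subset_ncbox[of n z "R z"] unfolding K'_def by (meson UN_upper order_trans)
  ultimately show ?thesis using nbox_subset_ncbox[of n x r] by (meson order_trans)
 qed
 obtain r where r: "r > 0" "!!x. x \<in> K ==> nbox n x r \<subseteq> K'"
 proof (rule Lebesgue_number_nbox[OF K, of "\<lambda>B. B \<subseteq> K'"])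
  show "\<exists>r>0. nbox n x r \<subseteq> K'" if "x \<in> K" for x by (rule ex[OF that])
  show "A \<subseteq> K'" if "B \<subseteq> K'" "A \<subseteq> B" for A B using that by (rule subset_trans[rotated])
 qed (rule that)
 have "K' \<subseteq> U" unfolding K'_def 
 proof (rule UN_least)
  fix z assume "z \<in> F"
  hence "z \<in> K" using F(2) by (rule subsetD[rotated])
  thus "ncbox n z (R z) \<subseteq> U" using R[of z] by simp
 qed
 thus ?thesis by (rule that[OF r(1) K' _ r(2)])
qed

text \<open>A Lebesgue number for the property of lying in \<open>U\<close> with oscillation below
  \<open>e\<close>. The second point ranges over a full cube and may leave \<open>K\<close>, as
  mollification requires.\<close>

lemma uniformly_continuous_nbox:
 assumes K: "compactin (Rn n) K" and U: "openin (Rn n) U" "K \<subseteq> U"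
  and f: "continuous_on U (f :: vec => real)" and e: "e > 0"
 obtains r where "r > 0" "!!x y. x \<in> K ==> y \<in> nbox n x r ==> y \<in> U \<and> \<bar>f y - f x\<bar> < e"
proof -
 let ?P = "\<lambda>B. B \<subseteq> U \<and> (\<forall>y\<in>B. \<forall>z\<in>B. \<bar>f y - f z\<bar> < e)"
 have ex: "\<exists>r>0. ?P (nbox n x r)" if x: "x \<in> K" for x
 proof -
  have "openin (top_of_set U) (U \<inter> f -` ball (f x) (e/2))"
   using f by (simp add: continuous_openin_preimage_gen)
  hence "openin (Rn n) (U \<inter> f -` ball (f x) (e/2))"
   using U(1) unfolding Rn_eq by (meson openin_trans)
  moreover have "x \<in> U \<inter> f -` ball (f x) (e/2)" using x U e by auto
  ultimately obtain r where r: "r > 0" "ncbox n x r \<subseteq> U \<inter> f -` ball (f x) (e/2)"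
   using openin_contains_nbox by blast
  have "?P (nbox n x r)"
  proof (intro conjI ballI)
   show "nbox n x r \<subseteq> U" using r nbox_subset_ncbox by blast
   fix y z assume "y \<in> nbox n x r" "z \<in> nbox n x r"
   hence "dist (f x) (f y) < e/2" "dist (f x) (f z) < e/2" using r nbox_subset_ncbox by fastforce+
   thus "\<bar>f y - f z\<bar> < e" unfolding dist_real_def by linarith
  qed
  thus ?thesis using r by blast
 qed
 obtain r where r: "r > 0" "!!x. x \<in> K ==> ?P (nbox n x r)"
 proof (rule Lebesgue_number_nbox[OF K, of ?P])
  show "\<exists>r>0. ?P (nbox n x r)" if "x \<in> K" for x by (rule ex[OF that])
  show "?P A" if "?P B" "A \<subseteq> B" for A B using that by (simp add: subset_iff)
 qed (rule that)
 have "y \<in> U \<and> \<bar>f y - f x\<bar> < e" if "x \<in> K" "y \<in> nbox n x r" for x y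
 proof -
  have "x \<in> En n" using that K unfolding compactin_Rn by blast
  hence "x \<in> nbox n x r" using r(1) by (rule nbox_centre)
  thus ?thesis using r(2)[OF that(1)] that(2) by (meson subsetD)
 qed
 thus ?thesis by (rule that[OF r(1)])
qed

lemma compactin_subset_ncbox:
 assumes K: "compactin (Rn n) K"
 obtains r where "r > 0" "K \<subseteq> nbox n (\<lambda>_. 0) r"
proof -
 have "\<forall>i<n. \<exists>b. \<forall>x\<in>K. \<bar>x i\<bar> \<le> b"
 proof (intro allI impI)
  fix i assume "i < n"
  have "compact ((\<lambda>x. x i) ` K)"
   using K by (intro compact_continuous_image) (auto simp: compactin_Rn intro: continuous_on_product_coordinates continuous_on_subset)
  hence "bounded ((\<lambda>x. x i) ` K)" by (rule compact_imp_bounded)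
  thus "\<exists>b. \<forall>x\<in>K. \<bar>x i\<bar> \<le> b" by (auto simp: bounded_iff)
 qed
 then obtain b where b: "!!i x. i < n ==> x \<in> K ==> \<bar>x i\<bar> \<le> b i" by metis
 define r where "r = Max (insert 0 (b ` {..<n})) + 1"
 have "b i < r" if "i < n" for i
 proof -
  have "b i \<le> Max (insert 0 (b ` {..<n}))" by (rule Max_ge) (use that in auto)
  thus ?thesis unfolding r_def by simp
 qed
 moreover have "r > 0" unfolding r_def by (simp add: add_nonneg_pos)
 ultimately have "K \<subseteq> nbox n (\<lambda>_. 0) r" using b K unfolding nbox_def compactin_Rn by fastforce
 thus ?thesis by (rule that[OF \<open>r > 0\<close>])
qed

lemma compact_exhaustion:
 assumes U: "openin (Rn n) U"
 obtains K :: "nat => vec set" where "!!m. compactin (Rn n) (K m)" "incseq K" "(\<Union>m. K m) = U"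
  "!!C. compactin (Rn n) C ==> C \<subseteq> U ==> \<exists>m. C \<subseteq> K m"
proof -
 obtain T where T: "open T" "U = T \<inter> En n" using U by (auto simp: openin_Rn)
 \<comment> \<open>\<open>dist\<close> is the metric of the ambient function space; all that matters
   is that it induces the product topology.\<close>
 define K where "K m = ncbox n (\<lambda>_. 0) (real m) \<inter> (\<Inter>z\<in>-T. {x. 1 / (real m + 1) \<le> dist x z})" for m :: nat
 have 1: "compactin (Rn n) (K m)" for m
 proof -
  have "closed (\<Inter>z\<in>-T. {x. 1 / (real m + 1) \<le> dist x z})"
   by (intro closed_INT ballI closed_Collect_le continuous_intros)
  thus ?thesis
   using compactin_ncbox[of n "\<lambda>_. 0" "real m"] unfolding K_def compactin_Rn
   by (auto intro: compact_Int_closed)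
 qed
 have 2: "incseq K"
 proof (rule incseq_SucI, rule subsetI)
  fix m x assume x: "x \<in> K m"
  have "1 / (real (Suc m) + 1) \<le> 1 / (real m + 1)" by (simp add: frac_le)
  thus "x \<in> K (Suc m)" using x unfolding K_def ncbox_def
   by (auto intro: order_trans)
 qed
 have 3: "\<exists>m. C \<subseteq> K m" if C: "compactin (Rn n) C" "C \<subseteq> U" for C
 proof -
  have "compact C" "C \<subseteq> T" "C \<subseteq> En n" using C T by (auto simp: compactin_Rn)
  then obtain e where e: "e > 0" "(\<Union>x\<in>C. ball x e) \<subseteq> T"
   using compact_subset_open_imp_ball_epsilon_subset[OF _ T(1)] by metis
  obtain r where r: "r > 0" "C \<subseteq> nbox n (\<lambda>_. 0) r" using compactin_subset_ncbox[OF C(1)] by blast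
  obtain m :: nat where m: "real m > max r (1/e)" using reals_Archimedean2 by blast
  have "1 / e \<le> real m + 1" using m by simp
  hence "1 / (real m + 1) \<le> e" using e(1) by (simp add: field_simps)
  hence "x \<in> K m" if "x \<in> C" for x
  proof -
   have "1 / (real m + 1) \<le> dist x z" if "z \<notin> T" for z
    using e \<open>x \<in> C\<close> that \<open>1 / (real m + 1) \<le> e\<close> by (force simp: subset_iff)
   moreover have "x \<in> ncbox n (\<lambda>_. 0) (real m)" using r(2) \<open>x \<in> C\<close> m unfolding ncbox_def nbox_def by fastforce
   ultimately show ?thesis unfolding K_def by auto
  qed
  thus ?thesis by blast
 qed
 have 4: "(\<Union>m. K m) = U"
 proof
  show "(\<Union>m. K m) \<subseteq> U"
  proof
   fix x assume "x \<in> (\<Union>m. K m)"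
   then obtain m where m: "x \<in> ncbox n (\<lambda>_. 0) (real m)" "!!z. z \<in> -T ==> 1 / (real m + 1) \<le> dist x z"
    unfolding K_def by auto
   have "0 < 1 / (real m + 1)" by simp
   hence "x \<in> T" using m(2)[of x] by (cases "x \<in> T") auto
   thus "x \<in> U" using m(1) T by (auto simp: ncbox_def)
  qed
  show "U \<subseteq> (\<Union>m. K m)"
  proof
   fix x assume "x \<in> U"
   hence "compactin (Rn n) {x}" "{x} \<subseteq> U" using openin_Rn_subset[OF U] unfolding compactin_Rn by (simp_all add: subset_iff)
   from 3[OF this] show "x \<in> (\<Union>m. K m)" by auto
  qed
 qed
 show ?thesis by (rule that[OF 1 2 4 3])
qed

section \<open>Domains compactly inside an open set\<close>

lemma is_domain_nbox: "x \<in> En n ==> r > 0 ==> is_domain n (nbox n x r)"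
 unfolding is_domain_def using openin_nbox connectedin_nbox nbox_centre by blast

lemma domain_nbox_inside:
 assumes "openin (Rn n) U" "x \<in> U"
 obtains r where "r > 0" "is_domain n (nbox n x r)" "compactly_inside n (nbox n x r) U"
proof -
 obtain r where r: "r > 0" "ncbox n x r \<subseteq> U" using openin_contains_nbox[OF assms] by blast
 moreover have "x \<in> En n" "U \<subseteq> En n" using assms openin_Rn_subset by auto
 moreover have "compactly_inside n (nbox n x r) U"
  unfolding compactly_inside_iff_ex[OF openin_Rn_subset[OF openin_nbox] \<open>U \<subseteq> En n\<close>]
  using r compactin_ncbox nbox_subset_ncbox by (intro exI[of _ "ncbox n x r"]) simp
 ultimately show ?thesis using assms(2) by (intro that[of r] is_domain_nbox)
qed

lemma domain_union_inside:
 assumes "is_domain n A" "compactly_inside n A U" "is_domain n B" "compactly_inside n B U" "A \<inter> B \<noteq> {}" "U \<subseteq> En n"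
 shows "is_domain n (A \<union> B) \<and> compactly_inside n (A \<union> B) U"
proof
 have sub: "A \<subseteq> En n" "B \<subseteq> En n" using assms openin_Rn_subset unfolding is_domain_def by auto
 show "is_domain n (A \<union> B)" using assms unfolding is_domain_def by (auto intro: connectedin_Un)
 obtain K L where "compactin (Rn n) K" "K \<subseteq> U" "A \<subseteq> K" "compactin (Rn n) L" "L \<subseteq> U" "B \<subseteq> L"
  using assms sub compactly_inside_iff_ex by metis
 thus "compactly_inside n (A \<union> B) U"
  using sub assms(6) by (subst compactly_inside_iff_ex) (auto intro!: exI[of _ "K \<union> L"] compactin_Un)
qed

text \<open>The local hypotheses on weights, matrix, potential and solution speak of domains
  compactly inside \<open>U\<close>, whereas integrals are taken over compact sets; this lemma links
  the two. The points that share a good domain with a fixed \<open>x0\<close> form an open set whose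
  complement in \<open>U\<close> is open, so connectedness gives all of \<open>U\<close>.\<close>

lemma domain_containing_compact:
 assumes U: "is_domain n U" and K: "compactin (Rn n) K" "K \<subseteq> U"
 obtains S where "is_domain n S" "compactly_inside n S U" "K \<subseteq> S"
proof -
 define good where "good S \<longleftrightarrow> is_domain n S \<and> compactly_inside n S U" for S
 have op: "openin (Rn n) U" and sub: "U \<subseteq> En n" using U openin_Rn_subset unfolding is_domain_def by auto
 obtain x0 where x0: "x0 \<in> U" using U unfolding is_domain_def by blast
 define R where "R = {y \<in> U. \<exists>S. good S \<and> x0 \<in> S \<and> y \<in> S}"
 have gsub: "S \<subseteq> U" if "good S" for S
  using that compactly_inside_iff[of S n U] closure_subset[of S] openin_Rn_subset unfolding good_def is_domain_def by blast
 have gop: "openin (Rn n) S" if "good S" for S using that unfolding good_def is_domain_def by blast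
 have near: "\<exists>B. good B \<and> y \<in> B" if "y \<in> U" for y
  using domain_nbox_inside[OF op that] nbox_centre[of y n] sub that unfolding good_def by (metis subsetD)
 \<comment> \<open>Two good domains with a common point merge into one. This gives both the openness
   of \<open>R\<close> and the openness of its complement.\<close>
 have step: "y \<in> R" if "z \<in> R" "good B" "z \<in> B" "y \<in> B" for y z B
 proof -
  obtain S where w: "good S" "x0 \<in> S" "z \<in> S" using \<open>z \<in> R\<close> unfolding R_def by blast
  have "good (S \<union> B)" using domain_union_inside[of n S U B] w that sub unfolding good_def by blast
  moreover have "x0 \<in> S \<union> B" "y \<in> S \<union> B" using w that by auto
  ultimately show ?thesis using gsub[of "S \<union> B"] unfolding R_def by blast
 qed
 have "openin (Rn n) R"
 proof (subst openin_subopen, intro ballI)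
  fix y assume y: "y \<in> R"
  then obtain B where "good B" "y \<in> B" using near unfolding R_def by blast
  thus "\<exists>T. openin (Rn n) T \<and> y \<in> T \<and> T \<subseteq> R" using gop step y by blast
 qed
 moreover have "openin (Rn n) (U - R)"
 proof (subst openin_subopen, intro ballI)
  fix y assume y: "y \<in> U - R"
  then obtain B where B: "good B" "y \<in> B" using near by blast
  have "B \<subseteq> U - R" using step[of _ B y] B y gsub by blast
  thus "\<exists>T. openin (Rn n) T \<and> y \<in> T \<and> T \<subseteq> U - R" using gop B by blast
 qed
 moreover have "connectedin (Rn n) U" using U unfolding is_domain_def by blast
 moreover have "x0 \<in> R" using near[OF x0] x0 unfolding R_def by blast
 moreover have "R \<subseteq> U" "U \<subseteq> R \<union> (U - R)" "R \<inter> (U - R) \<inter> U = {}" unfolding R_def by auto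
 ultimately have "(U - R) \<inter> U = {}" unfolding connectedin using x0 by blast
 hence R: "R = U" using \<open>R \<subseteq> U\<close> by blast
 have "\<forall>y\<in>U. \<exists>S. good S \<and> x0 \<in> S \<and> y \<in> S" using R unfolding R_def by blast
 from bchoice[OF this] obtain W where W: "!!y. y \<in> U ==> good (W y) \<and> x0 \<in> W y \<and> y \<in> W y" by blast
 obtain \<F> where F: "finite \<F>" "\<F> \<subseteq> W ` K" "K \<subseteq> \<Union>\<F>"
 proof -
  have "\<forall>Y \<in> W ` K. openin (Rn n) Y" "K \<subseteq> \<Union>(W ` K)" using W K(2) gop by (blast, blast)
  hence "\<exists>\<F>. finite \<F> \<and> \<F> \<subseteq> W ` K \<and> K \<subseteq> \<Union>\<F>" using K(1) unfolding compactin_def by simp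
  thus ?thesis using that by blast
 qed
 \<comment> \<open>Every member contains \<open>x0\<close>, so unions stay connected;
   \<open>W x0\<close> is added to cover the empty family.\<close>
 have "good (\<Union>\<G> \<union> W x0) \<and> x0 \<in> \<Union>\<G> \<union> W x0" if "finite \<G>" "\<G> \<subseteq> W ` K" for \<G>
  using that
 proof (induction \<G>)
  case empty thus ?case using W x0 by simp
 next
  case (insert A \<G>)
  hence "good A" "x0 \<in> A" using W K by auto
  moreover have "\<Union>(insert A \<G>) \<union> W x0 = A \<union> (\<Union>\<G> \<union> W x0)" by auto
  ultimately show ?case using insert domain_union_inside[of n A U "\<Union>\<G> \<union> W x0"] sub unfolding good_def by auto
 qed
 from this[OF F(1,2)] show ?thesis using that[of "\<Union>\<F> \<union> W x0"] F(3) unfolding good_def by blast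
qed

section \<open>Bregman distances of powers of norms\<close>

lemma powr_tangent:
 fixes p x y :: real
 assumes "p > 1" "x \<ge> 0" "y \<ge> 0"
 shows "y powr p + p * y powr (p - 1) * (x - y) \<le> x powr p"
proof (cases "x = 0 \<or> y = 0")
 case True
 thus ?thesis
 proof
  assume "x = 0"
  have "y powr (p - 1) * y = y powr p" using assms by (cases "y = 0") (auto simp: powr_diff)
  hence "y powr p + p * y powr (p - 1) * (x - y) = (1 - p) * y powr p" using \<open>x = 0\<close> by (simp add: algebra_simps)
  also have "\<dots> \<le> 0" using assms by (simp add: mult_nonpos_nonneg)
  finally show ?thesis using \<open>x = 0\<close> by simp
 qed auto
next
 case False
 hence xy: "x > 0" "y > 0" using assms by auto
 have "convex_on {0<..} (\<lambda>x::real. x powr p)" using powr_convex[of p] assms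
  by (auto intro: convex_on_subset)
 moreover have "((\<lambda>x. x powr p) has_field_derivative p * y powr (p - 1)) (at y within {0<..})"
  using xy by (auto intro!: derivative_eq_intros simp: powr_diff)
 ultimately have "p * y powr (p - 1) * (x - y) \<le> x powr p - y powr p"
  using convex_on_imp_above_tangent[of "{0<..}" "\<lambda>x. x powr p" y x "p * y powr (p - 1)"] xy interior_open[of "{0::real<..}"]
  by auto
 thus ?thesis by simp
qed

text \<open>The gap in Bernoulli's inequality, which is the Bregman distance of the p-th power
  between \<open>\<rho>\<close> and 1.\<close>

definition bern :: "real => real => real" where
 "bern p \<rho> = \<rho> powr p - 1 - p * (\<rho> - 1)"

lemma bern_nonneg: "p > 1 ==> \<rho> \<ge> 0 ==> bern p \<rho> \<ge> 0"
 using powr_tangent[of p \<rho> 1] by (simp add: bern_def)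

lemma bern_pos:
 assumes p: "p > 1" and \<rho>: "\<rho> \<ge> 0" "\<rho> \<noteq> 1"
 shows "bern p \<rho> > 0"
proof -
 have c: "continuous_on {a..b} (bern p)" if "a \<ge> 0" for a b
  unfolding bern_def using p that by (intro continuous_intros continuous_on_powr') auto
 have d: "(bern p has_real_derivative p * (t powr (p - 1) - 1)) (at t)" if "t > 0" for t
  unfolding bern_def using that by (auto intro!: derivative_eq_intros simp: powr_diff algebra_simps)
 show ?thesis
 proof (cases "\<rho> > 1")
  case True
  have "bern p 1 < bern p \<rho>"
  proof (rule DERIV_pos_imp_increasing_open[OF True])
   fix t assume t: "1 < t" "t < \<rho>"
   have "1 < t powr (p - 1)" using t p by simp
   thus "\<exists>y. DERIV (bern p) t :> y \<and> 0 < y" using d[of t] t p by (intro exI[of _ "p * (t powr (p - 1) - 1)"]) auto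
  qed (use c in auto)
  thus ?thesis by (simp add: bern_def)
 next
  case False
  hence lt: "\<rho> < 1" using \<rho> by auto
  have "bern p 1 < bern p \<rho>"
  proof (rule DERIV_neg_imp_decreasing_open[OF lt])
   fix t assume t: "\<rho> < t" "t < 1"
   have "t powr (p - 1) < 1 powr (p - 1)" using t p \<rho> by (intro powr_less_mono2) auto
   thus "\<exists>y. DERIV (bern p) t :> y \<and> y < 0" using d[of t] t p \<rho> by (intro exI[of _ "p * (t powr (p - 1) - 1)"]) (auto simp: mult_pos_neg)
  qed (use c \<rho> in auto)
  thus ?thesis by (simp add: bern_def)
 qed
qed

lemma bern_quadratic_limit:
 assumes p: "p > 1"
 shows "((\<lambda>\<rho>. bern p \<rho> / (\<rho> - 1)\<^sup>2) \<longlongrightarrow> p * (p - 1) / 2) (at 1)"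
 unfolding bern_def using p by real_asymp

text \<open>The quotient by \<open>(\<rho> - 1)\<^sup>2\<close>, completed at 1 by its limit
  \<open>p * (p - 1) / 2\<close>, is continuous and positive on \<open>{0..B}\<close>, hence lies
  between positive constants. Through the square the gaps for two different exponents become
  comparable on bounded sets.\<close>

lemma bern_quadratic_bounds:
 assumes p: "p > 1" and B: "B > 0"
 obtains c C where "c > 0" "C > 0"
  "!!\<rho>. 0 \<le> \<rho> ==> \<rho> \<le> B ==> c * (\<rho> - 1)\<^sup>2 \<le> bern p \<rho> \<and> bern p \<rho> \<le> C * (\<rho> - 1)\<^sup>2"
proof -
 define r where "r \<rho> = (if \<rho> = 1 then p * (p - 1) / 2 else bern p \<rho> / (\<rho> - 1)\<^sup>2)" for \<rho>
 have pos: "r \<rho> > 0" if "\<rho> \<ge> 0" for \<rho>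
  using bern_pos[OF p that] p unfolding r_def by auto
 have "continuous_on {0..B} r"
  unfolding continuous_on_eq_continuous_within
 proof
  fix x assume x: "x \<in> {0..B}"
  show "continuous (at x within {0..B}) r"
  proof (cases "x = 1")
   case True
   have "(r \<longlongrightarrow> p * (p - 1) / 2) (at 1)"
    using bern_quadratic_limit[OF p]
    by (rule Lim_transform_eventually) (auto simp: r_def eventually_at intro!: exI[of _ 1])
   thus ?thesis using True
    by (auto simp: continuous_within r_def intro: tendsto_within_subset)
  next
   case False
   have "continuous (at x within {0..B}) (\<lambda>\<rho>. bern p \<rho> / (\<rho> - 1)\<^sup>2)"
   proof -
    have "continuous_on {0..B} (\<lambda>\<rho>. bern p \<rho>)"
     unfolding bern_def using p by (intro continuous_intros continuous_on_powr') auto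
    hence "continuous (at x within {0..B}) (\<lambda>\<rho>. bern p \<rho>)"
     using x by (auto simp: continuous_on_eq_continuous_within)
    thus ?thesis using False by (intro continuous_intros) auto
   qed
   thus ?thesis
   proof (rule continuous_transform_within[where \<delta>="\<bar>x - 1\<bar>"])
    show "0 < \<bar>x - 1\<bar>" using False by simp
    show "x \<in> {0..B}" by (rule x)
    fix x' assume "x' \<in> {0..B}" "dist x' x < \<bar>x - 1\<bar>"
    hence "x' \<noteq> 1" by (auto simp: dist_real_def)
    thus "bern p x' / (x' - 1)\<^sup>2 = r x'" by (simp add: r_def)
   qed
  qed
 qed
 moreover have "{0..B} \<noteq> {}" using B by auto
 ultimately obtain x y where x: "x \<in> {0..B}" "!!z. z \<in> {0..B} ==> r x \<le> r z"
  and y: "y \<in> {0..B}" "!!z. z \<in> {0..B} ==> r z \<le> r y"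
  using continuous_attains_inf[of "{0..B}" r] continuous_attains_sup[of "{0..B}" r] by (metis compact_Icc)
 have eq: "bern p \<rho> = r \<rho> * (\<rho> - 1)\<^sup>2" for \<rho>
  unfolding r_def by (auto simp: bern_def)
 show ?thesis
 proof (rule that[of "r x" "r y"])
  show "r x > 0" "r y > 0" using pos x y by auto
  fix \<rho> :: real assume "0 \<le> \<rho>" "\<rho> \<le> B"
  thus "r x * (\<rho> - 1)\<^sup>2 \<le> bern p \<rho> \<and> bern p \<rho> \<le> r y * (\<rho> - 1)\<^sup>2"
   using x y unfolding eq by (auto intro!: mult_right_mono)
 qed
qed

text \<open>The Bregman distance of a p-th power of a norm, written in three numbers:
  \<open>f\<close> is the norm of the base point, \<open>\<rho>\<close> the norm of the other point,
  and \<open>l\<close> the pairing of the latter with the normalised gradient at the base point, so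
  that \<open>l \<le> \<rho>\<close> by Hoelder's inequality.\<close>

definition breg :: "real => real => real => real => real" where
 "breg p f \<rho> l = \<rho> powr p + (p - 1) * f powr p - p * f powr (p - 1) * l"

text \<open>The distance splits into the gap in Bernoulli's inequality and the gap in Hoelder's
  inequality. The exponent enters the second one only as a factor.\<close>

lemma breg_1: "breg p 1 \<rho> l = bern p \<rho> + p * (\<rho> - l)"
 by (simp add: breg_def bern_def algebra_simps)

lemma breg_scale:
 assumes "f > 0" "\<rho> \<ge> 0"
 shows "breg p f \<rho> l = f powr p * breg p 1 (\<rho> / f) (l / f)"
 using assms by (simp add: breg_def powr_divide powr_diff field_simps)

text \<open>\<open>R\<close> stands for the norm of the increment, relative to the base point. For
  bounded \<open>R\<close> the distances for \<open>p\<close> and \<open>s\<close> are comparable,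
  so doubling is inherited from \<open>s\<close>; for large \<open>R\<close> both sides are of the
  order of \<open>R powr p\<close>, and doubling holds by size alone.\<close>

lemma breg_doubling_unit:
 fixes p s c :: real
 assumes p: "p > 1" and s: "s > 1" and c: "c > 0"
 obtains C where "C > 0" "!!\<rho>1 \<rho>2 R l. 0 \<le> \<rho>1 ==> 0 \<le> \<rho>2 ==> \<rho>1 \<le> 1 + R ==> R - 1 \<le> \<rho>1 ==> \<rho>2 \<le> 1 + 2 * R ==>
   \<bar>l\<bar> \<le> R ==> 1 + l \<le> \<rho>1 ==> 1 + 2 * l \<le> \<rho>2 ==> breg s 1 \<rho>2 (1 + 2 * l) \<le> c * breg s 1 \<rho>1 (1 + l) ==>
   breg p 1 \<rho>2 (1 + 2 * l) \<le> C * breg p 1 \<rho>1 (1 + l)"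
proof -
 \<comment> \<open>If \<open>R > K\<close>, then \<open>R - 1\<close> is at least
   \<open>R / 2\<close>, and \<open>\<rho>1 \<ge> R - 1\<close> is so large that the linear term
   \<open>p * \<rho>1\<close> is at most half of \<open>\<rho>1 powr p\<close>.\<close>
 define K where "K = 2 + (2 * p) powr (1 / (p - 1))"
 have K: "K \<ge> 2" unfolding K_def by simp
 define B where "B = 1 + 2 * K"
 have B: "B > 0" using K unfolding B_def by simp
 obtain c1 C1 where 1: "c1 > 0" "C1 > 0"
  "!!\<rho>. 0 \<le> \<rho> ==> \<rho> \<le> B ==> c1 * (\<rho> - 1)\<^sup>2 \<le> bern p \<rho> \<and> bern p \<rho> \<le> C1 * (\<rho> - 1)\<^sup>2"
  using bern_quadratic_bounds[OF p B] by blast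
 obtain c2 C2 where 2: "c2 > 0" "C2 > 0"
  "!!\<rho>. 0 \<le> \<rho> ==> \<rho> \<le> B ==> c2 * (\<rho> - 1)\<^sup>2 \<le> bern s \<rho> \<and> bern s \<rho> \<le> C2 * (\<rho> - 1)\<^sup>2"
  using bern_quadratic_bounds[OF s B] by blast
 define m where "m = max (C1 / c2) (p / s)"
 define m' where "m' = max (C2 / c1) (s / p)"
 have mpos: "m > 0" "m' > 0" using p s 1 2 unfolding m_def m'_def by (auto simp: less_max_iff_disj)
 \<comment> \<open>The two gaps are compared separately: the quadratic bounds give
   \<open>A / a\<close> for the first one, the ratio of the exponents serves for the second.\<close>
 have cmp: "breg P 1 \<rho> l \<le> max (A / a) (P / S) * breg S 1 \<rho> l"
  if "0 \<le> \<rho>" "l \<le> \<rho>" "bern P \<rho> \<le> A * (\<rho> - 1)\<^sup>2" "a * (\<rho> - 1)\<^sup>2 \<le> bern S \<rho>" "a > 0" "A > 0" "P > 1" "S > 1"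
  for P S A a \<rho> l :: real
 proof -
  have "bern P \<rho> \<le> A / a * bern S \<rho>"
  proof -
   have "A * (\<rho> - 1)\<^sup>2 = A / a * (a * (\<rho> - 1)\<^sup>2)" using that by simp
   also have "\<dots> \<le> A / a * bern S \<rho>" using that by (intro mult_left_mono) auto
   finally show ?thesis using that by simp
  qed
  also have "\<dots> \<le> max (A / a) (P / S) * bern S \<rho>" using bern_nonneg[of S \<rho>] that by (intro mult_right_mono) auto
  finally have a: "bern P \<rho> \<le> max (A / a) (P / S) * bern S \<rho>" .
  have "P * (\<rho> - l) = P / S * (S * (\<rho> - l))" using that by simp
  also have "\<dots> \<le> max (A / a) (P / S) * (S * (\<rho> - l))" using that by (intro mult_right_mono) auto
  finally show ?thesis using a unfolding breg_1 by (simp add: algebra_simps)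
 qed
 \<comment> \<open>The first summand serves bounded \<open>R\<close>: compare with \<open>s\<close>,
   double, compare back. The second is the ratio of the upper bound
   \<open>2 * p * (3 * R) powr p\<close> to the lower bound \<open>(R / 2) powr p / 2\<close> for
   large \<open>R\<close>.\<close>
 define C where "C = m * c * m' + 4 * p * 6 powr p"
 have Cpos: "C > 0" unfolding C_def using mpos c p by (simp add: add_pos_pos)
 show ?thesis
 proof (rule that[OF Cpos])
  fix \<rho>1 \<rho>2 R l :: real
  assume h: "0 \<le> \<rho>1" "0 \<le> \<rho>2" "\<rho>1 \<le> 1 + R" "R - 1 \<le> \<rho>1" "\<rho>2 \<le> 1 + 2 * R"
   "\<bar>l\<bar> \<le> R" "1 + l \<le> \<rho>1" "1 + 2 * l \<le> \<rho>2" "breg s 1 \<rho>2 (1 + 2 * l) \<le> c * breg s 1 \<rho>1 (1 + l)"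
  have nn: "breg p 1 \<rho>1 (1 + l) \<ge> 0"
   unfolding breg_1 using bern_nonneg[OF p h(1)] h p by auto
  show "breg p 1 \<rho>2 (1 + 2 * l) \<le> C * breg p 1 \<rho>1 (1 + l)"
  proof (cases "R \<le> K")
   case True
   hence r: "\<rho>1 \<le> B" "\<rho>2 \<le> B" using h K unfolding B_def by auto
   have "breg p 1 \<rho>2 (1 + 2 * l) \<le> m * breg s 1 \<rho>2 (1 + 2 * l)"
    unfolding m_def using 1(3)[OF h(2) r(2)] 2(3)[OF h(2) r(2)] 1 2 h p s by (intro cmp) auto
   also have "\<dots> \<le> m * (c * breg s 1 \<rho>1 (1 + l))" using h mpos by (intro mult_left_mono) auto
   also have "\<dots> \<le> m * (c * (m' * breg p 1 \<rho>1 (1 + l)))"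
    unfolding m'_def using 1(3)[OF h(1) r(1)] 2(3)[OF h(1) r(1)] 1 2 h p s mpos c
    by (intro mult_left_mono cmp) auto
   also have "\<dots> \<le> C * breg p 1 \<rho>1 (1 + l)"
    unfolding C_def using nn p by (simp add: algebra_simps)
   finally show ?thesis .
  next
   case False
   hence R: "R > K" by simp
   have up: "breg p 1 \<rho>2 (1 + 2 * l) \<le> 2 * p * (3 * R) powr p"
   proof -
    have R1: "3 * R \<ge> 1" "3 * R \<le> (3 * R) powr p"
     using R K p powr_mono[of 1 p "3 * R"] by auto
    have "\<rho>2 powr p \<le> (3 * R) powr p" using h R K p by (intro powr_mono2) auto
    moreover have "(p - 1) * 1 \<le> (p - 1) * (3 * R) powr p" using R1 p by (intro mult_left_mono) auto
    moreover have "- p * (1 + 2 * l) \<le> p * (3 * R) powr p"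
    proof -
     have "- (1 + 2 * l) \<le> 3 * R" using h R K by auto
     hence "- (1 + 2 * l) \<le> (3 * R) powr p" using R1 by linarith
     hence "p * (- (1 + 2 * l)) \<le> p * (3 * R) powr p" using p by (intro mult_left_mono) auto
     thus ?thesis by (simp add: algebra_simps)
    qed
    ultimately show ?thesis unfolding breg_def by (simp add: algebra_simps)
   qed
   have low: "(R / 2) powr p / 2 \<le> breg p 1 \<rho>1 (1 + l)"
   proof -
    have k: "\<rho>1 \<ge> (2 * p) powr (1 / (p - 1))" using h R unfolding K_def by auto
    have k': "\<rho>1 > 0" using h R K by linarith
    have "((2 * p) powr (1 / (p - 1))) powr (p - 1) \<le> \<rho>1 powr (p - 1)" using k p by (intro powr_mono2) auto
    hence "2 * p \<le> \<rho>1 powr (p - 1)" using p by (simp add: powr_powr)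
    hence "2 * p * \<rho>1 \<le> \<rho>1 powr (p - 1) * \<rho>1" using k' by (intro mult_right_mono) auto
    also have "\<dots> = \<rho>1 powr p" using k' by (simp add: powr_diff)
    finally have "p * \<rho>1 \<le> \<rho>1 powr p / 2" by simp
    moreover have "(R / 2) powr p \<le> \<rho>1 powr p" using h R K p by (intro powr_mono2) auto
    moreover have "bern p \<rho>1 \<ge> \<rho>1 powr p - p * \<rho>1" using p by (simp add: bern_def algebra_simps)
    moreover have "p * (\<rho>1 - (1 + l)) \<ge> 0" using h p by simp
    ultimately show ?thesis unfolding breg_1 by linarith
   qed
   have "2 * p * (3 * R) powr p = 4 * p * 6 powr p * ((R / 2) powr p / 2)"
   proof -
    have "(3 * R) powr p = (6 * (R / 2)) powr p" by simp
    also have "\<dots> = 6 powr p * (R / 2) powr p" using R K by (intro powr_mult) 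
    finally show ?thesis by simp
   qed
   also have "\<dots> \<le> 4 * p * 6 powr p * breg p 1 \<rho>1 (1 + l)" using low p by (intro mult_left_mono) auto
   also have "\<dots> \<le> C * breg p 1 \<rho>1 (1 + l)" unfolding C_def using nn mpos c by (intro mult_right_mono) auto
   finally show ?thesis using up by simp
  qed
 qed
qed

text \<open>All that is required of a constant that turns doubling with constant \<open>c\<close>
  for the exponent \<open>s\<close> into doubling for \<open>p\<close>. The bound
  \<open>C \<ge> 2 powr p\<close> is for base points of norm zero, where the distance is the p-th
  power of the norm itself.\<close>

definition dbl_transfer :: "real => real => real => real => bool" where
 "dbl_transfer p s c C \<longleftrightarrow> C > 0 \<and> C \<ge> 2 powr p \<and> (\<forall>f>0. \<forall>\<rho>1 \<rho>2 R l. 0 \<le> \<rho>1 \<and> 0 \<le> \<rho>2 \<and> \<rho>1 \<le> f + R \<and> R - f \<le> \<rho>1 \<and> \<rho>2 \<le> f + 2 * R \<and>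
   \<bar>l\<bar> \<le> R \<and> f + l \<le> \<rho>1 \<and> f + 2 * l \<le> \<rho>2 \<and> breg s f \<rho>2 (f + 2 * l) \<le> c * breg s f \<rho>1 (f + l) -->
   breg p f \<rho>2 (f + 2 * l) \<le> C * breg p f \<rho>1 (f + l))"

lemma ex_dbl_transfer:
 assumes p: "p > 1" and s: "s > 1" and c: "c > 0"
 shows "\<exists>C. dbl_transfer p s c C"
proof -
 obtain C where C: "C > 0" "!!\<rho>1 \<rho>2 R l. 0 \<le> \<rho>1 ==> 0 \<le> \<rho>2 ==> \<rho>1 \<le> 1 + R ==> R - 1 \<le> \<rho>1 ==> \<rho>2 \<le> 1 + 2 * R ==>
   \<bar>l\<bar> \<le> R ==> 1 + l \<le> \<rho>1 ==> 1 + 2 * l \<le> \<rho>2 ==> breg s 1 \<rho>2 (1 + 2 * l) \<le> c * breg s 1 \<rho>1 (1 + l) ==>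
   breg p 1 \<rho>2 (1 + 2 * l) \<le> C * breg p 1 \<rho>1 (1 + l)"
  using breg_doubling_unit[OF p s c] by blast
 have "dbl_transfer p s c (max C (2 powr p))"
  unfolding dbl_transfer_def
 proof (intro conjI allI impI)
  show "max C (2 powr p) > 0" "max C (2 powr p) \<ge> 2 powr p" using C(1) by auto
  fix f \<rho>1 \<rho>2 R l :: real
  assume f: "f > 0" and "0 \<le> \<rho>1 \<and> 0 \<le> \<rho>2 \<and> \<rho>1 \<le> f + R \<and> R - f \<le> \<rho>1 \<and> \<rho>2 \<le> f + 2 * R \<and>
   \<bar>l\<bar> \<le> R \<and> f + l \<le> \<rho>1 \<and> f + 2 * l \<le> \<rho>2 \<and> breg s f \<rho>2 (f + 2 * l) \<le> c * breg s f \<rho>1 (f + l)"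
  hence h: "0 \<le> \<rho>1" "0 \<le> \<rho>2" "\<rho>1 \<le> f + R" "R - f \<le> \<rho>1" "\<rho>2 \<le> f + 2 * R"
   "\<bar>l\<bar> \<le> R" "f + l \<le> \<rho>1" "f + 2 * l \<le> \<rho>2" "breg s f \<rho>2 (f + 2 * l) \<le> c * breg s f \<rho>1 (f + l)" by auto
  have e: "(f + l) / f = 1 + l / f" "(f + 2 * l) / f = 1 + 2 * (l / f)" using f by (auto simp: field_simps)
  have "breg s 1 (\<rho>2 / f) (1 + 2 * (l / f)) \<le> c * breg s 1 (\<rho>1 / f) (1 + l / f)"
  proof -
   have "f powr s * breg s 1 (\<rho>2 / f) (1 + 2 * (l / f)) \<le> f powr s * (c * breg s 1 (\<rho>1 / f) (1 + l / f))"
    using h(9) unfolding breg_scale[OF f h(1)] breg_scale[OF f h(2)] e by (simp add: algebra_simps)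
   thus ?thesis using f by simp
  qed
  hence "breg p 1 (\<rho>2 / f) (1 + 2 * (l / f)) \<le> C * breg p 1 (\<rho>1 / f) (1 + l / f)"
  proof (intro C(2)[where R="R / f"])
   have q: "x / f \<le> y / f" if "x \<le> y" for x y using that f by (simp add: divide_right_mono)
   show "\<rho>1 / f \<le> 1 + R / f" using q[OF h(3)] f by (simp add: add_divide_distrib)
   show "R / f - 1 \<le> \<rho>1 / f" using q[OF h(4)] f by (simp add: diff_divide_distrib)
   show "\<rho>2 / f \<le> 1 + 2 * (R / f)" using q[OF h(5)] f by (simp add: add_divide_distrib)
   show "\<bar>l / f\<bar> \<le> R / f" using q[OF h(6)] f by (simp add: abs_divide)
   show "1 + l / f \<le> \<rho>1 / f" using q[OF h(7)] f by (simp add: add_divide_distrib)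
   show "1 + 2 * (l / f) \<le> \<rho>2 / f" using q[OF h(8)] f by (simp add: add_divide_distrib)
  qed (use h f in auto)
  hence "f powr p * breg p 1 (\<rho>2 / f) (1 + 2 * (l / f)) \<le> f powr p * (C * breg p 1 (\<rho>1 / f) (1 + l / f))"
   by (intro mult_left_mono) auto
  hence "breg p f \<rho>2 (f + 2 * l) \<le> C * breg p f \<rho>1 (f + l)"
   unfolding breg_scale[OF f h(1)] breg_scale[OF f h(2)] e by (simp add: algebra_simps)
  also have "\<dots> \<le> max C (2 powr p) * breg p f \<rho>1 (f + l)"
  proof (intro mult_right_mono)
   have "breg p 1 (\<rho>1 / f) (1 + l / f) \<ge> 0"
   proof -
    have "(f + l) / f \<le> \<rho>1 / f" using h f by (simp add: divide_right_mono)
    hence "1 + l / f \<le> \<rho>1 / f" using f by (simp add: add_divide_distrib)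
    thus ?thesis unfolding breg_1 using bern_nonneg[OF p, of "\<rho>1 / f"] h f p by simp
   qed
   thus "0 \<le> breg p f \<rho>1 (f + l)" unfolding breg_scale[OF f h(1)] e by simp
  qed auto
  finally show "breg p f \<rho>2 (f + 2 * l) \<le> max C (2 powr p) * breg p f \<rho>1 (f + l)" .
 qed
 thus ?thesis by blast
qed

text \<open>A choice depending on three numbers only. This is how the final constant becomes
  independent of the dimension, the point and the coefficients.\<close>

definition dblc :: "real => real => real => real" where
 "dblc p s c = (SOME C. dbl_transfer p s c C)"

lemma dblc: "p > 1 ==> s > 1 ==> c > 0 ==> dbl_transfer p s c (dblc p s c)"
 unfolding dblc_def by (rule someI_ex) (rule ex_dbl_transfer)

lemma dblc_doubling:
 assumes "p > 1" "s > 1" "c > 0" "f > 0" "0 \<le> \<rho>1" "0 \<le> \<rho>2" "\<rho>1 \<le> f + R" "R - f \<le> \<rho>1" "\<rho>2 \<le> f + 2 * R"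
  "\<bar>l\<bar> \<le> R" "f + l \<le> \<rho>1" "f + 2 * l \<le> \<rho>2" "breg s f \<rho>2 (f + 2 * l) \<le> c * breg s f \<rho>1 (f + l)"
 shows "breg p f \<rho>2 (f + 2 * l) \<le> dblc p s c * breg p f \<rho>1 (f + l)"
 using dblc[OF assms(1-3)] assms(4-) unfolding dbl_transfer_def by blast

lemma dblc_ge: "p > 1 ==> s > 1 ==> c > 0 ==> dblc p s c \<ge> 2 powr p \<and> dblc p s c > 0"
 using dblc unfolding dbl_transfer_def by blast

text \<open>For the square on the real line the distance from \<open>b\<close> to
  \<open>b + j * e\<close> is \<open>(j * e)\<^sup>2\<close>, which doubles with constant 4; the
  transfer from 2 to \<open>s\<close> does the rest. Being about single numbers, the inequality can
  be summed over coordinates with positive weights and with no loss in the constant.\<close>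

lemma scalar_doubling:
 fixes s b e :: real
 assumes s: "s > 1"
 defines "d \<equiv> \<lambda>x. \<bar>x\<bar> powr s + (s - 1) * \<bar>b\<bar> powr s - s * (\<bar>b\<bar> powr (s - 1) * sgn b * x)"
 shows "d (b + 2 * e) \<le> dblc s 2 4 * d (b + e)"
proof (cases "b = 0")
 case True
 have "\<bar>2 * e\<bar> powr s = 2 powr s * \<bar>e\<bar> powr s" by (simp add: abs_mult powr_mult)
 also have "\<dots> \<le> dblc s 2 4 * \<bar>e\<bar> powr s"
  using dblc_ge[of s 2 4] s by (intro mult_right_mono) auto
 finally show ?thesis using True by (simp add: d_def)
next
 case False
 hence b: "\<bar>b\<bar> > 0" by simp
 have sg: "sgn b * b = \<bar>b\<bar>" by (simp add: abs_sgn mult.commute)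
 have eq: "d x = breg s \<bar>b\<bar> \<bar>x\<bar> (sgn b * x)" for x by (simp add: d_def breg_def mult.assoc)
 have two: "breg 2 \<bar>b\<bar> \<bar>b + j * e\<bar> (sgn b * (b + j * e)) = (j * e)\<^sup>2" for j
 proof -
  have "breg 2 \<bar>b\<bar> \<bar>b + j * e\<bar> (sgn b * (b + j * e)) = (b + j * e)\<^sup>2 + b\<^sup>2 - 2 * (\<bar>b\<bar> * sgn b) * (b + j * e)"
   using b by (simp add: breg_def)
  also have "\<bar>b\<bar> * sgn b = b" by (simp add: abs_mult_sgn)
  finally show ?thesis by (simp add: power2_eq_square algebra_simps)
 qed
 have sgab: "sgn b * x \<le> \<bar>x\<bar>" "\<bar>sgn b * x\<bar> = \<bar>x\<bar>" for x using False by (auto simp: abs_mult sgn_if)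
 have split: "sgn b * (b + j * e) = \<bar>b\<bar> + j * (sgn b * e)" for j using sg by (simp add: algebra_simps)
 have "breg s \<bar>b\<bar> \<bar>b + 2 * e\<bar> (\<bar>b\<bar> + 2 * (sgn b * e)) \<le> dblc s 2 4 * breg s \<bar>b\<bar> \<bar>b + e\<bar> (\<bar>b\<bar> + sgn b * e)"
 proof -
  have f1: "breg 2 \<bar>b\<bar> \<bar>b + 2 * e\<bar> (\<bar>b\<bar> + 2 * (sgn b * e)) \<le> 4 * breg 2 \<bar>b\<bar> \<bar>b + e\<bar> (\<bar>b\<bar> + sgn b * e)"
   using two[of 1] two[of 2] split[of 1] split[of 2] by (simp add: power2_eq_square)
  have f2: "\<bar>b\<bar> + sgn b * e \<le> \<bar>b + e\<bar>" "\<bar>b\<bar> + 2 * (sgn b * e) \<le> \<bar>b + 2 * e\<bar>"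
   using sgab(1)[of "b + e"] sgab(1)[of "b + 2 * e"] split[of 1] split[of 2] by auto
  have f3: "\<bar>sgn b * e\<bar> \<le> \<bar>e\<bar>" using sgab(2)[of e] by simp
  show ?thesis
   by (rule dblc_doubling[where R="\<bar>e\<bar>", OF s _ _ b _ _ _ _ _ f3 f2 f1]) auto
 qed
 thus ?thesis using split[of 1] split[of 2] unfolding eq by simp
qed


section \<open>Norms with a gradient and the passage from the exponent s to p\<close>

lemma deriv_abs_powr_at_root:
 fixes f :: "real => real"
 assumes p: "p > 1" and f: "!!t. \<bar>f t\<bar> \<le> C * \<bar>t - x\<bar> powr p"
 shows "(f has_real_derivative 0) (at x)"
proof -
 have f0: "f x = 0" using f[of x] by simp
 have "((\<lambda>t. C * \<bar>t - x\<bar> powr (p - 1)) \<longlongrightarrow> C * \<bar>x - x\<bar> powr (p - 1)) (at x)"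
  using p by (intro tendsto_intros) auto
 hence lim: "((\<lambda>t. C * \<bar>t - x\<bar> powr (p - 1)) \<longlongrightarrow> 0) (at x)" using p by simp
 have "((\<lambda>t. (f t - f x) / (t - x)) \<longlongrightarrow> 0) (at x)"
 proof (rule Lim_null_comparison[OF _ lim])
  have "norm ((f t - f x) / (t - x)) \<le> C * \<bar>t - x\<bar> powr (p - 1)" if "t \<noteq> x" for t
  proof -
   have pos: "\<bar>t - x\<bar> > 0" using that by simp
   have "norm ((f t - f x) / (t - x)) = \<bar>f t\<bar> / \<bar>t - x\<bar>" using f0 by simp
   also have "\<dots> \<le> (C * \<bar>t - x\<bar> powr p) / \<bar>t - x\<bar>" using f pos by (intro divide_right_mono) auto
   also have "\<dots> = C * \<bar>t - x\<bar> powr (p - 1)" using pos by (simp add: powr_diff)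
   finally show ?thesis .
  qed
  thus "\<forall>\<^sub>F t in at x. norm ((f t - f x) / (t - x)) \<le> C * \<bar>t - x\<bar> powr (p - 1)"
   by (simp add: eventually_at_filter)
 qed
 thus ?thesis by (simp add: has_field_derivative_iff)
qed

text \<open>\<open>g\<close> is the gradient of \<open>\<nu> powr s / s\<close>, and
  \<open>\<nu>\<close> may vanish at nonzero vectors. The natural exponent \<open>s\<close> is the
  one for which Young's inequality and doubling can be checked by hand; Hoelder's inequality, the
  triangle inequality and the theory for every other exponent \<open>p > 1\<close> are derived from
  these assumptions. Both norms in \<open>H\<close> are instances.\<close>

locale hnorm =
 fixes n :: nat and s c :: real and \<nu> :: "vec => real" and g :: "vec => nat => real"
 assumes s1: "s > 1" and c0: "c > 0"
  and nonneg: "\<nu> x \<ge> 0"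
  and scale: "\<nu> (\<lambda>i. t * x i) = \<bar>t\<bar> * \<nu> x"
  and local: "(!!i. i < n ==> x i = y i) ==> \<nu> x = \<nu> y"
  and g_scale: "i < n ==> g (\<lambda>i. t * x i) i = \<bar>t\<bar> powr (s - 1) * sgn t * g x i"
  and euler: "(\<Sum>i<n. g b i * b i) = \<nu> b powr s"
  and young: "s * (\<Sum>i<n. g b i * \<xi> i) \<le> \<nu> \<xi> powr s + (s - 1) * \<nu> b powr s"
  and dbl: "\<nu> (\<lambda>i. b i + 2 * e i) powr s + (s - 1) * \<nu> b powr s - s * (\<Sum>i<n. g b i * (b i + 2 * e i))
   \<le> c * (\<nu> (\<lambda>i. b i + e i) powr s + (s - 1) * \<nu> b powr s - s * (\<Sum>i<n. g b i * (b i + e i)))"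
  and der: "i < n ==> ((\<lambda>t. \<nu> (b(i := t)) powr s) has_real_derivative s * g b i) (at (b i))"
begin

abbreviation ee :: "vec => vec => real" where
 "ee b \<xi> \<equiv> \<Sum>i<n. g b i * \<xi> i"

lemma ee_add: "ee b (\<lambda>i. x i + y i) = ee b x + ee b y"
 by (simp add: distrib_left sum.distrib)

lemma ee_scale: "ee b (\<lambda>i. t * x i) = t * ee b x"
 by (simp add: sum_distrib_left mult.left_commute)

text \<open>Young's inequality for \<open>t * \<xi>\<close> with the optimal
  \<open>t = \<nu> b / \<nu> \<xi>\<close>. If \<open>\<nu> \<xi> = 0\<close> and the pairing were
  positive, a large \<open>t\<close> would contradict it.\<close>

lemma holder: "\<nu> b > 0 ==> ee b \<xi> \<le> \<nu> b powr (s - 1) * \<nu> \<xi>"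
proof -
 assume b: "\<nu> b > 0"
 have y: "s * (t * ee b \<xi>) \<le> (t * \<nu> \<xi>) powr s + (s - 1) * \<nu> b powr s" if "t > 0" for t
  using young[of b "\<lambda>i. t * \<xi> i"] that unfolding ee_scale scale by simp
 show ?thesis
 proof (cases "\<nu> \<xi> = 0")
  case True
  have "ee b \<xi> \<le> 0"
  proof (rule ccontr)
   assume "\<not> ee b \<xi> \<le> 0"
   hence e: "ee b \<xi> > 0" by simp
   define t where "t = \<nu> b powr s / ee b \<xi>"
   have "t > 0" unfolding t_def using e b by simp
   from y[OF this] have "s * \<nu> b powr s \<le> (s - 1) * \<nu> b powr s"
    using True e by (simp add: t_def)
   thus False using b by (simp add: algebra_simps)
  qed
  thus ?thesis using True by simp
 next
  case False
  hence x: "\<nu> \<xi> > 0" using nonneg[of \<xi>] by simp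
  hence "s * (\<nu> b / \<nu> \<xi> * ee b \<xi>) \<le> \<nu> b powr s + (s - 1) * \<nu> b powr s"
   using y[of "\<nu> b / \<nu> \<xi>"] b by simp
  hence "s * (\<nu> b / \<nu> \<xi> * ee b \<xi>) \<le> s * \<nu> b powr s" by (simp add: algebra_simps)
  hence "\<nu> b / \<nu> \<xi> * ee b \<xi> \<le> \<nu> b powr s" by (rule mult_left_le_imp_le) (use s1 in simp)
  hence "\<nu> b * ee b \<xi> \<le> \<nu> b powr s * \<nu> \<xi>" using x by (simp add: field_simps)
  moreover have "\<nu> b powr s = \<nu> b * \<nu> b powr (s - 1)" using b by (simp add: powr_diff)
  ultimately have "\<nu> b * ee b \<xi> \<le> \<nu> b * (\<nu> b powr (s - 1) * \<nu> \<xi>)" by (simp add: mult.assoc)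
  thus ?thesis using b by simp
 qed
qed

lemma nu_minus: "\<nu> (\<lambda>i. - x i) = \<nu> x"
 using scale[of "-1" x] by simp

lemma holder_abs: "\<nu> b > 0 ==> \<bar>ee b \<xi>\<bar> \<le> \<nu> b powr (s - 1) * \<nu> \<xi>"
 using holder[of b \<xi>] holder[of b "\<lambda>i. - \<xi> i"] ee_scale[of b "-1" \<xi>] nu_minus[of \<xi>] by simp

text \<open>Duality: the sum \<open>z\<close> is paired with its own gradient, where Euler's
  identity gives \<open>\<nu> z powr s\<close>, and Hoelder's inequality is applied to the two
  summands.\<close>

lemma triangle: "\<nu> (\<lambda>i. x i + y i) \<le> \<nu> x + \<nu> y"
proof (cases "\<nu> (\<lambda>i. x i + y i) = 0")
 case True thus ?thesis using nonneg[of x] nonneg[of y] by simp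
next
 case False
 define z where "z = (\<lambda>i. x i + y i)"
 have z: "\<nu> z > 0" using False nonneg[of z] unfolding z_def by simp
 have "\<nu> z powr s = ee z z" by (simp add: euler)
 also have "\<dots> = ee z x + ee z y" using ee_add[of z x y] unfolding z_def by simp
 also have "\<dots> \<le> \<nu> z powr (s - 1) * \<nu> x + \<nu> z powr (s - 1) * \<nu> y"
  by (intro add_mono holder z)
 finally have "\<nu> z powr (s - 1) * \<nu> z \<le> \<nu> z powr (s - 1) * (\<nu> x + \<nu> y)"
  using z by (simp add: powr_diff distrib_left)
 thus ?thesis using z unfolding z_def by simp
qed

text \<open>The derivative of \<open>\<nu> powr p / p\<close> at \<open>b\<close> in the direction
  \<open>\<xi>\<close>, obtained from the exponent \<open>s\<close> by the chain rule. Since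
  \<open>0 powr\<close> anything is 0, the formula is also right where \<open>\<nu> b = 0\<close>,
  even for \<open>p < s\<close>.\<close>

definition ep :: "real => vec => vec => real" where
 "ep p b \<xi> = \<nu> b powr (p - s) * ee b \<xi>"

definition Dp :: "real => vec => vec => real" where
 "Dp p \<xi> b = \<nu> \<xi> powr p + (p - 1) * \<nu> b powr p - p * ep p b \<xi>"

lemma ep_add: "ep p b (\<lambda>i. x i + y i) = ep p b x + ep p b y"
 unfolding ep_def ee_add by (simp add: distrib_left)

lemma ep_cmult: "ep p b (\<lambda>i. t * x i) = t * ep p b x"
 unfolding ep_def ee_scale by simp

lemma ep_scale: "ep p (\<lambda>i. t * b i) \<xi> = \<bar>t\<bar> powr (p - 1) * sgn t * ep p b \<xi>"
proof (cases "t = 0")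
 case False
 have "ee (\<lambda>i. t * b i) \<xi> = \<bar>t\<bar> powr (s - 1) * sgn t * ee b \<xi>"
  by (simp add: g_scale sum_distrib_left mult.assoc)
 moreover have "\<bar>t\<bar> powr (p - s) * \<bar>t\<bar> powr (s - 1) = \<bar>t\<bar> powr (p - 1)" by (simp add: powr_add[symmetric])
 ultimately show ?thesis unfolding ep_def scale using nonneg[of b] by (simp add: powr_mult)
qed (simp add: ep_def scale[of 0, simplified])

lemma ep_holder: "\<bar>ep p b \<xi>\<bar> \<le> \<nu> b powr (p - 1) * \<nu> \<xi>"
proof (cases "\<nu> b = 0")
 case False
 hence b: "\<nu> b > 0" using nonneg[of b] by simp
 have "\<bar>ep p b \<xi>\<bar> = \<nu> b powr (p - s) * \<bar>ee b \<xi>\<bar>" by (simp add: ep_def abs_mult)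
 also have "\<dots> \<le> \<nu> b powr (p - s) * (\<nu> b powr (s - 1) * \<nu> \<xi>)" by (intro mult_left_mono holder_abs b) auto
 also have "\<dots> = \<nu> b powr (p - 1) * \<nu> \<xi>" by (simp add: powr_add[symmetric] mult.assoc[symmetric])
 finally show ?thesis .
qed (simp add: ep_def nonneg)

lemma ep_self: "ep p b b = \<nu> b powr p"
 unfolding ep_def euler by (cases "\<nu> b = 0") (simp_all add: powr_add[symmetric])

lemma Dp_shift: "Dp p (\<lambda>i. b i + e i) b = \<nu> (\<lambda>i. b i + e i) powr p - \<nu> b powr p - p * ep p b e"
 unfolding Dp_def ep_add ep_self by (simp add: algebra_simps)

lemma Dp_nonneg: "p > 1 ==> Dp p \<xi> b \<ge> 0"
proof -
 assume p: "p > 1"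
 have "p * ep p b \<xi> \<le> p * (\<nu> b powr (p - 1) * \<nu> \<xi>)" using ep_holder[of p b \<xi>] p by (intro mult_left_mono) auto
 moreover have "\<nu> b powr p + p * \<nu> b powr (p - 1) * (\<nu> \<xi> - \<nu> b) \<le> \<nu> \<xi> powr p"
  by (intro powr_tangent p nonneg)
 moreover have "\<nu> b powr (p - 1) * \<nu> b = \<nu> b powr p" using nonneg[of b] by (cases "\<nu> b = 0") (auto simp: powr_diff)
 ultimately show ?thesis unfolding Dp_def by (simp add: algebra_simps)
qed

text \<open>Convexity of \<open>\<nu> powr p\<close> along the segment from \<open>b\<close> to
  \<open>b + e\<close>: the distance at parameter \<open>k\<close> is at most \<open>k\<close> times
  the distance at its end.\<close>

lemma Dp_mono:
 assumes p: "p > 1" and k: "0 \<le> k" "k \<le> 1"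
 shows "Dp p (\<lambda>i. b i + k * e i) b \<le> Dp p (\<lambda>i. b i + e i) b"
proof -
 have "(\<lambda>i. b i + k * e i) = (\<lambda>i. (1 - k) * b i + k * (b i + e i))" by (auto simp: algebra_simps)
 hence "\<nu> (\<lambda>i. b i + k * e i) \<le> (1 - k) * \<nu> b + k * \<nu> (\<lambda>i. b i + e i)"
  using triangle[of "\<lambda>i. (1 - k) * b i" "\<lambda>i. k * (b i + e i)"] scale[of "1 - k" b] scale[of k "\<lambda>i. b i + e i"] k by simp
 hence "\<nu> (\<lambda>i. b i + k * e i) powr p \<le> ((1 - k) * \<nu> b + k * \<nu> (\<lambda>i. b i + e i)) powr p"
  using p nonneg by (intro powr_mono2) auto
 also have "\<dots> \<le> (1 - k) * \<nu> b powr p + k * \<nu> (\<lambda>i. b i + e i) powr p"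
 proof -
  let ?z = "(1 - k) * \<nu> b + k * \<nu> (\<lambda>i. b i + e i)"
  have z: "?z \<ge> 0" using k nonneg by simp
  have "(1 - k) * (?z powr p + p * ?z powr (p - 1) * (\<nu> b - ?z)) \<le> (1 - k) * \<nu> b powr p"
   using powr_tangent[OF p nonneg z, of b] k by (intro mult_left_mono) auto
  moreover have "k * (?z powr p + p * ?z powr (p - 1) * (\<nu> (\<lambda>i. b i + e i) - ?z)) \<le> k * \<nu> (\<lambda>i. b i + e i) powr p"
   using powr_tangent[OF p nonneg z, of "\<lambda>i. b i + e i"] k by (intro mult_left_mono) auto
  moreover have "(1 - k) * (?z powr p + p * ?z powr (p - 1) * (\<nu> b - ?z)) + k * (?z powr p + p * ?z powr (p - 1) * (\<nu> (\<lambda>i. b i + e i) - ?z)) = ?z powr p"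
  proof -
   have "(1 - k) * (A + B * (x - ((1 - k) * x + k * y))) + k * (A + B * (y - ((1 - k) * x + k * y))) = A" for A B x y :: real
    by (simp add: algebra_simps)
   thus ?thesis by blast
  qed
  ultimately show ?thesis by linarith
 qed
 finally have "Dp p (\<lambda>i. b i + k * e i) b \<le> k * Dp p (\<lambda>i. b i + e i) b"
  using Dp_shift[of p b "\<lambda>i. k * e i"] unfolding Dp_shift ep_cmult by (simp add: algebra_simps)
 also have "\<dots> \<le> Dp p (\<lambda>i. b i + e i) b" using Dp_nonneg[OF p] k by (simp add: mult_left_le_one_le)
 finally show ?thesis .
qed

lemma Dp_breg:
 assumes "\<nu> b > 0"
 shows "Dp p \<xi> b = breg p (\<nu> b) (\<nu> \<xi>) (ee b \<xi> / \<nu> b powr (s - 1))"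
proof -
 have "\<nu> b powr (p - 1) * (ee b \<xi> / \<nu> b powr (s - 1)) = \<nu> b powr (p - s) * ee b \<xi>"
  using assms by (simp add: powr_diff)
 thus ?thesis unfolding Dp_def breg_def ep_def by (simp only: mult.assoc)
qed

text \<open>If \<open>\<nu> b = 0\<close>, the distance is \<open>\<nu> powr p\<close> and
  \<open>\<nu> (b + t e) = t \<nu> e\<close>, so the factor is exactly \<open>2 powr p\<close>.
  Otherwise \<open>Dp_breg\<close> reduces the claim to the inequality between numbers with
  \<open>R = \<nu> e\<close>, whose side conditions are the triangle inequality and Hoelder's
  inequality.\<close>

lemma Dp_doubling:
 assumes p: "p > 1"
 shows "Dp p (\<lambda>i. b i + 2 * e i) b \<le> dblc p s c * Dp p (\<lambda>i. b i + e i) b"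
proof (cases "\<nu> b = 0")
 case True
 have z: "Dp p \<xi> b = \<nu> \<xi> powr p" for \<xi>
  unfolding Dp_def ep_def using True by simp
 have le: "\<nu> (\<lambda>i. b i + t * e i) \<le> t * \<nu> e" "t * \<nu> e \<le> \<nu> (\<lambda>i. b i + t * e i)" if "t \<ge> 0" for t
 proof -
  show "\<nu> (\<lambda>i. b i + t * e i) \<le> t * \<nu> e" using triangle[of b "\<lambda>i. t * e i"] True scale[of t e] that by simp
  show "t * \<nu> e \<le> \<nu> (\<lambda>i. b i + t * e i)"
   using triangle[of "\<lambda>i. b i + t * e i" "\<lambda>i. - b i"] nu_minus[of b] True scale[of t e] that by simp
 qed
 have "\<nu> (\<lambda>i. b i + 2 * e i) powr p = 2 powr p * \<nu> (\<lambda>i. b i + e i) powr p"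
  using le[of 1] le[of 2] nonneg[of e] by (simp add: powr_mult antisym[of _ "_ * _"] flip: powr_mult)
 also have "\<dots> \<le> dblc p s c * \<nu> (\<lambda>i. b i + e i) powr p"
  using dblc_ge[OF p s1 c0] by (intro mult_right_mono) auto
 finally show ?thesis unfolding z .
next
 case False
 hence b: "\<nu> b > 0" using nonneg[of b] by simp
 define l where "l = ee b e / \<nu> b powr (s - 1)"
 have L: "ee b (\<lambda>i. b i + t * e i) / \<nu> b powr (s - 1) = \<nu> b + t * l" for t
 proof -
  have "\<nu> b powr s / \<nu> b powr (s - 1) = \<nu> b" using b by (simp add: powr_diff)
  thus ?thesis unfolding ee_add ee_scale euler l_def by (simp add: add_divide_distrib)
 qed
 have hl: "\<bar>ee b \<xi> / \<nu> b powr (s - 1)\<bar> \<le> \<nu> \<xi>" for \<xi>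
  using holder_abs[OF b, of \<xi>] b by (simp add: abs_divide field_simps)
 have "breg p (\<nu> b) (\<nu> (\<lambda>i. b i + 2 * e i)) (\<nu> b + 2 * l) \<le> dblc p s c * breg p (\<nu> b) (\<nu> (\<lambda>i. b i + e i)) (\<nu> b + l)"
 proof (rule dblc_doubling[OF p s1 c0 b nonneg nonneg, where R="\<nu> e"])
  show "\<nu> (\<lambda>i. b i + e i) \<le> \<nu> b + \<nu> e" by (rule triangle)
  show "\<nu> e - \<nu> b \<le> \<nu> (\<lambda>i. b i + e i)"
   using triangle[of "\<lambda>i. b i + e i" "\<lambda>i. - b i"] nu_minus[of b] by simp
  show "\<nu> (\<lambda>i. b i + 2 * e i) \<le> \<nu> b + 2 * \<nu> e"
   using triangle[of b "\<lambda>i. 2 * e i"] scale[of 2 e] by simp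
  show "\<bar>l\<bar> \<le> \<nu> e" unfolding l_def by (rule hl)
  show "\<nu> b + l \<le> \<nu> (\<lambda>i. b i + e i)" using abs_le_D1[OF hl[of "\<lambda>i. b i + e i"]] L[of 1] by simp
  show "\<nu> b + 2 * l \<le> \<nu> (\<lambda>i. b i + 2 * e i)" using abs_le_D1[OF hl[of "\<lambda>i. b i + 2 * e i"]] L[of 2] by simp
  have "Dp s (\<lambda>i. b i + 2 * e i) b \<le> c * Dp s (\<lambda>i. b i + e i) b"
   using dbl[of b e] b unfolding Dp_def ep_def by simp
  thus "breg s (\<nu> b) (\<nu> (\<lambda>i. b i + 2 * e i)) (\<nu> b + 2 * l) \<le> c * breg s (\<nu> b) (\<nu> (\<lambda>i. b i + e i)) (\<nu> b + l)"
   unfolding Dp_breg[OF b] using L[of 1] L[of 2] by simp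
 qed
 thus ?thesis unfolding Dp_breg[OF b] using L[of 1] L[of 2] by simp
qed

text \<open>Where \<open>\<nu> b > 0\<close> this is the chain rule through the power
  \<open>p / s\<close> of \<open>\<nu> powr s\<close>. Where \<open>\<nu> b = 0\<close> the function
  grows at most like the p-th power of the increment, so its derivative vanishes, as does the
  formula.\<close>

lemma der_p:
 assumes p: "p > 1" and i: "i < n"
 shows "((\<lambda>t. \<nu> (b(i := t)) powr p) has_real_derivative p * (\<nu> b powr (p - s) * g b i)) (at (b i))"
proof (cases "\<nu> b = 0")
 case True
 define u where "u = (\<lambda>j. if j = i then 1 else 0 :: real)"
 have "((\<lambda>t. \<nu> (b(i := t)) powr p) has_real_derivative 0) (at (b i))"
 proof (rule deriv_abs_powr_at_root[OF p])
  fix t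
  have "b(i := t) = (\<lambda>j. b j + (t - b i) * u j)" by (auto simp: u_def)
  hence "\<nu> (b(i := t)) \<le> \<bar>t - b i\<bar> * \<nu> u"
   using triangle[of b "\<lambda>j. (t - b i) * u j"] True scale[of "t - b i" u] by simp
  hence "\<nu> (b(i := t)) powr p \<le> (\<bar>t - b i\<bar> * \<nu> u) powr p" using nonneg p by (intro powr_mono2) auto
  thus "\<bar>\<nu> (b(i := t)) powr p\<bar> \<le> \<nu> u powr p * \<bar>t - b i\<bar> powr p"
   using nonneg[of u] by (simp add: powr_mult mult.commute)
 qed
 thus ?thesis using True by simp
next
 case False
 hence b: "\<nu> b > 0" using nonneg[of b] by simp
 have "((\<lambda>t. (\<nu> (b(i := t)) powr s) powr (p / s)) has_real_derivative (p / s) * (\<nu> b powr s) powr (p / s - 1) * (s * g b i)) (at (b i))"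
  using der[OF i, of b] b by (intro DERIV_fun_powr[where r="p / s", THEN DERIV_cong]) auto
 moreover have "(\<nu> b powr s) powr (p / s - 1) = \<nu> b powr (p - s)" using s1 by (simp add: powr_powr right_diff_distrib)
 moreover have "(\<nu> x powr s) powr (p / s) = \<nu> x powr p" for x using s1 by (simp add: powr_powr)
 ultimately show ?thesis using s1 by (simp add: mult.assoc)
qed

end

section \<open>Truncation functions and the two norms\<close>

lemma abs_powr_deriv:
 assumes p: "p > 1"
 shows "((\<lambda>t. \<bar>t\<bar> powr p) has_real_derivative p * (\<bar>t\<bar> powr (p - 1) * sgn t)) (at t)"
proof (cases "t = 0")
 case True
 thus ?thesis using deriv_abs_powr_at_root[OF p, of "\<lambda>t. \<bar>t\<bar> powr p" 1 0] by simp
next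
 case False
 show ?thesis
 proof (cases "t > 0")
  case True
  have "((\<lambda>t. t powr p) has_real_derivative p * t powr (p - 1)) (at t)" using True
   by (auto intro!: derivative_eq_intros)
  thus ?thesis
   by (rule has_field_derivative_transform_within_open[of _ _ _ "{0<..}", THEN DERIV_cong]) (use True in auto)
 next
  case neg: False
  have "((\<lambda>t. (- t) powr p) has_real_derivative - (p * (- t) powr (p - 1))) (at t)" using False neg
   by (auto intro!: derivative_eq_intros)
  thus ?thesis
   by (rule has_field_derivative_transform_within_open[of _ _ _ "{..<0}", THEN DERIV_cong]) (use False neg in auto)
 qed
qed

lemma max0_power_deriv:
 assumes "k \<ge> 2"
 shows "((\<lambda>t::real. (max 0 t) ^ k) has_real_derivative real k * (max 0 t) ^ (k - 1)) (at t)"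
proof -
 consider "t > 0" | "t < 0" | "t = 0" by linarith
 thus ?thesis
 proof cases
  case 1
  have "((\<lambda>t::real. t ^ k) has_real_derivative real k * t ^ (k - 1)) (at t)" by (auto intro!: derivative_eq_intros)
  thus ?thesis
   by (rule has_field_derivative_transform_within_open[of _ _ _ "{0<..}", THEN DERIV_cong]) (use 1 in auto)
 next
  case 2
  have "((\<lambda>t::real. 0) has_real_derivative 0) (at t)" by simp
  thus ?thesis
   by (rule has_field_derivative_transform_within_open[of _ _ _ "{..<0}", THEN DERIV_cong]) (use 2 assms in auto)
 next
  case 3
  have "((\<lambda>t::real. (max 0 t) ^ k) has_real_derivative 0) (at 0)"
  proof (rule deriv_abs_powr_at_root[of "real k" _ 1])
   show "real k > 1" using assms by simp
   fix t :: real
   have "(max 0 t) ^ k \<le> \<bar>t\<bar> ^ k" by (intro power_mono) auto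
   thus "\<bar>(max 0 t) ^ k\<bar> \<le> 1 * \<bar>t - 0\<bar> powr real k" using assms
    by (cases "t = 0") (auto simp: powr_realpow zero_power)
  qed
  moreover have e: "real k * (max 0 t) ^ (k - 1) = 0" using 3 assms by (simp add: power_0_left)
  ultimately show ?thesis unfolding e using 3 by simp
 qed
qed

text \<open>On the unit interval this is \<open>(x * (2 - x)) ^ N\<close>: it vanishes to order
  \<open>N\<close> at 0 and has slope 0 at 1. So it is C1 for \<open>N \<ge> 2\<close>, and its
  logarithmic derivative blows up only at 0, with a rate that the order \<open>N\<close>
  compensates.\<close>

definition sstep :: "nat => real => real" where
 "sstep N x = (max 0 (1 - (max 0 (1 - x))\<^sup>2)) ^ N"

definition dsstep :: "nat => real => real" where
 "dsstep N x = real N * (max 0 (1 - (max 0 (1 - x))\<^sup>2)) ^ (N - 1) * (2 * max 0 (1 - x))"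

lemma sstep_deriv: "N \<ge> 2 ==> (sstep N has_real_derivative dsstep N x) (at x)"
proof -
 assume N: "N \<ge> 2"
 have "((\<lambda>x. (max 0 (1 - x))\<^sup>2) has_real_derivative (real 2 * (max 0 (1 - x)) ^ (2 - 1)) * (- 1)) (at x)"
  by (rule DERIV_chain2[OF max0_power_deriv]) (auto intro!: derivative_eq_intros)
 from DERIV_diff[OF DERIV_const this, of 1]
 have "((\<lambda>x. 1 - (max 0 (1 - x))\<^sup>2) has_real_derivative (2 * max 0 (1 - x))) (at x)" by simp
 from DERIV_chain2[OF max0_power_deriv[OF N] this] show ?thesis
  unfolding sstep_def dsstep_def by (simp add: mult.assoc)
qed

text \<open>The transition takes place on \<open>T < v\<^sup>2 < 2 * T\<close>.\<close>

definition psi :: "nat => real => real => real" where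
 "psi N T v = sstep N (v\<^sup>2 / T - 1)"

definition dpsi :: "nat => real => real => real" where
 "dpsi N T v = dsstep N (v\<^sup>2 / T - 1) * (2 * v / T)"

lemma psi_deriv: "N \<ge> 2 ==> T > 0 ==> (psi N T has_real_derivative dpsi N T v) (at v)"
 unfolding psi_def dpsi_def
 by (rule DERIV_chain2[OF sstep_deriv]) (auto intro!: derivative_eq_intros)

lemma continuous_on_psi: "continuous_on X (psi N T)"
 unfolding psi_def sstep_def divide_inverse by (intro continuous_intros)

lemma continuous_on_dpsi: "continuous_on X (dpsi N T)"
 unfolding dpsi_def dsstep_def divide_inverse by (intro continuous_intros)

lemma psi_low: "N \<ge> 2 ==> T > 0 ==> v\<^sup>2 \<le> T ==> psi N T v = 0 \<and> dpsi N T v = 0"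
proof -
 assume N: "N \<ge> 2" and T: "T > 0" and v: "v\<^sup>2 \<le> T"
 have "v\<^sup>2 / T - 1 \<le> 0" using T v by simp
 hence "(1::real)\<^sup>2 \<le> (max 0 (1 - (v\<^sup>2 / T - 1)))\<^sup>2" by (intro power_mono) auto
 hence "max 0 (1 - (max 0 (1 - (v\<^sup>2 / T - 1)))\<^sup>2) = 0" by simp
 thus ?thesis unfolding psi_def dpsi_def sstep_def dsstep_def using N by simp
qed

lemma psi_high: "T > 0 ==> v\<^sup>2 \<ge> 2 * T ==> psi N T v = 1 \<and> dpsi N T v = 0"
proof -
 assume T: "T > 0" and v: "v\<^sup>2 \<ge> 2 * T"
 have "v\<^sup>2 / T - 1 \<ge> 1" using T v by (simp add: field_simps)
 hence "max 0 (1 - (v\<^sup>2 / T - 1)) = 0" by simp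
 thus ?thesis unfolding psi_def dpsi_def sstep_def dsstep_def by simp
qed

lemma psi_bounds: "0 \<le> psi N T v \<and> psi N T v \<le> 1"
 unfolding psi_def sstep_def by (auto intro: power_le_one)

text \<open>With doubling constant \<open>2 ^ m\<close>, a dilation by \<open>k\<close> costs about
  \<open>k ^ m\<close>: double until the factor exceeds \<open>k\<close>, then use monotonicity to
  come back.\<close>

lemma doubling_growth:
 fixes h :: "real => real"
 assumes mono: "!!k x. 0 \<le> k ==> k \<le> 1 ==> h (k * x) \<le> h x"
  and dbl: "!!x. h (2 * x) \<le> 2 ^ m * h x" and nn: "!!x. h x \<ge> 0"
  and k: "0 \<le> k" "k \<le> K / 2" "K \<ge> 1"
 shows "h (k * x) \<le> K ^ m * h x"
proof (cases "k \<le> 1")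
 case True
 have "h (k * x) \<le> 1 * h x" using mono[OF k(1) True] by simp
 also have "\<dots> \<le> K ^ m * h x" using k nn by (intro mult_right_mono) auto
 finally show ?thesis .
next
 case False
 have it: "h (2 ^ j * x) \<le> (2 ^ j) ^ m * h x" for j :: nat
 proof (induction j)
  case (Suc j)
  have "h (2 ^ Suc j * x) \<le> 2 ^ m * h (2 ^ j * x)" using dbl[of "2 ^ j * x"] by (simp add: mult.assoc)
  also have "\<dots> \<le> 2 ^ m * ((2 ^ j) ^ m * h x)" using Suc by simp
  finally show ?case by (simp add: power_mult_distrib mult.assoc)
 qed simp
 \<comment> \<open>The least power of 2 above \<open>k\<close> is at most \<open>2 * k\<close>,
   hence at most \<open>K\<close>; this is where \<open>k \<le> K / 2\<close> enters.\<close>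
 define j where "j = (LEAST j. k \<le> 2 ^ j)"
 have ex: "\<exists>j. k \<le> 2 ^ j" using real_arch_pow[of 2 k] by (auto intro: less_imp_le)
 hence j: "k \<le> 2 ^ j" unfolding j_def by (rule LeastI_ex)
 have "j \<noteq> 0" using j False by (cases j) auto
 then obtain j' where j': "j = Suc j'" by (cases j) auto
 have "\<not> k \<le> 2 ^ j'" using not_less_Least[of j' "\<lambda>j. k \<le> 2 ^ j"] j' unfolding j_def by simp
 hence le: "2 ^ j \<le> 2 * k" using j' by simp
 have "h (k * x) = h ((k / 2 ^ j) * (2 ^ j * x))" by simp
 also have "\<dots> \<le> h (2 ^ j * x)" using j k by (intro mono) auto
 also have "\<dots> \<le> (2 ^ j) ^ m * h x" by (rule it)
 also have "\<dots> \<le> K ^ m * h x" using le k nn by (intro mult_right_mono power_mono) auto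
 finally show ?thesis .
qed

text \<open>The exponent \<open>N \<ge> m\<close> of the cut-off compensates for the singularity of its logarithmic
 derivative, since doubling only bounds \<open>D\<close> polynomially in that derivative.\<close>

lemma truncation_bound:
 fixes D :: "vec => vec => real"
 assumes hom: "!!t \<xi> b. D (\<lambda>i. t * \<xi> i) (\<lambda>i. t * b i) = \<bar>t\<bar> powr p * D \<xi> b"
  and mono: "!!k b e. 0 \<le> k ==> k \<le> 1 ==> D (\<lambda>i. b i + k * e i) b \<le> D (\<lambda>i. b i + e i) b"
  and dbl: "!!b e. D (\<lambda>i. b i + 2 * e i) b \<le> 2 ^ m * D (\<lambda>i. b i + e i) b"
  and nn: "!!\<xi> b. D \<xi> b \<ge> 0"
  and p: "p > 1" and N: "N \<ge> 2" "N \<ge> m" and T: "T > 0" and v: "T < v\<^sup>2" "v\<^sup>2 < 2 * T"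
 shows "D (\<lambda>i. psi N T v * b i + dpsi N T v * (\<xi> i - v * b i)) (\<lambda>i. psi N T v * b i)
  \<le> (16 * real N) ^ m * T powr (- p / 2) * D \<xi> (\<lambda>i. v * b i)"
proof -
 have v0: "v \<noteq> 0" using T v by auto
 define x where "x = v\<^sup>2 / T - 1"
 define y where "y = 1 - (1 - x)\<^sup>2"
 have x: "0 < x" "x < 1" using T v unfolding x_def by (auto simp: field_simps)
 have x2: "0 < (1 - x)" "(1 - x)\<^sup>2 < 1" using x by (auto simp: power2_eq_square) (metis diff_gt_0_iff_gt diff_less_eq less_add_same_cancel1 mult_strict_mono' mult_1 less_eq_real_def)
 have y: "0 < y" "y \<le> 1" using x2 unfolding y_def by auto
 have psi: "psi N T v = y ^ N" and dpsi: "dpsi N T v = real N * y ^ (N - 1) * (2 * (1 - x)) * (2 * v / T)"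
  unfolding psi_def dpsi_def sstep_def dsstep_def x_def[symmetric] using x y by (auto simp: y_def max_def)
 \<comment> \<open>\<open>k\<close> is \<open>v\<close> times the logarithmic derivative of
   \<open>psi N T\<close> at \<open>v\<close>, the factor by which the increment \<open>e\<close> is
   dilated.\<close>
 define k where "k = real N * (2 * (1 - x)) / y * (2 * v\<^sup>2 / T)"
 \<comment> \<open>Chosen so that \<open>\<xi> = v (b + e)\<close>; the first argument on the left
   of the claim is then \<open>psi N T v\<close> times \<open>b + k e\<close>.\<close>
 define e where "e = (\<lambda>i. \<xi> i / v - b i)"
 have k: "0 \<le> k" "k \<le> 16 * real N / y / 2"
 proof -
  show "0 \<le> k" unfolding k_def using x y T by simp
  have "real N * (2 * (1 - x)) / y \<le> real N * 2 / y" using x y by (intro divide_right_mono mult_left_mono) auto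
  moreover have "2 * v\<^sup>2 / T \<le> 4" using T v by (simp add: field_simps)
  ultimately have "k \<le> real N * 2 / y * 4" unfolding k_def using x y T by (intro mult_mono) auto
  thus "k \<le> 16 * real N / y / 2" by simp
 qed
 have K1: "16 * real N / y \<ge> 1" using N y by (simp add: field_simps)
 have pos: "psi N T v > 0" using psi y by simp
 have "y ^ N = y ^ (N - 1) * y" using N by (metis One_nat_def Suc_pred less_le_trans mult.commute pos2 power_Suc)
 moreover have "a * w * c * (2 * v / T) = (w * y) * (a * c / y * (2 * v\<^sup>2 / T)) / v" for a w c :: real
  using y v0 T by (simp add: power2_eq_square)
 ultimately have dk: "dpsi N T v = psi N T v * k / v" unfolding dpsi psi k_def by simp
 have "D (\<lambda>i. psi N T v * b i + dpsi N T v * (\<xi> i - v * b i)) (\<lambda>i. psi N T v * b i) = \<bar>psi N T v\<bar> powr p * D (\<lambda>i. b i + k * e i) b"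
 proof -
  have "(\<lambda>i. psi N T v * b i + dpsi N T v * (\<xi> i - v * b i)) = (\<lambda>i. psi N T v * (b i + k * e i))"
   unfolding dk e_def using v0 by (auto simp: field_simps)
  thus ?thesis using hom[of "psi N T v" "\<lambda>i. b i + k * e i" b] by simp
 qed
 also have "\<dots> \<le> \<bar>psi N T v\<bar> powr p * ((16 * real N / y) ^ m * D (\<lambda>i. b i + e i) b)"
 proof (rule mult_left_mono)
  define h where "h t = D (\<lambda>i. b i + t * e i) b" for t
  have "h (k * 1) \<le> (16 * real N / y) ^ m * h 1"
  proof (rule doubling_growth[OF _ _ _ k K1])
   show "h (k * x) \<le> h x" if "0 \<le> k" "k \<le> 1" for k x
    unfolding h_def using mono[OF that, of b "\<lambda>i. x * e i"] by (simp add: mult.assoc)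
   show "h (2 * x) \<le> 2 ^ m * h x" for x
    unfolding h_def using dbl[of b "\<lambda>i. x * e i"] by (simp add: mult.assoc)
   show "h x \<ge> 0" for x unfolding h_def by (rule nn)
  qed
  thus "D (\<lambda>i. b i + k * e i) b \<le> (16 * real N / y) ^ m * D (\<lambda>i. b i + e i) b"
   unfolding h_def by simp
 qed simp
 also have "D (\<lambda>i. b i + e i) b = \<bar>v\<bar> powr (- p) * D \<xi> (\<lambda>i. v * b i)"
 proof -
  have "D \<xi> (\<lambda>i. v * b i) = \<bar>v\<bar> powr p * D (\<lambda>i. b i + e i) b"
   using hom[of v "\<lambda>i. b i + e i" b] v0 unfolding e_def by (simp add: algebra_simps)
  thus ?thesis using v0 by (simp add: powr_minus)
 qed
 also have "\<bar>psi N T v\<bar> powr p * ((16 * real N / y) ^ m * (\<bar>v\<bar> powr (- p) * D \<xi> (\<lambda>i. v * b i)))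
  \<le> (16 * real N) ^ m * T powr (- p / 2) * D \<xi> (\<lambda>i. v * b i)"
 proof -
  \<comment> \<open>The singular factor \<open>y\<close> to the power \<open>-m\<close> is absorbed
    here: since \<open>p > 1\<close> and \<open>psi\<close> takes values in the unit interval,
    \<open>psi powr p \<le> psi = y ^ N \<le> y ^ m\<close>.\<close>
  have "\<bar>psi N T v\<bar> powr p * (16 * real N / y) ^ m \<le> (16 * real N) ^ m"
  proof -
   have "\<bar>psi N T v\<bar> powr p \<le> \<bar>psi N T v\<bar> powr 1" using psi_bounds[of N T v] pos p by (intro powr_mono') auto
   also have "\<dots> = y ^ N" using psi y by simp
   also have "\<dots> \<le> y ^ m" using y N by (intro power_decreasing) auto
   finally have "\<bar>psi N T v\<bar> powr p * (16 * real N / y) ^ m \<le> y ^ m * (16 * real N / y) ^ m"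
    using y by (intro mult_right_mono) auto
   also have "\<dots> = (16 * real N) ^ m" by (subst power_mult_distrib[symmetric]) (use y in simp)
   finally show ?thesis .
  qed
  moreover have "\<bar>v\<bar> powr (- p) \<le> T powr (- p / 2)"
  proof -
   have "(v\<^sup>2) powr (- p / 2) \<le> T powr (- p / 2)" using T v p by (intro powr_mono2') auto
   moreover have "(v\<^sup>2) powr (- p / 2) = \<bar>v\<bar> powr (- p)"
   proof -
    have "(v\<^sup>2) powr (- p / 2) = (\<bar>v\<bar> powr 2) powr (- p / 2)" using v0 by simp
    also have "\<dots> = \<bar>v\<bar> powr (2 * (- p / 2))" by (rule powr_powr)
    finally show ?thesis by simp
   qed
   ultimately show ?thesis by simp
  qed
  ultimately have "(\<bar>psi N T v\<bar> powr p * (16 * real N / y) ^ m) * (\<bar>v\<bar> powr (- p)) \<le> (16 * real N) ^ m * T powr (- p / 2)"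
   by (intro mult_mono) auto
  from mult_right_mono[OF this nn[of \<xi> "\<lambda>i. v * b i"]] show ?thesis by (simp add: mult.assoc)
 qed
 finally show ?thesis .
qed

section \<open>The weighted s-norm and the norm of a quadratic form\<close>

lemma norm_sa_powr:
 assumes "s > 1" "!!i. i < n ==> a i x > 0"
 shows "norm_sa n s a x \<xi> powr s = (\<Sum>i<n. a i x * \<bar>\<xi> i\<bar> powr s)"
proof -
 have "0 \<le> (\<Sum>i<n. a i x * \<bar>\<xi> i\<bar> powr s)" using assms(2) by (intro sum_nonneg mult_nonneg_nonneg) (auto simp: less_imp_le)
 thus ?thesis unfolding norm_sa_def using assms(1) by (simp add: powr_powr)
qed

text \<open>The s-th power is a sum over coordinates, so Young's inequality and doubling hold
  termwise. The doubling constant is the scalar one, whatever the number of coordinates and the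
  weights.\<close>

lemma hnorm_sa:
 assumes s: "s > 1" and a: "!!i. i < n ==> a i x > 0"
 shows "hnorm n s (dblc s 2 4) (norm_sa n s a x) (\<lambda>b i. a i x * (\<bar>b i\<bar> powr (s - 1) * sgn (b i)))"
proof
 have npow: "norm_sa n s a x \<xi> powr s = (\<Sum>i<n. a i x * \<bar>\<xi> i\<bar> powr s)" for \<xi>
  by (rule norm_sa_powr) (use s a in auto)
 show "1 < s" by (rule s)
 show "0 < dblc s 2 4" using dblc_ge[of s 2 4] s by simp
 show "0 \<le> norm_sa n s a x \<xi>" for \<xi> unfolding norm_sa_def by simp
 show "norm_sa n s a x (\<lambda>i. t * \<xi> i) = \<bar>t\<bar> * norm_sa n s a x \<xi>" for t \<xi>
 proof -
  have "(\<Sum>i<n. a i x * \<bar>t * \<xi> i\<bar> powr s) = \<bar>t\<bar> powr s * (\<Sum>i<n. a i x * \<bar>\<xi> i\<bar> powr s)"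
   by (simp add: abs_mult powr_mult sum_distrib_left mult.left_commute)
  thus ?thesis unfolding norm_sa_def using s a
   by (simp add: powr_mult sum_nonneg less_imp_le powr_powr)
 qed
 show "norm_sa n s a x \<xi> = norm_sa n s a x q" if "!!i. i < n ==> \<xi> i = q i" for \<xi> q
  unfolding norm_sa_def using that by simp
 show "a i x * (\<bar>t * \<xi> i\<bar> powr (s - 1) * sgn (t * \<xi> i)) = \<bar>t\<bar> powr (s - 1) * sgn t * (a i x * (\<bar>\<xi> i\<bar> powr (s - 1) * sgn (\<xi> i)))" for i t \<xi>
  by (simp add: abs_mult powr_mult sgn_mult mult_ac)
 have self: "\<bar>t\<bar> powr (s - 1) * sgn t * t = \<bar>t\<bar> powr s" for t :: real
  by (cases "t = 0") (auto simp: powr_diff sgn_if)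
 show "(\<Sum>i<n. a i x * (\<bar>b i\<bar> powr (s - 1) * sgn (b i)) * b i) = norm_sa n s a x b powr s" for b
  unfolding npow using self by (simp add: mult.assoc)
 have eq: "norm_sa n s a x \<xi> powr s + (s - 1) * norm_sa n s a x b powr s - s * (\<Sum>i<n. a i x * (\<bar>b i\<bar> powr (s - 1) * sgn (b i)) * \<xi> i)
  = (\<Sum>i<n. a i x * (\<bar>\<xi> i\<bar> powr s + (s - 1) * \<bar>b i\<bar> powr s - s * (\<bar>b i\<bar> powr (s - 1) * sgn (b i) * \<xi> i)))" for \<xi> b
  unfolding npow
  by (simp add: sum_distrib_left sum.distrib[symmetric] sum_subtractf[symmetric] algebra_simps)
 show "s * (\<Sum>i<n. a i x * (\<bar>b i\<bar> powr (s - 1) * sgn (b i)) * \<xi> i) \<le> norm_sa n s a x \<xi> powr s + (s - 1) * norm_sa n s a x b powr s" for b \<xi>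
 proof -
  have "0 \<le> \<bar>X\<bar> powr s + (s - 1) * \<bar>B\<bar> powr s - s * (\<bar>B\<bar> powr (s - 1) * sgn B * X)" for X B :: real
  proof -
   have "\<bar>B\<bar> powr s + s * \<bar>B\<bar> powr (s - 1) * (\<bar>X\<bar> - \<bar>B\<bar>) \<le> \<bar>X\<bar> powr s" by (intro powr_tangent s) auto
   moreover have "\<bar>B\<bar> powr (s - 1) * \<bar>B\<bar> = \<bar>B\<bar> powr s" by (cases "B = 0") (auto simp: powr_diff)
   moreover have "s * (\<bar>B\<bar> powr (s - 1) * (sgn B * X)) \<le> s * (\<bar>B\<bar> powr (s - 1) * \<bar>X\<bar>)"
    using s by (intro mult_left_mono) (auto simp: sgn_if)
   ultimately show ?thesis by (simp add: algebra_simps)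
  qed
  hence "0 \<le> (\<Sum>i<n. a i x * (\<bar>\<xi> i\<bar> powr s + (s - 1) * \<bar>b i\<bar> powr s - s * (\<bar>b i\<bar> powr (s - 1) * sgn (b i) * \<xi> i)))"
   using a by (intro sum_nonneg mult_nonneg_nonneg) (auto simp: less_imp_le)
  thus ?thesis using eq[of \<xi> b] by linarith
 qed
 show "norm_sa n s a x (\<lambda>i. b i + 2 * e i) powr s + (s - 1) * norm_sa n s a x b powr s - s * (\<Sum>i<n. a i x * (\<bar>b i\<bar> powr (s - 1) * sgn (b i)) * (b i + 2 * e i))
   \<le> dblc s 2 4 * (norm_sa n s a x (\<lambda>i. b i + e i) powr s + (s - 1) * norm_sa n s a x b powr s - s * (\<Sum>i<n. a i x * (\<bar>b i\<bar> powr (s - 1) * sgn (b i)) * (b i + e i)))" for b e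
  unfolding eq unfolding sum_distrib_left
 proof (rule sum_mono)
  fix i assume "i \<in> {..<n}"
  hence "a i x > 0" using a by simp
  from mult_left_mono[OF scalar_doubling[OF s, of "b i" "e i"] less_imp_le[OF this]]
  show "a i x * (\<bar>b i + 2 * e i\<bar> powr s + (s - 1) * \<bar>b i\<bar> powr s - s * (\<bar>b i\<bar> powr (s - 1) * sgn (b i) * (b i + 2 * e i)))
   \<le> dblc s 2 4 * (a i x * (\<bar>b i + e i\<bar> powr s + (s - 1) * \<bar>b i\<bar> powr s - s * (\<bar>b i\<bar> powr (s - 1) * sgn (b i) * (b i + e i))))"
   by (simp only: mult.left_commute)
 qed
 show "((\<lambda>t. norm_sa n s a x (b(i := t)) powr s) has_real_derivative s * (a i x * (\<bar>b i\<bar> powr (s - 1) * sgn (b i)))) (at (b i))" if "i < n" for i b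
 proof -
  have "norm_sa n s a x (b(i := t)) powr s = a i x * \<bar>t\<bar> powr s + (\<Sum>j\<in>{..<n} - {i}. a j x * \<bar>b j\<bar> powr s)" for t
   unfolding npow using that by (subst sum.remove[of _ i]) auto
  moreover have "((\<lambda>t. a i x * \<bar>t\<bar> powr s + (\<Sum>j\<in>{..<n} - {i}. a j x * \<bar>b j\<bar> powr s)) has_real_derivative a i x * (s * (\<bar>b i\<bar> powr (s - 1) * sgn (b i)))) (at (b i))"
   using DERIV_add[OF DERIV_cmult[OF abs_powr_deriv[OF s, of "b i"], of "a i x"] DERIV_const] by simp
  ultimately show ?thesis by (simp add: mult.left_commute)
 qed
qed

text \<open>For a symmetric positive semidefinite form \<open>B\<close> the distance from
  \<open>b\<close> to \<open>b + t e\<close> is \<open>t\<^sup>2 * B e e\<close>. So doubling is an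
  equality with constant 4, and Young's inequality is the sign of \<open>B\<close> at
  \<open>\<xi> - b\<close>.\<close>

lemma hnorm_A:
 assumes sym: "!!i j. i < n ==> j < n ==> A x i j = A x j i"
  and psd: "!!\<xi>. 0 \<le> (\<Sum>i<n. (\<Sum>j<n. A x i j * \<xi> j) * \<xi> i)"
 shows "hnorm n 2 4 (norm_A n A x) (\<lambda>b i. \<Sum>j<n. A x i j * b j)"
proof -
 define B where "B b \<xi> = (\<Sum>i<n. (\<Sum>j<n. A x i j * b j) * \<xi> i)" for b \<xi>
 have Bsym: "B b \<xi> = B \<xi> b" for b \<xi>
  unfolding B_def sum_distrib_right
  by (subst sum.swap) (auto intro!: sum.cong simp: sym mult_ac)
 have add: "B b (\<lambda>i. x i + t * y i) = B b x + t * B b y" for b x y t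
  unfolding B_def by (simp add: algebra_simps sum.distrib sum_distrib_left)
 have quad: "B (\<lambda>i. b i + t * e i) (\<lambda>i. b i + t * e i) = B b b + 2 * t * B b e + t\<^sup>2 * B e e" for b e t
 proof -
  have "B (\<lambda>i. b i + t * e i) (\<lambda>i. b i + t * e i) = B b (\<lambda>i. b i + t * e i) + t * B e (\<lambda>i. b i + t * e i)"
   unfolding add[of "\<lambda>i. b i + t * e i"] using Bsym[of _ b] Bsym[of _ e] by metis
  thus ?thesis unfolding add using Bsym[of e b] by (simp add: algebra_simps power2_eq_square)
 qed
 have nu: "norm_A n A x \<xi> = sqrt (B \<xi> \<xi>)" for \<xi> by (simp add: norm_A_def B_def)
 have Bpos: "B \<xi> \<xi> \<ge> 0" for \<xi> unfolding B_def by (rule psd)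
 have nu2: "norm_A n A x \<xi> powr 2 = B \<xi> \<xi>" for \<xi> unfolding nu using Bpos by simp
 have Bscale: "B (\<lambda>i. t * \<xi> i) (\<lambda>i. t * \<xi> i) = t\<^sup>2 * B \<xi> \<xi>" for t \<xi>
  using quad[of "\<lambda>_. 0" t \<xi>] by (simp add: B_def)
 show ?thesis
 proof
  show "0 \<le> norm_A n A x \<xi>" for \<xi> unfolding nu using Bpos by simp
  show "norm_A n A x (\<lambda>i. t * \<xi> i) = \<bar>t\<bar> * norm_A n A x \<xi>" for t \<xi>
   unfolding nu Bscale by (simp add: real_sqrt_mult)
  show "norm_A n A x \<xi> = norm_A n A x q" if "!!i. i < n ==> \<xi> i = q i" for \<xi> q
   unfolding norm_A_def using that by simp
  show "(\<Sum>j<n. A x i j * (t * \<xi> j)) = \<bar>t\<bar> powr (2 - 1) * sgn t * (\<Sum>j<n. A x i j * \<xi> j)" for i t \<xi>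
   by (simp add: sum_distrib_left abs_mult_sgn mult.left_commute)
  show "(\<Sum>i<n. (\<Sum>j<n. A x i j * b j) * b i) = norm_A n A x b powr 2" for b
   unfolding nu2 B_def ..
  have yg: "2 * B b \<xi> \<le> B \<xi> \<xi> + B b b" for b \<xi>
   using quad[of \<xi> "-1" b] Bpos[of "\<lambda>i. \<xi> i + -1 * b i"] Bsym[of \<xi> b] by simp
  show "2 * (\<Sum>i<n. (\<Sum>j<n. A x i j * b j) * \<xi> i) \<le> norm_A n A x \<xi> powr 2 + (2 - 1) * norm_A n A x b powr 2" for b \<xi>
   unfolding nu2 B_def[symmetric] using yg by simp
  show "norm_A n A x (\<lambda>i. b i + 2 * e i) powr 2 + (2 - 1) * norm_A n A x b powr 2 - 2 * (\<Sum>i<n. (\<Sum>j<n. A x i j * b j) * (b i + 2 * e i))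
   \<le> 4 * (norm_A n A x (\<lambda>i. b i + e i) powr 2 + (2 - 1) * norm_A n A x b powr 2 - 2 * (\<Sum>i<n. (\<Sum>j<n. A x i j * b j) * (b i + e i)))" for b e
   unfolding nu2 B_def[symmetric] using quad[of b 2 e] quad[of b 1 e] add[of b b 2 e] add[of b b 1 e] by simp
  show "((\<lambda>t. norm_A n A x (b(i := t)) powr 2) has_real_derivative 2 * (\<Sum>j<n. A x i j * b j)) (at (b i))" if "i < n" for i b
  proof -
   define u where "u = (\<lambda>j. if j = i then 1 else 0 :: real)"
   have "norm_A n A x (b(i := t)) powr 2 = B b b + 2 * (t - b i) * B b u + (t - b i)\<^sup>2 * B u u" for t
   proof -
    have "b(i := t) = (\<lambda>j. b j + (t - b i) * u j)" by (auto simp: u_def)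
    thus ?thesis unfolding nu2 using quad[of b "t - b i" u] by simp
   qed
   moreover have "B b u = (\<Sum>j<n. A x i j * b j)" unfolding B_def u_def using that
    by (simp add: if_distrib[of "\<lambda>z. _ * z"] cong: if_cong)
   moreover have "((\<lambda>t. B b b + 2 * (t - b i) * B b u + (t - b i)\<^sup>2 * B u u) has_real_derivative 2 * B b u) (at (b i))"
    by (auto intro!: derivative_eq_intros)
   ultimately show ?thesis by simp
  qed
 qed auto
qed

lemma H_fun_powr: "p > 0 ==> H_fun n p s a A x \<xi> powr p = norm_sa n s a x \<xi> powr p + norm_A n A x \<xi> powr p"
 unfolding H_fun_def by (simp add: powr_powr)

text \<open>\<open>A_field\<close> is defined by \<open>deriv\<close>, which says nothing at points
  where no derivative exists; \<open>der_p\<close> for the two norms shows that the partial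
  derivatives exist everywhere, zeros included, and gives their value.\<close>

lemma A_field_eq:
 assumes p: "p > 1" and s: "s > 1" and a: "!!i. i < n ==> a i x > 0"
  and sym: "!!i j. i < n ==> j < n ==> A x i j = A x j i"
  and psd: "!!\<xi>. 0 \<le> (\<Sum>i<n. (\<Sum>j<n. A x i j * \<xi> j) * \<xi> i)" and i: "i < n"
 shows "A_field p (H_fun n p s a A) x \<xi> i = norm_sa n s a x \<xi> powr (p - s) * (a i x * (\<bar>\<xi> i\<bar> powr (s - 1) * sgn (\<xi> i)))
  + norm_A n A x \<xi> powr (p - 2) * (\<Sum>j<n. A x i j * \<xi> j)"
proof -
 interpret S: hnorm n s "dblc s 2 4" "norm_sa n s a x" "\<lambda>b i. a i x * (\<bar>b i\<bar> powr (s - 1) * sgn (b i))"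
  by (rule hnorm_sa[where a=a and x=x]) (use s a in auto)
 interpret M: hnorm n 2 4 "norm_A n A x" "\<lambda>b i. \<Sum>j<n. A x i j * b j"
  by (rule hnorm_A[where A=A and x=x]) (use sym psd in auto)
 have "((\<lambda>t. 1 / p * (norm_sa n s a x (\<xi>(i := t)) powr p + norm_A n A x (\<xi>(i := t)) powr p)) has_real_derivative
   1 / p * (p * (norm_sa n s a x \<xi> powr (p - s) * (a i x * (\<bar>\<xi> i\<bar> powr (s - 1) * sgn (\<xi> i)))) + p * (norm_A n A x \<xi> powr (p - 2) * (\<Sum>j<n. A x i j * \<xi> j)))) (at (\<xi> i))"
  by (rule DERIV_cmult[OF DERIV_add[OF S.der_p[OF p i] M.der_p[OF p i]]])
 note d = DERIV_imp_deriv[OF this]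
 have p0: "p > 0" using p by simp
 have e: "1 / p * (p * X + p * Y) = X + Y" for X Y using p by (simp add: distrib_left)
 show ?thesis unfolding A_field_def partial_def H_fun_powr[OF p0] d by (rule e)
qed

section \<open>Smooth compactly supported functions of one variable\<close>

lemma tendsto_poly_exp_0: "((\<lambda>y. poly P y * exp (- y)) \<longlongrightarrow> (0::real)) at_top"
proof -
 have "((\<lambda>y. \<Sum>i\<le>degree P. coeff P i * (y ^ i / exp y)) \<longlongrightarrow> (\<Sum>i\<le>degree P. coeff P i * 0)) at_top"
  by (intro tendsto_sum tendsto_mult tendsto_const tendsto_power_div_exp_0)
 moreover have "(\<Sum>i\<le>degree P. coeff P i * (y ^ i / exp y)) = poly P y * exp (- y)" for y
  by (simp add: poly_altdef sum_distrib_right exp_minus divide_inverse mult.assoc)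
 ultimately show ?thesis by simp
qed

text \<open>The flat function \<open>exp (- 1 / t)\<close> with a polynomial factor in
  \<open>1 / t\<close>, extended by zero. The factor makes the family closed under differentiation:
  \<open>P\<close> becomes \<open>X\<^sup>2 (P - P')\<close>.\<close>

definition egerm :: "real poly => real => real" where
 "egerm P t = (if t > 0 then poly P (1 / t) * exp (- (1 / t)) else 0)"

lemma egerm_deriv: "(egerm P has_real_derivative egerm (monom 1 2 * (P - pderiv P)) t) (at t)"
proof -
 consider "t > 0" | "t < 0" | "t = 0" by linarith
 thus ?thesis
 proof cases
  case 1
  have d: "((\<lambda>t. poly P (1 / t)) has_real_derivative poly (pderiv P) (1 / t) * (- (1 / t\<^sup>2))) (at t)"
   by (rule DERIV_chain2[OF poly_DERIV]) (use 1 in \<open>auto intro!: derivative_eq_intros simp: power2_eq_square\<close>)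
  have e: "((\<lambda>t. exp (- (1 / t))) has_real_derivative exp (- (1 / t)) * (1 / t\<^sup>2)) (at t)"
   using 1 by (auto intro!: derivative_eq_intros simp: power2_eq_square)
  have "((\<lambda>t. poly P (1 / t) * exp (- (1 / t))) has_real_derivative egerm (monom 1 2 * (P - pderiv P)) t) (at t)"
   by (rule DERIV_cong[OF DERIV_mult[OF d e]])
    (use 1 in \<open>simp add: egerm_def poly_monom power_divide algebra_simps\<close>)
  thus ?thesis
   by (rule has_field_derivative_transform_within_open[of _ _ _ "{0<..}"]) (use 1 in \<open>auto simp: egerm_def\<close>)
 next
  case 2
  have "((\<lambda>t::real. 0::real) has_real_derivative egerm (monom 1 2 * (P - pderiv P)) t) (at t)"
   using 2 by (simp add: egerm_def)
  thus ?thesis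
   by (rule has_field_derivative_transform_within_open[of _ _ _ "{..<0}"]) (use 2 in \<open>auto simp: egerm_def\<close>)
 next
  case 3
  have "((\<lambda>h. egerm P h / h) \<longlongrightarrow> 0) (at_right 0)"
  proof -
   have "((\<lambda>h. poly (pCons 0 P) (inverse h) * exp (- inverse h)) \<longlongrightarrow> 0) (at_right (0::real))"
    by (rule filterlim_compose[OF tendsto_poly_exp_0 filterlim_inverse_at_top_right])
   moreover have "\<forall>\<^sub>F h in at_right (0::real). poly (pCons 0 P) (inverse h) * exp (- inverse h) = egerm P h / h"
    by (auto simp: egerm_def eventually_at_filter field_simps)
   ultimately show ?thesis by (rule Lim_transform_eventually)
  qed
  moreover have "((\<lambda>h. egerm P h / h) \<longlongrightarrow> 0) (at_left 0)"
   by (rule Lim_transform_eventually[OF tendsto_const]) (auto simp: egerm_def eventually_at_filter)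
  ultimately have "((\<lambda>h. egerm P h / h) \<longlongrightarrow> 0) (at 0)" by (simp add: filterlim_at_split)
  thus ?thesis using 3 by (simp add: has_field_derivative_iff egerm_def)
 qed
qed

text \<open>Products of two flat functions vanishing outside the interval from -1 to 1. Sums are
  included because the product rule leaves the set of single products.\<close>

inductive_set bumps :: "(real => real) set" where
 base: "(\<lambda>t. egerm P (1 + t) * egerm Q (1 - t)) \<in> bumps"
| add: "f \<in> bumps ==> g \<in> bumps ==> (\<lambda>t. f t + g t) \<in> bumps"

lemma bumps_deriv: "f \<in> bumps ==> \<exists>f'\<in>bumps. \<forall>t. (f has_real_derivative f' t) (at t)"
proof (induction rule: bumps.induct)
 case (base P Q)
 let ?D = "\<lambda>P. monom 1 2 * (P - pderiv P)"
 have neg: "egerm (- Q) t = - egerm Q t" for Q t by (simp add: egerm_def)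
 have "((\<lambda>t. egerm P (1 + t) * egerm Q (1 - t)) has_real_derivative
   egerm (?D P) (1 + t) * egerm Q (1 - t) + egerm P (1 + t) * egerm (- ?D Q) (1 - t)) (at t)" for t
 proof -
  have 1: "((\<lambda>t. egerm P (1 + t)) has_real_derivative egerm (?D P) (1 + t) * 1) (at t)"
   by (rule DERIV_chain2[OF egerm_deriv]) (auto intro!: derivative_eq_intros)
  have 2: "((\<lambda>t. egerm Q (1 - t)) has_real_derivative egerm (?D Q) (1 - t) * (- 1)) (at t)"
   by (rule DERIV_chain2[OF egerm_deriv]) (auto intro!: derivative_eq_intros)
  show ?thesis unfolding neg by (rule DERIV_cong[OF DERIV_mult[OF 1 2]]) simp
 qed
 moreover have "(\<lambda>t. egerm (?D P) (1 + t) * egerm Q (1 - t) + egerm P (1 + t) * egerm (- ?D Q) (1 - t)) \<in> bumps"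
  by (intro bumps.intros)
 ultimately show ?case by (intro bexI) auto
next
 case (add f g)
 then obtain f' g' where "f' \<in> bumps" "g' \<in> bumps" "!!t. (f has_real_derivative f' t) (at t)" "!!t. (g has_real_derivative g' t) (at t)"
  by blast
 thus ?case by (intro bexI[of _ "\<lambda>t. f' t + g' t"]) (auto intro: DERIV_add bumps.add)
qed

lemma bumps_support: "f \<in> bumps ==> \<bar>t\<bar> \<ge> 1 ==> f t = 0"
 by (induction rule: bumps.induct) (auto simp: egerm_def)

text \<open>Smooth compactly supported functions of one variable, defined coinductively.\<close>

definition test1 :: "(real => real) set" where
 "test1 = {f. \<exists>C. f \<in> C \<and> (\<forall>h\<in>C. (\<exists>h'\<in>C. \<forall>t. (h has_real_derivative h' t) (at t)) \<and> (\<exists>r. \<forall>t. \<bar>t\<bar> \<ge> r --> h t = 0))}"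

lemma bumps_test1: "f \<in> bumps ==> f \<in> test1"
 unfolding test1_def using bumps_deriv bumps_support by blast

lemma test1_deriv: "f \<in> test1 ==> \<exists>f'\<in>test1. \<forall>t. (f has_real_derivative f' t) (at t)"
 unfolding test1_def by blast

lemma test1_support: "f \<in> test1 ==> \<exists>r. \<forall>t. \<bar>t\<bar> \<ge> r --> f t = 0"
 unfolding test1_def by blast

lemma test1_affine:
 assumes f: "f \<in> test1" and c: "c \<noteq> 0"
 shows "(\<lambda>t. k * f (c * t + d)) \<in> test1"
proof -
 obtain C where C: "f \<in> C" "!!h. h \<in> C ==> \<exists>h'\<in>C. \<forall>t. (h has_real_derivative h' t) (at t)"
  "!!h. h \<in> C ==> \<exists>r. \<forall>t. \<bar>t\<bar> \<ge> r --> h t = 0"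
  using f unfolding test1_def by blast
 define C' where "C' = {\<lambda>t. k * h (c * t + d) | h k. h \<in> C}"
 have "(\<lambda>t. k * f (c * t + d)) \<in> C'" unfolding C'_def using C by blast
 moreover have "\<exists>g'\<in>C'. \<forall>t. (g has_real_derivative g' t) (at t)" if g: "g \<in> C'" for g
 proof -
  obtain h k where h: "h \<in> C" "g = (\<lambda>t. k * h (c * t + d))" using g unfolding C'_def by blast
  obtain h' where h': "h' \<in> C" "!!t. (h has_real_derivative h' t) (at t)" using C(2)[OF h(1)] by blast
  have "(g has_real_derivative (k * c) * h' (c * t + d)) (at t)" for t
  proof -
   have "((\<lambda>t. h (c * t + d)) has_real_derivative h' (c * t + d) * c) (at t)"
    by (rule DERIV_chain2[OF h'(2)]) (auto intro!: derivative_eq_intros)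
   from DERIV_cmult[OF this, of k] show ?thesis unfolding h(2) by (simp add: mult_ac)
  qed
  moreover have "(\<lambda>t. (k * c) * h' (c * t + d)) \<in> C'" unfolding C'_def using h' by blast
  ultimately show ?thesis by (intro bexI) auto
 qed
 moreover have "\<exists>r. \<forall>t. \<bar>t\<bar> \<ge> r --> g t = 0" if g: "g \<in> C'" for g
 proof -
  obtain h k where h: "h \<in> C" "g = (\<lambda>t. k * h (c * t + d))" using g unfolding C'_def by blast
  obtain r where r: "!!t. \<bar>t\<bar> \<ge> r ==> h t = 0" using C(3)[OF h(1)] by blast
  have "g t = 0" if "\<bar>t\<bar> \<ge> (\<bar>r\<bar> + \<bar>d\<bar>) / \<bar>c\<bar>" for t
  proof -
   have "\<bar>r\<bar> + \<bar>d\<bar> \<le> \<bar>c * t\<bar>" using that c by (simp add: pos_divide_le_eq abs_mult mult.commute)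
   hence "r \<le> \<bar>c * t + d\<bar>" by linarith
   thus ?thesis using r h by simp
  qed
  thus ?thesis by blast
 qed
 ultimately show ?thesis unfolding test1_def by blast
qed

lemma test1_continuous: "f \<in> test1 ==> continuous_on UNIV f"
 using test1_deriv by (meson DERIV_continuous_on has_field_derivative_at_within)

lemma test1_bounded:
 assumes "f \<in> test1" obtains B where "B > 0" "!!t. \<bar>f t\<bar> \<le> B"
proof -
 obtain r where r: "!!t. \<bar>t\<bar> \<ge> r ==> f t = 0" using test1_support[OF assms] by blast
 have "compact (f ` {- \<bar>r\<bar> .. \<bar>r\<bar>})"
  using test1_continuous[OF assms] by (intro compact_continuous_image) (auto intro: continuous_on_subset)
 then obtain B where B: "!!t. t \<in> {- \<bar>r\<bar> .. \<bar>r\<bar>} ==> \<bar>f t\<bar> \<le> B"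
  using compact_imp_bounded[THEN bounded_iff[THEN iffD1]] by (metis image_eqI real_norm_def)
 have "\<bar>f t\<bar> \<le> max B 1" for t
  using B[of t] r[of t] by (cases "t \<in> {- \<bar>r\<bar> .. \<bar>r\<bar>}") auto
 thus ?thesis using that[of "max B 1"] by auto
qed

lemma test1_measurable: "f \<in> test1 ==> f \<in> borel_measurable borel"
 by (rule borel_measurable_continuous_onI[OF test1_continuous])

lemma test1_integrable: "f \<in> test1 ==> integrable lborel f"
proof -
 assume f: "f \<in> test1"
 obtain r where r: "!!t. \<bar>t\<bar> \<ge> r ==> f t = 0" using test1_support[OF f] by blast
 have "set_integrable lborel {- \<bar>r\<bar> .. \<bar>r\<bar>} f"
  by (rule borel_integrable_atLeastAtMost') (rule continuous_on_subset[OF test1_continuous[OF f]], simp)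
 moreover have "(\<lambda>t. indicator {- \<bar>r\<bar> .. \<bar>r\<bar>} t *\<^sub>R f t) = f"
 proof
  fix t
  have "f t = 0" if "t \<notin> {- \<bar>r\<bar> .. \<bar>r\<bar>}" by (rule r) (use that in auto)
  thus "indicator {- \<bar>r\<bar> .. \<bar>r\<bar>} t *\<^sub>R f t = f t" by (cases "t \<in> {- \<bar>r\<bar> .. \<bar>r\<bar>}") auto
 qed
 ultimately show ?thesis by (simp add: set_integrable_def)
qed

lemma ex_mollifier:
 obtains f :: "real => real" where "f \<in> test1" "!!t. f t \<ge> 0" "!!t. \<bar>t\<bar> \<ge> 1 ==> f t = 0" "integral\<^sup>L lborel f = 1"
proof -
 define b where "b = (\<lambda>t. egerm 1 (1 + t) * egerm 1 (1 - t))"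
 have b: "b \<in> bumps" unfolding b_def by (rule bumps.base)
 have nn: "b t \<ge> 0" for t unfolding b_def egerm_def by simp
 have int: "integrable lborel b" by (rule test1_integrable[OF bumps_test1[OF b]])
 have "integral\<^sup>L lborel b \<noteq> 0"
 proof
  assume "integral\<^sup>L lborel b = 0"
  hence ae: "AE t in lborel. b t = 0" using integral_nonneg_eq_0_iff_AE[OF int] nn by simp
  have "{-1<..<1} \<subseteq> {t. b t \<noteq> 0}" unfolding b_def egerm_def by auto
  hence "AE t in lborel. t \<notin> {-1<..<1::real}" by (intro eventually_mono[OF ae]) auto
  hence "{-1<..<1::real} \<in> null_sets lborel" by (subst AE_iff_null_sets) auto
  hence "emeasure lborel {-1<..<1::real} = 0" by (rule null_setsD1)
  moreover have "emeasure lborel {-1<..<1::real} = 2" by (subst emeasure_lborel_Ioo) auto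
  ultimately show False by simp
 qed
 moreover have "integral\<^sup>L lborel b \<ge> 0" using nn by simp
 ultimately have pos: "integral\<^sup>L lborel b > 0" by simp
 have "(\<lambda>t. (1 / integral\<^sup>L lborel b) * b (1 * t + 0)) \<in> test1"
  by (rule test1_affine[OF bumps_test1[OF b]]) simp
 thus ?thesis using nn pos bumps_support[OF b]
  by (intro that[of "\<lambda>t. (1 / integral\<^sup>L lborel b) * b t"]) auto
qed

definition mollifier :: "real => real" where
 "mollifier = (SOME f. f \<in> test1 \<and> (\<forall>t. f t \<ge> 0) \<and> (\<forall>t. \<bar>t\<bar> \<ge> 1 --> f t = 0) \<and> integral\<^sup>L lborel f = 1)"

lemma mollifier: "mollifier \<in> test1" "mollifier t \<ge> 0" "\<bar>t\<bar> \<ge> 1 ==> mollifier t = 0" "integral\<^sup>L lborel mollifier = 1"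
proof -
 have "\<exists>f. f \<in> test1 \<and> (\<forall>t. f t \<ge> 0) \<and> (\<forall>t. \<bar>t\<bar> \<ge> 1 --> f t = 0) \<and> integral\<^sup>L lborel f = 1"
  using ex_mollifier by metis
 from someI_ex[OF this] show "mollifier \<in> test1" "mollifier t \<ge> 0" "\<bar>t\<bar> \<ge> 1 ==> mollifier t = 0" "integral\<^sup>L lborel mollifier = 1"
  unfolding mollifier_def[symmetric] by auto
qed

text \<open>\<open>Suc k\<close> instead of \<open>k\<close>, so that the kernel at
  \<open>k = 0\<close> is not degenerate; the radius of the support is
  \<open>1 / real (Suc k)\<close>.\<close>

definition mollk :: "nat => real => real" where
 "mollk k t = real (Suc k) * mollifier (real (Suc k) * t)"

lemma mollk_test1: "mollk k \<in> test1"
 using test1_affine[OF mollifier(1), of "real (Suc k)" "real (Suc k)" 0] by (simp add: mollk_def[abs_def])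

lemma mollk_nonneg: "mollk k t \<ge> 0"
 unfolding mollk_def using mollifier(2) by simp

lemma mollk_support: "\<bar>t\<bar> \<ge> 1 / real (Suc k) ==> mollk k t = 0"
 unfolding mollk_def using mollifier(3)[of "real (Suc k) * t"] by (simp add: abs_mult field_simps)

lemma mollk_integral: "integral\<^sup>L lborel (\<lambda>t. mollk k (x - t)) = 1" "integral\<^sup>L lborel (\<lambda>t. mollk k (t - x)) = 1"
proof -
 have 0: "integral\<^sup>L lborel (\<lambda>t. mollk k (c * t + d)) = 1" if "\<bar>c\<bar> = 1" for c d
 proof -
  let ?c = "real (Suc k) * c"
  have "integral\<^sup>L lborel mollifier = \<bar>?c\<bar> *\<^sub>R integral\<^sup>L lborel (\<lambda>t. mollifier (real (Suc k) * d + ?c * t))"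
   by (rule lborel_integral_real_affine) (use that in auto)
  moreover have "\<bar>?c\<bar> = real (Suc k)" using that by (simp add: abs_mult)
  ultimately have "1 = real (Suc k) * integral\<^sup>L lborel (\<lambda>t. mollifier (real (Suc k) * d + ?c * t))"
   using mollifier(4) by simp
  moreover have "real (Suc k) * d + ?c * t = real (Suc k) * (c * t + d)" for t by (simp only: distrib_left mult.assoc add.commute)
  ultimately show ?thesis unfolding mollk_def by simp
 qed
 show "integral\<^sup>L lborel (\<lambda>t. mollk k (x - t)) = 1" using 0[of "-1" x] by (simp add: algebra_simps)
 show "integral\<^sup>L lborel (\<lambda>t. mollk k (t - x)) = 1" using 0[of 1 "- x"] by (simp add: algebra_simps)
qed

section \<open>Smooth functions of several variables\<close>

lemma line_in_open:
 assumes U: "openin (Rn n) U" and x: "x \<in> U" and i: "i < n"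
 obtains S where "open S" "x i \<in> S" "!!t. t \<in> S ==> x(i := t) \<in> U"
proof -
 obtain r where r: "r > 0" "ncbox n x r \<subseteq> U" using openin_contains_nbox[OF U x] by blast
 have xE: "x \<in> En n" using openin_Rn_subset[OF U] x by blast
 have "x(i := t) \<in> U" if "t \<in> ball (x i) r" for t
 proof -
  have "x(i := t) \<in> ncbox n x r" using xE i that r(1) by (auto simp: ncbox_def in_En dist_real_def)
  thus ?thesis using r by blast
 qed
 thus ?thesis using that[of "ball (x i) r"] r(1) by auto
qed

lemma deriv_transform_line:
 assumes U: "openin (Rn n) U" and x: "x \<in> U" and i: "i < n"
  and d: "((\<lambda>t. f (x(i := t))) has_real_derivative d) (at (x i))" and eq: "!!y. y \<in> U ==> f y = g y"
 shows "((\<lambda>t. g (x(i := t))) has_real_derivative d) (at (x i))"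
proof -
 obtain S where S: "open S" "x i \<in> S" "!!t. t \<in> S ==> x(i := t) \<in> U" using line_in_open[OF U x i] by blast
 show ?thesis by (rule has_field_derivative_transform_within_open[OF d S(1,2)]) (use S(3) eq in auto)
qed

text \<open>\<open>smooth\<close> refers to all iterated partial derivatives. They are found by
  exhibiting a class of continuous functions that is closed under partial differentiation on
  \<open>U\<close>. Iterated \<open>partial\<close>s agree with members of the class on
  \<open>U\<close> only; openness makes this enough for the next derivative.\<close>

lemma smooth_coinduct:
 assumes U: "openin (Rn n) U" and f: "f \<in> C"
  and c: "!!h. h \<in> C ==> continuous_on U h"
  and d: "!!h i. h \<in> C ==> i < n ==> \<exists>h'\<in>C. \<forall>x\<in>U. ((\<lambda>t. h (x(i := t))) has_real_derivative h' x) (at (x i))"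
 shows "smooth n U f"
proof -
 have ex: "\<exists>h\<in>C. \<forall>x\<in>U. foldr partial js f x = h x" if "js \<in> lists {..<n}" for js
  using that
 proof (induction js)
  case Nil
  show ?case using f by (intro bexI[of _ f]) auto
 next
  case (Cons i js)
  then obtain h where h: "h \<in> C" "!!x. x \<in> U ==> h x = foldr partial js f x" and i: "i < n" by force
  obtain h' where h': "h' \<in> C" "!!x. x \<in> U ==> ((\<lambda>t. h (x(i := t))) has_real_derivative h' x) (at (x i))"
   using d[OF h(1) i] by blast
  have "foldr partial (i # js) f x = h' x" if x: "x \<in> U" for x
  proof -
   have "((\<lambda>t. foldr partial js f (x(i := t))) has_real_derivative h' x) (at (x i))"
    by (rule deriv_transform_line[OF U x i h'(2)[OF x]]) (rule h(2))
   from DERIV_imp_deriv[OF this] show ?thesis unfolding foldr.simps comp_def partial_def .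
  qed
  thus ?case using h'(1) by blast
 qed
 show ?thesis
  unfolding smooth_def
 proof (intro ballI conjI allI impI)
  fix js assume js: "js \<in> lists {..<n}"
  obtain h where h: "h \<in> C" "!!x. x \<in> U ==> h x = foldr partial js f x" using ex[OF js] by metis
  show "cont n U (foldr partial js f)"
   using c[OF h(1)] h(2) openin_Rn_subset[OF U] by (subst cont_iff) (auto cong: continuous_on_cong)
  fix x i assume x: "x \<in> U" and i: "i < n"
  obtain h' where h': "((\<lambda>t. h (x(i := t))) has_real_derivative h') (at (x i))"
   using d[OF h(1) i] x by blast
  have "((\<lambda>t. foldr partial js f (x(i := t))) has_real_derivative h') (at (x i))"
   by (rule deriv_transform_line[OF U x i h']) (rule h(2))
  thus "(\<lambda>t. foldr partial js f (x(i := t))) differentiable at (x i)"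
   unfolding real_differentiable_def by blast
 qed
qed

lemma smooth_partial: "smooth n U f ==> i < n ==> smooth n U (partial i f)"
 unfolding smooth_def
proof (intro ballI)
 fix js assume f: "\<forall>js\<in>lists {..<n}. cont n U (foldr partial js f) \<and>
    (\<forall>x\<in>U. \<forall>i<n. (\<lambda>t. foldr partial js f (x(i := t))) differentiable at (x i))"
  and i: "i < n" and js: "js \<in> lists {..<n}"
 have "js @ [i] \<in> lists {..<n}" using js i by simp
 from bspec[OF f this] show "cont n U (foldr partial js (partial i f)) \<and>
    (\<forall>x\<in>U. \<forall>ia<n. (\<lambda>t. foldr partial js (partial i f) (x(ia := t))) differentiable at (x ia))" by simp
qed

lemma smooth_cont: "smooth n U f ==> U \<subseteq> En n ==> continuous_on U f"
 unfolding smooth_def using cont_iff[of U n f] by (auto dest: bspec[of _ _ "[]"])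

lemma smooth_deriv:
 assumes "smooth n U f" "x \<in> U" "i < n"
 shows "((\<lambda>t. f (x(i := t))) has_real_derivative partial i f x) (at (x i))"
proof -
 have "(\<lambda>t. f (x(i := t))) differentiable at (x i)"
  using assms unfolding smooth_def by (auto dest!: bspec[of _ _ "[]"])
 thus ?thesis unfolding partial_def by (simp add: DERIV_deriv_iff_real_differentiable)
qed

definition tprod :: "nat => (nat => real => real) => vec => real" where
 "tprod n g x = (\<Prod>i<n. g i (x i))"

lemma tprod_deriv:
 assumes i: "i < n" and d: "(g i has_real_derivative g' (x i)) (at (x i))"
 shows "((\<lambda>t. tprod n g (x(i := t))) has_real_derivative tprod n (g(i := g')) x) (at (x i))"
proof -
 have 1: "tprod n g (x(i := t)) = g i t * (\<Prod>j\<in>{..<n} - {i}. g j (x j))" for t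
  unfolding tprod_def using i by (subst prod.remove[of _ i]) auto
 have 2: "tprod n (g(i := g')) x = g' (x i) * (\<Prod>j\<in>{..<n} - {i}. g j (x j))"
  unfolding tprod_def using i by (subst prod.remove[of _ i]) auto
 show ?thesis unfolding 1 2 by (rule DERIV_cmult_right[OF d])
qed

lemma tprod_continuous: "(!!i. i < n ==> g i \<in> test1) ==> continuous_on X (tprod n g)"
 unfolding tprod_def
proof (rule continuous_on_prod)
 fix i assume g: "!!i. i < n ==> g i \<in> test1" and "i \<in> {..<n}"
 hence "continuous_on UNIV (g i)" by (intro test1_continuous) auto
 thus "continuous_on X (\<lambda>x. g i (x i))"
  by (rule continuous_on_compose2[OF _ continuous_on_subset[OF continuous_on_product_coordinates subset_UNIV] subset_UNIV])
qed

lemma tprod_smooth: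
 assumes U: "openin (Rn n) U" and g: "!!i. g i \<in> test1"
 shows "smooth n U (tprod n g)"
proof (rule smooth_coinduct[OF U, of _ "{tprod n g | g. \<forall>i. g i \<in> test1}"])
 show "tprod n g \<in> {tprod n g | g. \<forall>i. g i \<in> test1}" using g by blast
 show "continuous_on U h" if "h \<in> {tprod n g | g. \<forall>i. g i \<in> test1}" for h
  using that tprod_continuous by blast
 fix h i assume "h \<in> {tprod n g | g. \<forall>i. g i \<in> test1}" and i: "i < n"
 then obtain g where h: "h = tprod n g" and g: "!!i. g i \<in> test1" by blast
 obtain g' where g': "g' \<in> test1" "!!t. (g i has_real_derivative g' t) (at t)" using test1_deriv[OF g] by blast
 have in1: "tprod n (g(i := g')) \<in> {tprod n g | g. \<forall>i. g i \<in> test1}"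
  by (intro CollectI exI[of _ "g(i := g')"] conjI refl) (simp add: g g'(1))
 show "\<exists>h'\<in>{tprod n g | g. \<forall>i. g i \<in> test1}. \<forall>x\<in>U. ((\<lambda>t. h (x(i := t))) has_real_derivative h' x) (at (x i))"
  unfolding h by (rule bexI[OF _ in1], rule ballI, rule tprod_deriv[where g=g and g'=g', OF i g'(2)])
qed

section \<open>Mollification\<close>

abbreviation Mn :: "nat => vec measure" where
 "Mn n \<equiv> Pi\<^sub>M {..<n} (\<lambda>_. lborel :: real measure)"

interpretation PL: product_sigma_finite "\<lambda>_::nat. lborel :: real measure"
 by standard

lemma space_Mn: "space (Mn n) = En n"
 by (simp add: space_PiM En_def)

lemma sigma_finite_Mn: "sigma_finite_measure (Mn n)"
 by (rule PL.sigma_finite) simp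

lemma coord_measurable: "i < n ==> (\<lambda>x. x i) \<in> borel_measurable (Mn n)"
 using measurable_component_singleton[of i "{..<n}" "\<lambda>_. lborel :: real measure"] by simp

text \<open>The coordinates from \<open>n\<close> on are constant on \<open>En n\<close>. Together
  with \<open>sets_Mn_eq\<close> this identifies the measurable sets of \<open>Mn n\<close> with the
  traces on \<open>En n\<close> of the Borel sets of the ambient space, so continuity there yields
  measurability.\<close>

lemma ident_measurable: "(\<lambda>x. x) \<in> Mn n \<rightarrow>\<^sub>M (borel :: vec measure)"
proof -
 have "(\<lambda>x. x) \<in> Mn n \<rightarrow>\<^sub>M Pi\<^sub>M UNIV (\<lambda>i. borel :: real measure)"
 proof (rule measurable_PiM_single'[where f="\<lambda>i x. x i"])
  fix i :: nat
  show "(\<lambda>x. x i) \<in> Mn n \<rightarrow>\<^sub>M (borel :: real measure)"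
  proof (cases "i < n")
   case False
   have "(\<lambda>x. undefined) \<in> Mn n \<rightarrow>\<^sub>M (borel :: real measure)" by simp
   thus ?thesis by (rule measurable_cong[THEN iffD1, rotated]) (use False in \<open>simp add: space_Mn in_En\<close>)
  qed (rule coord_measurable)
 qed auto
 thus ?thesis using sets_PiM_equal_borel measurable_cong_sets by blast
qed

lemma borel_Int_En: "B \<in> sets borel ==> B \<inter> En n \<in> sets (Mn n)"
 using measurable_sets[OF ident_measurable, of B n] by (simp add: space_Mn)

lemma sets_Mn_eq:
 assumes "A \<in> sets (Mn n)"
 obtains B where "B \<in> sets borel" "A = B \<inter> En n"
proof -
 have "(\<lambda>x. \<lambda>i\<in>{..<n}. x i) \<in> (borel :: vec measure) \<rightarrow>\<^sub>M Mn n"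
  by (rule measurable_restrict) (auto intro!: borel_measurable_continuous_onI continuous_on_product_coordinates)
 from measurable_sets[OF this assms] have "(\<lambda>x. restrict x {..<n}) -` A \<in> sets borel" by simp
 moreover have "A = ((\<lambda>x. restrict x {..<n}) -` A) \<inter> En n"
  using sets.sets_into_space[OF assms] unfolding space_Mn by (auto simp: En_def PiE_restrict)
 ultimately show ?thesis using that by blast
qed

lemma borel_open_Rn: "openin (Rn n) U ==> U \<in> sets borel"
 using borel_closed[OF closed_En] unfolding openin_Rn by (auto intro: borel_open)

lemma borel_compact_Rn: "compactin (Rn n) K ==> K \<in> sets borel"
 unfolding compactin_Rn by (auto intro: borel_compact)

lemma sets_openin: "openin (Rn n) U ==> U \<in> sets (Mn n)"
 using borel_Int_En[OF borel_open_Rn, of n U n] openin_Rn_subset[of n U] by (simp add: Int_absorb2)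

lemma sets_compactin: "compactin (Rn n) K ==> K \<in> sets (Mn n)"
 using borel_Int_En[OF borel_compact_Rn, of n K n] compactin_Rn[of n K] by (simp add: Int_absorb2)

lemma emeasure_nbox_finite: "emeasure (Mn n) (nbox n x r) < \<infinity>"
proof -
 have "emeasure (Mn n) (nbox n x r) = (\<Prod>i<n. emeasure lborel {x i - r<..<x i + r})"
  unfolding nbox_eq_PiE by (rule PL.emeasure_PiM) auto
 also have "\<dots> < \<infinity>"
 proof -
  have "emeasure lborel {x i - r<..<x i + r} \<noteq> top" for i
  proof -
   have "bounded {x i - r<..<x i + r}" by (metis bounded_box box_real(1))
   from emeasure_bounded_finite[OF this] show ?thesis by simp
  qed
  thus ?thesis by (simp add: ennreal_prod_eq_top less_top[symmetric])
 qed
 finally show ?thesis .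
qed

lemma emeasure_compact_finite: "compactin (Rn n) K ==> emeasure (Mn n) K < \<infinity>"
proof -
 assume K: "compactin (Rn n) K"
 obtain r where "K \<subseteq> nbox n (\<lambda>_. 0) r" using compactin_subset_ncbox[OF K] by blast
 hence "emeasure (Mn n) K \<le> emeasure (Mn n) (nbox n (\<lambda>_. 0) r)"
  by (rule emeasure_mono) (rule sets_openin[OF openin_nbox])
 thus ?thesis using emeasure_nbox_finite[of n "\<lambda>_. 0" r] by (rule le_less_trans)
qed

section \<open>Density of continuous functions in L1\<close>

lemma continuous_measurable_Mn:
 assumes "U \<in> sets borel" "continuous_on U (f :: vec => real)"
 shows "(\<lambda>x. indicator U x * f x) \<in> borel_measurable (Mn n)"
proof -
 have "(\<lambda>x. indicator U x *\<^sub>R f x) \<in> borel_measurable borel"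
  using assms by (rule borel_measurable_continuous_on_indicator)
 from measurable_compose[OF ident_measurable this] show ?thesis by simp
qed

lemma continuous_UNIV_measurable_Mn: "continuous_on UNIV (f :: vec => real) ==> f \<in> borel_measurable (Mn n)"
 using continuous_measurable_Mn[of UNIV f n] by simp

text \<open>Boundedness is a separate clause, because the vanishing outside a cube is asked only on
  \<open>En n\<close> while the bound is over all points of the type.\<close>

definition CBn :: "nat => (vec => real) => bool" where
 "CBn n g \<longleftrightarrow> continuous_on UNIV g \<and> (\<exists>r>0. \<forall>x\<in>En n. x \<notin> nbox n (\<lambda>_. 0) r --> g x = 0) \<and> (\<exists>B. \<forall>x. \<bar>g x\<bar> \<le> B)"

lemma integrable_bounded_box:
 assumes f: "f \<in> borel_measurable (Mn n)" and B: "!!x. x \<in> En n ==> \<bar>f x\<bar> \<le> B"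
  and z: "!!x. x \<in> En n ==> x \<notin> nbox n y r ==> f x = (0::real)"
 shows "integrable (Mn n) f"
proof (rule Bochner_Integration.integrable_bound[where f="\<lambda>x. indicator (nbox n y r) x * B"])
 show "integrable (Mn n) (\<lambda>x. indicator (nbox n y r) x * B)"
  using sets_openin[OF openin_nbox] emeasure_nbox_finite by (intro integrable_mult_left integrable_real_indicator) auto
 show "AE x in Mn n. norm (f x) \<le> norm (indicator (nbox n y r) x * B)"
 proof (rule AE_I2)
  fix x assume "x \<in> space (Mn n)"
  hence x: "x \<in> En n" by (simp add: space_Mn)
  hence "\<bar>f x\<bar> \<le> \<bar>B\<bar>" using B[OF x] by simp
  thus "norm (f x) \<le> norm (indicator (nbox n y r) x * B)" using z[OF x] by (auto simp: indicator_def)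
 qed
qed (rule f)

lemma CBn_integrable: "CBn n g ==> integrable (Mn n) g"
 unfolding CBn_def using integrable_bounded_box[of g n] continuous_UNIV_measurable_Mn by metis

lemma CBn_add: "CBn n f ==> CBn n g ==> CBn n (\<lambda>x. f x + g x)"
proof -
 assume "CBn n f" "CBn n g"
 then obtain r r' B B' where f: "continuous_on UNIV f" "!!x. x \<in> En n ==> x \<notin> nbox n (\<lambda>_. 0) r ==> f x = 0" "!!x. \<bar>f x\<bar> \<le> B" "r > 0"
  and g: "continuous_on UNIV g" "!!x. x \<in> En n ==> x \<notin> nbox n (\<lambda>_. 0) r' ==> g x = 0" "!!x. \<bar>g x\<bar> \<le> B'" "r' > 0"
  unfolding CBn_def by blast
 have "f x + g x = 0" if "x \<in> En n" "x \<notin> nbox n (\<lambda>_. 0) (max r r')" for x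
 proof -
  have "x \<notin> nbox n (\<lambda>_. 0) r" using that(2) nbox_mono[OF max.cobounded1[of r r']] by blast
  moreover have "x \<notin> nbox n (\<lambda>_. 0) r'" using that(2) nbox_mono[OF max.cobounded2[of r' r]] by blast
  ultimately show ?thesis using f(2)[OF that(1)] g(2)[OF that(1)] by simp
 qed
 moreover have "\<bar>f x + g x\<bar> \<le> B + B'" for x using f(3)[of x] g(3)[of x] by linarith
 moreover have "max r r' > 0" using f(4) by simp
 ultimately show ?thesis unfolding CBn_def using f(1) g(1) by (blast intro: continuous_on_add)
qed

text \<open>The functions \<open>max 0 (1 - k * infdist x K)\<close> decrease to the indicator of
  the closed set \<open>K\<close>; the factor \<open>c\<close> confines them to a cube of finite
  measure, so that convergence is dominated.\<close>

lemma CBn_compact_approx: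
 assumes K: "compactin (Rn n) K" and e: "e > 0"
 shows "\<exists>g. CBn n g \<and> (\<integral>x. \<bar>indicator K x - g x\<bar> \<partial>Mn n) < e"
proof (cases "K = {}")
 case True
 thus ?thesis using e by (intro exI[of _ "\<lambda>x. 0"]) (auto simp: CBn_def intro!: exI[of _ "1::real"])
next
 case ne: False
 obtain r where r: "r > 0" "K \<subseteq> nbox n (\<lambda>_. 0) r" using compactin_subset_ncbox[OF K] by blast
 define c where "c x = (\<Prod>i<n. max 0 (min 1 (r + 1 - \<bar>x i\<bar>)))" for x :: vec
 define g where "g k x = max 0 (1 - real k * infdist x K) * c x" for k :: nat and x
 let ?b = "nbox n (\<lambda>_. 0) (r + 1)"
 have c01: "0 \<le> c x" "c x \<le> 1" for x unfolding c_def by (auto intro: prod_nonneg prod_le_1)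
 have g01: "0 \<le> g k x" "g k x \<le> 1" for k x
  unfolding g_def using c01[of x] infdist_nonneg[of x K] by (auto intro!: mult_le_one)
 have c0: "c x = 0" if x: "x \<in> En n" "x \<notin> ?b" for x
 proof -
  obtain i where "i < n" "\<bar>x i\<bar> \<ge> r + 1" using x by (auto simp: nbox_def not_less)
  thus ?thesis unfolding c_def by (intro prod_zero bexI[of _ i]) auto
 qed
 have CB: "CBn n (g k)" for k
  unfolding CBn_def
 proof (intro conjI)
  show "continuous_on UNIV (g k)" unfolding g_def c_def
   by (intro continuous_intros continuous_on_max continuous_on_min continuous_on_product_coordinates)
  show "\<exists>r>0. \<forall>x\<in>En n. x \<notin> nbox n (\<lambda>_. 0) r --> g k x = 0"
   using r(1) c0 by (intro exI[of _ "r + 1"]) (auto simp: g_def)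
  show "\<exists>B. \<forall>x. \<bar>g k x\<bar> \<le> B" using g01[of k] by (intro exI[of _ 1]) auto
 qed
 have Kb: "K \<subseteq> ?b" using r(2) nbox_mono[of r "r + 1"] by auto
 have cl: "closed K" using K unfolding compactin_Rn by (simp add: compact_imp_closed)
 have lim: "(\<lambda>k. g k x) \<longlonglongrightarrow> indicator K x" for x
 proof (cases "x \<in> K")
  case True
  hence "c x = 1" unfolding c_def using r(2) by (intro prod.neutral) (force simp: nbox_def)
  thus ?thesis using True by (simp add: g_def)
 next
  case False
  hence d: "infdist x K > 0" using in_closed_iff_infdist_zero[OF cl ne, of x] infdist_nonneg[of x K] by (simp add: less_le)
  then obtain k0 :: nat where k0: "1 < real k0 * infdist x K" using reals_Archimedean3 by blast
  have "g k x = 0" if "k \<ge> k0" for k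
  proof -
   have "real k0 * infdist x K \<le> real k * infdist x K" using that d by (intro mult_right_mono) auto
   hence "1 - real k * infdist x K \<le> 0" using k0 by linarith
   thus ?thesis by (simp add: g_def max_def)
  qed
  thus ?thesis using False by (intro tendsto_eventually) (auto simp: eventually_sequentially)
 qed
 have "(\<lambda>k. \<integral>x. \<bar>indicator K x - g k x\<bar> \<partial>Mn n) \<longlonglongrightarrow> (\<integral>x. 0 \<partial>Mn n)"
 proof (rule integral_dominated_convergence[where w="indicator ?b"])
  show "integrable (Mn n) (indicator ?b :: vec => real)"
   using sets_openin[OF openin_nbox] emeasure_nbox_finite by (intro integrable_real_indicator) auto
  show "(\<lambda>x. \<bar>indicator K x - g k x\<bar>) \<in> borel_measurable (Mn n)" for k
   using borel_measurable_indicator[OF sets_compactin[OF K]] borel_measurable_integrable[OF CBn_integrable[OF CB]]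
   by (intro borel_measurable_abs borel_measurable_diff)
  show "AE x in Mn n. (\<lambda>k. \<bar>indicator K x - g k x\<bar>) \<longlonglongrightarrow> 0"
  proof (rule AE_I2)
   fix x
   from tendsto_rabs[OF tendsto_diff[OF tendsto_const lim[of x], of "indicator K x"]]
   show "(\<lambda>k. \<bar>indicator K x - g k x\<bar>) \<longlonglongrightarrow> 0" by simp
  qed
  show "AE x in Mn n. norm \<bar>indicator K x - g k x\<bar> \<le> indicator ?b x" for k
  proof (rule AE_I2)
   fix x assume "x \<in> space (Mn n)"
   thus "norm \<bar>indicator K x - g k x\<bar> \<le> indicator ?b x"
    using g01[of k x] c0[of x] Kb by (cases "x \<in> ?b") (auto simp: space_Mn indicator_def g_def)
  qed
 qed simp
 hence "\<forall>\<^sub>F k in sequentially. (\<integral>x. \<bar>indicator K x - g k x\<bar> \<partial>Mn n) < e" using e by (intro order_tendstoD) auto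
 thus ?thesis using CB unfolding eventually_sequentially by blast
qed

text \<open>Inner regularity is applied to a finite measure on the Borel sets of the ambient space,
  namely the image of the restriction of \<open>Mn n\<close> to \<open>A\<close>.\<close>

lemma compact_inner_approx:
 assumes A: "A \<in> sets (Mn n)" "emeasure (Mn n) A < \<infinity>" and e: "e > 0"
 obtains K where "compactin (Rn n) K" "K \<subseteq> A" "measure (Mn n) (A - K) < e"
proof -
 obtain B where B: "B \<in> sets borel" "A = B \<inter> En n" using sets_Mn_eq[OF A(1)] by blast
 define \<mu> where "\<mu> = distr (density (Mn n) (indicator A)) borel (\<lambda>x. x)"
 have \<mu>: "emeasure \<mu> X = emeasure (Mn n) (A \<inter> X)" if "X \<in> sets borel" for X
 proof -
  have XE: "X \<inter> En n \<in> sets (Mn n)" by (rule borel_Int_En[OF that])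
  have "emeasure \<mu> X = emeasure (density (Mn n) (indicator A)) (X \<inter> En n)"
   unfolding \<mu>_def using that ident_measurable[of n] by (subst emeasure_distr) (simp_all add: space_Mn)
  also have "\<dots> = emeasure (Mn n) (A \<inter> (X \<inter> En n))"
   using XE A by (subst emeasure_density) (auto simp: indicator_inter_arith[symmetric])
  also have "A \<inter> (X \<inter> En n) = A \<inter> X" using B by auto
  finally show ?thesis .
 qed
 have sb: "sets \<mu> = sets borel" "space \<mu> = UNIV" unfolding \<mu>_def by simp_all
 have fin: "emeasure \<mu> (space \<mu>) \<noteq> \<infinity>" using \<mu>[of UNIV] A(2) sb by simp
 have mA: "emeasure \<mu> B = ennreal (measure (Mn n) A)"
  using \<mu>[OF B(1)] A(2) B(2) by (simp add: emeasure_eq_ennreal_measure Int_absorb2)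
 obtain K where K: "K \<subseteq> B" "compact K" "measure (Mn n) A - e < measure (Mn n) (A \<inter> K)"
 proof (cases "measure (Mn n) A - e < 0")
  case False
  hence "ennreal (measure (Mn n) A - e) < (SUP K \<in> {K. K \<subseteq> B \<and> compact K}. emeasure \<mu> K)"
   unfolding inner_regular[OF sb(1) fin B(1), symmetric] mA using e by (simp add: ennreal_less_iff)
  then obtain K where K: "K \<subseteq> B" "compact K" "ennreal (measure (Mn n) A - e) < emeasure \<mu> K" unfolding less_SUP_iff by auto
  have "emeasure (Mn n) (A \<inter> K) < \<infinity>"
   by (rule le_less_trans[OF emeasure_mono[OF Int_lower1 A(1)] A(2)])
  hence "emeasure \<mu> K = ennreal (measure (Mn n) (A \<inter> K))"
   unfolding \<mu>[OF borel_compact[OF K(2)]] by (simp add: emeasure_eq_ennreal_measure)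
  thus ?thesis using that[OF K(1,2)] K(3) False by (simp add: ennreal_less_iff)
 qed (use that[of "{}"] in auto)
 have c: "compactin (Rn n) (K \<inter> En n)" unfolding compactin_Rn using K(2) closed_En by (auto intro: compact_Int_closed)
 have eq: "A \<inter> K = K \<inter> En n" using K(1) B by auto
 have "measure (Mn n) (A - K \<inter> En n) = measure (Mn n) A - measure (Mn n) (K \<inter> En n)"
  using A sets_compactin[OF c] K(1) B by (intro measure_Diff) auto
 thus thesis using that[OF c] K(1,3) B unfolding eq by auto
qed

lemma CBn_indicator_approx:
 assumes A: "A \<in> sets (Mn n)" "emeasure (Mn n) A < \<infinity>" and e: "e > 0"
 obtains g where "CBn n g" "(\<integral>x. \<bar>indicator A x - g x\<bar> \<partial>Mn n) < e"
proof -
 obtain K where K: "compactin (Rn n) K" "K \<subseteq> A" "measure (Mn n) (A - K) < e / 2"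
  using compact_inner_approx[OF A, of "e / 2"] e by auto
 obtain g where g: "CBn n g" "(\<integral>x. \<bar>indicator K x - g x\<bar> \<partial>Mn n) < e / 2"
  using CBn_compact_approx[OF K(1), of "e / 2"] e by auto
 have AK: "integrable (Mn n) (indicator (A - K) :: vec => real)"
  using A sets_compactin[OF K(1)] le_less_trans[OF emeasure_mono[OF Diff_subset A(1)] A(2), of K] by (intro integrable_real_indicator) auto
 have Kg: "integrable (Mn n) (\<lambda>x. \<bar>indicator K x - g x\<bar>)"
  using sets_compactin[OF K(1)] emeasure_compact_finite[OF K(1)] CBn_integrable[OF g(1)]
  by (intro integrable_abs Bochner_Integration.integrable_diff integrable_real_indicator) auto
 have "(\<integral>x. \<bar>indicator A x - g x\<bar> \<partial>Mn n) \<le> (\<integral>x. indicator (A - K) x + \<bar>indicator K x - g x\<bar> \<partial>Mn n)"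
 proof (rule integral_mono)
  show "integrable (Mn n) (\<lambda>x. \<bar>indicator A x - g x\<bar>)"
   using A CBn_integrable[OF g(1)] by (intro integrable_abs Bochner_Integration.integrable_diff integrable_real_indicator) auto
  show "integrable (Mn n) (\<lambda>x. indicator (A - K) x + \<bar>indicator K x - g x\<bar>)" by (rule Bochner_Integration.integrable_add[OF AK Kg])
  show "\<bar>indicator A x - g x\<bar> \<le> indicator (A - K) x + \<bar>indicator K x - g x\<bar>" for x
   using K(2) by (auto simp: indicator_def)
 qed
 also have "\<dots> = measure (Mn n) (A - K) + (\<integral>x. \<bar>indicator K x - g x\<bar> \<partial>Mn n)"
  using A sets_compactin[OF K(1)] by (subst Bochner_Integration.integral_add[OF AK Kg]) auto
 finally show thesis using that[OF g(1)] K(3) g(2) by linarith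
qed

lemma CBn_cmult: "CBn n g ==> CBn n (\<lambda>x. c * g x)"
proof -
 assume "CBn n g"
 then obtain r B where g: "continuous_on UNIV g" "r > 0" "!!x. x \<in> En n ==> x \<notin> nbox n (\<lambda>_. 0) r ==> g x = 0" "!!x. \<bar>g x\<bar> \<le> B"
  unfolding CBn_def by blast
 have "\<bar>c * g x\<bar> \<le> \<bar>c\<bar> * B" for x using g(4)[of x] by (simp add: abs_mult mult_left_mono)
 thus ?thesis unfolding CBn_def using g by (auto intro!: continuous_on_mult_left)
qed

lemma CBn_dense_L1:
 assumes "integrable (Mn n) f" and "e > 0"
 shows "\<exists>g. CBn n g \<and> (\<integral>x. \<bar>f x - g x\<bar> \<partial>Mn n) < e"
 using assms
proof (induction f arbitrary: e rule: integrable_induct)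
 case (base A c)
 define d where "d = e / (\<bar>c\<bar> + 1)"
 have "d > 0" using base unfolding d_def by simp
 then obtain g where g: "CBn n g" "(\<integral>x. \<bar>indicator A x - g x\<bar> \<partial>Mn n) < d"
  using CBn_indicator_approx base by blast
 have "(\<integral>x. \<bar>indicator A x *\<^sub>R c - c * g x\<bar> \<partial>Mn n) = (\<integral>x. \<bar>c\<bar> * \<bar>indicator A x - g x\<bar> \<partial>Mn n)"
  by (intro Bochner_Integration.integral_cong) (auto simp: abs_mult[symmetric] algebra_simps)
 also have "\<dots> = \<bar>c\<bar> * (\<integral>x. \<bar>indicator A x - g x\<bar> \<partial>Mn n)" by simp
 also have "\<dots> \<le> \<bar>c\<bar> * d" using g by (intro mult_left_mono) auto
 also have "\<dots> < e" unfolding d_def using base(3) by (simp add: field_simps)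
 finally show ?case using CBn_cmult[OF g(1), of c] by blast
next
 case (add f1 f2)
 obtain g1 g2 where g: "CBn n g1" "(\<integral>x. \<bar>f1 x - g1 x\<bar> \<partial>Mn n) < e / 2" "CBn n g2" "(\<integral>x. \<bar>f2 x - g2 x\<bar> \<partial>Mn n) < e / 2"
  using add(3)[of "e / 2"] add(4)[of "e / 2"] add(5) by auto
 have "(\<integral>x. \<bar>f1 x + f2 x - (g1 x + g2 x)\<bar> \<partial>Mn n) \<le> (\<integral>x. \<bar>f1 x - g1 x\<bar> + \<bar>f2 x - g2 x\<bar> \<partial>Mn n)"
  using add CBn_integrable[OF g(1)] CBn_integrable[OF g(3)]
  by (intro integral_mono integrable_abs Bochner_Integration.integrable_diff Bochner_Integration.integrable_add) auto
 also have "\<dots> = (\<integral>x. \<bar>f1 x - g1 x\<bar> \<partial>Mn n) + (\<integral>x. \<bar>f2 x - g2 x\<bar> \<partial>Mn n)"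
  using add CBn_integrable[OF g(1)] CBn_integrable[OF g(3)]
  by (intro Bochner_Integration.integral_add integrable_abs Bochner_Integration.integrable_diff) auto
 finally show ?case using g CBn_add[OF g(1) g(3)] by (intro exI[of _ "\<lambda>x. g1 x + g2 x"]) auto
next
 case (lim f s)
 have "(\<lambda>i. \<integral>x. \<bar>f x - s i x\<bar> \<partial>Mn n) \<longlonglongrightarrow> (\<integral>x. \<bar>0\<bar> \<partial>Mn n)"
 proof (rule integral_dominated_convergence[where w="\<lambda>x. 3 * \<bar>f x\<bar>"])
  show "AE x in Mn n. (\<lambda>i. \<bar>f x - s i x\<bar>) \<longlonglongrightarrow> \<bar>0\<bar>"
  proof (rule AE_I2)
   fix x assume "x \<in> space (Mn n)"
   from tendsto_rabs[OF tendsto_diff[OF tendsto_const lim(2)[OF this], of "f x"]]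
   show "(\<lambda>i. \<bar>f x - s i x\<bar>) \<longlonglongrightarrow> \<bar>0\<bar>" by simp
  qed
  show "AE x in Mn n. norm \<bar>f x - s i x\<bar> \<le> 3 * \<bar>f x\<bar>" for i
  proof (rule AE_I2)
   fix x assume "x \<in> space (Mn n)"
   thus "norm \<bar>f x - s i x\<bar> \<le> 3 * \<bar>f x\<bar>" using lim(3)[of x i] by simp
  qed
  show "(\<lambda>x. \<bar>f x - s i x\<bar>) \<in> borel_measurable (Mn n)" for i
   using borel_measurable_integrable[OF lim(1)] borel_measurable_integrable[OF lim(4)] by measurable
 qed (use lim in auto)
 hence "\<forall>\<^sub>F i in sequentially. (\<integral>x. \<bar>f x - s i x\<bar> \<partial>Mn n) < e / 2"
  using lim(6) by (intro order_tendstoD) auto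
 then obtain i where i: "(\<integral>x. \<bar>f x - s i x\<bar> \<partial>Mn n) < e / 2" unfolding eventually_sequentially by blast
 obtain g where g: "CBn n g" "(\<integral>x. \<bar>s i x - g x\<bar> \<partial>Mn n) < e / 2" using lim(5)[of "e / 2" i] lim(6) by auto
 have "(\<integral>x. \<bar>f x - g x\<bar> \<partial>Mn n) \<le> (\<integral>x. \<bar>f x - s i x\<bar> + \<bar>s i x - g x\<bar> \<partial>Mn n)"
  using lim CBn_integrable[OF g(1)]
  by (intro integral_mono integrable_abs Bochner_Integration.integrable_diff Bochner_Integration.integrable_add) auto
 also have "\<dots> = (\<integral>x. \<bar>f x - s i x\<bar> \<partial>Mn n) + (\<integral>x. \<bar>s i x - g x\<bar> \<partial>Mn n)"
  using lim CBn_integrable[OF g(1)]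
  by (intro Bochner_Integration.integral_add integrable_abs Bochner_Integration.integrable_diff) auto
 finally show ?case using g i by (intro exI[of _ g]) auto
qed

section \<open>Convolution with product kernels\<close>

definition mollg :: "nat => (nat => real => real) => (vec => real) => vec => real" where
 "mollg n g f x = (\<integral>y. f y * (\<Prod>i<n. g i (x i - y i)) \<partial>Mn n)"

lemma test1_common_bound:
 fixes g :: "nat => real => real" and n :: nat
 assumes "!!i. g i \<in> test1"
 shows "\<exists>B\<ge>1. \<forall>i t. i < n --> \<bar>g i t\<bar> \<le> B"
proof -
 have "\<exists>B. \<forall>t. \<bar>g i t\<bar> \<le> B" for i using test1_bounded[OF assms] by metis
 then obtain b where b: "!!i t. \<bar>g i t\<bar> \<le> b i" by metis
 define B where "B = Max (insert 1 (b ` {..<n}))"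
 have "B \<ge> 1" unfolding B_def by (intro Max_ge) auto
 moreover have "\<bar>g i t\<bar> \<le> B" if "i < n" for i t
 proof -
  have "b i \<le> B" unfolding B_def using that by (intro Max_ge) auto
  thus ?thesis using b[of i t] by linarith
 qed
 ultimately show ?thesis by blast
qed

lemma prod_bound:
 fixes a :: "nat => real"
 assumes "!!i. i \<in> I ==> \<bar>a i\<bar> \<le> B"
 shows "\<bar>\<Prod>i\<in>I. a i\<bar> \<le> B ^ card I"
proof -
 have "\<bar>\<Prod>i\<in>I. a i\<bar> = (\<Prod>i\<in>I. \<bar>a i\<bar>)" by (rule abs_prod)
 also have "\<dots> \<le> (\<Prod>i\<in>I. B)" using assms by (intro prod_mono) auto
 finally show ?thesis by simp
qed

lemma kernel_measurable:
 assumes "!!i. g i \<in> test1"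
 shows "(\<lambda>y. \<Prod>i<n. g i (x i - y i)) \<in> borel_measurable (Mn n)"
proof (rule borel_measurable_prod)
 fix i assume "i \<in> {..<n}"
 hence "(\<lambda>y. x i - y i) \<in> borel_measurable (Mn n)" by (intro borel_measurable_diff borel_measurable_const coord_measurable) simp
 from measurable_compose[OF this test1_measurable[OF assms]] show "(\<lambda>y. g i (x i - y i)) \<in> borel_measurable (Mn n)" .
qed

lemma mollg_integrable:
 assumes f: "integrable (Mn n) f" and g: "!!i. g i \<in> test1"
 shows "integrable (Mn n) (\<lambda>y. f y * (\<Prod>i<n. g i (x i - y i)))"
proof -
 obtain B where B: "B \<ge> 1" "!!i t. i < n ==> \<bar>g i t\<bar> \<le> B" using test1_common_bound[where g=g and n=n, OF g] by blast
 show ?thesis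
 proof (rule Bochner_Integration.integrable_bound[where f="\<lambda>y. B ^ n * f y"])
  show "AE y in Mn n. norm (f y * (\<Prod>i<n. g i (x i - y i))) \<le> norm (B ^ n * f y)"
  proof (rule AE_I2)
   fix y
   have "\<bar>\<Prod>i<n. g i (x i - y i)\<bar> \<le> B ^ n" using prod_bound[of "{..<n}" "\<lambda>i. g i (x i - y i)" B] B by simp
   hence "\<bar>f y\<bar> * \<bar>\<Prod>i<n. g i (x i - y i)\<bar> \<le> \<bar>f y\<bar> * B ^ n" by (intro mult_left_mono) auto
   thus "norm (f y * (\<Prod>i<n. g i (x i - y i))) \<le> norm (B ^ n * f y)" using B by (simp add: abs_mult mult.commute)
  qed
 qed (use f kernel_measurable[OF g] in auto)
qed

lemma mollg_continuous:
 assumes f: "integrable (Mn n) f" and g: "!!i. g i \<in> test1"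
 shows "continuous_on UNIV (mollg n g f)"
 unfolding continuous_on_sequentially
proof (intro allI impI ballI)
 fix X :: "nat => vec" and x assume X: "(\<forall>m. X m \<in> UNIV) \<and> X \<longlonglongrightarrow> x"
 obtain B where B: "B \<ge> 1" "!!i t. i < n ==> \<bar>g i t\<bar> \<le> B" using test1_common_bound[where g=g and n=n, OF g] by blast
 have Xi: "(\<lambda>m. X m i) \<longlonglongrightarrow> x i" for i
  by (rule continuous_on_tendsto_compose[OF continuous_on_product_coordinates[of i], of X x]) (use X in auto)
 show "(mollg n g f \<circ> X) \<longlonglongrightarrow> mollg n g f x"
  unfolding mollg_def comp_def
 proof (rule integral_dominated_convergence[where w="\<lambda>y. B ^ n * \<bar>f y\<bar>"])
  show "AE y in Mn n. (\<lambda>m. f y * (\<Prod>i<n. g i (X m i - y i))) \<longlonglongrightarrow> f y * (\<Prod>i<n. g i (x i - y i))"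
  proof (rule AE_I2, intro tendsto_mult tendsto_const tendsto_prod)
   fix y i
   have "isCont (g i) (x i - y i)" using test1_continuous[OF g] by (simp add: continuous_on_eq_continuous_at)
   thus "(\<lambda>m. g i (X m i - y i)) \<longlonglongrightarrow> g i (x i - y i)"
    by (rule isCont_tendsto_compose) (intro tendsto_intros Xi)
  qed
  show "AE y in Mn n. norm (f y * (\<Prod>i<n. g i (X m i - y i))) \<le> B ^ n * \<bar>f y\<bar>" for m
  proof (rule AE_I2)
   fix y
   have "\<bar>\<Prod>i<n. g i (X m i - y i)\<bar> \<le> B ^ n" using prod_bound[where I="{..<n}" and a="\<lambda>i. g i (X m i - y i)" and B=B] B by simp
   hence "\<bar>f y\<bar> * \<bar>\<Prod>i<n. g i (X m i - y i)\<bar> \<le> \<bar>f y\<bar> * B ^ n" by (intro mult_left_mono) auto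
   thus "norm (f y * (\<Prod>i<n. g i (X m i - y i))) \<le> B ^ n * \<bar>f y\<bar>" by (simp add: abs_mult mult.commute)
  qed
 qed (use f borel_measurable_integrable[OF mollg_integrable[where g=g, OF f g]] in auto)
qed

text \<open>Each coordinate has its own factor \<open>g i\<close>, so that differentiating in
  coordinate \<open>j\<close> only replaces \<open>g j\<close> by its derivative and the family of
  convolutions is closed under differentiation. The difference quotients are dominated because
  \<open>g j\<close> is Lipschitz with the bound \<open>B'\<close> on its derivative.\<close>

lemma mollg_deriv:
 assumes f: "integrable (Mn n) f" and g: "!!i. g i \<in> test1" and j: "j < n"
  and g': "g' \<in> test1" "!!t. (g j has_real_derivative g' t) (at t)"
 shows "((\<lambda>t. mollg n g f (x(j := t))) has_real_derivative mollg n (g(j := g')) f x) (at (x j))"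
proof -
 obtain B where B: "B \<ge> 1" "!!i t. i < n ==> \<bar>g i t\<bar> \<le> B" using test1_common_bound[where g=g and n=n, OF g] by blast
 obtain B' where B': "B' > 0" "!!t. \<bar>g' t\<bar> \<le> B'" using test1_bounded[OF g'(1)] by blast
 define R where "R y = (\<Prod>i\<in>{..<n} - {j}. g i (x i - y i))" for y
 have R: "(\<Prod>i<n. g i ((x(j := t)) i - y i)) = g j (t - y j) * R y" for t y
  unfolding R_def using j by (subst prod.remove[of _ j]) auto
 have R': "(\<Prod>i<n. (g(j := g')) i (x i - y i)) = g' (x j - y j) * R y" for y
  unfolding R_def using j by (subst prod.remove[of _ j]) auto
 have Rb: "\<bar>R y\<bar> \<le> B ^ n" for y
 proof -
  have "\<bar>R y\<bar> \<le> B ^ card ({..<n} - {j})" unfolding R_def by (rule prod_bound) (use B in auto)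
  also have "\<dots> \<le> B ^ n" using B j by (intro power_increasing) auto
  finally show ?thesis .
 qed
 have lip: "\<bar>g j a - g j b\<bar> \<le> B' * \<bar>a - b\<bar>" for a b
  using field_differentiable_bound[of UNIV "g j" g' B' a b] g'(2) B'(2) by simp
 have int: "integrable (Mn n) (\<lambda>y. f y * (g j (t - y j) * R y))" for t
  using mollg_integrable[where g=g and x="x(j := t)", OF f g] unfolding R .
 have "((\<lambda>t. (mollg n g f (x(j := t)) - mollg n g f (x(j := x j))) / (t - x j)) \<longlongrightarrow> mollg n (g(j := g')) f x) (at (x j))"
  unfolding tendsto_at_iff_sequentially
 proof (intro allI impI)
  fix X :: "nat => real" assume Xn: "\<forall>m. X m \<in> UNIV - {x j}" and X: "X \<longlonglongrightarrow> x j"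
  have ne: "X m \<noteq> x j" for m using Xn by auto
  have q: "(mollg n g f (x(j := t)) - mollg n g f (x(j := x j))) / (t - x j)
   = (\<integral>y. f y * ((g j (t - y j) - g j (x j - y j)) / (t - x j) * R y) \<partial>Mn n)" for t
  proof -
   have "mollg n g f (x(j := t)) - mollg n g f (x(j := x j)) = (\<integral>y. f y * (g j (t - y j) * R y) - f y * (g j (x j - y j) * R y) \<partial>Mn n)"
    unfolding mollg_def R by (rule Bochner_Integration.integral_diff[OF int int, symmetric])
   hence "(mollg n g f (x(j := t)) - mollg n g f (x(j := x j))) / (t - x j)
    = (\<integral>y. (f y * (g j (t - y j) * R y) - f y * (g j (x j - y j) * R y)) / (t - x j) \<partial>Mn n)" by simp
   also have "\<dots> = (\<integral>y. f y * ((g j (t - y j) - g j (x j - y j)) / (t - x j) * R y) \<partial>Mn n)"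
    by (intro Bochner_Integration.integral_cong refl) (simp add: diff_divide_distrib algebra_simps)
   finally show ?thesis .
  qed
  have "(\<lambda>m. \<integral>y. f y * ((g j (X m - y j) - g j (x j - y j)) / (X m - x j) * R y) \<partial>Mn n)
    \<longlonglongrightarrow> (\<integral>y. f y * (g' (x j - y j) * R y) \<partial>Mn n)"
  proof (rule integral_dominated_convergence[where w="\<lambda>y. (B' * B ^ n) * \<bar>f y\<bar>"])
   show "AE y in Mn n. (\<lambda>m. f y * ((g j (X m - y j) - g j (x j - y j)) / (X m - x j) * R y)) \<longlonglongrightarrow> f y * (g' (x j - y j) * R y)"
   proof (rule AE_I2, intro tendsto_mult tendsto_const)
    fix y
    have "((\<lambda>z. (g j z - g j (x j - y j)) / (z - (x j - y j))) \<longlongrightarrow> g' (x j - y j)) (at (x j - y j))"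
     using g'(2) by (simp add: has_field_derivative_iff)
    note lim = this[unfolded tendsto_at_iff_sequentially, THEN spec, of "\<lambda>m. X m - y j"]
    have "(\<lambda>m. X m - y j) \<longlonglongrightarrow> x j - y j" by (intro tendsto_intros X)
    moreover have "\<forall>m. X m - y j \<in> UNIV - {x j - y j}" using ne by simp
    ultimately have "((\<lambda>z. (g j z - g j (x j - y j)) / (z - (x j - y j))) \<circ> (\<lambda>m. X m - y j)) \<longlonglongrightarrow> g' (x j - y j)"
     using lim by simp
    thus "(\<lambda>m. (g j (X m - y j) - g j (x j - y j)) / (X m - x j)) \<longlonglongrightarrow> g' (x j - y j)"
     by (simp add: comp_def)
   qed
   show "AE y in Mn n. norm (f y * ((g j (X m - y j) - g j (x j - y j)) / (X m - x j) * R y)) \<le> (B' * B ^ n) * \<bar>f y\<bar>" for m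
   proof (rule AE_I2)
    fix y
    have "\<bar>(g j (X m - y j) - g j (x j - y j)) / (X m - x j)\<bar> \<le> B'"
     using lip[of "X m - y j" "x j - y j"] ne[of m] by (simp add: abs_divide field_simps)
    hence "\<bar>(g j (X m - y j) - g j (x j - y j)) / (X m - x j)\<bar> * \<bar>R y\<bar> \<le> B' * B ^ n"
     using Rb[of y] B' by (intro mult_mono) auto
    hence "\<bar>f y\<bar> * (\<bar>(g j (X m - y j) - g j (x j - y j)) / (X m - x j)\<bar> * \<bar>R y\<bar>) \<le> \<bar>f y\<bar> * (B' * B ^ n)"
     by (intro mult_left_mono) auto
    thus "norm (f y * ((g j (X m - y j) - g j (x j - y j)) / (X m - x j) * R y)) \<le> (B' * B ^ n) * \<bar>f y\<bar>"
     by (simp only: real_norm_def abs_mult mult.commute[of "\<bar>f y\<bar>" "B' * B ^ n"])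
   qed
   have mi: "(\<lambda>y. f y * (g j (t - y j) * R y)) \<in> borel_measurable (Mn n)" for t
    using borel_measurable_integrable[OF int] .
   show "(\<lambda>y. f y * ((g j (X m - y j) - g j (x j - y j)) / (X m - x j) * R y)) \<in> borel_measurable (Mn n)" for m
   proof -
    have "(\<lambda>y. (f y * (g j (X m - y j) * R y) - f y * (g j (x j - y j) * R y)) / (X m - x j)) \<in> borel_measurable (Mn n)"
     using mi by measurable
    thus ?thesis by (simp add: diff_divide_distrib algebra_simps)
   qed
   show "(\<lambda>y. f y * (g' (x j - y j) * R y)) \<in> borel_measurable (Mn n)"
    using borel_measurable_integrable[OF mollg_integrable[where g="g(j := g')" and x=x, OF f]] g g'(1) unfolding R' by simp
  qed (use f in auto)
  thus "((\<lambda>t. (mollg n g f (x(j := t)) - mollg n g f (x(j := x j))) / (t - x j)) \<circ> X) \<longlonglongrightarrow> mollg n (g(j := g')) f x"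
   unfolding comp_def q unfolding mollg_def R' .
 qed
 thus ?thesis by (simp add: has_field_derivative_iff)
qed

lemma mollg_smooth:
 assumes U: "openin (Rn n) U" and f: "integrable (Mn n) f" and g: "!!i. g i \<in> test1"
 shows "smooth n U (mollg n g f)"
proof (rule smooth_coinduct[OF U, of _ "{mollg n g f | g. \<forall>i. g i \<in> test1}"])
 show "mollg n g f \<in> {mollg n g f | g. \<forall>i. g i \<in> test1}" using g by blast
 show "continuous_on U h" if "h \<in> {mollg n g f | g. \<forall>i. g i \<in> test1}" for h
  using that mollg_continuous[OF f] by (auto intro: continuous_on_subset)
 fix h i assume "h \<in> {mollg n g f | g. \<forall>i. g i \<in> test1}" and i: "i < n"
 then obtain g where h: "h = mollg n g f" and g: "!!i. g i \<in> test1" by blast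
 obtain g' where g': "g' \<in> test1" "!!t. (g i has_real_derivative g' t) (at t)" using test1_deriv[OF g] by blast
 have in1: "mollg n (g(i := g')) f \<in> {mollg n g f | g. \<forall>i. g i \<in> test1}"
  by (intro CollectI exI[of _ "g(i := g')"] conjI refl) (simp add: g g'(1))
 show "\<exists>h'\<in>{mollg n g f | g. \<forall>i. g i \<in> test1}. \<forall>x\<in>U. ((\<lambda>t. h (x(i := t))) has_real_derivative h' x) (at (x i))"
  unfolding h by (rule bexI[OF _ in1], rule ballI, rule mollg_deriv[where g=g and g'=g', OF f g i g'])
qed

definition kern :: "nat => nat => vec => vec => real" where
 "kern n k x y = (\<Prod>i<n. mollk k (x i - y i))"

definition moll :: "nat => nat => (vec => real) => vec => real" where
 "moll n k f x = (\<integral>y. f y * kern n k x y \<partial>Mn n)"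

lemma moll_mollg: "moll n k f = mollg n (\<lambda>_. mollk k) f"
 by (simp add: moll_def mollg_def kern_def fun_eq_iff)

lemma kern_nonneg: "kern n k x y \<ge> 0"
 unfolding kern_def by (intro prod_nonneg ballI mollk_nonneg)

lemma kern_support: "y \<in> En n ==> y \<notin> nbox n x (1 / real (Suc k)) ==> kern n k x y = 0"
proof -
 assume "y \<in> En n" "y \<notin> nbox n x (1 / real (Suc k))"
 then obtain i where i: "i < n" "\<bar>y i - x i\<bar> \<ge> 1 / real (Suc k)" by (auto simp: nbox_def not_less)
 hence "mollk k (x i - y i) = 0" by (intro mollk_support) (simp add: abs_minus_commute)
 thus ?thesis unfolding kern_def using i by (intro prod_zero) auto
qed

lemma kern_integral: "(\<integral>y. kern n k x y \<partial>Mn n) = 1" "(\<integral>x. kern n k x y \<partial>Mn n) = 1"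
 and kern_integrable: "integrable (Mn n) (kern n k x)" "integrable (Mn n) (\<lambda>x. kern n k x y)"
proof -
 have i1: "integrable lborel (\<lambda>t. mollk k (a - t))" for a
  using test1_integrable[OF test1_affine[OF mollk_test1, of "-1" 1 k a]] by simp
 have i2: "integrable lborel (\<lambda>t. mollk k (t - a))" for a
  using test1_integrable[OF test1_affine[OF mollk_test1, of 1 1 k "- a"]] by simp
 show "(\<integral>y. kern n k x y \<partial>Mn n) = 1"
  unfolding kern_def using PL.product_integral_prod[of "{..<n}" "\<lambda>i t. mollk k (x i - t)"] i1 by (simp add: mollk_integral)
 show "(\<integral>x. kern n k x y \<partial>Mn n) = 1"
  unfolding kern_def using PL.product_integral_prod[of "{..<n}" "\<lambda>i t. mollk k (t - y i)"] i2 by (simp add: mollk_integral)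
 show "integrable (Mn n) (kern n k x)"
  unfolding kern_def[abs_def] using PL.product_integrable_prod[of "{..<n}" "\<lambda>i t. mollk k (x i - t)"] i1 by simp
 show "integrable (Mn n) (\<lambda>x. kern n k x y)"
  unfolding kern_def[abs_def] using PL.product_integrable_prod[of "{..<n}" "\<lambda>i t. mollk k (t - y i)"] i2 by simp
qed

lemma moll_integrable: "integrable (Mn n) f ==> integrable (Mn n) (\<lambda>y. f y * kern n k x y)"
 using mollg_integrable[of n f "\<lambda>_. mollk k" x] mollk_test1 by (simp add: kern_def)

text \<open>The kernel is a probability density on a small cube, so the mollified value is an
  average of nearby values. With \<open>e = 0\<close> this shows that the mollification equals a
  constant exactly wherever \<open>f\<close> is that constant nearby.\<close>

lemma moll_close:
 assumes f: "integrable (Mn n) f" and e: "!!y. y \<in> nbox n x (1 / real (Suc k)) ==> \<bar>f y - c\<bar> \<le> e"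
 shows "\<bar>moll n k f x - c\<bar> \<le> e"
proof -
 have "moll n k f x - c = (\<integral>y. f y * kern n k x y - c * kern n k x y \<partial>Mn n)"
  unfolding moll_def using moll_integrable[OF f] kern_integrable(1)[of n k x] kern_integral(1)[of n k x] by simp
 also have "\<bar>\<dots>\<bar> \<le> (\<integral>y. e * kern n k x y \<partial>Mn n)"
 proof (rule order_trans[OF integral_abs_bound], rule integral_mono)
  show "integrable (Mn n) (\<lambda>y. \<bar>f y * kern n k x y - c * kern n k x y\<bar>)" "integrable (Mn n) (\<lambda>y. e * kern n k x y)"
   using moll_integrable[OF f] kern_integrable(1)[of n k x] by auto
  fix y assume "y \<in> space (Mn n)"
  hence y: "y \<in> En n" by (simp add: space_Mn)
  show "\<bar>f y * kern n k x y - c * kern n k x y\<bar> \<le> e * kern n k x y"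
  proof (cases "y \<in> nbox n x (1 / real (Suc k))")
   case True
   have "\<bar>(f y - c) * kern n k x y\<bar> \<le> e * kern n k x y"
    unfolding abs_mult using e[OF True] kern_nonneg[of n k x y] by (intro mult_mono) auto
   thus ?thesis by (simp add: algebra_simps)
  next
   case False
   thus ?thesis using kern_support[OF y] by simp
  qed
 qed
 also have "\<dots> = e" using kern_integral(1)[of n k x] by simp
 finally show ?thesis .
qed

lemma moll_diff:
 assumes "integrable (Mn n) f" "integrable (Mn n) g"
 shows "moll n k (\<lambda>y. f y - g y) x = moll n k f x - moll n k g x"
 unfolding moll_def using moll_integrable[OF assms(1)] moll_integrable[OF assms(2)]
 by (simp add: left_diff_distrib)

section \<open>Convergence of mollifications in Lp\<close>

lemma kern2_measurable: "(\<lambda>z. kern n k (fst z) (snd z)) \<in> borel_measurable (Mn n \<Otimes>\<^sub>M Mn n)"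
 unfolding kern_def
proof (rule borel_measurable_prod)
 fix i assume i: "i \<in> {..<n}"
 have "(\<lambda>z. fst z i - snd z i) \<in> borel_measurable (Mn n \<Otimes>\<^sub>M Mn n)"
  using measurable_compose[OF measurable_fst coord_measurable[of i n]] measurable_compose[OF measurable_snd coord_measurable[of i n]] i
  by (intro borel_measurable_diff) auto
 from measurable_compose[OF this test1_measurable[OF mollk_test1]]
 show "(\<lambda>z. mollk k (fst z i - snd z i)) \<in> borel_measurable (Mn n \<Otimes>\<^sub>M Mn n)" .
qed

lemma powr_tangent1:
 fixes p x y :: real
 assumes "p \<ge> 1" "x \<ge> 0" "y \<ge> 0"
 shows "y powr p + p * y powr (p - 1) * (x - y) \<le> x powr p"
 using powr_tangent[of p x y] assms by (cases "p = 1"; cases "y = 0") auto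

text \<open>Jensen's inequality by integrating, against the kernel, the tangent of the p-th power at
  the average \<open>A\<close> of \<open>\<bar>f\<bar>\<close>.\<close>

lemma moll_Jensen:
 assumes p: "p \<ge> 1" and f: "integrable (Mn n) f" and fp: "integrable (Mn n) (\<lambda>x. \<bar>f x\<bar> powr p)"
 shows "\<bar>moll n k f x\<bar> powr p \<le> (\<integral>y. \<bar>f y\<bar> powr p * kern n k x y \<partial>Mn n)"
proof -
 define A where "A = (\<integral>y. \<bar>f y\<bar> * kern n k x y \<partial>Mn n)"
 have ia: "integrable (Mn n) (\<lambda>y. \<bar>f y\<bar> * kern n k x y)" by (rule moll_integrable) (use f in auto)
 have ip: "integrable (Mn n) (\<lambda>y. \<bar>f y\<bar> powr p * kern n k x y)" by (rule moll_integrable[OF fp])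
 have A0: "A \<ge> 0" unfolding A_def using kern_nonneg by (intro integral_nonneg_AE) auto
 have "\<bar>moll n k f x\<bar> \<le> A" unfolding moll_def A_def
  using integral_abs_bound[of "Mn n" "\<lambda>y. f y * kern n k x y"] kern_nonneg[of n k x] by (simp add: abs_mult)
 hence "\<bar>moll n k f x\<bar> powr p \<le> A powr p" using p by (intro powr_mono2) auto
 also have "\<dots> = (\<integral>y. (A powr p + p * A powr (p - 1) * (\<bar>f y\<bar> - A)) * kern n k x y \<partial>Mn n)"
 proof -
  have "(\<lambda>y. (A powr p + p * A powr (p - 1) * (\<bar>f y\<bar> - A)) * kern n k x y)
   = (\<lambda>y. (A powr p - p * A powr (p - 1) * A) * kern n k x y + p * A powr (p - 1) * (\<bar>f y\<bar> * kern n k x y))"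
   by (simp add: fun_eq_iff algebra_simps)
  thus ?thesis using ia kern_integrable(1)[of n k x] kern_integral(1)[of n k x] by (simp add: A_def[symmetric])
 qed
 also have "\<dots> \<le> (\<integral>y. \<bar>f y\<bar> powr p * kern n k x y \<partial>Mn n)"
 proof (rule integral_mono[OF _ ip])
  have "(\<lambda>y. (A powr p + p * A powr (p - 1) * (\<bar>f y\<bar> - A)) * kern n k x y)
   = (\<lambda>y. (A powr p - p * A powr (p - 1) * A) * kern n k x y + p * A powr (p - 1) * (\<bar>f y\<bar> * kern n k x y))"
   by (simp add: fun_eq_iff algebra_simps)
  thus "integrable (Mn n) (\<lambda>y. (A powr p + p * A powr (p - 1) * (\<bar>f y\<bar> - A)) * kern n k x y)"
   using ia kern_integrable(1)[of n k x] by simp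
  fix y
  show "(A powr p + p * A powr (p - 1) * (\<bar>f y\<bar> - A)) * kern n k x y \<le> \<bar>f y\<bar> powr p * kern n k x y"
   by (intro mult_right_mono powr_tangent1 p A0 kern_nonneg) simp
 qed
 finally show ?thesis .
qed

text \<open>Jensen's inequality and then Tonelli's theorem; the kernel has integral 1 in its other
  variable as well.\<close>

lemma moll_Lp_bound:
 assumes p: "p \<ge> 1" and f: "integrable (Mn n) f" and fp: "integrable (Mn n) (\<lambda>x. \<bar>f x\<bar> powr p)"
 shows "(\<integral>\<^sup>+x. ennreal (\<bar>moll n k f x\<bar> powr p) \<partial>Mn n) \<le> (\<integral>\<^sup>+x. ennreal (\<bar>f x\<bar> powr p) \<partial>Mn n)"
proof -
 interpret S: sigma_finite_measure "Mn n" by (rule sigma_finite_Mn)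
 interpret P: pair_sigma_finite "Mn n" "Mn n" ..
 have fm: "f \<in> borel_measurable (Mn n)" using f by auto
 have "(\<integral>\<^sup>+x. ennreal (\<bar>moll n k f x\<bar> powr p) \<partial>Mn n) \<le> (\<integral>\<^sup>+x. (\<integral>\<^sup>+y. ennreal (\<bar>f y\<bar> powr p * kern n k x y) \<partial>Mn n) \<partial>Mn n)"
 proof (rule nn_integral_mono)
  fix x
  have "ennreal (\<bar>moll n k f x\<bar> powr p) \<le> ennreal (\<integral>y. \<bar>f y\<bar> powr p * kern n k x y \<partial>Mn n)"
   by (intro ennreal_leI moll_Jensen assms)
  also have "\<dots> = (\<integral>\<^sup>+y. ennreal (\<bar>f y\<bar> powr p * kern n k x y) \<partial>Mn n)"
   using moll_integrable[OF fp] kern_nonneg by (intro nn_integral_eq_integral[symmetric]) auto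
  finally show "ennreal (\<bar>moll n k f x\<bar> powr p) \<le> (\<integral>\<^sup>+y. ennreal (\<bar>f y\<bar> powr p * kern n k x y) \<partial>Mn n)" .
 qed
 also have "\<dots> = (\<integral>\<^sup>+y. (\<integral>\<^sup>+x. ennreal (\<bar>f y\<bar> powr p * kern n k x y) \<partial>Mn n) \<partial>Mn n)"
 proof (rule P.Fubini'[symmetric])
  have "(\<lambda>z. \<bar>f (snd z)\<bar> powr p) \<in> borel_measurable (Mn n \<Otimes>\<^sub>M Mn n)"
   using measurable_compose[OF measurable_snd fm] by measurable
  thus "(\<lambda>(x, y). ennreal (\<bar>f y\<bar> powr p * kern n k x y)) \<in> borel_measurable (Mn n \<Otimes>\<^sub>M Mn n)"
   using kern2_measurable[of n k] by (simp add: case_prod_beta')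
 qed
 also have "\<dots> = (\<integral>\<^sup>+y. ennreal (\<bar>f y\<bar> powr p) \<partial>Mn n)"
 proof (rule nn_integral_cong)
  fix y
  have "(\<integral>\<^sup>+x. ennreal (\<bar>f y\<bar> powr p * kern n k x y) \<partial>Mn n) = ennreal (\<integral>x. \<bar>f y\<bar> powr p * kern n k x y \<partial>Mn n)"
   using kern_integrable(2)[of n k y] kern_nonneg by (intro nn_integral_eq_integral) auto
  thus "(\<integral>\<^sup>+x. ennreal (\<bar>f y\<bar> powr p * kern n k x y) \<partial>Mn n) = ennreal (\<bar>f y\<bar> powr p)"
   using kern_integral(2)[of n k y] by simp
 qed
 finally show ?thesis .
qed

lemma powr_add_bound:
 fixes a b p :: real
 assumes "p \<ge> 1"
 shows "\<bar>a + b\<bar> powr p \<le> 2 powr p * (\<bar>a\<bar> powr p + \<bar>b\<bar> powr p)"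
proof -
 have "\<bar>a + b\<bar> \<le> 2 * max \<bar>a\<bar> \<bar>b\<bar>" by linarith
 hence "\<bar>a + b\<bar> powr p \<le> (2 * max \<bar>a\<bar> \<bar>b\<bar>) powr p" using assms by (intro powr_mono2) auto
 also have "\<dots> = 2 powr p * (max \<bar>a\<bar> \<bar>b\<bar>) powr p" by (simp add: powr_mult)
 also have "(max \<bar>a\<bar> \<bar>b\<bar>) powr p \<le> \<bar>a\<bar> powr p + \<bar>b\<bar> powr p" by (auto simp: max_def)
 finally show ?thesis by simp
qed

lemma abs_powr_measurable: "f \<in> borel_measurable M ==> (\<lambda>x. \<bar>f x\<bar> powr p :: real) \<in> borel_measurable M"
 by measurable

lemma integrable_powr_add:
 assumes p: "p \<ge> 1" and f: "f \<in> borel_measurable M" "integrable M (\<lambda>x. \<bar>f x\<bar> powr p)"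
  and g: "g \<in> borel_measurable M" "integrable M (\<lambda>x. \<bar>g x\<bar> powr p)"
 shows "integrable M (\<lambda>x. \<bar>f x + g x\<bar> powr p :: real)"
proof (rule Bochner_Integration.integrable_bound[where f="\<lambda>x. 2 powr p * (\<bar>f x\<bar> powr p + \<bar>g x\<bar> powr p)"])
 show "AE x in M. norm (\<bar>f x + g x\<bar> powr p) \<le> norm (2 powr p * (\<bar>f x\<bar> powr p + \<bar>g x\<bar> powr p))"
  using powr_add_bound[OF p] by (intro AE_I2) simp
 show "(\<lambda>x. \<bar>f x + g x\<bar> powr p) \<in> borel_measurable M" using f g by measurable
qed (use f g in auto)

lemma integrable_powr_diff:
 assumes p: "p \<ge> 1" and f: "f \<in> borel_measurable M" "integrable M (\<lambda>x. \<bar>f x\<bar> powr p)"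
  and g: "g \<in> borel_measurable M" "integrable M (\<lambda>x. \<bar>g x\<bar> powr p)"
 shows "integrable M (\<lambda>x. \<bar>f x - g x\<bar> powr p :: real)"
 using integrable_powr_add[OF p f, of "\<lambda>x. - g x"] g by simp

lemma CBn_powr_integrable: "CBn n g ==> p \<ge> 1 ==> integrable (Mn n) (\<lambda>x. \<bar>g x\<bar> powr p)"
proof -
 assume g: "CBn n g" and p: "p \<ge> 1"
 obtain r B where r: "!!x. x \<in> En n ==> x \<notin> nbox n (\<lambda>_. 0) r ==> g x = 0" "!!x. \<bar>g x\<bar> \<le> B"
  using g unfolding CBn_def by blast
 have "g \<in> borel_measurable (Mn n)" using g continuous_UNIV_measurable_Mn unfolding CBn_def by blast
 thus ?thesis
 proof (intro integrable_bounded_box[where B="B powr p" and y="\<lambda>_. 0" and r=r])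
  show "\<bar>\<bar>g x\<bar> powr p\<bar> \<le> B powr p" for x using r(2)[of x] p by (simp add: powr_mono2)
  show "\<bar>g x\<bar> powr p = 0" if "x \<in> En n" "x \<notin> nbox n (\<lambda>_. 0) r" for x using r(1)[OF that] by simp
 qed (rule abs_powr_measurable)
qed

text \<open>After clipping at height \<open>m\<close> the p-th power of a difference is at most a
  constant times the difference, and density in L1 applies.\<close>

lemma CBn_dense_Lp:
 assumes p: "p \<ge> 1" and f: "integrable (Mn n) f" and fp: "integrable (Mn n) (\<lambda>x. \<bar>f x\<bar> powr p)" and e: "e > 0"
 obtains g where "CBn n g" "(\<integral>x. \<bar>f x - g x\<bar> powr p \<partial>Mn n) < e"
proof -
 define c where "c m t = max (- real m) (min (real m) t)" for m and t :: real
 have fm: "f \<in> borel_measurable (Mn n)" using f by auto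
 have cm: "(\<lambda>x. c m (f x)) \<in> borel_measurable (Mn n)" for m unfolding c_def using fm by measurable
 have cb: "\<bar>c m t\<bar> \<le> real m" "\<bar>t - c m t\<bar> \<le> \<bar>t\<bar>" "\<bar>c m t\<bar> \<le> \<bar>t\<bar>" "\<bar>c m t - c m u\<bar> \<le> \<bar>t - u\<bar>" for m t u
  unfolding c_def by (auto simp: max_def min_def)
 have "(\<lambda>m. \<integral>x. \<bar>f x - c m (f x)\<bar> powr p \<partial>Mn n) \<longlonglongrightarrow> (\<integral>x. 0 \<partial>Mn n)"
 proof (rule integral_dominated_convergence[where w="\<lambda>x. \<bar>f x\<bar> powr p"])
  show "AE x in Mn n. (\<lambda>m. \<bar>f x - c m (f x)\<bar> powr p) \<longlonglongrightarrow> 0"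
  proof (rule AE_I2)
   fix x
   obtain m0 :: nat where m0: "\<bar>f x\<bar> \<le> real m0" using real_arch_simple by blast
   have "\<forall>\<^sub>F m in sequentially. \<bar>f x - c m (f x)\<bar> powr p = 0"
    using eventually_ge_at_top[of m0]
   proof eventually_elim
    case (elim m)
    hence "\<bar>f x\<bar> \<le> real m" using m0 by linarith
    hence "c m (f x) = f x" unfolding c_def by auto
    thus ?case using p by simp
   qed
   thus "(\<lambda>m. \<bar>f x - c m (f x)\<bar> powr p) \<longlonglongrightarrow> 0" by (rule tendsto_eventually)
  qed
  show "AE x in Mn n. norm (\<bar>f x - c m (f x)\<bar> powr p) \<le> \<bar>f x\<bar> powr p" for m
   using cb(2) p by (intro AE_I2) (simp add: powr_mono2)
  show "(\<lambda>x. \<bar>f x - c m (f x)\<bar> powr p) \<in> borel_measurable (Mn n)" for m using fm cm[of m] by measurable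
 qed (use fp in auto)
 moreover define e' where "e' = e / (2 * 2 powr p)"
 have e': "e' > 0" unfolding e'_def using e by simp
 ultimately have "\<forall>\<^sub>F m in sequentially. (\<integral>x. \<bar>f x - c m (f x)\<bar> powr p \<partial>Mn n) < e'"
  by (intro order_tendstoD) auto
 then obtain m where m: "(\<integral>x. \<bar>f x - c m (f x)\<bar> powr p \<partial>Mn n) < e'" unfolding eventually_sequentially by blast
 have ci: "integrable (Mn n) (\<lambda>x. c m (f x))"
  by (rule Bochner_Integration.integrable_bound[OF f cm]) (use cb(3) in \<open>auto intro: AE_I2\<close>)
 have cpi: "integrable (Mn n) (\<lambda>x. \<bar>c m (f x)\<bar> powr p)"
  by (rule Bochner_Integration.integrable_bound[OF fp]) (use cb(3) p cm[of m] in \<open>auto intro!: AE_I2 powr_mono2\<close>)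
 \<comment> \<open>Two values clipped at \<open>m\<close> differ by at most
   \<open>2 * real m\<close>. The added 1 keeps \<open>K\<close> positive.\<close>
 define K where "K = (2 * real m) powr (p - 1) + 1"
 have K: "K > 0" unfolding K_def by (simp add: add_nonneg_pos)
 obtain g where g: "CBn n g" "(\<integral>x. \<bar>c m (f x) - g x\<bar> \<partial>Mn n) < e' / K"
  using CBn_dense_L1[OF ci, of "e' / K"] e' K by auto
 \<comment> \<open>Clipping \<open>g\<close> as well bounds its distance to the clipped
   \<open>f\<close>, and clipping does not increase distances.\<close>
 define h where "h x = c m (g x)" for x
 have h: "CBn n h"
 proof -
  obtain r where r: "r > 0" "!!x. x \<in> En n ==> x \<notin> nbox n (\<lambda>_. 0) r ==> g x = 0" and gc: "continuous_on UNIV g"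
   using g(1) unfolding CBn_def by blast
  have "continuous_on UNIV h" unfolding h_def c_def using gc by (intro continuous_intros)
  moreover have "h x = 0" if "x \<in> En n" "x \<notin> nbox n (\<lambda>_. 0) r" for x using r(2)[OF that] unfolding h_def c_def by simp
  ultimately show ?thesis unfolding CBn_def using r(1) cb(1) unfolding h_def by blast
 qed
 have hm: "h \<in> borel_measurable (Mn n)" using CBn_integrable[OF h] by auto
 have hp: "integrable (Mn n) (\<lambda>x. \<bar>h x\<bar> powr p)" by (rule CBn_powr_integrable[OF h p])
 have cch: "c m (c m t) = c m t" for t unfolding c_def by (auto simp: max_def min_def)
 have i1: "integrable (Mn n) (\<lambda>x. \<bar>f x - c m (f x)\<bar> powr p)" by (rule integrable_powr_diff[OF p fm fp cm cpi])
 have i2: "integrable (Mn n) (\<lambda>x. \<bar>c m (f x) - h x\<bar> powr p)" by (rule integrable_powr_diff[OF p cm cpi hm hp])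
 have "(\<integral>x. \<bar>c m (f x) - h x\<bar> powr p \<partial>Mn n) \<le> (\<integral>x. K * \<bar>c m (f x) - g x\<bar> \<partial>Mn n)"
 proof (rule integral_mono[OF i2])
  show "integrable (Mn n) (\<lambda>x. K * \<bar>c m (f x) - g x\<bar>)"
   using ci CBn_integrable[OF g(1)] by (intro integrable_mult_right integrable_abs Bochner_Integration.integrable_diff)
  fix x
  let ?d = "\<bar>c m (f x) - h x\<bar>"
  have d1: "?d \<le> \<bar>c m (f x) - g x\<bar>" using cb(4)[of m "c m (f x)" "g x"] unfolding h_def cch .
  have d2: "?d \<le> 2 * real m" using cb(1)[of m "f x"] cb(1)[of m "g x"] unfolding h_def by linarith
  have "?d powr p = ?d powr (p - 1) * ?d" using p by (cases "?d = 0") (auto simp: powr_diff)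
  also have "\<dots> \<le> K * \<bar>c m (f x) - g x\<bar>"
  proof (rule mult_mono[OF _ d1])
   have "?d powr (p - 1) \<le> (2 * real m) powr (p - 1)" using d2 p by (intro powr_mono2) auto
   thus "?d powr (p - 1) \<le> K" unfolding K_def by simp
  qed (use K in auto)
  finally show "?d powr p \<le> K * \<bar>c m (f x) - g x\<bar>" .
 qed
 also have "\<dots> < e'" using g(2) K by (simp add: field_simps)
 finally have m2: "(\<integral>x. \<bar>c m (f x) - h x\<bar> powr p \<partial>Mn n) < e'" .
 have "(\<integral>x. \<bar>f x - h x\<bar> powr p \<partial>Mn n) \<le> (\<integral>x. 2 powr p * (\<bar>f x - c m (f x)\<bar> powr p + \<bar>c m (f x) - h x\<bar> powr p) \<partial>Mn n)"
 proof (rule integral_mono[OF integrable_powr_diff[OF p fm fp hm hp]])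
  show "\<bar>f x - h x\<bar> powr p \<le> 2 powr p * (\<bar>f x - c m (f x)\<bar> powr p + \<bar>c m (f x) - h x\<bar> powr p)" for x
   using powr_add_bound[OF p, of "f x - c m (f x)" "c m (f x) - h x"] by simp
 qed (use i1 i2 in auto)
 also have "\<dots> = 2 powr p * ((\<integral>x. \<bar>f x - c m (f x)\<bar> powr p \<partial>Mn n) + (\<integral>x. \<bar>c m (f x) - h x\<bar> powr p \<partial>Mn n))"
  using i1 i2 by simp
 also have "\<dots> < 2 powr p * (e' + e')" using m m2 by (intro mult_strict_left_mono) auto
 also have "\<dots> = e" unfolding e'_def by simp
 finally show ?thesis using that h by blast
qed

lemma moll_measurable: "integrable (Mn n) f ==> moll n k f \<in> borel_measurable (Mn n)"
 unfolding moll_mollg by (intro continuous_UNIV_measurable_Mn mollg_continuous mollk_test1)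

lemma moll_powr_integrable:
 assumes p: "p \<ge> 1" and f: "integrable (Mn n) f" and fp: "integrable (Mn n) (\<lambda>x. \<bar>f x\<bar> powr p)"
 shows "integrable (Mn n) (\<lambda>x. \<bar>moll n k f x\<bar> powr p)"
  "(\<integral>x. \<bar>moll n k f x\<bar> powr p \<partial>Mn n) \<le> (\<integral>x. \<bar>f x\<bar> powr p \<partial>Mn n)"
proof -
 have b: "(\<integral>\<^sup>+x. ennreal (\<bar>moll n k f x\<bar> powr p) \<partial>Mn n) \<le> ennreal (\<integral>x. \<bar>f x\<bar> powr p \<partial>Mn n)"
  using moll_Lp_bound[OF p f fp] nn_integral_eq_integral[OF fp] by simp
 show i: "integrable (Mn n) (\<lambda>x. \<bar>moll n k f x\<bar> powr p)"
  using moll_measurable[OF f] b by (intro integrableI_bounded) (auto intro: le_less_trans)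
 show "(\<integral>x. \<bar>moll n k f x\<bar> powr p \<partial>Mn n) \<le> (\<integral>x. \<bar>f x\<bar> powr p \<partial>Mn n)"
  using b unfolding nn_integral_eq_integral[OF i AE_I2[OF powr_ge_zero]] by (subst (asm) ennreal_le_iff) auto
qed

lemma moll_CBn_uniform:
 assumes g: "CBn n g" and e: "e > 0"
 shows "\<exists>R k0. R > 0 \<and> (\<forall>k\<ge>k0. (\<forall>x\<in>En n. \<bar>moll n k g x - g x\<bar> \<le> e) \<and> (\<forall>x\<in>En n. x \<notin> nbox n (\<lambda>_. 0) R --> moll n k g x - g x = 0))"
proof -
 obtain r where r: "r > 0" "!!x. x \<in> En n ==> x \<notin> nbox n (\<lambda>_. 0) r ==> g x = 0" and gc: "continuous_on UNIV g"
  using g unfolding CBn_def by blast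
 have out: "y \<notin> nbox n (\<lambda>_. 0) r" if "x \<notin> nbox n (\<lambda>_. 0) (r + 1)" "x \<in> En n" "y \<in> nbox n x 1" for x y
 proof
  assume y: "y \<in> nbox n (\<lambda>_. 0) r"
  have "\<bar>x i - 0\<bar> < r + 1" if "i < n" for i
  proof -
   have "\<bar>y i - x i\<bar> < 1" "\<bar>y i\<bar> < r" using \<open>y \<in> nbox n x 1\<close> y that by (auto simp: nbox_def)
   thus ?thesis by linarith
  qed
  thus False using that by (auto simp: nbox_def)
 qed
 have op: "openin (Rn n) (En n)" using openin_topspace[of "Rn n"] unfolding topspace_Rn .
 have sub: "ncbox n (\<lambda>_. 0) (r + 1) \<subseteq> En n" by (auto simp: ncbox_def)
 obtain d where d: "d > 0" "!!x y. x \<in> ncbox n (\<lambda>_. 0) (r + 1) ==> y \<in> nbox n x d ==> y \<in> En n \<and> \<bar>g y - g x\<bar> < e"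
  using uniformly_continuous_nbox[OF compactin_ncbox op sub continuous_on_subset[OF gc] e] by blast
 obtain k0 :: nat where k0: "1 / real (Suc k0) < d" using d(1) nat_approx_posE by blast
 have gi: "integrable (Mn n) g" by (rule CBn_integrable[OF g])
 have "(\<forall>x\<in>En n. \<bar>moll n k g x - g x\<bar> \<le> e) \<and> (\<forall>x\<in>En n. x \<notin> nbox n (\<lambda>_. 0) (r + 1) --> moll n k g x - g x = 0)"
  if k: "k \<ge> k0" for k
 proof (intro conjI ballI impI)
  have "1 / real (Suc k) \<le> 1 / real (Suc k0)" using k by (intro divide_left_mono) auto
  hence kd: "1 / real (Suc k) \<le> d" using k0 by linarith
  have k1: "1 / real (Suc k) \<le> 1" by simp
  show z: "moll n k g x - g x = 0" if x: "x \<in> En n" "x \<notin> nbox n (\<lambda>_. 0) (r + 1)" for x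
  proof -
   have "g x = 0" using r(2)[OF x(1)] x(2) nbox_mono[of r "r + 1" n "\<lambda>_. 0"] by auto
   moreover have "\<bar>moll n k g x - 0\<bar> \<le> 0"
   proof (rule moll_close[OF gi])
    fix y assume "y \<in> nbox n x (1 / real (Suc k))"
    hence y: "y \<in> nbox n x 1" using nbox_mono[OF k1] by blast
    have "g y = 0" using r(2)[of y] out[OF x(2,1) y] y by (auto simp: nbox_def)
    thus "\<bar>g y - 0\<bar> \<le> 0" by simp
   qed
   ultimately show ?thesis by simp
  qed
  fix x assume x: "x \<in> En n"
  show "\<bar>moll n k g x - g x\<bar> \<le> e"
  proof (cases "x \<in> nbox n (\<lambda>_. 0) (r + 1)")
   case True
   hence xc: "x \<in> ncbox n (\<lambda>_. 0) (r + 1)" using nbox_subset_ncbox by blast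
   show ?thesis
    by (rule moll_close[OF gi]) (use d(2)[OF xc] nbox_mono[OF kd, of n x] in \<open>auto intro: less_imp_le\<close>)
  next
   case False
   thus ?thesis using z[OF x] e by simp
  qed
 qed
 thus ?thesis using r(1) by (intro exI[of _ "r + 1"] exI[of _ k0]) auto
qed

theorem moll_Lp_tendsto:
 assumes p: "p \<ge> 1" and f: "integrable (Mn n) f" and fp: "integrable (Mn n) (\<lambda>x. \<bar>f x\<bar> powr p)"
 shows "(\<lambda>k. \<integral>x. \<bar>moll n k f x - f x\<bar> powr p \<partial>Mn n) \<longlonglongrightarrow> 0"
proof (rule LIMSEQ_I)
 fix e :: real assume e: "e > 0"
 \<comment> \<open>Two applications of \<open>powr_add_bound\<close> split the error into three
   terms at the cost of \<open>2 powr p\<close> each time; three errors of at most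
   \<open>e / (4 * C)\<close> stay below \<open>e\<close>.\<close>
 define C where "C = 4 powr p"
 have C: "C > 0" unfolding C_def by simp
 have fm: "f \<in> borel_measurable (Mn n)" using f by auto
 define e1 where "e1 = e / (4 * C)"
 have e1: "e1 > 0" unfolding e1_def using e C by simp
 obtain g where g: "CBn n g" "(\<integral>x. \<bar>f x - g x\<bar> powr p \<partial>Mn n) < e1" using CBn_dense_Lp[OF p f fp e1] by blast
 have gi: "integrable (Mn n) g" and gp: "integrable (Mn n) (\<lambda>x. \<bar>g x\<bar> powr p)"
  using CBn_integrable[OF g(1)] CBn_powr_integrable[OF g(1) p] by auto
 have gm: "g \<in> borel_measurable (Mn n)" using gi by auto
 obtain R k0 where R: "R > 0" "!!k x. k \<ge> k0 ==> x \<in> En n ==> \<bar>moll n k g x - g x\<bar> \<le> 1"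
  "!!k x. k \<ge> k0 ==> x \<in> En n ==> x \<notin> nbox n (\<lambda>_. 0) R ==> moll n k g x - g x = 0"
  using moll_CBn_uniform[OF g(1) zero_less_one] by blast
 define \<mu> where "\<mu> = measure (Mn n) (nbox n (\<lambda>_. 0) R)"
 have bs: "nbox n (\<lambda>_. 0) R \<in> sets (Mn n)" by (rule sets_openin[OF openin_nbox])
 \<comment> \<open>A uniform error of \<open>e2\<close> on a cube of measure \<open>\<mu>\<close>
   contributes at most \<open>e1\<close>. The 1 avoids division by zero.\<close>
 define e2 where "e2 = (e1 / (\<mu> + 1)) powr (1 / p)"
 have \<mu>: "\<mu> \<ge> 0" unfolding \<mu>_def by simp
 have e2: "e2 > 0" "e2 powr p = e1 / (\<mu> + 1)" unfolding e2_def using e1 \<mu> p by (auto simp: powr_powr)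
 obtain R' k1 where R': "!!k x. k \<ge> k1 ==> x \<in> En n ==> \<bar>moll n k g x - g x\<bar> \<le> e2"
  using moll_CBn_uniform[OF g(1) e2(1)] by blast
 have "norm ((\<integral>x. \<bar>moll n k f x - f x\<bar> powr p \<partial>Mn n) - 0) < e" if k: "k \<ge> max k0 k1" for k
 proof -
  have fgi: "integrable (Mn n) (\<lambda>x. f x - g x)" using f gi by auto
  have fgp: "integrable (Mn n) (\<lambda>x. \<bar>f x - g x\<bar> powr p)" by (rule integrable_powr_diff[OF p fm fp gm gp])
  define D where "D = moll n k (\<lambda>x. f x - g x)"
  have D: "D x = moll n k f x - moll n k g x" for x unfolding D_def by (rule moll_diff[OF f gi])
  have Dp: "integrable (Mn n) (\<lambda>x. \<bar>D x\<bar> powr p)" "(\<integral>x. \<bar>D x\<bar> powr p \<partial>Mn n) \<le> (\<integral>x. \<bar>f x - g x\<bar> powr p \<partial>Mn n)"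
   unfolding D_def using moll_powr_integrable[OF p fgi fgp] by auto
  have Dm: "D \<in> borel_measurable (Mn n)" unfolding D_def by (rule moll_measurable[OF fgi])
  have mgm: "moll n k g \<in> borel_measurable (Mn n)" by (rule moll_measurable[OF gi])
  have mp: "\<bar>moll n k g x - g x\<bar> powr p \<le> indicator (nbox n (\<lambda>_. 0) R) x * (e1 / (\<mu> + 1))" if x: "x \<in> En n" for x
  proof (cases "x \<in> nbox n (\<lambda>_. 0) R")
   case True
   have "\<bar>moll n k g x - g x\<bar> powr p \<le> e2 powr p" using R'[of k x] k x p by (intro powr_mono2) auto
   thus ?thesis using True e2 by simp
  next
   case False
   thus ?thesis using R(3)[of k x] k x by simp
  qed
  have ii: "integrable (Mn n) (\<lambda>x. indicator (nbox n (\<lambda>_. 0) R) x * (e1 / (\<mu> + 1)))"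
   using bs emeasure_nbox_finite by (intro integrable_mult_left integrable_real_indicator) auto
  have mi: "integrable (Mn n) (\<lambda>x. \<bar>moll n k g x - g x\<bar> powr p)"
  proof (rule Bochner_Integration.integrable_bound[OF ii])
   show "(\<lambda>x. \<bar>moll n k g x - g x\<bar> powr p) \<in> borel_measurable (Mn n)"
    by (intro abs_powr_measurable borel_measurable_diff mgm gm)
   show "AE x in Mn n. norm (\<bar>moll n k g x - g x\<bar> powr p) \<le> norm (indicator (nbox n (\<lambda>_. 0) R) x * (e1 / (\<mu> + 1)))"
    using order_trans[OF mp abs_ge_self] by (intro AE_I2) (simp add: space_Mn)
  qed
  have "(\<integral>x. \<bar>moll n k g x - g x\<bar> powr p \<partial>Mn n) \<le> (\<integral>x. indicator (nbox n (\<lambda>_. 0) R) x * (e1 / (\<mu> + 1)) \<partial>Mn n)"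
   by (rule integral_mono[OF mi ii]) (use mp in \<open>simp add: space_Mn\<close>)
  also have "\<dots> = \<mu> * (e1 / (\<mu> + 1))" using bs by (simp add: \<mu>_def)
  also have "\<dots> \<le> e1" using \<mu> e1 by (simp add: field_simps)
  finally have mle: "(\<integral>x. \<bar>moll n k g x - g x\<bar> powr p \<partial>Mn n) \<le> e1" .
  have pt: "\<bar>moll n k f x - f x\<bar> powr p \<le> C * (\<bar>D x\<bar> powr p + \<bar>moll n k g x - g x\<bar> powr p + \<bar>f x - g x\<bar> powr p)" for x
  proof -
   have "\<bar>moll n k f x - f x\<bar> powr p \<le> 2 powr p * (\<bar>D x + (moll n k g x - g x)\<bar> powr p + \<bar>g x - f x\<bar> powr p)"
    using powr_add_bound[OF p, of "D x + (moll n k g x - g x)" "g x - f x"] unfolding D by simp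
   also have "\<dots> \<le> 2 powr p * (2 powr p * (\<bar>D x\<bar> powr p + \<bar>moll n k g x - g x\<bar> powr p) + 2 powr p * \<bar>f x - g x\<bar> powr p)"
   proof (intro mult_left_mono add_mono powr_add_bound p)
    have "1 * \<bar>f x - g x\<bar> powr p \<le> 2 powr p * \<bar>f x - g x\<bar> powr p" using p by (intro mult_right_mono) (auto simp: ge_one_powr_ge_zero)
    thus "\<bar>g x - f x\<bar> powr p \<le> 2 powr p * \<bar>f x - g x\<bar> powr p" by (simp add: abs_minus_commute)
   qed auto
   also have "\<dots> = (2 powr p * 2 powr p) * (\<bar>D x\<bar> powr p + \<bar>moll n k g x - g x\<bar> powr p + \<bar>f x - g x\<bar> powr p)" by (simp add: algebra_simps)
   also have "2 powr p * 2 powr p = C" unfolding C_def by (simp flip: powr_mult)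
   finally show ?thesis .
  qed
  have mfp: "integrable (Mn n) (\<lambda>x. \<bar>moll n k f x - f x\<bar> powr p)"
   by (rule integrable_powr_diff[OF p moll_measurable[OF f] moll_powr_integrable(1)[OF p f fp] fm fp])
  have "(\<integral>x. \<bar>moll n k f x - f x\<bar> powr p \<partial>Mn n) \<le> (\<integral>x. C * (\<bar>D x\<bar> powr p + \<bar>moll n k g x - g x\<bar> powr p + \<bar>f x - g x\<bar> powr p) \<partial>Mn n)"
   by (rule integral_mono[OF mfp _ pt]) (use Dp mi fgp in auto)
  also have "\<dots> = C * ((\<integral>x. \<bar>D x\<bar> powr p \<partial>Mn n) + (\<integral>x. \<bar>moll n k g x - g x\<bar> powr p \<partial>Mn n) + (\<integral>x. \<bar>f x - g x\<bar> powr p \<partial>Mn n))"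
   using Dp mi fgp by simp
  also have "\<dots> \<le> C * (e1 + e1 + e1)" using Dp(2) g(2) mle C by (intro mult_left_mono add_mono) auto
  also have "\<dots> < e" unfolding e1_def using C e by (simp add: field_simps)
  finally show ?thesis by (simp add: integral_nonneg_AE)
 qed
 thus "\<exists>no. \<forall>k\<ge>no. norm ((\<integral>x. \<bar>moll n k f x - f x\<bar> powr p \<partial>Mn n) - 0) < e" by blast
qed

section \<open>Weak gradients\<close>

lemma space_leb: "space (leb n) = En n"
 by (simp add: leb_def space_completion space_Mn)

lemma leb_sets: "A \<in> sets (Mn n) ==> A \<in> sets (leb n)"
 by (simp add: leb_def)

lemma leb_openin: "openin (Rn n) U ==> U \<in> sets (leb n)"
 by (rule leb_sets[OF sets_openin])

lemma leb_compactin: "compactin (Rn n) K ==> K \<in> sets (leb n)"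
 by (rule leb_sets[OF sets_compactin])

lemma leb_measurable: "f \<in> borel_measurable (Mn n) ==> f \<in> borel_measurable (leb n)"
 unfolding leb_def by (rule measurable_completion)

lemma leb_borel_version:
 assumes "(f :: vec => real) \<in> borel_measurable (leb n)"
 obtains f' where "f' \<in> borel_measurable (Mn n)" "AE x in leb n. f x = f' x"
 using completion_ex_borel_measurable_real[of f "Mn n"] assms AE_completion unfolding leb_def by blast

lemma leb_integral: "(f :: vec => real) \<in> borel_measurable (Mn n) ==> integral\<^sup>L (leb n) f = integral\<^sup>L (Mn n) f"
 unfolding leb_def by (rule integral_completion)

lemma leb_integrable: "(f :: vec => real) \<in> borel_measurable (Mn n) ==> integrable (leb n) f \<longleftrightarrow> integrable (Mn n) f"
 unfolding leb_def by (rule integrable_completion)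

lemma leb_AE_iff: "(AE x in leb n. P x) \<longleftrightarrow> (AE x in Mn n. P x)"
 unfolding leb_def by (rule AE_completion_iff)

lemma leb_emeasure_compact: "compactin (Rn n) K ==> emeasure (leb n) K < \<infinity>"
 using emeasure_compact_finite[of n K] sets_compactin[of n K] by (simp add: leb_def)

text \<open>Completeness of \<open>leb\<close>: measurability passes to every function that is equal
  almost everywhere. Gradients and coefficients are controlled only up to null sets.\<close>

lemma leb_measurable_AE:
 assumes f: "(f :: vec => real) \<in> borel_measurable (leb n)" and ae: "AE x in leb n. f x = g x"
 shows "g \<in> borel_measurable (leb n)"
proof (rule borel_measurableI)
 fix S :: "real set" assume S: "open S"
 have A: "f -` S \<inter> space (leb n) \<in> sets (leb n)" by (rule measurable_sets[OF f borel_open[OF S]])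
 have B: "AE x in leb n. x \<in> f -` S \<inter> space (leb n) \<longleftrightarrow> x \<in> g -` S \<inter> space (leb n)"
  using ae by eventually_elim simp
 note t = completion.in_sets_AE[OF B[unfolded leb_def] A[unfolded leb_def]]
 show "g -` S \<inter> space (leb n) \<in> sets (leb n)" unfolding leb_def by (rule t) (rule Int_lower2)
qed

lemma set_integrable_alt: "set_integrable M K f \<longleftrightarrow> integrable M (\<lambda>x. indicator K x * (f x :: real))"
 by (simp add: set_integrable_def)

lemma set_integral_alt: "(LINT x:K|M. f x) = (\<integral>x. indicator K x * (f x :: real) \<partial>M)"
 by (simp add: set_lebesgue_integral_def)

lemma set_integral_supp:
 assumes "K \<subseteq> U" "!!x. x \<in> U ==> x \<notin> K ==> h x = (0::real)"
 shows "set_integrable M U h \<longleftrightarrow> set_integrable M K h" "(LINT x:U|M. h x) = (LINT x:K|M. h x)"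
proof -
 have "(\<lambda>x. indicator U x * h x) = (\<lambda>x. indicator K x * h x)" using assms by (auto simp: indicator_def fun_eq_iff)
 thus "set_integrable M U h \<longleftrightarrow> set_integrable M K h" "(LINT x:U|M. h x) = (LINT x:K|M. h x)"
  unfolding set_integrable_alt set_integral_alt by simp_all
qed

lemma set_integrable_AE:
 assumes f: "set_integrable (leb n) K f" and ae: "AE x in leb n. x \<in> K --> f x = g x"
 shows "set_integrable (leb n) K (g :: vec => real)" "(LINT x:K|leb n. f x) = (LINT x:K|leb n. g x)"
proof -
 have ae': "AE x in leb n. indicator K x * f x = indicator K x * g x"
  using ae by eventually_elim (auto simp: indicator_def)
 have m: "(\<lambda>x. indicator K x * f x) \<in> borel_measurable (leb n)" using f unfolding set_integrable_alt by auto
 note m' = leb_measurable_AE[OF m ae']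
 show "set_integrable (leb n) K g" using f unfolding set_integrable_alt
  by (rule integrable_cong_AE[THEN iffD1, OF m m' ae'])
 show "(LINT x:K|leb n. f x) = (LINT x:K|leb n. g x)" unfolding set_integral_alt
  by (rule integral_cong_AE[OF m m' ae'])
qed

lemma continuous_ind_measurable:
 "U \<in> sets borel ==> continuous_on U (f :: vec => real) ==> (\<lambda>x. indicator U x * f x) \<in> borel_measurable (leb n)"
 by (rule leb_measurable[OF continuous_measurable_Mn])

lemma compact_bounded_real:
 assumes "compactin (Rn n) K" "continuous_on K (f :: vec => real)"
 obtains B where "B > 0" "!!x. x \<in> K ==> \<bar>f x\<bar> \<le> B"
proof -
 have "compact (f ` K)" using assms by (intro compact_continuous_image) (auto simp: compactin_Rn)
 then obtain B where "\<forall>y\<in>f ` K. norm y \<le> B" using compact_imp_bounded bounded_iff by blast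
 hence "\<bar>f x\<bar> \<le> max B 1" if "x \<in> K" for x using that by fastforce
 thus ?thesis using that[of "max B 1"] by auto
qed

lemma set_integrable_times_bounded:
 assumes f: "set_integrable (leb n) K f" and K: "K \<in> sets (leb n)"
  and g: "(\<lambda>x. indicator K x * g x) \<in> borel_measurable (leb n)" "AE x in leb n. x \<in> K --> \<bar>g x\<bar> \<le> (B::real)"
 shows "set_integrable (leb n) K (\<lambda>x. f x * g x)"
 unfolding set_integrable_alt
proof (rule Bochner_Integration.integrable_bound[where f="\<lambda>x. B * (indicator K x * f x)"])
 show "integrable (leb n) (\<lambda>x. B * (indicator K x * f x))" using f unfolding set_integrable_alt by simp
 have "(\<lambda>x. (indicator K x * f x) * (indicator K x * g x)) \<in> borel_measurable (leb n)"
  by (rule borel_measurable_times[OF borel_measurable_integrable[OF f[unfolded set_integrable_alt]] g(1)])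
 moreover have "(\<lambda>x. (indicator K x * f x) * (indicator K x * g x)) = (\<lambda>x. indicator K x * (f x * g x))"
  by (auto simp: indicator_def fun_eq_iff)
 ultimately show "(\<lambda>x. indicator K x * (f x * g x)) \<in> borel_measurable (leb n)" by simp
 show "AE x in leb n. norm (indicator K x * (f x * g x)) \<le> norm (B * (indicator K x * f x))"
  using g(2)
 proof eventually_elim
  case (elim x)
  show ?case
  proof (cases "x \<in> K")
   case True
   hence "\<bar>g x\<bar> \<le> \<bar>B\<bar>" using elim by simp
   hence "\<bar>f x\<bar> * \<bar>g x\<bar> \<le> \<bar>f x\<bar> * \<bar>B\<bar>" by (intro mult_left_mono) auto
   thus ?thesis using True by (simp add: abs_mult mult.commute)
  qed simp
 qed
qed

lemma set_integrable_times_continuous: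
 assumes f: "set_integrable (leb n) K f" and K: "compactin (Rn n) K" and g: "continuous_on K g"
 shows "set_integrable (leb n) K (\<lambda>x. f x * (g x :: real))"
proof -
 obtain B where "!!x. x \<in> K ==> \<bar>g x\<bar> \<le> B" using compact_bounded_real[OF K g] by blast
 thus ?thesis
  by (intro set_integrable_times_bounded[OF f leb_compactin[OF K] continuous_ind_measurable[OF borel_compact_Rn[OF K] g], of B]) auto
qed

lemma set_integrable_const_compact: "compactin (Rn n) K ==> set_integrable (leb n) K (\<lambda>_. c::real)"
 unfolding set_integrable_alt using leb_compactin leb_emeasure_compact
 by (intro integrable_mult_left integrable_real_indicator) auto

lemma set_integrable_continuous:
 assumes K: "compactin (Rn n) K" and g: "continuous_on K g"
 shows "set_integrable (leb n) K (g :: vec => real)"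
 using set_integrable_times_continuous[OF set_integrable_const_compact[OF K] K g, of 1] by simp

lemma L1_loc_continuous: "U \<subseteq> En n ==> continuous_on U f ==> f \<in> L1_loc n U"
 unfolding L1_loc_def by (auto intro: set_integrable_continuous continuous_on_subset)

lemma L1_locD: "f \<in> L1_loc n U ==> compactin (Rn n) K ==> K \<subseteq> U ==> set_integrable (leb n) K f"
 unfolding L1_loc_def by blast

lemma L1_loc_times_supp:
 assumes f: "f \<in> L1_loc n U" and K: "compactin (Rn n) K" "K \<subseteq> U" and c: "continuous_on U q"
  and z: "!!x. x \<in> U ==> x \<notin> K ==> q x = 0"
 shows "set_integrable (leb n) U (\<lambda>x. f x * q x)"
proof -
 have "set_integrable (leb n) K (\<lambda>x. f x * q x)"
  by (rule set_integrable_times_continuous[OF L1_locD[OF f K] K(1) continuous_on_subset[OF c K(2)]])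
 thus ?thesis using set_integral_supp(1)[OF K(2), of "\<lambda>x. f x * q x"] z by simp
qed

section \<open>Integration by parts and weak gradients of C1 functions\<close>

definition ext0 :: "vec set => (vec => real) => vec => real" where
 "ext0 U f x = (if x \<in> U then f x else 0)"

lemma openin_En: "openin (Rn n) (En n)"
 using openin_topspace[of "Rn n"] unfolding topspace_Rn .

lemma openin_compl: "compactin (Rn n) K ==> openin (Rn n) (En n - K)"
 using compact_imp_closed[of K] unfolding openin_Rn compactin_Rn by (intro exI[of _ "- K"]) auto

lemma ext0_continuous:
 assumes U: "openin (Rn n) U" and K: "compactin (Rn n) K" "K \<subseteq> U" and f: "continuous_on U f"
  and z: "!!x. x \<in> U ==> x \<notin> K ==> f x = 0"
 shows "continuous_on (En n) (ext0 U f)"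
proof -
 have "continuous_on U (ext0 U f)" using f by (rule continuous_on_eq) (simp add: ext0_def)
 moreover have "continuous_on (En n - K) (ext0 U f)"
  by (rule continuous_on_eq[OF continuous_on_const[of _ 0]]) (use z in \<open>auto simp: ext0_def\<close>)
 moreover have "openin (top_of_set (En n)) U" "openin (top_of_set (En n)) (En n - K)"
  using U openin_compl[OF K(1)] unfolding Rn_eq by auto
 moreover have "En n = U \<union> (En n - K)" using K openin_Rn_subset[OF U] by auto
 ultimately show ?thesis using continuous_on_Un_local_open[of U "En n - K" "ext0 U f"] by simp
qed

lemma ext0_deriv:
 assumes U: "openin (Rn n) U" and K: "compactin (Rn n) K" "K \<subseteq> U" and i: "i < n"
  and z: "!!x. x \<in> U ==> x \<notin> K ==> f x = 0"
  and d: "!!x. x \<in> U ==> ((\<lambda>t. f (x(i := t))) has_real_derivative f' x) (at (x i))"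
  and x: "x \<in> En n"
 shows "((\<lambda>t. ext0 U f (x(i := t))) has_real_derivative ext0 U f' x) (at (x i))"
proof (cases "x \<in> U")
 case True
 thus ?thesis using deriv_transform_line[OF U True i d[OF True], of "ext0 U f"] by (simp add: ext0_def)
next
 case False
 hence xK: "x \<in> En n - K" using K x by auto
 have "((\<lambda>t. ext0 U f (x(i := t))) has_real_derivative 0) (at (x i))"
  by (rule deriv_transform_line[OF openin_compl[OF K(1)] xK i, of "\<lambda>_. 0"]) (use z in \<open>auto simp: ext0_def\<close>)
 thus ?thesis using False by (simp add: ext0_def)
qed

lemma deriv_vanishes:
 assumes U: "openin (Rn n) U" and K: "compactin (Rn n) K" and i: "i < n"
  and z: "!!x. x \<in> U ==> x \<notin> K ==> f x = 0"
  and x: "x \<in> U" "x \<notin> K" and d: "((\<lambda>t. f (x(i := t))) has_real_derivative d) (at (x i))"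
 shows "d = 0"
proof -
 have op: "openin (Rn n) (U \<inter> (En n - K))" using U openin_compl[OF K] by (rule openin_Int)
 have "x \<in> U \<inter> (En n - K)" using x openin_Rn_subset[OF U] by auto
 from deriv_transform_line[OF op this i d, of "\<lambda>_. 0"] z
 have "((\<lambda>t. 0) has_real_derivative d) (at (x i))" by auto
 thus ?thesis using DERIV_unique[OF _ DERIV_const] by blast
qed

text \<open>Fubini's theorem with the coordinate \<open>i\<close> innermost, and the fundamental
  theorem of calculus on \<open>{-R .. R}\<close>, where \<open>H\<close> vanishes at both
  ends.\<close>

lemma integral_partial_zero_En:
 fixes H H' :: "vec => real"
 assumes i: "i < n" and c: "continuous_on (En n) H'"
  and d: "!!x. x \<in> En n ==> ((\<lambda>t. H (x(i := t))) has_real_derivative H' x) (at (x i))"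
  and z: "!!x. x \<in> En n ==> x \<notin> nbox n (\<lambda>_. 0) R ==> H x = 0 \<and> H' x = 0" and R: "R > 0"
 shows "integrable (Mn n) H'" "(\<integral>x. H' x \<partial>Mn n) = 0"
proof -
 have cm: "(\<lambda>x. indicator (En n) x * H' x) \<in> borel_measurable (Mn n)"
  by (rule continuous_measurable_Mn[OF borel_open_Rn[OF openin_En] c])
 hence m: "H' \<in> borel_measurable (Mn n)" by (rule measurable_cong[THEN iffD1, rotated]) (simp add: space_Mn)
 have cc: "continuous_on (ncbox n (\<lambda>_. 0) R) H'" by (rule continuous_on_subset[OF c]) (auto simp: ncbox_def)
 obtain B where B: "B > 0" "!!x. x \<in> ncbox n (\<lambda>_. 0) R ==> \<bar>H' x\<bar> \<le> B"
  using compact_bounded_real[OF compactin_ncbox cc] by blast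
 show int: "integrable (Mn n) H'"
 proof (rule integrable_bounded_box[OF m])
  fix x assume x: "x \<in> En n"
  show "\<bar>H' x\<bar> \<le> B" using z[OF x] B(1) B(2)[of x] nbox_subset_ncbox[of n "\<lambda>_. 0" R] by (cases "x \<in> nbox n (\<lambda>_. 0) R") auto
  show "H' x = 0" if "x \<notin> nbox n (\<lambda>_. 0) R" using z[OF x that] by simp
 qed
 let ?I = "{..<n} - {i}"
 have I: "insert i ?I = {..<n}" using i by auto
 have "(\<integral>x. H' x \<partial>Mn n) = (\<integral>x. (\<integral>t. H' (x(i := t)) \<partial>lborel) \<partial>Pi\<^sub>M ?I (\<lambda>_. lborel))"
  using PL.product_integral_insert[of ?I i H'] int unfolding I by simp
 also have "\<dots> = (\<integral>x. 0 \<partial>Pi\<^sub>M ?I (\<lambda>_. lborel :: real measure))"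
 proof (rule Bochner_Integration.integral_cong[OF refl])
  fix x assume "x \<in> space (Pi\<^sub>M ?I (\<lambda>_. lborel :: real measure))"
  hence xI: "x \<in> ?I \<rightarrow>\<^sub>E UNIV" by (simp add: space_PiM)
  have xt: "x(i := t) \<in> En n" for t using xI i by (auto simp: in_En PiE_iff extensional_def)
  have D: "((\<lambda>t. H (x(i := t))) has_real_derivative H' (x(i := t))) (at t)" for t
   using d[OF xt[of t]] by simp
  have zt: "H (x(i := t)) = 0 \<and> H' (x(i := t)) = 0" if "\<bar>t\<bar> \<ge> R" for t
  proof -
   have "x(i := t) \<notin> nbox n (\<lambda>_. 0) R"
   proof
    assume "x(i := t) \<in> nbox n (\<lambda>_. 0) R"
    hence "\<bar>(x(i := t)) i - 0\<bar> < R" using i unfolding nbox_def by blast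
    thus False using that by simp
   qed
   thus ?thesis by (rule z[OF xt])
  qed
  have "continuous_on UNIV (\<lambda>t. x(i := t))"
  proof (rule continuous_on_coordinatewise_then_product)
   fix j show "continuous_on UNIV (\<lambda>t. (x(i := t)) j)" by (cases "j = i") auto
  qed
  hence "continuous_on UNIV (\<lambda>t. H' (x(i := t)))"
   by (rule continuous_on_compose2[OF c]) (use xt in auto)
  hence ic: "isCont (\<lambda>t. H' (x(i := t))) t" for t by (simp add: continuous_on_eq_continuous_at)
  have "(\<integral>t. H' (x(i := t)) * indicator {-R .. R} t \<partial>lborel) = H (x(i := R)) - H (x(i := -R))"
   by (rule integral_FTC_Icc_real[OF _ D ic]) (use R in simp)
  moreover have "(\<lambda>t. H' (x(i := t)) * indicator {-R .. R} t) = (\<lambda>t. H' (x(i := t)))"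
  proof
   fix t show "H' (x(i := t)) * indicator {-R .. R} t = H' (x(i := t))"
   proof (cases "t \<in> {-R .. R}")
    case False
    hence "\<bar>t\<bar> \<ge> R" by auto
    thus ?thesis using zt by simp
   qed simp
  qed
  ultimately show "(\<integral>t. H' (x(i := t)) \<partial>lborel) = 0" using zt[of R] zt[of "-R"] R by simp
 qed
 finally show "(\<integral>x. H' x \<partial>Mn n) = 0" by simp
qed

lemma integral_partial_zero:
 assumes U: "openin (Rn n) U" and K: "compactin (Rn n) K" "K \<subseteq> U" and i: "i < n"
  and z: "!!x. x \<in> U ==> x \<notin> K ==> h x = 0"
  and d: "!!x. x \<in> U ==> ((\<lambda>t. h (x(i := t))) has_real_derivative h' x) (at (x i))"
  and c: "continuous_on U h'"
 shows "(LINT x:U|leb n. h' x) = 0"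
proof -
 have z': "h' x = 0" if "x \<in> U" "x \<notin> K" for x
  by (rule deriv_vanishes[OF U K(1) i z that d[OF that(1)]])
 obtain R where R: "R > 0" "K \<subseteq> nbox n (\<lambda>_. 0) R" using compactin_subset_ncbox[OF K(1)] by blast
 have c': "continuous_on (En n) (ext0 U h')" by (rule ext0_continuous[OF U K c z'])
 have z0: "ext0 U h x = 0 \<and> ext0 U h' x = 0" if "x \<notin> nbox n (\<lambda>_. 0) R" for x
  using z[of x] z'[of x] that R unfolding ext0_def by auto
 note r = integral_partial_zero_En[OF i c' ext0_deriv[where f=h and f'=h', OF U K i z d] z0 R(1)]
 have "(LINT x:U|leb n. h' x) = (\<integral>x. ext0 U h' x \<partial>leb n)"
  unfolding set_integral_alt by (rule arg_cong[where f="integral\<^sup>L (leb n)"]) (auto simp: ext0_def indicator_def fun_eq_iff)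
 also have "\<dots> = (\<integral>x. ext0 U h' x \<partial>Mn n)" using r(1) by (intro leb_integral) auto
 finally show ?thesis using r(2) by simp
qed

lemma Cc_smooth_supp:
 assumes U: "openin (Rn n) U" and q: "q \<in> Cc_smooth n U"
 obtains K where "compactin (Rn n) K" "K \<subseteq> U" "!!x. x \<in> U ==> x \<notin> K ==> q x = 0"
  "!!x i. x \<in> U ==> x \<notin> K ==> i < n ==> partial i q x = 0"
proof -
 have sub: "U \<subseteq> En n" by (rule openin_Rn_subset[OF U])
 have s: "smooth n U q" "compactly_inside n {x \<in> U. q x \<noteq> 0} U"
  using q unfolding Cc_smooth_def compactly_supported_def by auto
 have "{x \<in> U. q x \<noteq> 0} \<subseteq> En n" using sub by auto
 then obtain K where K: "compactin (Rn n) K" "K \<subseteq> U" "{x \<in> U. q x \<noteq> 0} \<subseteq> K"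
  using s(2) compactly_inside_iff_ex[OF _ sub] by blast
 have z: "q x = 0" if "x \<in> U" "x \<notin> K" for x using K(3) that by blast
 have "partial i q x = 0" if "x \<in> U" "x \<notin> K" "i < n" for x i
  by (rule deriv_vanishes[OF U K(1) that(3) z that(1,2) smooth_deriv[OF s(1) that(1,3)]])
 thus ?thesis using that K z by blast
qed

lemma Cc_smooth_supportI:
 assumes U: "openin (Rn n) U" and "smooth n U q" and K: "compactin (Rn n) K" "K \<subseteq> U"
  and z: "!!x. x \<in> U ==> x \<notin> K ==> q x = 0"
 shows "q \<in> Cc_smooth n U"
proof -
 have sub: "U \<subseteq> En n" by (rule openin_Rn_subset[OF U])
 have "{x \<in> U. q x \<noteq> 0} \<subseteq> K" using z by blast
 moreover have "{x \<in> U. q x \<noteq> 0} \<subseteq> En n" using sub by auto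
 ultimately show ?thesis
  unfolding Cc_smooth_def compactly_supported_def using assms compactly_inside_iff_ex[OF _ sub] by blast
qed

lemma Cc_smooth_continuous:
 assumes U: "openin (Rn n) U" and q: "q \<in> Cc_smooth n U"
 shows "continuous_on U q" "i < n ==> continuous_on U (partial i q)"
 using q smooth_cont[OF _ openin_Rn_subset[OF U]] smooth_partial unfolding Cc_smooth_def by auto

text \<open>The partial derivative of the product of \<open>f\<close> and the test function has
  compact support and integral zero; the product rule splits that integral.\<close>

lemma has_weak_grad_C1:
 assumes U: "openin (Rn n) U" and c: "continuous_on U f" "!!i. i < n ==> continuous_on U (\<lambda>x. G x i)"
  and d: "!!x i. x \<in> U ==> i < n ==> ((\<lambda>t. f (x(i := t))) has_real_derivative G x i) (at (x i))"
 shows "has_weak_grad n U f G"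
 unfolding has_weak_grad_def
proof (intro conjI allI impI ballI)
 have sub: "U \<subseteq> En n" by (rule openin_Rn_subset[OF U])
 show f: "f \<in> L1_loc n U" by (rule L1_loc_continuous[OF sub c(1)])
 fix i assume i: "i < n"
 show G: "(\<lambda>x. G x i) \<in> L1_loc n U" by (rule L1_loc_continuous[OF sub c(2)[OF i]])
 fix q assume q: "q \<in> Cc_smooth n U"
 obtain K where K: "compactin (Rn n) K" "K \<subseteq> U" "!!x. x \<in> U ==> x \<notin> K ==> q x = 0"
  "!!x i. x \<in> U ==> x \<notin> K ==> i < n ==> partial i q x = 0" using Cc_smooth_supp[OF U q] by blast
 note cc = Cc_smooth_continuous[OF U q]
 have sm: "smooth n U q" using q unfolding Cc_smooth_def by auto
 have "(LINT x:U|leb n. f x * partial i q x + G x i * q x) = 0"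
 proof (rule integral_partial_zero[OF U K(1,2) i, of "\<lambda>x. f x * q x"])
  show "f x * q x = 0" if "x \<in> U" "x \<notin> K" for x using K(3) that by simp
  show "continuous_on U (\<lambda>x. f x * partial i q x + G x i * q x)"
   using c cc i by (intro continuous_intros) auto
  fix x assume x: "x \<in> U"
  from DERIV_mult[OF d[OF x i] smooth_deriv[OF sm x i]]
  show "((\<lambda>t. f (x(i := t)) * q (x(i := t))) has_real_derivative f x * partial i q x + G x i * q x) (at (x i))"
   by (simp add: algebra_simps)
 qed
 moreover have "(LINT x:U|leb n. f x * partial i q x + G x i * q x)
   = (LINT x:U|leb n. f x * partial i q x) + (LINT x:U|leb n. G x i * q x)"
  by (intro set_integral_add L1_loc_times_supp[OF f K(1,2)] L1_loc_times_supp[OF G K(1,2)] cc i K)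
 ultimately show "(LINT x:U|leb n. f x * partial i q x) = - (LINT x:U|leb n. G x i * q x)" by simp
qed

lemma has_weak_grad_smooth:
 assumes U: "openin (Rn n) U" and f: "smooth n U f"
 shows "has_weak_grad n U f (\<lambda>x i. partial i f x)"
 by (rule has_weak_grad_C1[OF U])
  (use smooth_cont[OF _ openin_Rn_subset[OF U]] smooth_partial[OF f] f smooth_deriv[OF f] in auto)

section \<open>Mollification of functions with a weak gradient\<close>

lemma set_integrable_version:
 fixes f :: "vec => real"
 assumes f: "set_integrable (leb n) K f"
 obtains f1 where "integrable (Mn n) f1" "AE x in leb n. f1 x = indicator K x * f x"
proof -
 have i: "integrable (leb n) (\<lambda>x. indicator K x * f x)" using f unfolding set_integrable_alt .
 obtain f1 where f1: "f1 \<in> borel_measurable (Mn n)" "AE x in leb n. indicator K x * f x = f1 x"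
  using leb_borel_version[OF borel_measurable_integrable[OF i]] by blast
 have "integrable (leb n) f1"
  by (rule integrable_cong_AE[THEN iffD1, OF borel_measurable_integrable[OF i] leb_measurable[OF f1(1)] f1(2) i])
 hence "integrable (Mn n) f1" using leb_integrable[OF f1(1)] by simp
 moreover have "AE x in leb n. f1 x = indicator K x * f x" using f1(2) by eventually_elim simp
 ultimately show ?thesis by (rule that)
qed

lemma tprod_kern: "tprod n (\<lambda>i t. mollk k (x i - t)) = kern n k x"
 by (simp add: tprod_def kern_def fun_eq_iff)

lemma mollk_reflect_test1: "g \<in> test1 ==> (\<lambda>t. c * g (a - t)) \<in> test1"
 using test1_affine[of g "-1" c a] by simp

lemma kern_Cc_smooth:
 assumes U: "openin (Rn n) U" and K: "compactin (Rn n) K" "K \<subseteq> U" "nbox n x (1 / real (Suc k)) \<subseteq> K"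
 shows "kern n k x \<in> Cc_smooth n U"
proof (rule Cc_smooth_supportI[OF U _ K(1,2)])
 show "smooth n U (kern n k x)"
  unfolding tprod_kern[symmetric] using mollk_reflect_test1[OF mollk_test1, of 1] by (intro tprod_smooth[OF U]) simp
 show "kern n k x y = 0" if "y \<in> U" "y \<notin> K" for y
  using kern_support[of y n x k] that K(3) openin_Rn_subset[OF U] by blast
qed

text \<open>As a function of \<open>y\<close> the kernel is a test function once its cube lies in
  \<open>K\<close>, so the mollification at \<open>x\<close> is the pairing of \<open>g\<close> with
  a test function. The Borel version \<open>g1\<close> is needed because mollification is defined
  with \<open>Mn n\<close>.\<close>

lemma moll_version_eq:
 assumes g: "AE y in leb n. g1 y = indicator K y * g y" and g1: "integrable (Mn n) g1"
  and K: "K \<subseteq> U" "U \<subseteq> En n" "nbox n x (1 / real (Suc k)) \<subseteq> K"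
 shows "moll n k g1 x = (LINT y:U|leb n. g y * kern n k x y)"
proof -
 have m: "(\<lambda>y. g1 y * kern n k x y) \<in> borel_measurable (Mn n)"
  using moll_integrable[OF g1] by auto
 have "moll n k g1 x = (\<integral>y. g1 y * kern n k x y \<partial>leb n)"
  unfolding moll_def by (rule leb_integral[OF m, symmetric])
 also have "\<dots> = (\<integral>y. indicator U y * (g y * kern n k x y) \<partial>leb n)"
 proof -
  have ae: "AE y in leb n. g1 y * kern n k x y = indicator U y * (g y * kern n k x y)"
   using g AE_space
  proof eventually_elim
   case (elim y)
   thus ?case using kern_support[of y n x k] K by (cases "y \<in> K") (auto simp: space_leb indicator_def)
  qed
  show ?thesis by (rule integral_cong_AE[OF leb_measurable[OF m] leb_measurable_AE[OF leb_measurable[OF m] ae] ae])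
 qed
 finally show ?thesis unfolding set_integral_alt .
qed

text \<open>The derivative of the kernel in \<open>x\<close> is minus its derivative in
  \<open>y\<close>; the definition of the weak gradient, tested with the kernel itself, then moves
  the derivative onto \<open>f\<close>. This holds only where the cube around \<open>x\<close> fits
  into \<open>K\<close>.\<close>

lemma partial_moll:
 assumes U: "openin (Rn n) U" and G: "has_weak_grad n U f G" and i: "i < n"
  and K: "compactin (Rn n) K" "K \<subseteq> U" "nbox n x (1 / real (Suc k)) \<subseteq> K"
  and f1: "integrable (Mn n) f1" "AE y in leb n. f1 y = indicator K y * f y"
  and g1: "integrable (Mn n) g1" "AE y in leb n. g1 y = indicator K y * G y i"
 shows "partial i (moll n k f1) x = moll n k g1 x"
proof -
 have sub: "U \<subseteq> En n" by (rule openin_Rn_subset[OF U])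
 obtain h where h: "h \<in> test1" "!!t. (mollk k has_real_derivative h t) (at t)" using test1_deriv[OF mollk_test1] by blast
 have ker: "kern n k x \<in> Cc_smooth n U" by (rule kern_Cc_smooth[OF U K])
 have pk: "partial i (kern n k x) y = - (\<Prod>j<n. ((\<lambda>_. mollk k)(i := h)) j (x j - y j))" for y
 proof -
  have d: "((\<lambda>t. mollk k (x i - t)) has_real_derivative h (x i - y i) * (- 1)) (at (y i))"
   by (rule DERIV_chain2[OF h(2)]) (auto intro!: derivative_eq_intros)
  have "((\<lambda>t. tprod n (\<lambda>j t. mollk k (x j - t)) (y(i := t))) has_real_derivative
    tprod n ((\<lambda>j t. mollk k (x j - t))(i := (\<lambda>t. h (x i - t) * (- 1)))) y) (at (y i))"
   by (rule tprod_deriv[OF i]) (rule d)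
  from DERIV_imp_deriv[OF this]
  have "partial i (kern n k x) y = tprod n ((\<lambda>j t. mollk k (x j - t))(i := (\<lambda>t. h (x i - t) * (- 1)))) y"
   unfolding tprod_kern partial_def .
  also have "\<dots> = - (\<Prod>j<n. ((\<lambda>_. mollk k)(i := h)) j (x j - y j))"
   unfolding tprod_def using i by (subst (1 2) prod.remove[of _ i]) auto
  finally show ?thesis .
 qed
 have "((\<lambda>t. mollg n (\<lambda>_. mollk k) f1 (x(i := t))) has_real_derivative mollg n ((\<lambda>_. mollk k)(i := h)) f1 x) (at (x i))"
  by (rule mollg_deriv[OF f1(1) mollk_test1 i h])
 from DERIV_imp_deriv[OF this]
 have "partial i (moll n k f1) x = mollg n ((\<lambda>_. mollk k)(i := h)) f1 x"
  unfolding partial_def moll_mollg .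
 also have "\<dots> = (\<integral>y. f1 y * (\<Prod>j<n. ((\<lambda>_. mollk k)(i := h)) j (x j - y j)) \<partial>Mn n)" unfolding mollg_def ..
 also have "\<dots> = (\<integral>y. f1 y * (- partial i (kern n k x) y) \<partial>Mn n)" unfolding pk by simp
 also have "\<dots> = - (LINT y:U|leb n. f y * partial i (kern n k x) y)"
 proof -
  have m: "(\<lambda>y. f1 y * (- partial i (kern n k x) y)) \<in> borel_measurable (Mn n)"
  proof -
   have "((\<lambda>_. mollk k)(i := h)) j \<in> test1" for j using mollk_test1 h(1) by simp
   from borel_measurable_integrable[OF mollg_integrable[where g="(\<lambda>_. mollk k)(i := h)", OF f1(1) this]]
   show ?thesis unfolding pk by simp
  qed
  have z: "partial i (kern n k x) y = 0" if "y \<in> U" "y \<notin> K" for y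
  proof (rule deriv_vanishes[OF U K(1) i _ that])
   show "kern n k x y = 0" if "y \<in> U" "y \<notin> K" for y
    using kern_support[of y n x k] that K(3) sub by blast
   show "((\<lambda>t. kern n k x (y(i := t))) has_real_derivative partial i (kern n k x) y) (at (y i))"
    using ker that i unfolding Cc_smooth_def by (intro smooth_deriv[of n U]) auto
  qed
  have z2: "partial i (kern n k x) y = 0" if y: "y \<in> En n" "y \<notin> U" for y
  proof -
   have "y \<in> En n - K" using y K by auto
   from deriv_transform_line[OF openin_compl[OF K(1)] this i, of "\<lambda>_. 0" 0 "kern n k x"]
   have "((\<lambda>t. kern n k x (y(i := t))) has_real_derivative 0) (at (y i))"
    using kern_support[of _ n x k] K(3) by fastforce
   from DERIV_imp_deriv[OF this] show ?thesis unfolding partial_def .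
  qed
  have ae: "AE y in leb n. f1 y * (- partial i (kern n k x) y) = indicator U y * (- (f y * partial i (kern n k x) y))"
   using f1(2) AE_space
  proof eventually_elim
   case (elim y)
   thus ?case using z[of y] z2[of y] K(2) by (cases "y \<in> K"; cases "y \<in> U") (auto simp: space_leb)
  qed
  have "(\<integral>y. f1 y * (- partial i (kern n k x) y) \<partial>Mn n) = (\<integral>y. f1 y * (- partial i (kern n k x) y) \<partial>leb n)"
   by (rule leb_integral[OF m, symmetric])
  also have "\<dots> = (\<integral>y. indicator U y * (- (f y * partial i (kern n k x) y)) \<partial>leb n)"
   by (rule integral_cong_AE[OF leb_measurable[OF m] leb_measurable_AE[OF leb_measurable[OF m] ae] ae])
  also have "\<dots> = - (LINT y:U|leb n. f y * partial i (kern n k x) y)"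
   unfolding set_integral_alt by simp
  finally show ?thesis .
 qed
 also have "\<dots> = (LINT y:U|leb n. G y i * kern n k x y)"
  using G i ker unfolding has_weak_grad_def by simp
 also have "\<dots> = moll n k g1 x" by (rule moll_version_eq[OF g1(2,1) K(2) sub K(3), symmetric])
 finally show ?thesis .
qed

lemma set_integral_le_integral_Mn:
 fixes h d :: "vec => real"
 assumes h: "integrable (Mn n) h" "!!x. h x \<ge> 0" and K: "K \<in> sets (Mn n)"
  and ae: "AE x in leb n. x \<in> K --> d x = h x"
 shows "set_integrable (leb n) K d" "(LINT x:K|leb n. d x) \<le> (\<integral>x. h x \<partial>Mn n)"
proof -
 have hl: "integrable (leb n) h" using h leb_integrable[of h n] by auto
 hence hK: "set_integrable (leb n) K h" unfolding set_integrable_def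
  by (intro integrable_mult_indicator leb_sets[OF K])
 have ae': "AE x in leb n. x \<in> K --> h x = d x" using ae by eventually_elim simp
 show "set_integrable (leb n) K d" by (rule set_integrable_AE(1)[OF hK ae'])
 have "(LINT x:K|leb n. d x) = (LINT x:K|leb n. h x)" by (rule set_integrable_AE(2)[OF hK ae', symmetric])
 also have "\<dots> \<le> (\<integral>x. h x \<partial>leb n)" unfolding set_integral_alt
  by (rule integral_mono[OF hK[unfolded set_integrable_alt] hl]) (use h(2) in \<open>simp add: indicator_def\<close>)
 also have "\<dots> = (\<integral>x. h x \<partial>Mn n)" using h by (intro leb_integral) auto
 finally show "(LINT x:K|leb n. d x) \<le> (\<integral>x. h x \<partial>Mn n)" .
qed

text \<open>Mollifications of \<open>f\<close>, cut off to a thickening of \<open>K\<close>.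
  Continuity of \<open>f\<close> makes them converge uniformly, and their gradients are
  mollifications of \<open>G\<close> on \<open>K\<close> once the scale is below the margin. The
  last conclusion keeps the supports inside \<open>K\<close> when \<open>f\<close> is supported well
  inside \<open>K\<close>; it provides test functions.\<close>

theorem smooth_approximation:
 assumes U: "openin (Rn n) U" and f: "continuous_on U f" and G: "has_weak_grad n U f G" and p: "p \<ge> 1"
  and Gp: "!!i C. i < n ==> compactin (Rn n) C ==> C \<subseteq> U ==> set_integrable (leb n) C (\<lambda>x. \<bar>G x i\<bar> powr p)"
  and K: "compactin (Rn n) K" "K \<subseteq> U"
 obtains F where "!!k. smooth n U (F k)"
  "!!e. e > 0 ==> \<forall>\<^sub>F k in sequentially. \<forall>x\<in>K. \<bar>F k x - f x\<bar> \<le> e"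
  "!!i. i < n ==> (\<lambda>k. LINT x:K|leb n. \<bar>partial i (F k) x - G x i\<bar> powr p) \<longlonglongrightarrow> 0"
  "!!K0 d. d > 0 ==> (!!x. x \<in> K0 ==> nbox n x d \<subseteq> K) ==> (!!x. x \<in> U ==> x \<notin> K0 ==> f x = 0) ==>
   \<forall>\<^sub>F k in sequentially. \<forall>x\<in>U. x \<notin> K --> F k x = 0"
proof -
 have sub: "U \<subseteq> En n" by (rule openin_Rn_subset[OF U])
 obtain r K' where K': "r > 0" "compactin (Rn n) K'" "K' \<subseteq> U" "!!x. x \<in> K ==> nbox n x r \<subseteq> K'"
  using compactin_thickening[OF K(1) U K(2)] by blast
 define f1 where "f1 x = indicator K' x * f x" for x
 have cK': "continuous_on K' f" using f K'(3) by (rule continuous_on_subset)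
 have f1m: "f1 \<in> borel_measurable (Mn n)"
  unfolding f1_def by (rule continuous_measurable_Mn[OF borel_compact_Rn[OF K'(2)] cK'])
 have "set_integrable (leb n) K' f" by (rule set_integrable_continuous[OF K'(2) cK'])
 hence f1i: "integrable (Mn n) f1" using leb_integrable[OF f1m] unfolding set_integrable_alt f1_def by simp
 have ae1: "AE y in leb n. f1 y = indicator K' y * f y" unfolding f1_def by simp
 define F where "F k = moll n k f1" for k
 obtain k0 :: nat where k0: "1 / real (Suc k0) < r" using K'(1) nat_approx_posE by blast
 have kr: "nbox n x (1 / real (Suc k)) \<subseteq> nbox n x r" if "k \<ge> k0" for k x
 proof (rule nbox_mono)
  have "1 / real (Suc k) \<le> 1 / real (Suc k0)" using that by (intro divide_left_mono) auto
  thus "1 / real (Suc k) \<le> r" using k0 by linarith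
 qed
 have KE: "K \<subseteq> En n" using K by (simp add: compactin_Rn)
 have "\<exists>g1. integrable (Mn n) g1 \<and> (AE x in leb n. g1 x = indicator K' x * G x i)" if i: "i < n" for i
 proof -
  have "(\<lambda>x. G x i) \<in> L1_loc n U" using G i unfolding has_weak_grad_def by blast
  from set_integrable_version[OF L1_locD[OF this K'(2,3)]] show ?thesis by blast
 qed
 then obtain g1 where g1: "!!i. i < n ==> integrable (Mn n) (g1 i)" "!!i. i < n ==> AE x in leb n. g1 i x = indicator K' x * G x i"
  by metis
 have g1p: "integrable (Mn n) (\<lambda>x. \<bar>g1 i x\<bar> powr p)" if i: "i < n" for i
 proof -
  have m: "(\<lambda>x. \<bar>g1 i x\<bar> powr p) \<in> borel_measurable (Mn n)" using g1(1)[OF i] by (intro abs_powr_measurable) auto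
  have ae: "AE x in leb n. indicator K' x * \<bar>G x i\<bar> powr p = \<bar>g1 i x\<bar> powr p"
   using g1(2)[OF i] by eventually_elim (use p in \<open>auto simp: indicator_def\<close>)
  have Gi: "integrable (leb n) (\<lambda>x. indicator K' x * \<bar>G x i\<bar> powr p)" using Gp[OF i K'(2,3)] unfolding set_integrable_alt .
  have "integrable (leb n) (\<lambda>x. \<bar>g1 i x\<bar> powr p)"
   by (rule integrable_cong_AE[THEN iffD1, OF borel_measurable_integrable[OF Gi] leb_measurable[OF m] ae Gi])
  thus ?thesis using leb_integrable[OF m] by simp
 qed
 have pF: "partial i (F k) x = moll n k (g1 i) x" if "i < n" "k \<ge> k0" "x \<in> K" for i k x
  unfolding F_def
  by (rule partial_moll[OF U G that(1) K'(2,3) _ f1i ae1 g1(1)[OF that(1)] g1(2)[OF that(1)]])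
   (use kr[OF that(2)] K'(4)[OF that(3)] in blast)
 have sK: "K \<subseteq> K'"
 proof
  fix x assume "x \<in> K"
  hence "x \<in> nbox n x r" using KE K'(1) by (intro nbox_centre) auto
  thus "x \<in> K'" using K'(4)[OF \<open>x \<in> K\<close>] by blast
 qed
 have aeG: "AE x in leb n. x \<in> K --> \<bar>partial i (F k) x - G x i\<bar> powr p = \<bar>moll n k (g1 i) x - g1 i x\<bar> powr p"
  if "i < n" "k \<ge> k0" for i k
  using g1(2)[OF that(1)]
 proof eventually_elim
  case (elim x)
  show ?case
  proof
   assume x: "x \<in> K"
   hence "x \<in> K'" using sK by blast
   hence "g1 i x = G x i" using elim by simp
   thus "\<bar>partial i (F k) x - G x i\<bar> powr p = \<bar>moll n k (g1 i) x - g1 i x\<bar> powr p"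
    using pF[OF that x] by simp
  qed
 qed
 have ip: "integrable (Mn n) (\<lambda>x. \<bar>moll n k (g1 i) x - g1 i x\<bar> powr p)" if "i < n" for i k
  by (rule integrable_powr_diff[OF p moll_measurable[OF g1(1)[OF that]] moll_powr_integrable(1)[OF p g1(1)[OF that] g1p[OF that]] _ g1p[OF that]])
   (use g1(1)[OF that] in auto)
 note cmp = set_integral_le_integral_Mn[OF ip powr_ge_zero sets_compactin[OF K(1)] aeG]
 show ?thesis
 proof (rule that[of F])
  show "smooth n U (F k)" for k
   unfolding F_def moll_mollg by (rule mollg_smooth[OF U f1i mollk_test1])
  show "\<forall>\<^sub>F k in sequentially. \<forall>x\<in>K. \<bar>F k x - f x\<bar> \<le> e" if e: "e > 0" for e
  proof -
   obtain d where d: "d > 0" "!!x y. x \<in> K ==> y \<in> nbox n x d ==> y \<in> U \<and> \<bar>f y - f x\<bar> < e"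
    using uniformly_continuous_nbox[OF K(1) U K(2) f e] by blast
   obtain k1 :: nat where k1: "1 / real (Suc k1) < d" using d(1) nat_approx_posE by blast
   show ?thesis unfolding eventually_sequentially
   proof (intro exI[of _ "max k0 k1"] allI impI ballI)
    fix k x assume k: "max k0 k1 \<le> k" and x: "x \<in> K"
    have "1 / real (Suc k) \<le> 1 / real (Suc k1)" using k by (intro divide_left_mono) auto
    hence kd: "nbox n x (1 / real (Suc k)) \<subseteq> nbox n x d" using k1 by (intro nbox_mono) linarith
    show "\<bar>F k x - f x\<bar> \<le> e" unfolding F_def
    proof (rule moll_close[OF f1i])
     fix y assume y: "y \<in> nbox n x (1 / real (Suc k))"
     hence "y \<in> K'" using kr[of k x] k K'(4)[OF x] by auto
     moreover have "\<bar>f y - f x\<bar> < e" using d(2)[OF x] kd y by blast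
     ultimately show "\<bar>f1 y - f x\<bar> \<le> e" by (simp add: f1_def)
    qed
   qed
  qed
  show "(\<lambda>k. LINT x:K|leb n. \<bar>partial i (F k) x - G x i\<bar> powr p) \<longlonglongrightarrow> 0" if i: "i < n" for i
  proof (rule tendsto_sandwich[OF _ _ tendsto_const moll_Lp_tendsto[OF p g1(1)[OF i] g1p[OF i]]])
   show "\<forall>\<^sub>F k in sequentially. 0 \<le> (LINT x:K|leb n. \<bar>partial i (F k) x - G x i\<bar> powr p)"
    unfolding set_integral_alt by (intro always_eventually allI integral_nonneg_AE AE_I2) simp
   show "\<forall>\<^sub>F k in sequentially. (LINT x:K|leb n. \<bar>partial i (F k) x - G x i\<bar> powr p) \<le> (\<integral>x. \<bar>moll n k (g1 i) x - g1 i x\<bar> powr p \<partial>Mn n)"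
    using eventually_ge_at_top[of k0] by eventually_elim (use cmp(2)[OF i i] in blast)
  qed
  fix K0 :: "vec set" and d :: real
  assume d: "d > 0" "!!x. x \<in> K0 ==> nbox n x d \<subseteq> K" "!!x. x \<in> U ==> x \<notin> K0 ==> f x = 0"
  obtain k1 :: nat where k1: "1 / real (Suc k1) < d" using d(1) nat_approx_posE by blast
  show "\<forall>\<^sub>F k in sequentially. \<forall>x\<in>U. x \<notin> K --> F k x = 0" unfolding eventually_sequentially
  proof (intro exI[of _ k1] allI impI ballI)
   fix k x assume k: "k1 \<le> k" and x: "x \<in> U" "x \<notin> K"
   have "1 / real (Suc k) \<le> 1 / real (Suc k1)" using k by (intro divide_left_mono) auto
   hence kd: "1 / real (Suc k) < d" using k1 by linarith
   have "\<bar>F k x - 0\<bar> \<le> 0" unfolding F_def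
   proof (rule moll_close[OF f1i])
    fix y assume y: "y \<in> nbox n x (1 / real (Suc k))"
    have "y \<notin> K0"
    proof
     assume "y \<in> K0"
     moreover have "x \<in> nbox n y d"
     proof -
      have "\<bar>x i - y i\<bar> < d" if "i < n" for i
      proof -
       have "\<bar>y i - x i\<bar> < 1 / real (Suc k)" using y that by (simp add: nbox_def)
       thus ?thesis using kd by linarith
      qed
      thus ?thesis using x sub by (auto simp: nbox_def)
     qed
     ultimately show False using d(2) x(2) by blast
    qed
    hence "y \<in> K' ==> f y = 0" using d(3)[of y] K'(3) by blast
    thus "\<bar>f1 y - 0\<bar> \<le> 0" unfolding f1_def by (cases "y \<in> K'") auto
   qed
   thus "F k x = 0" by simp
  qed
 qed
qed

section \<open>Uniqueness, restriction and gluing of weak gradients\<close>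

lemma AE_on_exhaustion:
 assumes U: "openin (Rn n) U" and P: "!!K. compactin (Rn n) K ==> K \<subseteq> U ==> AE x in leb n. x \<in> K --> P x"
 shows "AE x in leb n. x \<in> U --> P x"
proof -
 obtain K :: "nat => vec set" where K: "!!m. compactin (Rn n) (K m)" "(\<Union>m. K m) = U" using compact_exhaustion[OF U] by metis
 have "AE x in leb n. \<forall>m. x \<in> K m --> P x"
  unfolding AE_all_countable using P K by blast
 thus ?thesis by eventually_elim (use K(2) in blast)
qed

text \<open>The fundamental lemma of the calculus of variations: the mollifications of
  \<open>D\<close> are pairings with test functions, hence vanish on \<open>K\<close> at small
  scales, and they converge to \<open>D\<close> in L1.\<close>

lemma weak_zero_imp_AE_zero:
 assumes U: "openin (Rn n) U" and D: "D \<in> L1_loc n U"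
  and z: "!!q. q \<in> Cc_smooth n U ==> (LINT x:U|leb n. D x * q x) = 0"
 shows "AE x in leb n. x \<in> U --> D x = 0"
proof (rule AE_on_exhaustion[OF U])
 fix K assume K: "compactin (Rn n) K" "K \<subseteq> U"
 have sub: "U \<subseteq> En n" by (rule openin_Rn_subset[OF U])
 obtain r K' where K': "r > 0" "compactin (Rn n) K'" "K' \<subseteq> U" "!!x. x \<in> K ==> nbox n x r \<subseteq> K'"
  using compactin_thickening[OF K(1) U K(2)] by blast
 obtain d where d: "integrable (Mn n) d" "AE x in leb n. d x = indicator K' x * D x"
  using set_integrable_version[OF L1_locD[OF D K'(2,3)]] by blast
 obtain k0 :: nat where k0: "1 / real (Suc k0) < r" using K'(1) nat_approx_posE by blast
 have m0: "moll n k d x = 0" if k: "k \<ge> k0" and x: "x \<in> K" for k x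
 proof -
  have "1 / real (Suc k) \<le> 1 / real (Suc k0)" using k by (intro divide_left_mono) auto
  hence "nbox n x (1 / real (Suc k)) \<subseteq> nbox n x r" using k0 by (intro nbox_mono) linarith
  hence b: "nbox n x (1 / real (Suc k)) \<subseteq> K'" using K'(4)[OF x] by blast
  have "moll n k d x = (LINT y:U|leb n. D y * kern n k x y)" by (rule moll_version_eq[OF d(2,1) K'(3) sub b])
  also have "\<dots> = 0" by (rule z[OF kern_Cc_smooth[OF U K'(2,3) b]])
  finally show ?thesis .
 qed
 have KM: "K \<in> sets (Mn n)" by (rule sets_compactin[OF K(1)])
 have dK: "integrable (Mn n) (\<lambda>x. indicator K x * \<bar>d x\<bar>)"
  using integrable_mult_indicator[OF KM integrable_abs[OF d(1)]] by simp
 have dp: "integrable (Mn n) (\<lambda>x. \<bar>d x\<bar> powr 1)" using d(1) by simp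
 note lim = moll_Lp_tendsto[OF order_refl d(1) dp]
 have "(\<integral>x. indicator K x * \<bar>d x\<bar> \<partial>Mn n) \<le> (\<integral>x. \<bar>moll n k d x - d x\<bar> powr 1 \<partial>Mn n)" if k: "k \<ge> k0" for k
 proof (rule integral_mono[OF dK])
  show "integrable (Mn n) (\<lambda>x. \<bar>moll n k d x - d x\<bar> powr 1)"
   by (rule integrable_powr_diff[OF order_refl moll_measurable[OF d(1)] moll_powr_integrable(1)[OF order_refl d(1) dp] _ dp]) (use d in auto)
  show "indicator K x * \<bar>d x\<bar> \<le> \<bar>moll n k d x - d x\<bar> powr 1" for x using m0[OF k, of x] by (cases "x \<in> K") auto
 qed
 hence "(\<integral>x. indicator K x * \<bar>d x\<bar> \<partial>Mn n) \<le> 0"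
  by (intro LIMSEQ_le_const[OF lim]) blast
 moreover have "(\<integral>x. indicator K x * \<bar>d x\<bar> \<partial>Mn n) \<ge> 0" by (intro integral_nonneg_AE AE_I2) simp
 ultimately have "(\<integral>x. indicator K x * \<bar>d x\<bar> \<partial>Mn n) = 0" by simp
 hence "AE x in Mn n. indicator K x * \<bar>d x\<bar> = 0"
  by (subst (asm) integral_nonneg_eq_0_iff_AE[OF dK]) auto
 hence "AE x in leb n. indicator K x * \<bar>d x\<bar> = 0" unfolding leb_AE_iff .
 thus "AE x in leb n. x \<in> K --> D x = 0" using d(2)
 proof eventually_elim
  case (elim x)
  show ?case
  proof
   assume x: "x \<in> K"
   hence "x \<in> nbox n x r" using K sub K'(1) by (intro nbox_centre) auto
   hence "x \<in> K'" using K'(4)[OF x] by blast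
   thus "D x = 0" using elim x by simp
  qed
 qed
qed

text \<open>Makes the arbitrary choice in \<open>weak_grad\<close> harmless under integrals.\<close>

lemma weak_grad_unique:
 assumes U: "openin (Rn n) U" and G: "has_weak_grad n U f G" "has_weak_grad n U f G'"
 shows "AE x in leb n. x \<in> U --> (\<forall>i<n. G x i = G' x i)"
proof -
 have one: "AE x in leb n. x \<in> U --> G x i - G' x i = 0" if i: "i < n" for i
 proof (rule weak_zero_imp_AE_zero[OF U])
  have L: "(\<lambda>x. G x i) \<in> L1_loc n U" "(\<lambda>x. G' x i) \<in> L1_loc n U" using G i unfolding has_weak_grad_def by auto
  show "(\<lambda>x. G x i - G' x i) \<in> L1_loc n U" unfolding L1_loc_def
   using L1_locD[OF L(1)] L1_locD[OF L(2)] by (auto intro: set_integral_diff)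
  fix q assume z: "q \<in> Cc_smooth n U"
  obtain K where K: "compactin (Rn n) K" "K \<subseteq> U" "!!x. x \<in> U ==> x \<notin> K ==> q x = 0" using Cc_smooth_supp[OF U z] by metis
  note c = Cc_smooth_continuous(1)[OF U z]
  have "(LINT x:U|leb n. (G x i - G' x i) * q x) = (LINT x:U|leb n. G x i * q x - G' x i * q x)"
   by (simp add: left_diff_distrib)
  also have "\<dots> = (LINT x:U|leb n. G x i * q x) - (LINT x:U|leb n. G' x i * q x)"
   by (rule set_integral_diff(2)[OF L1_loc_times_supp[OF L(1) K(1,2) c K(3)] L1_loc_times_supp[OF L(2) K(1,2) c K(3)]])
  also have "\<dots> = 0" using G i z unfolding has_weak_grad_def by (metis (no_types, lifting) add.inverse_inverse diff_self)
  finally show "(LINT x:U|leb n. (G x i - G' x i) * q x) = 0" .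
 qed
 have "AE x in leb n. \<forall>i\<in>{..<n}. x \<in> U --> G x i - G' x i = 0"
  by (rule AE_finite_allI) (use one in auto)
 thus ?thesis by eventually_elim auto
qed

text \<open>Needed to restrict weak gradients to open subsets: a test function of the smaller set
  becomes one of the larger set. The coinduction runs through extensions of functions that all
  vanish off the same compact set.\<close>

lemma Cc_smooth_ext0:
 assumes S: "openin (Rn n) S" and U: "openin (Rn n) U" and sub: "S \<subseteq> U" and z: "q \<in> Cc_smooth n S"
 shows "ext0 S q \<in> Cc_smooth n U"
proof -
 obtain K where K: "compactin (Rn n) K" "K \<subseteq> S" "!!x. x \<in> S ==> x \<notin> K ==> q x = 0" using Cc_smooth_supp[OF S z] by metis
 have E: "U \<subseteq> En n" by (rule openin_Rn_subset[OF U])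
 let ?C = "{ext0 S h | h. smooth n S h \<and> (\<forall>x\<in>S. x \<notin> K --> h x = 0)}"
 have "smooth n U (ext0 S q)"
 proof (rule smooth_coinduct[OF U, of _ ?C])
  show "ext0 S q \<in> ?C" using z K(3) unfolding Cc_smooth_def by blast
  show "continuous_on U h" if "h \<in> ?C" for h
  proof -
   obtain g where g: "h = ext0 S g" "smooth n S g" "!!x. x \<in> S ==> x \<notin> K ==> g x = 0" using \<open>h \<in> ?C\<close> by blast
   have "continuous_on (En n) (ext0 S g)"
    by (rule ext0_continuous[OF S K(1,2) smooth_cont[OF g(2) openin_Rn_subset[OF S]] g(3)])
   thus ?thesis unfolding g(1) using E by (rule continuous_on_subset)
  qed
  fix h i assume "h \<in> ?C" and i: "i < n"
  then obtain g where g: "h = ext0 S g" "smooth n S g" "!!x. x \<in> S ==> x \<notin> K ==> g x = 0" by blast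
  have "partial i g x = 0" if "x \<in> S" "x \<notin> K" for x
   by (rule deriv_vanishes[OF S K(1) i g(3) that smooth_deriv[OF g(2) that(1) i]])
  hence in1: "ext0 S (partial i g) \<in> ?C" using smooth_partial[OF g(2) i] by blast
  show "\<exists>h'\<in>?C. \<forall>x\<in>U. ((\<lambda>t. h (x(i := t))) has_real_derivative h' x) (at (x i))"
  proof (rule bexI[OF _ in1], rule ballI)
   fix x assume "x \<in> U"
   hence x: "x \<in> En n" using E by blast
   show "((\<lambda>t. h (x(i := t))) has_real_derivative ext0 S (partial i g) x) (at (x i))"
    unfolding g(1) by (rule ext0_deriv[where f=g and f'="partial i g", OF S K(1,2) i g(3) smooth_deriv[OF g(2) _ i] x])
  qed
 qed
 thus ?thesis
  by (rule Cc_smooth_supportI[OF U _ K(1)]) (use K sub in \<open>auto simp: ext0_def\<close>)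
qed

lemma has_weak_grad_restrict:
 assumes U: "openin (Rn n) U" and S: "openin (Rn n) S" "S \<subseteq> U" and G: "has_weak_grad n U f G"
 shows "has_weak_grad n S f G"
 unfolding has_weak_grad_def
proof (intro conjI allI impI ballI)
 show "f \<in> L1_loc n S" using G S(2) unfolding has_weak_grad_def L1_loc_def by blast
 fix i assume i: "i < n"
 show "(\<lambda>x. G x i) \<in> L1_loc n S" using G S(2) i unfolding has_weak_grad_def L1_loc_def by blast
 fix q assume z: "q \<in> Cc_smooth n S"
 have e: "ext0 S q \<in> Cc_smooth n U" by (rule Cc_smooth_ext0[OF S(1) U S(2) z])
 obtain K where K: "compactin (Rn n) K" "K \<subseteq> S" "!!x. x \<in> S ==> x \<notin> K ==> q x = 0" using Cc_smooth_supp[OF S(1) z] by metis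
 have sm: "smooth n S q" using z unfolding Cc_smooth_def by auto
 have pe: "partial i (ext0 S q) x = ext0 S (partial i q) x" if "x \<in> U" for x
 proof -
  have x: "x \<in> En n" using that openin_Rn_subset[OF U] by blast
  show ?thesis
   unfolding partial_def[of i "ext0 S q"]
   by (rule DERIV_imp_deriv[OF ext0_deriv[where f=q and f'="partial i q", OF S(1) K(1,2) i K(3) smooth_deriv[OF sm _ i] x]])
 qed
 have "(LINT x:S|leb n. f x * partial i q x) = (LINT x:U|leb n. f x * partial i (ext0 S q) x)"
  unfolding set_integral_alt by (rule arg_cong[where f="integral\<^sup>L (leb n)"]) (use pe S(2) in \<open>auto simp: ext0_def indicator_def fun_eq_iff\<close>)
 also have "\<dots> = - (LINT x:U|leb n. G x i * ext0 S q x)" using G i e unfolding has_weak_grad_def by blast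
 also have "(LINT x:U|leb n. G x i * ext0 S q x) = (LINT x:S|leb n. G x i * q x)"
  unfolding set_integral_alt by (rule arg_cong[where f="integral\<^sup>L (leb n)"]) (use S(2) in \<open>auto simp: ext0_def indicator_def fun_eq_iff\<close>)
 finally show "(LINT x:S|leb n. f x * partial i q x) = - (LINT x:S|leb n. G x i * q x)" .
qed

lemma has_weak_grad_AE:
 assumes G: "has_weak_grad n U f G" and ae: "AE x in leb n. x \<in> U --> (\<forall>i<n. G x i = G' x i)" and U: "openin (Rn n) U"
 shows "has_weak_grad n U f G'"
 unfolding has_weak_grad_def
proof (intro conjI allI impI ballI)
 show "f \<in> L1_loc n U" using G unfolding has_weak_grad_def by blast
 fix i assume i: "i < n"
 have L: "(\<lambda>x. G x i) \<in> L1_loc n U" using G i unfolding has_weak_grad_def by blast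
 show "(\<lambda>x. G' x i) \<in> L1_loc n U" unfolding L1_loc_def
 proof (intro CollectI allI impI)
  fix K assume K: "compactin (Rn n) K \<and> K \<subseteq> U"
  show "set_integrable (leb n) K (\<lambda>x. G' x i)"
   by (rule set_integrable_AE(1)[OF L1_locD[OF L]]) (use K ae i in \<open>auto elim!: eventually_mono\<close>)
 qed
 fix q assume z: "q \<in> Cc_smooth n U"
 obtain K where K: "compactin (Rn n) K" "K \<subseteq> U" "!!x. x \<in> U ==> x \<notin> K ==> q x = 0" using Cc_smooth_supp[OF U z] by metis
 have "(LINT x:U|leb n. G x i * q x) = (LINT x:U|leb n. G' x i * q x)"
  by (rule set_integrable_AE(2)[OF L1_loc_times_supp[OF L K(1,2) Cc_smooth_continuous(1)[OF U z] K(3)]])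
   (use ae i in \<open>auto elim!: eventually_mono\<close>)
 thus "(LINT x:U|leb n. f x * partial i q x) = - (LINT x:U|leb n. G' x i * q x)"
  using G i z unfolding has_weak_grad_def by metis
qed

lemma smooth_subset: "smooth n U f ==> S \<subseteq> U ==> U \<subseteq> En n ==> smooth n S f"
 unfolding smooth_def using cont_iff[of U n] cont_iff[of S n] by (meson continuous_on_subset subset_iff subset_trans)

lemma Cc_smooth_restrict:
 assumes U: "openin (Rn n) U" and S: "openin (Rn n) S" "S \<subseteq> U" and z: "q \<in> Cc_smooth n U"
  and K: "compactin (Rn n) K" "K \<subseteq> S" "!!x. x \<in> U ==> x \<notin> K ==> q x = 0"
 shows "q \<in> Cc_smooth n S"
proof (rule Cc_smooth_supportI[OF S(1) _ K(1,2)])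
 have "smooth n U q" using z unfolding Cc_smooth_def by simp
 thus "smooth n S q" by (rule smooth_subset[OF _ S(2) openin_Rn_subset[OF U]])
 show "q x = 0" if "x \<in> S" "x \<notin> K" for x using K(3) that S(2) by blast
qed

lemma is_domain_open: "is_domain n S ==> openin (Rn n) S"
 unfolding is_domain_def by blast

lemma compactly_inside_subset: "compactly_inside n S U ==> S \<subseteq> En n ==> S \<subseteq> U"
 using closure_subset by (auto simp: compactly_inside_iff)

text \<open>\<open>W1p_loc\<close> provides a separate gradient on each domain compactly inside
  \<open>U\<close>. Countably many of them, covering an exhaustion, agree almost everywhere on
  overlaps and are glued; a given test function is supported in a single one of these
  domains.\<close>

theorem W1p_loc_weak_grad:
 assumes U: "is_domain n U" and u: "u \<in> W1p_loc n p U"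
 obtains G where "has_weak_grad n U u G"
  "!!i C. i < n ==> compactin (Rn n) C ==> C \<subseteq> U ==> set_integrable (leb n) C (\<lambda>x. \<bar>G x i\<bar> powr p)"
proof -
 have op: "openin (Rn n) U" by (rule is_domain_open[OF U])
 obtain K :: "nat => vec set" where K: "!!m. compactin (Rn n) (K m)" "(\<Union>m. K m) = U"
  "!!C. compactin (Rn n) C ==> C \<subseteq> U ==> \<exists>m. C \<subseteq> K m" using compact_exhaustion[OF op] by metis
 have "\<exists>S. is_domain n S \<and> compactly_inside n S U \<and> K m \<subseteq> S" for m
  using domain_containing_compact[OF U K(1), of m] K(2) by blast
 then obtain S where w: "!!m. is_domain n (S m)" "!!m. compactly_inside n (S m) U" "!!m. K m \<subseteq> S m" by metis
 have wo: "openin (Rn n) (S m)" for m by (rule is_domain_open[OF w(1)])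
 have ws: "S m \<subseteq> U" for m by (rule compactly_inside_subset[OF w(2) openin_Rn_subset[OF wo]])
 have "\<exists>G. has_weak_grad n (S m) u G \<and> (\<forall>i<n. (\<lambda>x. G x i) \<in> Lp n p (S m))" for m
  using u w(1)[of m] w(2)[of m] unfolding W1p_loc_def W1p_def by blast
 then obtain Gm where Gm: "!!m. has_weak_grad n (S m) u (Gm m)" "!!m i. i < n ==> (\<lambda>x. Gm m x i) \<in> Lp n p (S m)" by metis
 \<comment> \<open>The gradient of the first domain that contains \<open>x\<close>; the domains
   themselves need not increase.\<close>
 define G where "G x = Gm (LEAST m. x \<in> S m) x" for x
 have agree: "AE x in leb n. x \<in> S j \<inter> S m --> (\<forall>i<n. Gm j x i = Gm m x i)" for j m
 proof (rule weak_grad_unique)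
  show o: "openin (Rn n) (S j \<inter> S m)" by (rule openin_Int[OF wo wo])
  show "has_weak_grad n (S j \<inter> S m) u (Gm j)" by (rule has_weak_grad_restrict[OF wo[of j] o _ Gm(1)]) blast
  show "has_weak_grad n (S j \<inter> S m) u (Gm m)" by (rule has_weak_grad_restrict[OF wo[of m] o _ Gm(1)]) blast
 qed
 have GG: "AE x in leb n. x \<in> S m --> (\<forall>i<n. Gm m x i = G x i)" for m
 proof -
  have "AE x in leb n. \<forall>j. x \<in> S j \<inter> S m --> (\<forall>i<n. Gm j x i = Gm m x i)"
   unfolding AE_all_countable using agree by blast
  thus ?thesis
  proof eventually_elim
   case (elim x)
   show ?case
   proof
    assume x: "x \<in> S m"
    have "x \<in> S (LEAST m. x \<in> S m)" using x by (rule LeastI)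
    hence "\<forall>i<n. Gm (LEAST m. x \<in> S m) x i = Gm m x i" using elim x by blast
    thus "\<forall>i<n. Gm m x i = G x i" unfolding G_def by simp
   qed
  qed
 qed
 have Gw: "has_weak_grad n (S m) u G" for m by (rule has_weak_grad_AE[OF Gm(1) GG wo])
 have cw: "\<exists>m. C \<subseteq> S m" if "compactin (Rn n) C" "C \<subseteq> U" for C using K(3)[OF that] w(3) by blast
 have "has_weak_grad n U u G"
  unfolding has_weak_grad_def
 proof (intro conjI allI impI ballI)
  show "u \<in> L1_loc n U" unfolding L1_loc_def
  proof (intro CollectI allI impI)
   fix C assume C: "compactin (Rn n) C \<and> C \<subseteq> U"
   then obtain m where "C \<subseteq> S m" using cw by blast
   moreover have "u \<in> L1_loc n (S m)" using Gw[of m] unfolding has_weak_grad_def by blast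
   ultimately show "set_integrable (leb n) C u" using C L1_locD by blast
  qed
  fix i assume i: "i < n"
  show "(\<lambda>x. G x i) \<in> L1_loc n U" unfolding L1_loc_def
  proof (intro CollectI allI impI)
   fix C assume C: "compactin (Rn n) C \<and> C \<subseteq> U"
   then obtain m where "C \<subseteq> S m" using cw by blast
   moreover have "(\<lambda>x. G x i) \<in> L1_loc n (S m)" using Gw[of m] i unfolding has_weak_grad_def by blast
   ultimately show "set_integrable (leb n) C (\<lambda>x. G x i)" using C L1_locD by blast
  qed
  fix q assume z: "q \<in> Cc_smooth n U"
  obtain C where C: "compactin (Rn n) C" "C \<subseteq> U" "!!x. x \<in> U ==> x \<notin> C ==> q x = 0"
   "!!x i. x \<in> U ==> x \<notin> C ==> i < n ==> partial i q x = 0" using Cc_smooth_supp[OF op z] by blast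
  obtain m where m: "C \<subseteq> S m" using cw[OF C(1,2)] by blast
  have zm: "q \<in> Cc_smooth n (S m)" by (rule Cc_smooth_restrict[OF op wo ws z C(1) m C(3)])
  have "(LINT x:U|leb n. u x * partial i q x) = (LINT x:S m|leb n. u x * partial i q x)"
   using m ws[of m] C(4)[OF _ _ i] by (intro set_integral_supp(2)) auto
  also have "\<dots> = - (LINT x:S m|leb n. G x i * q x)" using Gw[of m] i zm unfolding has_weak_grad_def by blast
  also have "(LINT x:S m|leb n. G x i * q x) = (LINT x:U|leb n. G x i * q x)"
   using m ws[of m] C(3) by (intro set_integral_supp(2)[symmetric]) auto
  finally show "(LINT x:U|leb n. u x * partial i q x) = - (LINT x:U|leb n. G x i * q x)" .
 qed
 moreover have "set_integrable (leb n) C (\<lambda>x. \<bar>G x i\<bar> powr p)" if i: "i < n" and C: "compactin (Rn n) C" "C \<subseteq> U" for i C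
 proof -
  obtain m where m: "C \<subseteq> S m" using cw[OF C] by blast
  have "set_integrable (leb n) (S m) (\<lambda>x. \<bar>Gm m x i\<bar> powr p)" using Gm(2)[OF i] unfolding Lp_def by blast
  hence "set_integrable (leb n) C (\<lambda>x. \<bar>Gm m x i\<bar> powr p)"
   by (rule set_integrable_subset[OF _ leb_compactin[OF C(1)] m])
  thus ?thesis
   by (rule set_integrable_AE(1)) (use GG[of m] m i in \<open>auto elim!: eventually_mono\<close>)
 qed
 ultimately show ?thesis by (rule that)
qed

lemma has_weak_grad_weak_grad: "has_weak_grad n U f G ==> has_weak_grad n U f (weak_grad n U f)"
 unfolding weak_grad_def by (rule someI[where P="has_weak_grad n U f"])

lemma weak_grad_AE_eq:
 assumes "openin (Rn n) U" "has_weak_grad n U f G"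
 shows "AE x in leb n. x \<in> U --> (\<forall>i<n. weak_grad n U f x i = G x i)"
 by (rule weak_grad_unique[OF assms(1) has_weak_grad_weak_grad[OF assms(2)] assms(2)])

text \<open>On the open set \<open>U - K\<close> the function is zero, and so is its gradient by
  uniqueness.\<close>

lemma weak_grad_vanishes:
 assumes U: "openin (Rn n) U" and f: "continuous_on U f" and G: "has_weak_grad n U f G" and K: "compactin (Rn n) K"
  and z: "!!x. x \<in> U ==> x \<notin> K ==> f x = 0"
 shows "AE x in leb n. x \<in> U - K --> (\<forall>i<n. G x i = 0)"
proof -
 have eq: "U - K = U \<inter> (En n - K)" using openin_Rn_subset[OF U] by blast
 have o: "openin (Rn n) (U - K)" unfolding eq by (rule openin_Int[OF U openin_compl[OF K]])
 have 1: "has_weak_grad n (U - K) f G" by (rule has_weak_grad_restrict[OF U o _ G]) blast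
 have 2: "has_weak_grad n (U - K) f (\<lambda>x i. 0)"
 proof (rule has_weak_grad_C1[OF o])
  show "continuous_on (U - K) f" using f by (rule continuous_on_subset) blast
  show "((\<lambda>t. f (x(i := t))) has_real_derivative 0) (at (x i))" if "x \<in> U - K" "i < n" for x i
   by (rule deriv_transform_line[OF o that, of "\<lambda>_. 0"]) (use z in auto)
 qed simp
 show ?thesis using weak_grad_unique[OF o 1 2] .
qed

section \<open>The chain rule for weak gradients\<close>

lemma set_integral_product_tendsto:
 fixes A :: "nat => vec => real"
 assumes K: "K \<in> sets (leb n)"
  and Am: "!!k. (\<lambda>x. indicator K x * A k x) \<in> borel_measurable (leb n)"
  and Ab: "!!k x. x \<in> K ==> \<bar>A k x\<bar> \<le> B"
  and At: "!!x. x \<in> K ==> (\<lambda>k. A k x) \<longlonglongrightarrow> A' x"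
  and h: "set_integrable (leb n) K h" "!!k. set_integrable (leb n) K (hk k)"
  and hl: "(\<lambda>k. LINT x:K|leb n. \<bar>hk k x - h x\<bar>) \<longlonglongrightarrow> 0"
 shows "(\<lambda>k. LINT x:K|leb n. hk k x * A k x) \<longlonglongrightarrow> (LINT x:K|leb n. h x * A' x)"
proof -
 have A'm: "(\<lambda>x. indicator K x * A' x) \<in> borel_measurable (leb n)"
 proof (rule borel_measurable_LIMSEQ_real[OF _ Am])
  show "(\<lambda>k. indicator K x * A k x) \<longlonglongrightarrow> indicator K x * A' x" for x
   using At[of x] by (cases "x \<in> K") auto
 qed
 have A'b: "\<bar>A' x\<bar> \<le> B" if "x \<in> K" for x
  by (rule LIMSEQ_le_const2[OF tendsto_rabs[OF At[OF that]]]) (use Ab[OF that] in auto)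
 have d: "set_integrable (leb n) K (\<lambda>x. hk k x - h x)" for k by (intro set_integral_diff h)
 have i1: "set_integrable (leb n) K (\<lambda>x. (hk k x - h x) * A k x)" for k
  by (rule set_integrable_times_bounded[where B=B, OF d K Am]) (use Ab in auto)
 have i2: "set_integrable (leb n) K (\<lambda>x. h x * A k x)" for k
  by (rule set_integrable_times_bounded[where B=B, OF h(1) K Am]) (use Ab in auto)
 \<comment> \<open>The first term is small because the \<open>A k\<close> are uniformly bounded, the
   second converges by domination since \<open>h\<close> is fixed.\<close>
 have split: "(LINT x:K|leb n. hk k x * A k x) = (LINT x:K|leb n. (hk k x - h x) * A k x) + (LINT x:K|leb n. h x * A k x)" for k
  unfolding set_integral_add(2)[OF i1 i2, symmetric] by (simp add: algebra_simps)
 have "(\<lambda>k. LINT x:K|leb n. (hk k x - h x) * A k x) \<longlonglongrightarrow> 0"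
 proof (rule Lim_null_comparison)
  show "\<forall>\<^sub>F k in sequentially. norm (LINT x:K|leb n. (hk k x - h x) * A k x) \<le> \<bar>B\<bar> * (LINT x:K|leb n. \<bar>hk k x - h x\<bar>)"
  proof (rule always_eventually, rule allI)
   fix k
   have dk: "integrable (leb n) (\<lambda>x. indicator K x * \<bar>hk k x - h x\<bar>)"
    using set_integrable_abs[OF d[of k]] unfolding set_integrable_alt .
   have "norm (LINT x:K|leb n. (hk k x - h x) * A k x) \<le> (\<integral>x. \<bar>indicator K x * ((hk k x - h x) * A k x)\<bar> \<partial>leb n)"
    unfolding set_integral_alt real_norm_def by (rule integral_abs_bound)
   also have "\<dots> \<le> (\<integral>x. \<bar>B\<bar> * (indicator K x * \<bar>hk k x - h x\<bar>) \<partial>leb n)"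
   proof (rule integral_mono)
    show "integrable (leb n) (\<lambda>x. \<bar>indicator K x * ((hk k x - h x) * A k x)\<bar>)"
     using i1[of k] unfolding set_integrable_alt by (rule integrable_abs)
    show "integrable (leb n) (\<lambda>x. \<bar>B\<bar> * (indicator K x * \<bar>hk k x - h x\<bar>))" using dk by simp
    fix x
    show "\<bar>indicator K x * ((hk k x - h x) * A k x)\<bar> \<le> \<bar>B\<bar> * (indicator K x * \<bar>hk k x - h x\<bar>)"
    proof (cases "x \<in> K")
     case True
     have "\<bar>A k x\<bar> * \<bar>hk k x - h x\<bar> \<le> \<bar>B\<bar> * \<bar>hk k x - h x\<bar>" using Ab[OF True, of k] by (intro mult_right_mono) auto
     thus ?thesis using True by (simp add: abs_mult mult.commute)
    qed simp
   qed
   also have "\<dots> = \<bar>B\<bar> * (LINT x:K|leb n. \<bar>hk k x - h x\<bar>)" unfolding set_integral_alt by simp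
   finally show "norm (LINT x:K|leb n. (hk k x - h x) * A k x) \<le> \<bar>B\<bar> * (LINT x:K|leb n. \<bar>hk k x - h x\<bar>)" .
  qed
  show "(\<lambda>k. \<bar>B\<bar> * (LINT x:K|leb n. \<bar>hk k x - h x\<bar>)) \<longlonglongrightarrow> 0" using tendsto_mult_right_zero[OF hl] .
 qed
 moreover have "(\<lambda>k. LINT x:K|leb n. h x * A k x) \<longlonglongrightarrow> (LINT x:K|leb n. h x * A' x)"
  unfolding set_integral_alt
 proof (rule integral_dominated_convergence[where w="\<lambda>x. \<bar>B\<bar> * \<bar>indicator K x * h x\<bar>"])
  show "integrable (leb n) (\<lambda>x. \<bar>B\<bar> * \<bar>indicator K x * h x\<bar>)"
   using h(1) unfolding set_integrable_alt by (intro integrable_mult_right integrable_abs)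
  show "AE x in leb n. (\<lambda>k. indicator K x * (h x * A k x)) \<longlonglongrightarrow> indicator K x * (h x * A' x)"
  proof (rule AE_I2)
   fix x show "(\<lambda>k. indicator K x * (h x * A k x)) \<longlonglongrightarrow> indicator K x * (h x * A' x)"
    using At[of x] by (cases "x \<in> K") (auto intro: tendsto_mult_left)
  qed
  show "AE x in leb n. norm (indicator K x * (h x * A k x)) \<le> \<bar>B\<bar> * \<bar>indicator K x * h x\<bar>" for k
  proof (rule AE_I2)
   fix x show "norm (indicator K x * (h x * A k x)) \<le> \<bar>B\<bar> * \<bar>indicator K x * h x\<bar>"
   proof (cases "x \<in> K")
    case True
    have "\<bar>A k x\<bar> * \<bar>h x\<bar> \<le> \<bar>B\<bar> * \<bar>h x\<bar>" using Ab[OF True, of k] by (intro mult_right_mono) auto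
    thus ?thesis using True by (simp add: abs_mult mult.commute)
   qed simp
  qed
  show "(\<lambda>x. indicator K x * (h x * A k x)) \<in> borel_measurable (leb n)" for k
   using i2[of k] unfolding set_integrable_alt by (rule borel_measurable_integrable)
  have "set_integrable (leb n) K (\<lambda>x. h x * A' x)"
   by (rule set_integrable_times_bounded[where B=B, OF h(1) K A'm]) (use A'b in auto)
  thus "(\<lambda>x. indicator K x * (h x * A' x)) \<in> borel_measurable (leb n)"
   unfolding set_integrable_alt by (rule borel_measurable_integrable)
 qed
 ultimately show ?thesis unfolding split using tendsto_add[of _ 0] by fastforce
qed

lemma openin_superlevel:
 assumes "openin (Rn n) U" "continuous_on U (g :: vec => real)"
 shows "openin (Rn n) {x \<in> U. g x > c}"
proof -
 have "openin (top_of_set U) (U \<inter> g -` {c<..})"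
  using assms(2) by (simp add: continuous_openin_preimage_gen)
 moreover have "U \<inter> g -` {c<..} = {x \<in> U. g x > c}" by auto
 ultimately have "openin (top_of_set U) {x \<in> U. g x > c}" by simp
 thus ?thesis using assms(1) unfolding Rn_eq by (rule openin_trans)
qed

text \<open>The second argument will be the positive function \<open>u\<close>, which appears with
  negative powers and in denominators.\<close>

abbreviation cont2 :: "(real => real => real) => bool" where
 "cont2 \<Phi> \<equiv> continuous_on (UNIV \<times> {0<..}) (\<lambda>z. \<Phi> (fst z) (snd z))"

lemma continuous_on_comp2:
 assumes "cont2 \<Phi>" "continuous_on X f" "continuous_on X g" "!!x. x \<in> X ==> 0 < g x"
 shows "continuous_on X (\<lambda>x. \<Phi> (f x) (g x) :: real)"
proof -
 have "(\<lambda>x. (f x, g x)) ` X \<subseteq> UNIV \<times> {0<..}" using assms(4) by auto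
 from continuous_on_compose2[OF assms(1) continuous_on_Pair[OF assms(2,3)] this] show ?thesis by simp
qed

lemma eventually_uniform_tendsto:
 assumes "!!e. e > 0 ==> \<forall>\<^sub>F k in sequentially. \<forall>x\<in>K. \<bar>F k x - f x\<bar> \<le> (e :: real)" and x: "x \<in> K"
 shows "(\<lambda>k. F k x) \<longlonglongrightarrow> f x"
proof (rule LIMSEQ_I)
 fix e :: real assume "e > 0"
 hence "\<forall>\<^sub>F k in sequentially. \<forall>x\<in>K. \<bar>F k x - f x\<bar> \<le> e / 2" by (intro assms(1)) simp
 then obtain k0 where "!!k. k \<ge> k0 ==> \<bar>F k x - f x\<bar> \<le> e / 2" unfolding eventually_sequentially using x by blast
 thus "\<exists>k0. \<forall>k\<ge>k0. norm (F k x - f x) < e" using \<open>e > 0\<close> by (intro exI[of _ k0]) fastforce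
qed

lemma smooth_approximation_L1:
 assumes U: "openin (Rn n) U" and w: "continuous_on U w" "has_weak_grad n U w D"
  and K: "compactin (Rn n) K" "K \<subseteq> U" and e: "e > 0"
 shows "\<exists>F. (\<forall>k. smooth n U (F k)) \<and> (\<forall>k. \<forall>x\<in>K. \<bar>F k x - w x\<bar> \<le> e) \<and> (\<forall>x\<in>K. (\<lambda>k. F k x) \<longlonglongrightarrow> w x) \<and>
  (\<forall>i<n. (\<lambda>k. LINT x:K|leb n. \<bar>partial i (F k) x - D x i\<bar>) \<longlonglongrightarrow> 0)"
proof -
 have p1: "set_integrable (leb n) C (\<lambda>x. \<bar>D x i\<bar> powr 1)" if "i < n" "compactin (Rn n) C" "C \<subseteq> U" for i C
 proof -
  have "(\<lambda>x. D x i) \<in> L1_loc n U" using w(2) that unfolding has_weak_grad_def by blast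
  from set_integrable_abs[OF L1_locD[OF this that(2,3)]] show ?thesis by simp
 qed
 show ?thesis
 proof (rule smooth_approximation[OF U w order_refl p1 K], assumption, assumption, assumption, goal_cases)
  case (1 F)
  obtain N where N: "!!k x. k \<ge> N ==> x \<in> K ==> \<bar>F k x - w x\<bar> \<le> e"
   using 1(2)[OF e] unfolding eventually_sequentially by blast
  have "(\<lambda>k. LINT x:K|leb n. \<bar>partial i (F (k + N)) x - D x i\<bar>) \<longlonglongrightarrow> 0" if "i < n" for i
   using LIMSEQ_ignore_initial_segment[OF 1(3)[OF that], of N] by simp
  thus ?case using 1(1) N LIMSEQ_ignore_initial_segment[OF eventually_uniform_tendsto[OF 1(2)]]
   by (intro exI[of _ "\<lambda>k. F (k + N)"]) auto
 qed
qed

text \<open>The classical rule holds for smooth approximations of \<open>f\<close> and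
  \<open>g\<close>. In the limit the composed factors converge boundedly and pointwise, the
  gradients in L1 on the support of the test function. The derivative hypothesis is stated along
  curves because \<open>partial\<close> differentiates along coordinate lines.\<close>

theorem weak_chain_rule:
 fixes \<Phi> \<Phi>1 \<Phi>2 :: "real => real => real"
 assumes U: "openin (Rn n) U" and f: "continuous_on U f" "has_weak_grad n U f Gf"
  and g: "continuous_on U g" "has_weak_grad n U g Gg" "!!x. x \<in> U ==> 0 < g x"
  and c: "cont2 \<Phi>"
   "cont2 \<Phi>1" "cont2 \<Phi>2"
  and d: "!!a b a' b' t. (a has_real_derivative a') (at t) ==> (b has_real_derivative b') (at t) ==> b t > 0 ==>
   ((\<lambda>t. \<Phi> (a t) (b t)) has_real_derivative \<Phi>1 (a t) (b t) * a' + \<Phi>2 (a t) (b t) * b') (at t)"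
 shows "has_weak_grad n U (\<lambda>x. \<Phi> (f x) (g x)) (\<lambda>x i. \<Phi>1 (f x) (g x) * Gf x i + \<Phi>2 (f x) (g x) * Gg x i)"
 unfolding has_weak_grad_def
proof (intro conjI allI impI ballI)
 have sub: "U \<subseteq> En n" by (rule openin_Rn_subset[OF U])
 note cc = continuous_on_comp2[OF _ f(1) g(1) g(3)]
 show L: "(\<lambda>x. \<Phi> (f x) (g x)) \<in> L1_loc n U" by (rule L1_loc_continuous[OF sub cc[OF c(1)]])
 fix i assume i: "i < n"
 have Lf: "(\<lambda>x. Gf x i) \<in> L1_loc n U" and Lg: "(\<lambda>x. Gg x i) \<in> L1_loc n U"
  using f(2) g(2) i unfolding has_weak_grad_def by auto
 have Li: "set_integrable (leb n) C (\<lambda>x. Gf x i * \<Phi>1 (f x) (g x))" "set_integrable (leb n) C (\<lambda>x. Gg x i * \<Phi>2 (f x) (g x))"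
  if "compactin (Rn n) C" "C \<subseteq> U" for C
  using set_integrable_times_continuous[OF L1_locD[OF Lf that] that(1) continuous_on_subset[OF cc[OF c(2)] that(2)]]
   set_integrable_times_continuous[OF L1_locD[OF Lg that] that(1) continuous_on_subset[OF cc[OF c(3)] that(2)]] by auto
 show LG: "(\<lambda>x. \<Phi>1 (f x) (g x) * Gf x i + \<Phi>2 (f x) (g x) * Gg x i) \<in> L1_loc n U"
  unfolding L1_loc_def using Li by (auto simp: mult.commute intro!: set_integral_add)
 fix q assume z: "q \<in> Cc_smooth n U"
 obtain K where K: "compactin (Rn n) K" "K \<subseteq> U" "!!x. x \<in> U ==> x \<notin> K ==> q x = 0"
  "!!x i. x \<in> U ==> x \<notin> K ==> i < n ==> partial i q x = 0" using Cc_smooth_supp[OF U z] by blast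
 note zc = Cc_smooth_continuous[OF U z]
 have KL: "K \<in> sets (leb n)" by (rule leb_compactin[OF K(1)])
 have Kb: "K \<in> sets borel" by (rule borel_compact_Rn[OF K(1)])
 obtain Bf where Bf: "Bf > 0" "!!x. x \<in> K ==> \<bar>f x\<bar> \<le> Bf" using compact_bounded_real[OF K(1) continuous_on_subset[OF f(1) K(2)]] by blast
 obtain Bg where Bg: "Bg > 0" "!!x. x \<in> K ==> \<bar>g x\<bar> \<le> Bg" using compact_bounded_real[OF K(1) continuous_on_subset[OF g(1) K(2)]] by blast
 have "continuous_on K (\<lambda>x. 1 / g x)"
  using continuous_on_subset[OF g(1) K(2)] g(3) K(2) by (intro continuous_intros) force+
 then obtain Bi where Bi: "Bi > 0" "!!x. x \<in> K ==> \<bar>1 / g x\<bar> \<le> Bi" using compact_bounded_real[OF K(1)] by blast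
 \<comment> \<open>A positive lower bound of \<open>g\<close> on \<open>K\<close>, from the upper
   bound of \<open>1 / g\<close>.\<close>
 define m where "m = 1 / Bi"
 have m: "m > 0" "!!x. x \<in> K ==> m \<le> g x"
 proof -
  show "m > 0" unfolding m_def using Bi by simp
  fix x assume x: "x \<in> K"
  hence "g x > 0" using g(3) K(2) by blast
  moreover have "1 / g x \<le> Bi" by (rule order_trans[OF abs_ge_self Bi(2)[OF x]])
  ultimately show "m \<le> g x" unfolding m_def using Bi(1) by (simp add: field_simps)
 qed
 obtain F where F: "!!k. smooth n U (F k)" "!!k x. x \<in> K ==> \<bar>F k x - f x\<bar> \<le> 1" "!!x. x \<in> K ==> (\<lambda>k. F k x) \<longlonglongrightarrow> f x"
  "(\<lambda>k. LINT x:K|leb n. \<bar>partial i (F k) x - Gf x i\<bar>) \<longlonglongrightarrow> 0"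
  using smooth_approximation_L1[OF U f K(1,2) zero_less_one] i by blast
 \<comment> \<open>An error of at most \<open>m / 2\<close> keeps the approximations of
   \<open>g\<close> positive on \<open>K\<close>; the 1 bounds them from above, so that all values
   lie in the compact rectangle \<open>R\<close>.\<close>
 have m1: "min 1 (m / 2) > 0" using m(1) by simp
 obtain G where G: "!!k. smooth n U (G k)" "!!k x. x \<in> K ==> \<bar>G k x - g x\<bar> \<le> min 1 (m / 2)" "!!x. x \<in> K ==> (\<lambda>k. G k x) \<longlonglongrightarrow> g x"
  "(\<lambda>k. LINT x:K|leb n. \<bar>partial i (G k) x - Gg x i\<bar>) \<longlonglongrightarrow> 0"
  using smooth_approximation_L1[OF U g(1,2) K(1,2) m1] i by blast
 have Gpos: "G k x \<ge> m / 2" if "x \<in> K" for k x using G(2)[OF that, of k] m(2)[OF that] by linarith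
 have cF: "continuous_on U (F k)" "continuous_on U (G k)" for k using smooth_cont[OF _ sub] F(1) G(1) by auto
 have cF': "continuous_on U (partial i (F k))" "continuous_on U (partial i (G k))" for k
  using smooth_cont[OF smooth_partial[OF _ i] sub] F(1) G(1) by auto
 define R where "R = {- (Bf + 1) .. Bf + 1} \<times> {m / 2 .. Bg + 1}"
 have Rc: "compact R" unfolding R_def by (intro compact_Times compact_Icc)
 have Rs: "R \<subseteq> UNIV \<times> {0<..}" unfolding R_def using m(1) by auto
 have inR: "(F k x, G k x) \<in> R" if "x \<in> K" for k x
  unfolding R_def using F(2)[OF that, of k] G(2)[OF that, of k] Gpos[OF that, of k] Bf(2)[OF that] Bg(2)[OF that] by auto
 have bnd: "\<exists>B. \<forall>z\<in>R. \<bar>\<Psi> (fst z) (snd z)\<bar> \<le> B" if "cont2 \<Psi>" for \<Psi>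
 proof -
  have "compact ((\<lambda>z. \<Psi> (fst z) (snd z)) ` R)" by (rule compact_continuous_image[OF continuous_on_subset[OF that Rs] Rc])
  then obtain B where "\<forall>y\<in>(\<lambda>z. \<Psi> (fst z) (snd z)) ` R. norm y \<le> B" using compact_imp_bounded bounded_iff by blast
  thus ?thesis by (intro exI[of _ B]) simp
 qed
 have ptPsi: "(\<lambda>k. \<Psi> (F k x) (G k x)) \<longlonglongrightarrow> \<Psi> (f x) (g x)"
  if x: "x \<in> K" and cP: "cont2 \<Psi>" for x \<Psi>
 proof -
  have "(\<lambda>k. (F k x, G k x)) \<longlonglongrightarrow> (f x, g x)" by (intro tendsto_Pair F(3) G(3) x)
  moreover have "(f x, g x) \<in> UNIV \<times> {0<..}" using g(3) x K(2) by auto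
  moreover have "\<forall>\<^sub>F k in sequentially. (F k x, G k x) \<in> UNIV \<times> {0<..}" using inR[OF x] Rs by (intro always_eventually) blast
  ultimately have "(\<lambda>k. (\<lambda>z. \<Psi> (fst z) (snd z)) (F k x, G k x)) \<longlonglongrightarrow> (\<lambda>z. \<Psi> (fst z) (snd z)) (f x, g x)"
   by (rule continuous_on_tendsto_compose[OF cP])
  thus ?thesis by simp
 qed
 have cPK: "continuous_on K (\<lambda>x. \<Psi> (F k x) (G k x))"
  if cP: "cont2 \<Psi>" for k \<Psi>
  by (rule continuous_on_comp2[OF cP continuous_on_subset[OF cF(1) K(2)] continuous_on_subset[OF cF(2) K(2)]])
   (use Gpos m(1) in \<open>fastforce intro: less_le_trans[of 0 "m / 2"]\<close>)
 have zb: "\<exists>B. \<forall>x\<in>K. \<bar>\<eta> x\<bar> \<le> B" if "continuous_on U \<eta>" for \<eta> :: "vec => real"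
  using compact_bounded_real[OF K(1) continuous_on_subset[OF that K(2)]] by metis
 have lim: "(\<lambda>k. LINT x:K|leb n. hk k x * (\<Psi> (F k x) (G k x) * \<eta> x)) \<longlonglongrightarrow> (LINT x:K|leb n. h x * (\<Psi> (f x) (g x) * \<eta> x))"
  if cP: "cont2 \<Psi>" and ce: "continuous_on U \<eta>"
   and h: "set_integrable (leb n) K h" "!!k. set_integrable (leb n) K (hk k)" "(\<lambda>k. LINT x:K|leb n. \<bar>hk k x - h x\<bar>) \<longlonglongrightarrow> 0"
  for \<Psi> and \<eta> h hk
 proof -
  obtain B1 where B1: "!!z. z \<in> R ==> \<bar>\<Psi> (fst z) (snd z)\<bar> \<le> B1" using bnd[OF cP] by blast
  obtain B2 where B2: "!!x. x \<in> K ==> \<bar>\<eta> x\<bar> \<le> B2" using zb[OF ce] by blast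
  show ?thesis
  proof (rule set_integral_product_tendsto[where B="B1 * B2", OF KL _ _ _ h])
   show "(\<lambda>x. indicator K x * (\<Psi> (F k x) (G k x) * \<eta> x)) \<in> borel_measurable (leb n)" for k
    by (intro continuous_ind_measurable[OF Kb] continuous_on_mult cPK[OF cP] continuous_on_subset[OF ce K(2)])
   show "\<bar>\<Psi> (F k x) (G k x) * \<eta> x\<bar> \<le> B1 * B2" if "x \<in> K" for k x
    unfolding abs_mult using B1[OF inR[OF that, of k]] B2[OF that] by (intro mult_mono) auto
   show "(\<lambda>k. \<Psi> (F k x) (G k x) * \<eta> x) \<longlonglongrightarrow> \<Psi> (f x) (g x) * \<eta> x" if "x \<in> K" for x
    by (intro tendsto_mult ptPsi[OF that cP] tendsto_const)
  qed
 qed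
 have sFi: "set_integrable (leb n) K (partial i (F k))" "set_integrable (leb n) K (partial i (G k))" for k
  by (intro set_integrable_continuous[OF K(1)] continuous_on_subset[OF cF'(1) K(2)] continuous_on_subset[OF cF'(2) K(2)])+
 have l1: "(\<lambda>k. LINT x:K|leb n. partial i (F k) x * (\<Phi>1 (F k x) (G k x) * q x)) \<longlonglongrightarrow> (LINT x:K|leb n. Gf x i * (\<Phi>1 (f x) (g x) * q x))"
  by (rule lim[OF c(2) zc(1) L1_locD[OF Lf K(1,2)] sFi(1) F(4)])
 have l2: "(\<lambda>k. LINT x:K|leb n. partial i (G k) x * (\<Phi>2 (F k x) (G k x) * q x)) \<longlonglongrightarrow> (LINT x:K|leb n. Gg x i * (\<Phi>2 (f x) (g x) * q x))"
  by (rule lim[OF c(3) zc(1) L1_locD[OF Lg K(1,2)] sFi(2) G(4)])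
 have l0: "(\<lambda>k. LINT x:K|leb n. 1 * (\<Phi> (F k x) (G k x) * partial i q x)) \<longlonglongrightarrow> (LINT x:K|leb n. 1 * (\<Phi> (f x) (g x) * partial i q x))"
  by (rule lim[OF c(1) zc(2)[OF i]]) (use set_integrable_const_compact[OF K(1)] in \<open>auto simp: set_integral_alt\<close>)
 have tI: "set_integrable (leb n) K (\<lambda>x. h x * (\<Psi> (F k x) (G k x) * q x))"
  if "set_integrable (leb n) K h" "cont2 \<Psi>" for \<Psi> and h k
  by (intro set_integrable_times_continuous[OF that(1) K(1)] continuous_on_mult cPK that(2) continuous_on_subset[OF zc(1) K(2)])
 have id: "(LINT x:K|leb n. 1 * (\<Phi> (F k x) (G k x) * partial i q x))
   = - ((LINT x:K|leb n. partial i (F k) x * (\<Phi>1 (F k x) (G k x) * q x)) + (LINT x:K|leb n. partial i (G k) x * (\<Phi>2 (F k x) (G k x) * q x)))" for k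
 proof -
  \<comment> \<open>Positivity of the approximation is known on \<open>K\<close> only, so the
    classical rule is used on this open set between \<open>K\<close> and \<open>U\<close>.\<close>
  define Y where "Y = {x \<in> U. G k x > 0}"
  have Uo: "openin (Rn n) Y" unfolding Y_def by (rule openin_superlevel[OF U cF(2)])
  have Us: "Y \<subseteq> U" unfolding Y_def by blast
  have KU: "K \<subseteq> Y" unfolding Y_def using K(2) Gpos m(1) by (fastforce intro: less_le_trans[of 0 "m / 2"])
  have zU: "q \<in> Cc_smooth n Y" by (rule Cc_smooth_restrict[OF U Uo Us z K(1) KU K(3)])
  have cU: "continuous_on Y (F k)" "continuous_on Y (G k)"
   using cF Us continuous_on_subset by blast+
  have cU': "continuous_on Y (partial j (F k))" "continuous_on Y (partial j (G k))" if "j < n" for j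
   using smooth_cont[OF smooth_partial[OF _ that] sub] F(1) G(1) continuous_on_subset[OF _ Us] by blast+
  have Upos: "G k x > 0" if "x \<in> Y" for x using that unfolding Y_def by simp
  have "has_weak_grad n Y (\<lambda>x. \<Phi> (F k x) (G k x)) (\<lambda>x j. \<Phi>1 (F k x) (G k x) * partial j (F k) x + \<Phi>2 (F k x) (G k x) * partial j (G k) x)"
  proof (rule has_weak_grad_C1[OF Uo])
   show "continuous_on Y (\<lambda>x. \<Phi> (F k x) (G k x))" by (rule continuous_on_comp2[OF c(1) cU Upos])
   show "continuous_on Y (\<lambda>x. \<Phi>1 (F k x) (G k x) * partial j (F k) x + \<Phi>2 (F k x) (G k x) * partial j (G k) x)" if "j < n" for j
    by (intro continuous_on_add continuous_on_mult continuous_on_comp2[OF c(2) cU Upos] continuous_on_comp2[OF c(3) cU Upos] cU'[OF that])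
   fix x j assume x: "x \<in> Y" and j: "j < n"
   have xO: "x \<in> U" using x Us by blast
   have "((\<lambda>t. \<Phi> (F k (x(j := t))) (G k (x(j := t)))) has_real_derivative
     \<Phi>1 (F k (x(j := x j))) (G k (x(j := x j))) * partial j (F k) x + \<Phi>2 (F k (x(j := x j))) (G k (x(j := x j))) * partial j (G k) x) (at (x j))"
    by (rule d[OF smooth_deriv[OF F(1) xO j] smooth_deriv[OF G(1) xO j]]) (use Upos[OF x] in simp)
   thus "((\<lambda>t. \<Phi> (F k (x(j := t))) (G k (x(j := t)))) has_real_derivative
     \<Phi>1 (F k x) (G k x) * partial j (F k) x + \<Phi>2 (F k x) (G k x) * partial j (G k) x) (at (x j))" by simp
  qed
  hence "(LINT x:Y|leb n. \<Phi> (F k x) (G k x) * partial i q x)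
   = - (LINT x:Y|leb n. (\<Phi>1 (F k x) (G k x) * partial i (F k) x + \<Phi>2 (F k x) (G k x) * partial i (G k) x) * q x)"
   using i zU unfolding has_weak_grad_def by blast
  moreover have "(LINT x:Y|leb n. \<Phi> (F k x) (G k x) * partial i q x) = (LINT x:K|leb n. \<Phi> (F k x) (G k x) * partial i q x)"
   by (rule set_integral_supp(2)[OF KU]) (use K(4)[OF _ _ i] Us in auto)
  moreover have "(LINT x:Y|leb n. (\<Phi>1 (F k x) (G k x) * partial i (F k) x + \<Phi>2 (F k x) (G k x) * partial i (G k) x) * q x)
    = (LINT x:K|leb n. (\<Phi>1 (F k x) (G k x) * partial i (F k) x + \<Phi>2 (F k x) (G k x) * partial i (G k) x) * q x)"
   by (rule set_integral_supp(2)[OF KU]) (use K(3) Us in auto)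
  moreover have "(LINT x:K|leb n. (\<Phi>1 (F k x) (G k x) * partial i (F k) x + \<Phi>2 (F k x) (G k x) * partial i (G k) x) * q x)
    = (LINT x:K|leb n. partial i (F k) x * (\<Phi>1 (F k x) (G k x) * q x)) + (LINT x:K|leb n. partial i (G k) x * (\<Phi>2 (F k x) (G k x) * q x))"
   unfolding set_integral_add(2)[OF tI[OF sFi(1) c(2)] tI[OF sFi(2) c(3)], symmetric] by (simp add: algebra_simps)
  ultimately show ?thesis by simp
 qed
 have "(LINT x:K|leb n. 1 * (\<Phi> (f x) (g x) * partial i q x))
   = - ((LINT x:K|leb n. Gf x i * (\<Phi>1 (f x) (g x) * q x)) + (LINT x:K|leb n. Gg x i * (\<Phi>2 (f x) (g x) * q x)))"
  using LIMSEQ_unique[OF l0] tendsto_minus[OF tendsto_add[OF l1 l2]] unfolding id .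
 also have "(LINT x:K|leb n. Gf x i * (\<Phi>1 (f x) (g x) * q x)) + (LINT x:K|leb n. Gg x i * (\<Phi>2 (f x) (g x) * q x))
   = (LINT x:K|leb n. (\<Phi>1 (f x) (g x) * Gf x i + \<Phi>2 (f x) (g x) * Gg x i) * q x)"
 proof -
  have si: "set_integrable (leb n) K (\<lambda>x. h x * (\<Psi> (f x) (g x) * q x))"
   if h: "set_integrable (leb n) K h" and cP: "cont2 \<Psi>" for h \<Psi>
  proof (rule set_integrable_times_continuous[OF h K(1)])
   show "continuous_on K (\<lambda>x. \<Psi> (f x) (g x) * q x)"
    by (rule continuous_on_mult[OF continuous_on_subset[OF cc[OF cP] K(2)] continuous_on_subset[OF zc(1) K(2)]])
  qed
  from set_integral_add(2)[OF si[OF L1_locD[OF Lf K(1,2)] c(2)] si[OF L1_locD[OF Lg K(1,2)] c(3)], symmetric] show ?thesis by (simp add: algebra_simps)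
 qed
 also have "(LINT x:K|leb n. 1 * (\<Phi> (f x) (g x) * partial i q x)) = (LINT x:U|leb n. \<Phi> (f x) (g x) * partial i q x)"
  using set_integral_supp(2)[OF K(2), of "\<lambda>x. \<Phi> (f x) (g x) * partial i q x"] K(4)[OF _ _ i] by simp
 also have "(LINT x:K|leb n. (\<Phi>1 (f x) (g x) * Gf x i + \<Phi>2 (f x) (g x) * Gg x i) * q x)
   = (LINT x:U|leb n. (\<Phi>1 (f x) (g x) * Gf x i + \<Phi>2 (f x) (g x) * Gg x i) * q x)"
  using set_integral_supp(2)[OF K(2), of "\<lambda>x. (\<Phi>1 (f x) (g x) * Gf x i + \<Phi>2 (f x) (g x) * Gg x i) * q x"] K(3) by simp
 finally show "(LINT x:U|leb n. \<Phi> (f x) (g x) * partial i q x)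
   = - (LINT x:U|leb n. (\<Phi>1 (f x) (g x) * Gf x i + \<Phi>2 (f x) (g x) * Gg x i) * q x)" .
qed

section \<open>Compactly supported functions and their gradients\<close>

definition LpK :: "nat => real => vec set => (vec => vec) => bool" where
 "LpK n p K \<xi> \<longleftrightarrow> (\<forall>i<n. (\<lambda>x. indicator K x * \<xi> x i) \<in> borel_measurable (leb n) \<and> set_integrable (leb n) K (\<lambda>x. \<bar>\<xi> x i\<bar> powr p))"

lemma LpK_diff:
 assumes p: "p \<ge> 1" and 1: "LpK n p K \<xi>" and 2: "LpK n p K \<eta>"
 shows "LpK n p K (\<lambda>x i. \<xi> x i - \<eta> x i)"
 unfolding LpK_def
proof (intro allI impI conjI)
 fix i assume i: "i < n"
 have m: "(\<lambda>x. indicator K x * \<xi> x i) \<in> borel_measurable (leb n)" "(\<lambda>x. indicator K x * \<eta> x i) \<in> borel_measurable (leb n)"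
  using 1 2 i unfolding LpK_def by auto
 have "(\<lambda>x. indicator K x * \<xi> x i - indicator K x * \<eta> x i) \<in> borel_measurable (leb n)" using m by (rule borel_measurable_diff)
 thus "(\<lambda>x. indicator K x * (\<xi> x i - \<eta> x i)) \<in> borel_measurable (leb n)" by (simp add: right_diff_distrib)
 have e: "indicator K x * \<bar>f\<bar> powr p = \<bar>indicator K x * f\<bar> powr p" for x and f :: real
  by (cases "x \<in> K") auto
 have i12: "integrable (leb n) (\<lambda>x. \<bar>indicator K x * \<xi> x i\<bar> powr p)" "integrable (leb n) (\<lambda>x. \<bar>indicator K x * \<eta> x i\<bar> powr p)"
  using 1 2 i unfolding LpK_def set_integrable_alt e by auto
 from integrable_powr_diff[OF p m(1) i12(1) m(2) i12(2)]
 show "set_integrable (leb n) K (\<lambda>x. \<bar>\<xi> x i - \<eta> x i\<bar> powr p)"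
  unfolding set_integrable_alt e by (simp add: right_diff_distrib)
qed

lemma LpK_continuous:
 assumes K: "compactin (Rn n) K" and c: "!!i. i < n ==> continuous_on K (\<lambda>x. \<xi> x i)" and p: "p > 0"
 shows "LpK n p K \<xi>"
 unfolding LpK_def
proof (intro allI impI conjI)
 fix i assume i: "i < n"
 show "(\<lambda>x. indicator K x * \<xi> x i) \<in> borel_measurable (leb n)"
  by (rule continuous_ind_measurable[OF borel_compact_Rn[OF K] c[OF i]])
 show "set_integrable (leb n) K (\<lambda>x. \<bar>\<xi> x i\<bar> powr p)"
  using p by (intro set_integrable_continuous[OF K] continuous_on_powr' continuous_on_rabs c[OF i] continuous_on_const) auto
qed

lemma has_weak_grad_LpK:
 assumes G: "has_weak_grad n U f G" and K: "compactin (Rn n) K" "K \<subseteq> U"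
  and "!!i. i < n ==> set_integrable (leb n) K (\<lambda>x. \<bar>G x i\<bar> powr p)"
 shows "LpK n p K G"
 using assms L1_locD[OF _ K] unfolding LpK_def has_weak_grad_def set_integrable_alt
 by (blast intro: borel_measurable_integrable)

theorem smooth_approximation_Cc:
 assumes U: "openin (Rn n) U" and f: "continuous_on U f" and G: "has_weak_grad n U f G" and p: "p \<ge> 1"
  and Gp: "!!C. compactin (Rn n) C ==> C \<subseteq> U ==> LpK n p C G"
  and K0: "compactin (Rn n) K0" "K0 \<subseteq> U" "!!x. x \<in> U ==> x \<notin> K0 ==> f x = 0"
 shows "\<exists>F K. compactin (Rn n) K \<and> K \<subseteq> U \<and> K0 \<subseteq> K \<and> (\<forall>k. F k \<in> Cc_smooth n U) \<and>
  (\<forall>k. \<forall>x\<in>U. x \<notin> K --> F k x = 0 \<and> (\<forall>i<n. partial i (F k) x = 0)) \<and>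
  (\<forall>e>0. \<forall>\<^sub>F k in sequentially. \<forall>x\<in>K. \<bar>F k x - f x\<bar> \<le> e) \<and>
  (\<forall>k. LpK n p K (\<lambda>x i. partial i (F k) x - G x i)) \<and>
  (\<forall>i<n. (\<lambda>k. LINT x:K|leb n. \<bar>partial i (F k) x - G x i\<bar> powr p) \<longlonglongrightarrow> 0)"
proof -
 have sub: "U \<subseteq> En n" by (rule openin_Rn_subset[OF U])
 obtain d K where K: "d > 0" "compactin (Rn n) K" "K \<subseteq> U" "!!x. x \<in> K0 ==> nbox n x d \<subseteq> K"
  using compactin_thickening[OF K0(1) U K0(2)] by blast
 have K0K: "K0 \<subseteq> K"
 proof
  fix x assume x: "x \<in> K0"
  hence "x \<in> nbox n x d" using K0 sub K(1) by (intro nbox_centre) auto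
  thus "x \<in> K" using K(4)[OF x] by blast
 qed
 have Gp': "set_integrable (leb n) C (\<lambda>x. \<bar>G x i\<bar> powr p)" if "i < n" "compactin (Rn n) C" "C \<subseteq> U" for i C
  using Gp[OF that(2,3)] that(1) unfolding LpK_def by blast
 obtain F where F: "!!k. smooth n U (F k)"
  "!!e. e > 0 ==> \<forall>\<^sub>F k in sequentially. \<forall>x\<in>K. \<bar>F k x - f x\<bar> \<le> e"
  "!!i. i < n ==> (\<lambda>k. LINT x:K|leb n. \<bar>partial i (F k) x - G x i\<bar> powr p) \<longlonglongrightarrow> 0"
  "!!K0 d. d > 0 ==> (!!x. x \<in> K0 ==> nbox n x d \<subseteq> K) ==> (!!x. x \<in> U ==> x \<notin> K0 ==> f x = 0) ==>
   \<forall>\<^sub>F k in sequentially. \<forall>x\<in>U. x \<notin> K --> F k x = 0"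
 proof (rule smooth_approximation[OF U f G p Gp' K(2,3)], assumption, assumption, assumption, goal_cases)
  case (1 F)
  show ?case by (rule 1(1)[OF 1(2,3,4,5)])
 qed
 have "\<forall>\<^sub>F k in sequentially. \<forall>x\<in>U. x \<notin> K --> F k x = 0" by (rule F(4)[OF K(1) K(4) K0(3)])
 then obtain N where N: "!!k x. k \<ge> N ==> x \<in> U ==> x \<notin> K ==> F k x = 0" unfolding eventually_sequentially by blast
 \<comment> \<open>Dropping the first \<open>N\<close> terms makes every approximation, not only the
   late ones, a test function supported in \<open>K\<close>.\<close>
 define F' where "F' k = F (k + N)" for k
 have z: "F' k x = 0" if "x \<in> U" "x \<notin> K" for k x using N[of "k + N" x] that unfolding F'_def by simp
 have sm: "smooth n U (F' k)" for k unfolding F'_def by (rule F(1))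
 have 1: "F' k \<in> Cc_smooth n U" for k by (rule Cc_smooth_supportI[OF U sm K(2,3) z])
 have 2: "partial i (F' k) x = 0" if "x \<in> U" "x \<notin> K" "i < n" for i k x
  by (rule deriv_vanishes[OF U K(2) that(3) z that(1,2) smooth_deriv[OF sm that(1,3)]])
 have 3: "\<forall>\<^sub>F k in sequentially. \<forall>x\<in>K. \<bar>F' k x - f x\<bar> \<le> e" if "e > 0" for e
  using F(2)[OF that] unfolding F'_def by (rule sequentially_offset)
 have 4: "LpK n p K (\<lambda>x i. partial i (F' k) x - G x i)" for k
 proof (rule LpK_diff[OF p _ Gp[OF K(2,3)]], rule LpK_continuous[OF K(2)])
  show "continuous_on K (partial i (F' k))" if "i < n" for i
   by (rule continuous_on_subset[OF smooth_cont[OF smooth_partial[OF sm that] sub] K(3)])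
 qed (use p in simp)
 have 5: "(\<lambda>k. LINT x:K|leb n. \<bar>partial i (F' k) x - G x i\<bar> powr p) \<longlonglongrightarrow> 0" if "i < n" for i
  unfolding F'_def by (rule LIMSEQ_ignore_initial_segment[OF F(3)[OF that]])
 show ?thesis using K(2,3) K0K z 1 2 3 4 5 by (intro exI[of _ F'] exI[of _ K]) auto
qed

lemma Cc_iff:
 assumes U: "openin (Rn n) U"
 shows "f \<in> Cc n U \<longleftrightarrow> continuous_on U f \<and> (\<exists>K. compactin (Rn n) K \<and> K \<subseteq> U \<and> (\<forall>x\<in>U. x \<notin> K --> f x = 0))"
proof -
 have sub: "U \<subseteq> En n" by (rule openin_Rn_subset[OF U])
 hence "{x \<in> U. f x \<noteq> 0} \<subseteq> En n" by blast
 from compactly_inside_iff_ex[OF this sub] show ?thesis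
  unfolding Cc_def compactly_supported_def using cont_iff[OF sub] by (auto simp: subset_iff)
qed

lemma W1p_LpK:
 assumes U: "openin (Rn n) U" and f: "f \<in> W1p n p U" and K: "compactin (Rn n) K" "K \<subseteq> U"
 shows "has_weak_grad n U f (weak_grad n U f)" "LpK n p K (weak_grad n U f)"
proof -
 obtain G where G: "has_weak_grad n U f G" "!!i. i < n ==> (\<lambda>x. G x i) \<in> Lp n p U"
  using f unfolding W1p_def by blast
 show w: "has_weak_grad n U f (weak_grad n U f)" by (rule has_weak_grad_weak_grad[OF G(1)])
 show "LpK n p K (weak_grad n U f)"
 proof (rule has_weak_grad_LpK[OF w K])
  fix i assume i: "i < n"
  have "set_integrable (leb n) U (\<lambda>x. \<bar>G x i\<bar> powr p)" using G(2)[OF i] unfolding Lp_def by blast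
  hence "set_integrable (leb n) K (\<lambda>x. \<bar>G x i\<bar> powr p)" by (rule set_integrable_subset[OF _ leb_compactin[OF K(1)] K(2)])
  thus "set_integrable (leb n) K (\<lambda>x. \<bar>weak_grad n U f x i\<bar> powr p)"
   by (rule set_integrable_AE(1)) (use weak_grad_AE_eq[OF U G(1)] K(2) i in \<open>auto elim!: eventually_mono\<close>)
 qed
qed

lemma W1p_CcI:
 assumes U: "openin (Rn n) U" and f: "continuous_on U f" and G: "has_weak_grad n U f G" and p: "p > 0"
  and K: "compactin (Rn n) K" "K \<subseteq> U" "!!x. x \<in> U ==> x \<notin> K ==> f x = 0" and GK: "LpK n p K G"
 shows "f \<in> W1p n p U \<inter> Cc n U"
proof
 show "f \<in> Cc n U" unfolding Cc_iff[OF U] using f K by blast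
 have cK: "continuous_on K (\<lambda>x. \<bar>f x\<bar> powr p)"
  using p by (intro continuous_on_powr' continuous_on_rabs continuous_on_subset[OF f K(2)] continuous_on_const) auto
 have fL: "f \<in> Lp n p U" unfolding Lp_def
 proof (intro CollectI conjI)
  show "set_borel_measurable (leb n) U f"
   unfolding set_borel_measurable_def using continuous_ind_measurable[OF borel_open_Rn[OF U] f] by simp
  show "set_integrable (leb n) U (\<lambda>x. \<bar>f x\<bar> powr p)"
   using set_integral_supp(1)[OF K(2), of "\<lambda>x. \<bar>f x\<bar> powr p"] K(3) set_integrable_continuous[OF K(1) cK] by simp
 qed
 \<comment> \<open>\<open>W1p\<close> asks for integrability of the gradient over all of
   \<open>U\<close>; this version is controlled by the hypothesis on \<open>K\<close> and differs
   from \<open>G\<close> on a null set only.\<close>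
 define G' where "G' x i = indicator K x * G x i" for x i
 have ae: "AE x in leb n. x \<in> U - K --> (\<forall>i<n. G x i = 0)" by (rule weak_grad_vanishes[OF U f G K(1) K(3)])
 have "AE x in leb n. x \<in> U --> (\<forall>i<n. G x i = G' x i)"
  using ae by eventually_elim (auto simp: G'_def indicator_def)
 hence w: "has_weak_grad n U f G'" by (rule has_weak_grad_AE[OF G _ U])
 have "(\<lambda>x. G' x i) \<in> Lp n p U" if i: "i < n" for i unfolding Lp_def
 proof (intro CollectI conjI)
  have "(\<lambda>x. indicator U x * G' x i) = (\<lambda>x. indicator K x * G x i)" using K(2) by (auto simp: G'_def indicator_def fun_eq_iff)
  thus "set_borel_measurable (leb n) U (\<lambda>x. G' x i)"
   unfolding set_borel_measurable_def using GK i unfolding LpK_def by simp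
  have "set_integrable (leb n) K (\<lambda>x. \<bar>G' x i\<bar> powr p)"
   using GK i unfolding LpK_def by (subst set_integrable_cong[OF refl refl, of K _ "\<lambda>x. \<bar>G x i\<bar> powr p"]) (auto simp: G'_def)
  thus "set_integrable (leb n) U (\<lambda>x. \<bar>G' x i\<bar> powr p)"
   using set_integral_supp(1)[OF K(2), of "\<lambda>x. \<bar>G' x i\<bar> powr p"] p by (simp add: G'_def)
 qed
 thus "f \<in> W1p n p U" unfolding W1p_def using fL w by blast
qed

lemma Cc_smooth_W1p_Cc:
 assumes U: "openin (Rn n) U" and f: "f \<in> Cc_smooth n U" and p: "p > 0"
 shows "f \<in> W1p n p U \<inter> Cc n U"
proof -
 obtain K where K: "compactin (Rn n) K" "K \<subseteq> U" "!!x. x \<in> U ==> x \<notin> K ==> f x = 0" using Cc_smooth_supp[OF U f] by metis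
 have sm: "smooth n U f" using f unfolding Cc_smooth_def by simp
 note c = Cc_smooth_continuous[OF U f]
 show ?thesis
  by (rule W1p_CcI[OF U c(1) has_weak_grad_smooth[OF U sm] p K LpK_continuous[OF K(1) continuous_on_subset[OF c(2) K(2)] p]]) auto
qed

text \<open>The cut-off is the mollified indicator function of a neighbourhood.\<close>

lemma ex_cutoff:
 assumes U: "openin (Rn n) U" and K: "compactin (Rn n) K" "K \<subseteq> U"
 obtains q where "q \<in> Cc_smooth n U" "!!x. x \<in> K ==> q x = 1"
proof -
 have sub: "U \<subseteq> En n" by (rule openin_Rn_subset[OF U])
 obtain r K1 where K1: "r > 0" "compactin (Rn n) K1" "K1 \<subseteq> U" "!!x. x \<in> K ==> nbox n x r \<subseteq> K1"
  using compactin_thickening[OF K(1) U K(2)] by blast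
 obtain r2 K2 where K2: "r2 > 0" "compactin (Rn n) K2" "K2 \<subseteq> U" "!!x. x \<in> K1 ==> nbox n x r2 \<subseteq> K2"
  using compactin_thickening[OF K1(2) U K1(3)] by blast
 obtain k :: nat where k: "1 / real (Suc k) < min r r2" using K1(1) K2(1) nat_approx_posE[of "min r r2"] by auto
 define f where "f = (indicator K1 :: vec => real)"
 have f: "integrable (Mn n) f" unfolding f_def using sets_compactin[OF K1(2)] emeasure_compact_finite[OF K1(2)]
  by (intro integrable_real_indicator) auto
 have "moll n k f \<in> Cc_smooth n U"
 proof (rule Cc_smooth_supportI[OF U _ K2(2,3)])
  show "smooth n U (moll n k f)" unfolding moll_mollg by (rule mollg_smooth[OF U f mollk_test1])
  fix x assume x: "x \<in> U" "x \<notin> K2"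
  have "\<bar>moll n k f x - 0\<bar> \<le> 0"
  proof (rule moll_close[OF f])
   fix y assume y: "y \<in> nbox n x (1 / real (Suc k))"
   have "y \<notin> K1"
   proof
    assume "y \<in> K1"
    moreover have "x \<in> nbox n y r2"
    proof -
     have "\<bar>x i - y i\<bar> < r2" if "i < n" for i
     proof -
      have "\<bar>y i - x i\<bar> < 1 / real (Suc k)" using y that by (simp add: nbox_def)
      thus ?thesis using k by linarith
     qed
     thus ?thesis using x sub by (auto simp: nbox_def)
    qed
    ultimately show False using K2(4) x(2) by blast
   qed
   thus "\<bar>f y - 0\<bar> \<le> 0" by (simp add: f_def)
  qed
  thus "moll n k f x = 0" by simp
 qed
 moreover have "moll n k f x = 1" if x: "x \<in> K" for x
 proof -
  have "\<bar>moll n k f x - 1\<bar> \<le> 0"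
  proof (rule moll_close[OF f])
   fix y assume "y \<in> nbox n x (1 / real (Suc k))"
   hence "y \<in> nbox n x r" using nbox_mono[of "1 / real (Suc k)" r n x] k by auto
   hence "y \<in> K1" using K1(4)[OF x] by blast
   thus "\<bar>f y - 1\<bar> \<le> 0" by (simp add: f_def)
  qed
  thus ?thesis by simp
 qed
 ultimately show ?thesis by (rule that)
qed

lemma Cc_smooth_cmult:
 assumes U: "openin (Rn n) U" and f: "f \<in> Cc_smooth n U"
 shows "(\<lambda>x. c * f x) \<in> Cc_smooth n U"
proof -
 obtain K where K: "compactin (Rn n) K" "K \<subseteq> U" "!!x. x \<in> U ==> x \<notin> K ==> f x = 0" using Cc_smooth_supp[OF U f] by metis
 have "smooth n U (\<lambda>x. c * f x)"
 proof (rule smooth_coinduct[OF U, of _ "{\<lambda>x. c * h x | h. smooth n U h}"])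
  show "(\<lambda>x. c * f x) \<in> {\<lambda>x. c * h x | h. smooth n U h}" using f unfolding Cc_smooth_def by blast
  show "continuous_on U h" if h: "h \<in> {\<lambda>x. c * h x | h. smooth n U h}" for h
  proof -
   obtain g where "h = (\<lambda>x. c * g x)" "smooth n U g" using h by blast
   thus ?thesis using smooth_cont[OF _ openin_Rn_subset[OF U]] by (auto intro: continuous_on_mult_left)
  qed
  fix h i assume h: "h \<in> {\<lambda>x. c * h x | h. smooth n U h}" and i: "i < n"
  obtain g where g: "h = (\<lambda>x. c * g x)" "smooth n U g" using h by blast
  have in1: "(\<lambda>x. c * partial i g x) \<in> {\<lambda>x. c * h x | h. smooth n U h}" using smooth_partial[OF g(2) i] by blast
  show "\<exists>h'\<in>{\<lambda>x. c * h x | h. smooth n U h}. \<forall>x\<in>U. ((\<lambda>t. h (x(i := t))) has_real_derivative h' x) (at (x i))"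
   unfolding g(1) by (rule bexI[OF _ in1], rule ballI, rule DERIV_cmult[OF smooth_deriv[OF g(2) _ i]])
 qed
 thus ?thesis by (rule Cc_smooth_supportI[OF U _ K(1,2)]) (use K(3) in simp)
qed

section \<open>Energy forms\<close>

text \<open>Fits Young-type estimates, in which a small coefficient at the fixed function is bought
  by a large coefficient at the quantity tending to zero.\<close>

lemma set_integral_small_tendsto:
 fixes h d :: "nat => vec => real" and f :: "vec => real"
 assumes h: "!!k. set_integrable M K (h k)" and d: "!!k. set_integrable M K (d k)" and f: "set_integrable M K f"
  and dom: "!!e. e > 0 ==> \<exists>A. \<forall>k x. \<bar>h k x\<bar> \<le> A * d k x + e * f x"
  and lim: "(\<lambda>k. LINT x:K|M. d k x) \<longlonglongrightarrow> 0"
 shows "(\<lambda>k. LINT x:K|M. \<bar>h k x\<bar>) \<longlonglongrightarrow> 0"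
proof (rule LIMSEQ_I)
 fix r :: real assume r: "r > 0"
 define I where "I = (LINT x:K|M. f x)"
 define e where "e = r / (2 * (\<bar>I\<bar> + 1))"
 have e: "e > 0" "e * \<bar>I\<bar> < r / 2" using r unfolding e_def by (auto simp: field_simps intro: add_nonneg_pos)
 obtain A where A: "!!k x. \<bar>h k x\<bar> \<le> A * d k x + e * f x" using dom[OF e(1)] by blast
 have le: "(LINT x:K|M. \<bar>h k x\<bar>) \<le> A * (LINT x:K|M. d k x) + e * I" for k
 proof -
  have 1: "set_integrable M K (\<lambda>x. A * d k x)" "set_integrable M K (\<lambda>x. e * f x)"
   using d[of k] f by (auto intro: set_integrable_mult_right)
  have "(LINT x:K|M. \<bar>h k x\<bar>) \<le> (LINT x:K|M. A * d k x + e * f x)"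
   by (rule set_integral_mono[OF set_integrable_abs[OF h] set_integral_add(1)[OF 1]]) (rule A)
  also have "\<dots> = A * (LINT x:K|M. d k x) + e * I" using set_integral_add(2)[OF 1] by (simp add: I_def)
  finally show ?thesis .
 qed
 have "(\<lambda>k. A * (LINT x:K|M. d k x)) \<longlonglongrightarrow> A * 0" by (rule tendsto_mult_left[OF lim])
 hence "\<forall>\<^sub>F k in sequentially. A * (LINT x:K|M. d k x) < r / 2" using r by (intro order_tendstoD(2)) auto
 then obtain N where N: "!!k. k \<ge> N ==> A * (LINT x:K|M. d k x) < r / 2" unfolding eventually_sequentially by blast
 have "norm ((LINT x:K|M. \<bar>h k x\<bar>) - 0) < r" if "k \<ge> N" for k
 proof -
  have "0 \<le> (LINT x:K|M. \<bar>h k x\<bar>)" unfolding set_lebesgue_integral_def by (intro integral_nonneg_AE) auto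
  moreover have "e * I \<le> e * \<bar>I\<bar>" using e(1) by (intro mult_left_mono) auto
  ultimately show ?thesis using le[of k] N[OF that] e(2) by simp
 qed
 thus "\<exists>N. \<forall>k\<ge>N. norm ((LINT x:K|M. \<bar>h k x\<bar>) - 0) < r" by blast
qed

lemma set_integral_tendsto_L1:
 fixes h :: "nat => vec => real" and f :: "vec => real"
 assumes h: "!!k. set_integrable M K (h k)" and f: "set_integrable M K f"
  and lim: "(\<lambda>k. LINT x:K|M. \<bar>h k x - f x\<bar>) \<longlonglongrightarrow> 0"
 shows "(\<lambda>k. LINT x:K|M. h k x) \<longlonglongrightarrow> (LINT x:K|M. f x)"
proof (rule LIM_zero_cancel, rule Lim_null_comparison[OF always_eventually lim], rule allI)
 fix k
 have "norm ((LINT x:K|M. h k x) - (LINT x:K|M. f x)) = \<bar>LINT x:K|M. h k x - f x\<bar>"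
  using set_integral_diff(2)[OF h f] by simp
 also have "\<dots> \<le> (LINT x:K|M. \<bar>h k x - f x\<bar>)" using set_integral_norm_bound[OF set_integral_diff(1)[OF h f], of k] by simp
 finally show "norm ((LINT x:K|M. h k x) - (LINT x:K|M. f x)) \<le> (LINT x:K|M. \<bar>h k x - f x\<bar>)" .
qed

lemma LpK_mult_continuous:
 assumes K: "compactin (Rn n) K" and c: "continuous_on K c" and \<xi>: "LpK n p K \<xi>" and p: "p > 0"
 shows "LpK n p K (\<lambda>x i. c x * \<xi> x i)"
 unfolding LpK_def
proof (intro allI impI conjI)
 fix i assume i: "i < n"
 have m: "(\<lambda>x. indicator K x * \<xi> x i) \<in> borel_measurable (leb n)" and s: "set_integrable (leb n) K (\<lambda>x. \<bar>\<xi> x i\<bar> powr p)"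
  using \<xi> i unfolding LpK_def by auto
 have "(\<lambda>x. (indicator K x * c x) * (indicator K x * \<xi> x i)) \<in> borel_measurable (leb n)"
  by (rule borel_measurable_times[OF continuous_ind_measurable[OF borel_compact_Rn[OF K] c] m])
 moreover have "(\<lambda>x. (indicator K x * c x) * (indicator K x * \<xi> x i)) = (\<lambda>x. indicator K x * (c x * \<xi> x i))"
  by (auto simp: indicator_def fun_eq_iff)
 ultimately show "(\<lambda>x. indicator K x * (c x * \<xi> x i)) \<in> borel_measurable (leb n)" by simp
 have "continuous_on K (\<lambda>x. \<bar>c x\<bar> powr p)" using p by (intro continuous_on_powr' continuous_on_rabs c continuous_on_const) auto
 from set_integrable_times_continuous[OF s K this]
 show "set_integrable (leb n) K (\<lambda>x. \<bar>c x * \<xi> x i\<bar> powr p)" by (simp add: abs_mult powr_mult mult.commute)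
qed

lemma LpK_add:
 assumes p: "p \<ge> 1" and 1: "LpK n p K \<xi>" and 2: "LpK n p K \<eta>" and K: "compactin (Rn n) K"
 shows "LpK n p K (\<lambda>x i. \<xi> x i + \<eta> x i)"
 using LpK_diff[OF p 1 LpK_mult_continuous[OF K continuous_on_const[of K "- 1"] 2]] p by simp

text \<open>At a single point, \<open>F\<close> is the p-th power of \<open>H\<close>, and
  \<open>E b\<close> is the pairing with the field at \<open>b\<close>. These properties, stated for
  the Bregman distance \<open>F \<xi> + (p - 1) * F b - p * E b \<xi>\<close>, are all that the
  variational argument asks of the energy density; the exponent \<open>m\<close> records the
  doubling constant \<open>2 ^ m\<close>.\<close>

locale energy_point =
 fixes n :: nat and p :: real and m :: nat and F :: "vec => real" and E :: "vec => vec => real"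
 assumes F_nonneg: "F \<xi> \<ge> 0"
  and F_hom: "F (\<lambda>i. t * \<xi> i) = \<bar>t\<bar> powr p * F \<xi>"
  and F_local: "(!!i. i < n ==> \<xi> i = q i) ==> F \<xi> = F q"
  and E_local: "(!!i. i < n ==> \<xi> i = q i) ==> E b \<xi> = E b q"
  and E_add: "E b (\<lambda>i. \<xi> i + q i) = E b \<xi> + E b q"
  and E_cmult: "E b (\<lambda>i. t * \<xi> i) = t * E b \<xi>"
  and E_scale: "E (\<lambda>i. t * b i) \<xi> = \<bar>t\<bar> powr (p - 1) * sgn t * E b \<xi>"
  and E_self: "E b b = F b"
  and convex: "F \<xi> + (p - 1) * F b - p * E b \<xi> \<ge> 0"
  and D_mono': "0 \<le> k ==> k \<le> 1 ==> F (\<lambda>i. b i + k * e i) + (p - 1) * F b - p * E b (\<lambda>i. b i + k * e i)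
   \<le> F (\<lambda>i. b i + e i) + (p - 1) * F b - p * E b (\<lambda>i. b i + e i)"
  and D_doubling': "F (\<lambda>i. b i + 2 * e i) + (p - 1) * F b - p * E b (\<lambda>i. b i + 2 * e i)
   \<le> 2 ^ m * (F (\<lambda>i. b i + e i) + (p - 1) * F b - p * E b (\<lambda>i. b i + e i))"

lemma energy_point_zero: "energy_point n p m (\<lambda>\<xi>. 0) (\<lambda>b \<xi>. 0)"
 by standard auto

text \<open>Separates the variational argument from the concrete norms. \<open>F\<close> has its
  properties at every point and agrees with \<open>H powr p\<close> almost everywhere;
  \<open>G\<close> is a fixed weak gradient of \<open>u\<close>, and the equation is assumed for
  smooth test functions.\<close>

locale energy_form =
 fixes n :: nat and U :: "vec set" and p :: real and m :: nat
  and F :: "vec => vec => real" and E :: "vec => vec => vec => real"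
  and V u :: "vec => real" and G :: "vec => vec" and H :: "vec => vec => real"
 assumes p: "p > 1" and U: "openin (Rn n) U" and point: "energy_point n p m (F x) (E x)"
  and F_bound: "compactin (Rn n) K ==> K \<subseteq> U ==> \<exists>C. AE x in leb n. x \<in> K --> (\<forall>\<xi>. F x \<xi> \<le> C * (\<Sum>i<n. \<bar>\<xi> i\<bar> powr p))"
  and F_measurable: "compactin (Rn n) K ==> K \<subseteq> U ==>
   (!!i. i < n ==> (\<lambda>x. indicator K x * X x i) \<in> borel_measurable (leb n)) ==>
   (\<lambda>x. indicator K x * F x (X x)) \<in> borel_measurable (leb n)"
  and E_measurable: "compactin (Rn n) K ==> K \<subseteq> U ==>
   (!!i. i < n ==> (\<lambda>x. indicator K x * X x i) \<in> borel_measurable (leb n)) ==>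
   (!!i. i < n ==> (\<lambda>x. indicator K x * Y x i) \<in> borel_measurable (leb n)) ==>
   (\<lambda>x. indicator K x * E x (X x) (Y x)) \<in> borel_measurable (leb n)"
  and F_H: "AE x in leb n. x \<in> U --> (\<forall>\<xi>. H x \<xi> powr p = F x \<xi>)"
  and V: "V \<in> L1_loc n U" and u: "continuous_on U u" "!!x. x \<in> U ==> u x > 0"
  and G: "has_weak_grad n U u G" "!!K. compactin (Rn n) K ==> K \<subseteq> U ==> LpK n p K G"
  and weak_eq: "\<phi> \<in> Cc_smooth n U ==>
   (LINT x:U|leb n. E x (G x) (\<lambda>i. partial i \<phi> x)) + (LINT x:U|leb n. V x * u x powr (p - 1) * \<phi> x) = 0"
begin

lemmas F_nonneg = energy_point.F_nonneg[OF point] and F_hom = energy_point.F_hom[OF point]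
 and F_local = energy_point.F_local[OF point] and E_local = energy_point.E_local[OF point]
 and E_add = energy_point.E_add[OF point] and E_cmult = energy_point.E_cmult[OF point]
 and E_scale = energy_point.E_scale[OF point] and E_self = energy_point.E_self[OF point]
 and convex = energy_point.convex[OF point] and D_mono' = energy_point.D_mono'[OF point]
 and D_doubling' = energy_point.D_doubling'[OF point]

abbreviation Q :: "(vec => real) => real" where
 "Q \<equiv> Q_fun n p H V U"

definition D :: "vec => vec => vec => real" where
 "D x \<xi> b = F x \<xi> + (p - 1) * F x b - p * E x b \<xi>"

lemma D_nonneg: "D x \<xi> b \<ge> 0"
 unfolding D_def by (rule convex)

lemma D_hom: "D x (\<lambda>i. t * \<xi> i) (\<lambda>i. t * b i) = \<bar>t\<bar> powr p * D x \<xi> b"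
proof -
 have "\<bar>t\<bar> powr (p - 1) * sgn t * t = \<bar>t\<bar> powr p" by (cases "t = 0") (auto simp: powr_diff sgn_if)
 hence "E x (\<lambda>i. t * b i) (\<lambda>i. t * \<xi> i) = \<bar>t\<bar> powr p * E x b \<xi>"
  unfolding E_cmult E_scale by (metis mult.assoc mult.left_commute)
 thus ?thesis unfolding D_def F_hom by (simp add: algebra_simps)
qed

lemma D_diag: "D x b b = 0"
 unfolding D_def E_self by (simp add: algebra_simps)

lemma F_zero: "F x (\<lambda>i. 0) = 0"
 using F_hom[of x 0] p by simp

lemma E_zero: "E x b (\<lambda>i. 0) = 0"
 using E_cmult[of x b 0] by simp

lemma E_diff: "E x b (\<lambda>i. \<xi> i - q i) = E x b \<xi> - E x b q"
 using E_add[of x b "\<lambda>i. \<xi> i - q i" q] by simp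

text \<open>Nonnegativity of the Bregman distance for the multiples of \<open>\<xi>\<close> by
  \<open>t\<close> and by \<open>- t\<close>. A large \<open>t\<close> makes the coefficient at the
  base point small.\<close>

lemma E_young:
 assumes t: "t > 0"
 shows "\<bar>E x b \<xi>\<bar> \<le> t powr (p - 1) * F x \<xi> + (p - 1) / t * F x b"
proof -
 have 1: "r * E x b \<xi> * p \<le> t powr p * F x \<xi> + (p - 1) * F x b" if "\<bar>r\<bar> = t" for r
  using convex[of x "\<lambda>i. r * \<xi> i" b] unfolding F_hom E_cmult that by (simp add: algebra_simps)
 have "t * \<bar>E x b \<xi>\<bar> * 1 \<le> t * \<bar>E x b \<xi>\<bar> * p" using t p by (intro mult_left_mono) auto
 also have "\<dots> \<le> t powr p * F x \<xi> + (p - 1) * F x b"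
  using 1[of t] 1[of "- t"] t by (cases "E x b \<xi> \<ge> 0") auto
 finally have "\<bar>E x b \<xi>\<bar> \<le> (t powr p * F x \<xi> + (p - 1) * F x b) / t" using t by (simp add: field_simps)
 also have "\<dots> = t powr (p - 1) * F x \<xi> + (p - 1) / t * F x b" using t by (simp add: powr_diff field_simps)
 finally show ?thesis .
qed

lemma E_small: "e > 0 ==> \<exists>A\<ge>0. \<forall>x b \<xi>. \<bar>E x b \<xi>\<bar> \<le> A * F x \<xi> + e * F x b"
proof -
 assume e: "e > 0"
 hence "(p - 1) / e > 0" "(p - 1) / ((p - 1) / e) = e" using p by auto
 thus ?thesis using E_young[of "(p - 1) / e"] by (intro exI[of _ "((p - 1) / e) powr (p - 1)"]) simp
qed

text \<open>Convexity bounds the difference by a pairing with \<open>\<xi> - b\<close>, with the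
  field taken at whichever point has the larger energy; the pairing is then split with a small
  coefficient.\<close>

lemma F_diff_small:
 assumes e: "e > 0"
 shows "\<exists>A. \<forall>x b \<xi>. \<bar>F x \<xi> - F x b\<bar> \<le> A * F x (\<lambda>i. \<xi> i - b i) + e * F x b"
proof -
 \<comment> \<open>The bound 1/2 allows the energy of \<open>\<xi>\<close> to be absorbed on the
   left; \<open>e / 4\<close> pays for the multiples of the energy of \<open>b\<close> that
   remain.\<close>
 define d where "d = min (1 / 2) (e / 4)"
 have d: "d > 0" "d \<le> 1/2" "4 * d \<le> e" using e unfolding d_def by auto
 obtain A where A: "A \<ge> 0" "!!x b \<xi>. \<bar>E x b \<xi>\<bar> \<le> A * F x \<xi> + d / p * F x b" using E_small[of "d / p"] d(1) p by auto
 have "\<bar>F x \<xi> - F x b\<bar> \<le> (2 * p * A) * F x (\<lambda>i. \<xi> i - b i) + e * F x b" for x b \<xi>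
 proof -
  define Z where "Z = F x (\<lambda>i. \<xi> i - b i)"
  have sym: "F x (\<lambda>i. b i - \<xi> i) = Z" using F_hom[of x "- 1" "\<lambda>i. \<xi> i - b i"] by (simp add: Z_def)
  have c: "F x c - F x z \<le> p * (A * F x (\<lambda>i. c i - z i)) + d * F x c" for c z
  proof -
   have "F x c - F x z \<le> p * E x c (\<lambda>i. c i - z i)" using convex[of x z c] unfolding E_diff E_self by (simp add: algebra_simps)
   also have "\<dots> \<le> p * (A * F x (\<lambda>i. c i - z i) + d / p * F x c)"
    using A(2)[of x c "\<lambda>i. c i - z i"] p by (intro mult_left_mono) auto
   also have "\<dots> = p * (A * F x (\<lambda>i. c i - z i)) + d * F x c" using p by (simp add: distrib_left)
   finally show ?thesis .
  qed
  have 1: "F x \<xi> - F x b \<le> p * (A * Z) + d * F x \<xi>" using c[of \<xi> b] by (simp add: Z_def)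
  have 2: "F x b - F x \<xi> \<le> p * (A * Z) + d * F x b" using c[of b \<xi>] by (simp add: sym)
  have Z: "0 \<le> p * (A * Z)" using p A(1) F_nonneg unfolding Z_def by simp
  have db: "d * F x b \<le> e * F x b" using d e F_nonneg by (intro mult_right_mono) auto
  have 3: "4 * d * F x b \<le> e * F x b" using d F_nonneg by (intro mult_right_mono) auto
  have "F x \<xi> - F x b \<le> 2 * (p * (A * Z)) + e * F x b"
  proof (cases "F x \<xi> \<le> F x b")
   case True
   thus ?thesis using Z e F_nonneg[of x b] mult_nonneg_nonneg[of e "F x b"] by linarith
  next
   case False
   have "d * (F x \<xi> - F x b) \<le> 1/2 * (F x \<xi> - F x b)" using d False by (intro mult_right_mono) auto
   hence "d * F x \<xi> \<le> d * F x b + 1/2 * (F x \<xi> - F x b)" by (simp add: right_diff_distrib)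
   hence "F x \<xi> - F x b \<le> 2 * (p * (A * Z)) + 2 * (d * F x b)" using 1 by argo
   also have "2 * (d * F x b) \<le> e * F x b" using 3 d(1) F_nonneg[of x b] mult_nonneg_nonneg[of d "F x b"] by linarith
   finally show ?thesis by simp
  qed
  moreover have "F x b - F x \<xi> \<le> 2 * (p * (A * Z)) + e * F x b" using 2 Z db by linarith
  ultimately show ?thesis unfolding Z_def[symmetric] by (simp add: abs_le_iff mult.assoc)
 qed
 thus ?thesis by blast
qed

lemma F_integrable:
 assumes K: "compactin (Rn n) K" "K \<subseteq> U" and X: "LpK n p K X"
 shows "set_integrable (leb n) K (\<lambda>x. F x (X x))"
  "AE x in leb n. x \<in> K --> (\<forall>\<xi>. F x \<xi> \<le> C * (\<Sum>i<n. \<bar>\<xi> i\<bar> powr p)) ==>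
   (LINT x:K|leb n. F x (X x)) \<le> C * (\<Sum>i<n. LINT x:K|leb n. \<bar>X x i\<bar> powr p)"
proof -
 have int: "set_integrable (leb n) K (\<lambda>x. \<bar>X x i\<bar> powr p)" if "i < n" for i using X that unfolding LpK_def by blast
 have ib: "set_integrable (leb n) K (\<lambda>x. C * (\<Sum>i<n. \<bar>X x i\<bar> powr p))" for C
 proof -
  have "integrable (leb n) (\<lambda>x. \<Sum>i<n. C * (indicator K x * \<bar>X x i\<bar> powr p))"
   using int unfolding set_integrable_alt by (intro Bochner_Integration.integrable_sum Bochner_Integration.integrable_mult_right) auto
  thus ?thesis unfolding set_integrable_alt by (simp only: sum_distrib_left mult.left_commute)
 qed
 obtain C' where C': "AE x in leb n. x \<in> K --> (\<forall>\<xi>. F x \<xi> \<le> C' * (\<Sum>i<n. \<bar>\<xi> i\<bar> powr p))" using F_bound[OF K] by blast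
 have m: "(\<lambda>x. indicator K x * F x (X x)) \<in> borel_measurable (leb n)"
  by (rule F_measurable[OF K]) (use X in \<open>auto simp: LpK_def\<close>)
 show fi: "set_integrable (leb n) K (\<lambda>x. F x (X x))" unfolding set_integrable_alt
 proof (rule Bochner_Integration.integrable_bound[OF ib[of C', unfolded set_integrable_alt] m])
  show "AE x in leb n. norm (indicator K x * F x (X x)) \<le> norm (indicator K x * (C' * (\<Sum>i<n. \<bar>X x i\<bar> powr p)))"
   using C' F_nonneg by (auto elim!: eventually_mono simp: indicator_def) (meson abs_ge_self order_trans)
 qed
 assume C: "AE x in leb n. x \<in> K --> (\<forall>\<xi>. F x \<xi> \<le> C * (\<Sum>i<n. \<bar>\<xi> i\<bar> powr p))"
 have "(LINT x:K|leb n. F x (X x)) \<le> (LINT x:K|leb n. C * (\<Sum>i<n. \<bar>X x i\<bar> powr p))"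
  using C by (intro set_integral_mono_AE fi ib) auto
 also have "\<dots> = C * (\<Sum>i<n. LINT x:K|leb n. \<bar>X x i\<bar> powr p)"
 proof -
  have "(LINT x:K|leb n. C * (\<Sum>i<n. \<bar>X x i\<bar> powr p)) = (\<integral>x. (\<Sum>i<n. C * (indicator K x * \<bar>X x i\<bar> powr p)) \<partial>leb n)"
   unfolding set_integral_alt by (simp only: sum_distrib_left mult.left_commute)
  also have "\<dots> = (\<Sum>i<n. \<integral>x. C * (indicator K x * \<bar>X x i\<bar> powr p) \<partial>leb n)"
   by (rule Bochner_Integration.integral_sum, rule Bochner_Integration.integrable_mult_right) (use int in \<open>simp add: set_integrable_alt\<close>)
  finally show ?thesis unfolding set_integral_alt by (simp add: sum_distrib_left)
 qed
 finally show "(LINT x:K|leb n. F x (X x)) \<le> C * (\<Sum>i<n. LINT x:K|leb n. \<bar>X x i\<bar> powr p)" .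
qed

lemma E_integrable:
 assumes K: "compactin (Rn n) K" "K \<subseteq> U" and X: "LpK n p K X" and Y: "LpK n p K Y"
 shows "set_integrable (leb n) K (\<lambda>x. E x (X x) (Y x))"
proof -
 obtain A where A: "A \<ge> 0" "!!x b \<xi>. \<bar>E x b \<xi>\<bar> \<le> A * F x \<xi> + 1 * F x b" using E_small[of 1] by auto
 have "set_integrable (leb n) K (\<lambda>x. A * F x (Y x) + 1 * F x (X x))"
  using F_integrable(1)[OF K X] F_integrable(1)[OF K Y] by (intro set_integral_add(1) set_integrable_mult_right) auto
 moreover have "(\<lambda>x. indicator K x * E x (X x) (Y x)) \<in> borel_measurable (leb n)"
  by (rule E_measurable[OF K]) (use X Y in \<open>auto simp: LpK_def\<close>)
 ultimately show ?thesis unfolding set_integrable_alt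
 proof (rule Bochner_Integration.integrable_bound)
  show "AE x in leb n. norm (indicator K x * E x (X x) (Y x)) \<le> norm (indicator K x * (A * F x (Y x) + 1 * F x (X x)))"
   using A by (intro AE_I2) (auto simp: indicator_def intro: order_trans[OF _ abs_ge_self])
 qed
qed

lemma F_tendsto_zero:
 assumes K: "compactin (Rn n) K" "K \<subseteq> U" and X: "!!k. LpK n p K (X k)"
  and l: "!!i. i < n ==> (\<lambda>k. LINT x:K|leb n. \<bar>X k x i\<bar> powr p) \<longlonglongrightarrow> 0"
 shows "(\<lambda>k. LINT x:K|leb n. F x (X k x)) \<longlonglongrightarrow> 0"
proof -
 obtain C where C: "AE x in leb n. x \<in> K --> (\<forall>\<xi>. F x \<xi> \<le> C * (\<Sum>i<n. \<bar>\<xi> i\<bar> powr p))" using F_bound[OF K] by blast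
 have "(\<lambda>k. C * (\<Sum>i<n. LINT x:K|leb n. \<bar>X k x i\<bar> powr p)) \<longlonglongrightarrow> C * (\<Sum>i<n. 0)"
  by (intro tendsto_intros) (use l in auto)
 hence 1: "(\<lambda>k. C * (\<Sum>i<n. LINT x:K|leb n. \<bar>X k x i\<bar> powr p)) \<longlonglongrightarrow> 0" by simp
 show ?thesis
 proof (rule tendsto_sandwich[OF _ _ tendsto_const 1])
  show "\<forall>\<^sub>F k in sequentially. 0 \<le> (LINT x:K|leb n. F x (X k x))"
   unfolding set_lebesgue_integral_def using F_nonneg by (intro always_eventually allI integral_nonneg_AE) auto
  show "\<forall>\<^sub>F k in sequentially. (LINT x:K|leb n. F x (X k x)) \<le> C * (\<Sum>i<n. LINT x:K|leb n. \<bar>X k x i\<bar> powr p)"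
   by (intro always_eventually allI F_integrable(2)[OF K X C])
 qed
qed

lemma approximation:
 assumes f: "continuous_on U f" "has_weak_grad n U f X" "!!C. compactin (Rn n) C ==> C \<subseteq> U ==> LpK n p C X"
  and K0: "compactin (Rn n) K0" "K0 \<subseteq> U" "!!x. x \<in> U ==> x \<notin> K0 ==> f x = 0"
 shows "\<exists>g K B. compactin (Rn n) K \<and> K \<subseteq> U \<and> K0 \<subseteq> K \<and> (\<forall>k. g k \<in> Cc_smooth n U) \<and>
  (\<forall>k. \<forall>x\<in>U. x \<notin> K --> g k x = 0 \<and> (\<forall>i<n. partial i (g k) x = 0)) \<and>
  (\<forall>k. \<forall>x\<in>K. \<bar>g k x\<bar> \<le> B) \<and> (\<forall>x\<in>U. (\<lambda>k. g k x) \<longlonglongrightarrow> f x) \<and>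
  (\<forall>k. LpK n p K (\<lambda>x i. partial i (g k) x - X x i)) \<and>
  (\<lambda>k. LINT x:K|leb n. F x (\<lambda>i. partial i (g k) x - X x i)) \<longlonglongrightarrow> 0"
proof -
 have p1: "p \<ge> 1" using p by simp
 obtain g0 K where g0: "compactin (Rn n) K" "K \<subseteq> U" "K0 \<subseteq> K" "!!k. g0 k \<in> Cc_smooth n U"
  and z0: "!!k x. x \<in> U ==> x \<notin> K ==> g0 k x = 0 \<and> (\<forall>i<n. partial i (g0 k) x = 0)"
  and u0: "!!e. e > 0 ==> \<forall>\<^sub>F k in sequentially. \<forall>x\<in>K. \<bar>g0 k x - f x\<bar> \<le> e"
  and L0: "!!k. LpK n p K (\<lambda>x i. partial i (g0 k) x - X x i)"
  and l0: "!!i. i < n ==> (\<lambda>k. LINT x:K|leb n. \<bar>partial i (g0 k) x - X x i\<bar> powr p) \<longlonglongrightarrow> 0"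
  using smooth_approximation_Cc[OF U f(1,2) p1 f(3) K0] by blast
 obtain B where B: "!!x. x \<in> K ==> \<bar>f x\<bar> \<le> B" using compact_bounded_real[OF g0(1) continuous_on_subset[OF f(1) g0(2)]] by blast
 obtain N where N: "!!k x. k \<ge> N ==> x \<in> K ==> \<bar>g0 k x - f x\<bar> \<le> 1"
  using u0[of 1] unfolding eventually_sequentially by auto
 define g where "g k = g0 (k + N)" for k
 have 1: "\<bar>g k x\<bar> \<le> B + 1" if "x \<in> K" for k x using N[of "k + N" x] B[OF that] that unfolding g_def by force
 have 2: "(\<lambda>k. g k x) \<longlonglongrightarrow> f x" if x: "x \<in> U" for x
 proof (cases "x \<in> K")
  case True
  have "(\<lambda>k. g0 k x) \<longlonglongrightarrow> f x" by (rule eventually_uniform_tendsto[OF u0 True])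
  thus ?thesis unfolding g_def by (rule LIMSEQ_ignore_initial_segment)
 next
  case False
  hence "f x = 0" "!!k. g k x = 0" using K0(3)[OF x] g0(3) z0[OF x False] unfolding g_def by auto
  thus ?thesis by simp
 qed
 have 3: "(\<lambda>k. LINT x:K|leb n. F x (\<lambda>i. partial i (g k) x - X x i)) \<longlonglongrightarrow> 0"
  unfolding g_def by (rule LIMSEQ_ignore_initial_segment[OF F_tendsto_zero[OF g0(1,2) L0 l0]])
 show ?thesis
  by (rule exI[of _ g], rule exI[of _ K], rule exI[of _ "B + 1"]) (use g0 z0 L0 1 2 3 in \<open>auto simp: g_def\<close>)
qed

end

section \<open>Admissible functions and extension by density\<close>

lemma L1_loc_measurable:
 assumes U: "openin (Rn n) U" and g: "g \<in> L1_loc n U"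
 shows "(\<lambda>x. indicator U x * g x) \<in> borel_measurable (leb n)"
proof -
 obtain K :: "nat => vec set" where K: "!!m. compactin (Rn n) (K m)" "incseq K" "(\<Union>m. K m) = U"
  using compact_exhaustion[OF U] by metis
 have m: "(\<lambda>x. indicator (K m) x * g x) \<in> borel_measurable (leb n)" for m
  using L1_locD[OF g K(1)] K(3) unfolding set_integrable_alt by (blast intro: borel_measurable_integrable)
 show ?thesis
 proof (rule borel_measurable_LIMSEQ_real[OF _ m])
  fix x
  have "(\<lambda>m. indicator (K m) x :: real) \<longlonglongrightarrow> indicator (\<Union>m. K m) x" by (rule LIMSEQ_indicator_incseq[OF K(2)])
  thus "(\<lambda>m. indicator (K m) x * g x) \<longlonglongrightarrow> indicator U x * g x" unfolding K(3) by (rule tendsto_mult_right)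
 qed
qed

lemma indicator_idem: "indicator A x * (indicator A x * y) = (indicator A x * y :: real)"
 by (simp add: indicator_def)

context energy_form
begin

text \<open>A member of the form domain together with data that the definitions hide:
  \<open>X\<close> is any version of the gradient and \<open>K\<close> any compact set outside which
  \<open>f\<close> vanishes, not necessarily the support.\<close>

definition admissible :: "(vec => real) => (vec => vec) => vec set => bool" where
 "admissible f X K \<longleftrightarrow> continuous_on U f \<and> has_weak_grad n U f X \<and>
   (\<forall>C. compactin (Rn n) C --> C \<subseteq> U --> LpK n p C X) \<and>
   compactin (Rn n) K \<and> K \<subseteq> U \<and> (\<forall>x\<in>U. x \<notin> K --> f x = 0)"

lemma W1p_Cc_admissible:
 assumes "f \<in> W1p n p U \<inter> Cc n U"
 obtains K where "admissible f (weak_grad n U f) K"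
proof -
 have f: "f \<in> W1p n p U" "f \<in> Cc n U" using assms by auto
 obtain K where K: "continuous_on U f" "compactin (Rn n) K" "K \<subseteq> U" "\<forall>x\<in>U. x \<notin> K --> f x = 0"
  using f(2) unfolding Cc_iff[OF U] by blast
 have "admissible f (weak_grad n U f) K"
  unfolding admissible_def using K W1p_LpK(1)[OF U f(1) K(2,3)] W1p_LpK(2)[OF U f(1)] by blast
 thus thesis by (rule that)
qed

lemma admissible_W1p_Cc: "admissible f X K ==> f \<in> W1p n p U \<inter> Cc n U"
proof -
 assume a: "admissible f X K"
 hence f: "continuous_on U f" "has_weak_grad n U f X" and K: "compactin (Rn n) K" "K \<subseteq> U"
  and z: "!!x. x \<in> U ==> x \<notin> K ==> f x = 0" and L: "LpK n p K X"
  unfolding admissible_def by auto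
 have p0: "p > 0" using p by simp
 show ?thesis by (rule W1p_CcI[OF U f p0 K z L])
qed

lemma abs_powr_continuous: "continuous_on X (f :: vec => real) ==> continuous_on X (\<lambda>x. \<bar>f x\<bar> powr p)"
 using p by (intro continuous_on_powr' continuous_on_rabs continuous_on_const) auto

lemma V_term_integrable:
 assumes "continuous_on U f" "compactin (Rn n) K" "K \<subseteq> U"
 shows "set_integrable (leb n) K (\<lambda>x. V x * f x)"
 by (rule set_integrable_times_continuous[OF L1_locD[OF V assms(2,3)] assms(2) continuous_on_subset[OF assms(1,3)]])

lemma gradient_AE_zero:
 assumes "admissible f X K"
 shows "AE x in leb n. x \<in> U - K --> (\<forall>i<n. X x i = 0)"
 by (rule weak_grad_vanishes[OF U, of f X K]) (use assms in \<open>auto simp: admissible_def\<close>)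

text \<open>Replaces the chosen gradient by \<open>X\<close> and the domain of integration by
  \<open>K\<close>: outside \<open>K\<close> both \<open>f\<close> and, almost everywhere, its
  gradient vanish.\<close>

lemma Q_eq:
 assumes a: "admissible f X K"
 shows "set_integrable (leb n) K (\<lambda>x. F x (X x) + V x * \<bar>f x\<bar> powr p)"
  "Q f = (LINT x:K|leb n. F x (X x) + V x * \<bar>f x\<bar> powr p)"
proof -
 have f: "continuous_on U f" "has_weak_grad n U f X" and K: "compactin (Rn n) K" "K \<subseteq> U"
  and z: "!!x. x \<in> U ==> x \<notin> K ==> f x = 0" and L: "LpK n p K X"
  using a unfolding admissible_def by auto
 show int: "set_integrable (leb n) K (\<lambda>x. F x (X x) + V x * \<bar>f x\<bar> powr p)"
  by (rule set_integral_add(1)[OF F_integrable(1)[OF K L] V_term_integrable[OF abs_powr_continuous[OF f(1)] K]])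
 define h where "h x = indicator K x * (F x (X x) + V x * \<bar>f x\<bar> powr p)" for x
 have 1: "set_integrable (leb n) U h \<longleftrightarrow> set_integrable (leb n) K h" "(LINT x:U|leb n. h x) = (LINT x:K|leb n. h x)"
  by (rule set_integral_supp[OF K(2)]; simp add: h_def)+
 have 2: "set_integrable (leb n) K h" "(LINT x:K|leb n. h x) = (LINT x:K|leb n. F x (X x) + V x * \<bar>f x\<bar> powr p)"
  using int unfolding set_integrable_alt set_integral_alt h_def indicator_idem by auto
 have "AE x in leb n. x \<in> U --> h x = H x (weak_grad n U f x) powr p + V x * \<bar>f x\<bar> powr p"
  using gradient_AE_zero[OF a] weak_grad_AE_eq[OF U f(2)] F_H
 proof eventually_elim
  case (elim x)
  show ?case
  proof
   assume x: "x \<in> U"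
   have "F x (weak_grad n U f x) = F x (X x)" using elim(2) x by (intro F_local) auto
   moreover have "F x (X x) = 0" if "x \<notin> K" using F_local[of "X x" "\<lambda>i. 0" x] F_zero elim(1) x that by auto
   ultimately show "h x = H x (weak_grad n U f x) powr p + V x * \<bar>f x\<bar> powr p"
    using elim(3) x z[OF x] unfolding h_def by (cases "x \<in> K") auto
  qed
 qed
 from set_integrable_AE(2)[OF _ this] 1 2
 show "Q f = (LINT x:K|leb n. F x (X x) + V x * \<bar>f x\<bar> powr p)" unfolding Q_fun_def by simp
qed

lemma admissible_approximation:
 assumes a: "admissible f X K0"
 obtains g K B where "compactin (Rn n) K" "K \<subseteq> U" "K0 \<subseteq> K" "!!k. g k \<in> Cc_smooth n U"
  "!!k. admissible (g k) (\<lambda>x i. partial i (g k) x) K"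
  "!!k x. x \<in> K ==> \<bar>g k x\<bar> \<le> B" "!!x. x \<in> U ==> (\<lambda>k. g k x) \<longlonglongrightarrow> f x"
  "!!k. LpK n p K (\<lambda>x i. partial i (g k) x - X x i)"
  "(\<lambda>k. LINT x:K|leb n. F x (\<lambda>i. partial i (g k) x - X x i)) \<longlonglongrightarrow> 0"
  "!!k x i. x \<in> U ==> x \<notin> K ==> i < n ==> partial i (g k) x = 0"
proof -
 have f: "continuous_on U f" "has_weak_grad n U f X" "!!C. compactin (Rn n) C ==> C \<subseteq> U ==> LpK n p C X"
  and K0: "compactin (Rn n) K0" "K0 \<subseteq> U" "!!x. x \<in> U ==> x \<notin> K0 ==> f x = 0"
  using a unfolding admissible_def by auto
 obtain g K B where g: "compactin (Rn n) K" "K \<subseteq> U" "K0 \<subseteq> K" "!!k. g k \<in> Cc_smooth n U"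
  "!!k x. x \<in> U ==> x \<notin> K ==> g k x = 0 \<and> (\<forall>i<n. partial i (g k) x = 0)"
  "!!k x. x \<in> K ==> \<bar>g k x\<bar> \<le> B" "!!x. x \<in> U ==> (\<lambda>k. g k x) \<longlonglongrightarrow> f x"
  "!!k. LpK n p K (\<lambda>x i. partial i (g k) x - X x i)"
  "(\<lambda>k. LINT x:K|leb n. F x (\<lambda>i. partial i (g k) x - X x i)) \<longlonglongrightarrow> 0"
  using approximation[OF f K0] by blast
 have p0: "p > 0" using p by simp
 have "admissible (g k) (\<lambda>x i. partial i (g k) x) K" for k
 proof -
  have "LpK n p C (\<lambda>x i. partial i (g k) x)" if C: "compactin (Rn n) C" "C \<subseteq> U" for C
   by (rule LpK_continuous[OF C(1) continuous_on_subset[OF Cc_smooth_continuous(2)[OF U g(4)] C(2)] p0])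
  moreover have "has_weak_grad n U (g k) (\<lambda>x i. partial i (g k) x)"
   by (rule has_weak_grad_smooth[OF U]) (use g(4)[of k] in \<open>simp add: Cc_smooth_def\<close>)
  ultimately show ?thesis unfolding admissible_def using g(1,2,5) Cc_smooth_continuous(1)[OF U g(4)] by blast
 qed
 thus thesis using g(5) by (intro that[OF g(1-4) _ g(6-9)]) auto
qed

text \<open>The equation is given for smooth test functions, but Picone's test function is merely
  continuous with a weak gradient. Mollification converges in the energy, which controls the pairing
  by \<open>E_small\<close>, and converges boundedly in the potential term.\<close>

lemma weak_eq_admissible:
 assumes a: "admissible f X K0"
 shows "(LINT x:K0|leb n. E x (G x) (X x)) + (LINT x:K0|leb n. V x * u x powr (p - 1) * f x) = 0"
proof (rule admissible_approximation[OF a])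
 fix g K B
 assume K: "compactin (Rn n) K" "K \<subseteq> U" "K0 \<subseteq> K" and g: "!!k. g k \<in> Cc_smooth n U"
  and adm: "!!k. admissible (g k) (\<lambda>x i. partial i (g k) x) K"
  and B: "!!k x. x \<in> K ==> \<bar>g k x\<bar> \<le> B" and lim: "!!x. x \<in> U ==> (\<lambda>k. g k x) \<longlonglongrightarrow> f x"
  and L: "!!k. LpK n p K (\<lambda>x i. partial i (g k) x - X x i)"
  and F0: "(\<lambda>k. LINT x:K|leb n. F x (\<lambda>i. partial i (g k) x - X x i)) \<longlonglongrightarrow> 0"
  and z': "!!k x i. x \<in> U ==> x \<notin> K ==> i < n ==> partial i (g k) x = 0"
 have LX: "LpK n p K X" and z0: "!!x. x \<in> U ==> x \<notin> K0 ==> f x = 0" using a K unfolding admissible_def by auto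
 have Lg: "LpK n p K (\<lambda>x i. partial i (g k) x)" and cg: "continuous_on K (g k)" and zg: "!!x. x \<in> U ==> x \<notin> K ==> g k x = 0" for k
  using adm[of k] K continuous_on_subset unfolding admissible_def by blast+
 have cu: "continuous_on U (\<lambda>x. u x powr (p - 1))" using u by (intro continuous_on_powr continuous_on_const) force+
 have Vu: "set_integrable (leb n) K (\<lambda>x. V x * u x powr (p - 1))" by (rule V_term_integrable[OF cu K(1,2)])
 note GK = G(2)[OF K(1,2)]
 have eq0: "(LINT x:K|leb n. E x (G x) (\<lambda>i. partial i (g k) x)) + (LINT x:K|leb n. V x * u x powr (p - 1) * g k x) = 0" for k
 proof -
  have "E x (G x) (\<lambda>i. partial i (g k) x) = 0" if "x \<in> U" "x \<notin> K" for x
   using E_local[of "\<lambda>i. partial i (g k) x" "\<lambda>i. 0" x] z'[OF that] E_zero by simp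
  thus ?thesis using weak_eq[OF g[of k]] zg[of _ k]
   by (simp add: set_integral_supp(2)[OF K(2), of "\<lambda>x. E x (G x) (\<lambda>i. partial i (g k) x)"] set_integral_supp(2)[OF K(2), of "\<lambda>x. V x * u x powr (p - 1) * g k x"])
 qed
 have l1: "(\<lambda>k. LINT x:K|leb n. E x (G x) (\<lambda>i. partial i (g k) x)) \<longlonglongrightarrow> (LINT x:K|leb n. E x (G x) (X x))"
 proof (rule set_integral_tendsto_L1[OF E_integrable[OF K(1,2) GK Lg] E_integrable[OF K(1,2) GK LX]])
  show "(\<lambda>k. LINT x:K|leb n. \<bar>E x (G x) (\<lambda>i. partial i (g k) x) - E x (G x) (X x)\<bar>) \<longlonglongrightarrow> 0"
  proof (rule set_integral_small_tendsto[OF _ F_integrable(1)[OF K(1,2) L] F_integrable(1)[OF K(1,2) GK] _ F0])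
   show "set_integrable (leb n) K (\<lambda>x. E x (G x) (\<lambda>i. partial i (g k) x) - E x (G x) (X x))" for k
    by (rule set_integral_diff(1)[OF E_integrable[OF K(1,2) GK Lg] E_integrable[OF K(1,2) GK LX]])
   fix e :: real assume "e > 0"
   then obtain A where A: "!!x b \<xi>. \<bar>E x b \<xi>\<bar> \<le> A * F x \<xi> + e * F x b" using E_small by blast
   show "\<exists>A. \<forall>k x. \<bar>E x (G x) (\<lambda>i. partial i (g k) x) - E x (G x) (X x)\<bar> \<le> A * F x (\<lambda>i. partial i (g k) x - X x i) + e * F x (G x)"
    unfolding E_diff[symmetric] using A by blast
  qed
 qed
 have l2: "(\<lambda>k. LINT x:K|leb n. V x * u x powr (p - 1) * g k x) \<longlonglongrightarrow> (LINT x:K|leb n. V x * u x powr (p - 1) * f x)"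
 proof (rule set_integral_product_tendsto[OF leb_compactin[OF K(1)] _ B _ Vu Vu])
  show "(\<lambda>x. indicator K x * g k x) \<in> borel_measurable (leb n)" for k
   by (rule continuous_ind_measurable[OF borel_compact_Rn[OF K(1)] cg])
 qed (use lim K in auto)
 have "(\<lambda>k. 0 :: real) \<longlonglongrightarrow> (LINT x:K|leb n. E x (G x) (X x)) + (LINT x:K|leb n. V x * u x powr (p - 1) * f x)"
  using tendsto_add[OF l1 l2] unfolding eq0 .
 hence s0: "(LINT x:K|leb n. E x (G x) (X x)) + (LINT x:K|leb n. V x * u x powr (p - 1) * f x) = 0"
  by (simp add: LIMSEQ_const_iff)
 have r1: "(LINT x:K|leb n. E x (G x) (X x)) = (LINT x:K0|leb n. E x (G x) (X x))"
 proof -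
  define h where "h x = indicator K0 x * E x (G x) (X x)" for x
  have "AE x in leb n. x \<in> K --> E x (G x) (X x) = h x"
   using gradient_AE_zero[OF a]
  proof eventually_elim
   case (elim x)
   thus ?case using E_local[of "X x" "\<lambda>i. 0" x "G x"] E_zero K(2) unfolding h_def by (cases "x \<in> K0") auto
  qed
  from set_integrable_AE(2)[OF E_integrable[OF K(1,2) GK LX] this]
  have "(LINT x:K|leb n. E x (G x) (X x)) = (LINT x:K|leb n. h x)" .
  also have "\<dots> = (LINT x:K0|leb n. h x)" by (rule set_integral_supp(2)[OF K(3)]) (simp add: h_def)
  also have "\<dots> = (LINT x:K0|leb n. E x (G x) (X x))" unfolding set_integral_alt h_def indicator_idem ..
  finally show ?thesis .
 qed
 have r2: "(LINT x:K|leb n. V x * u x powr (p - 1) * f x) = (LINT x:K0|leb n. V x * u x powr (p - 1) * f x)"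
  by (rule set_integral_supp(2)[OF K(3)]) (use z0 K(2) in auto)
 show ?thesis using s0 unfolding r1 r2 .
qed

text \<open>Hardy weights are defined with smooth functions, \<open>S_const\<close> and
  \<open>Cap\<close> with the larger class \<open>W1p n p U \<inter> Cc n U\<close>; this density
  result reconciles them.\<close>

lemma Q_approximation:
 assumes a: "admissible f X K0"
 obtains g where "!!k. g k \<in> Cc_smooth n U" "!!x. x \<in> U ==> (\<lambda>k. g k x) \<longlonglongrightarrow> f x" "(\<lambda>k. Q (g k)) \<longlonglongrightarrow> Q f"
proof (rule admissible_approximation[OF a])
 fix g K B
 assume K: "compactin (Rn n) K" "K \<subseteq> U" "K0 \<subseteq> K" and g: "!!k. g k \<in> Cc_smooth n U"
  and adm: "!!k. admissible (g k) (\<lambda>x i. partial i (g k) x) K"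
  and B: "!!k x. x \<in> K ==> \<bar>g k x\<bar> \<le> B" and lim: "!!x. x \<in> U ==> (\<lambda>k. g k x) \<longlonglongrightarrow> f x"
  and L: "!!k. LpK n p K (\<lambda>x i. partial i (g k) x - X x i)"
  and F0: "(\<lambda>k. LINT x:K|leb n. F x (\<lambda>i. partial i (g k) x - X x i)) \<longlonglongrightarrow> 0"
 have aK: "admissible f X K" using a K unfolding admissible_def by blast
 have LX: "LpK n p K X" and cf: "continuous_on U f" using aK unfolding admissible_def by auto
 have Lg: "LpK n p K (\<lambda>x i. partial i (g k) x)" and cg: "continuous_on U (g k)" for k
  using adm[of k] K unfolding admissible_def by blast+
 note FX = F_integrable(1)[OF K(1,2) LX] and Fg = F_integrable(1)[OF K(1,2) Lg]
 note Vf = V_term_integrable[OF abs_powr_continuous[OF cf] K(1,2)] and Vg = V_term_integrable[OF abs_powr_continuous[OF cg] K(1,2)]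
 have l1: "(\<lambda>k. LINT x:K|leb n. F x (\<lambda>i. partial i (g k) x)) \<longlonglongrightarrow> (LINT x:K|leb n. F x (X x))"
 proof (rule set_integral_tendsto_L1[OF Fg FX])
  show "(\<lambda>k. LINT x:K|leb n. \<bar>F x (\<lambda>i. partial i (g k) x) - F x (X x)\<bar>) \<longlonglongrightarrow> 0"
  proof (rule set_integral_small_tendsto[OF set_integral_diff(1)[OF Fg FX] F_integrable(1)[OF K(1,2) L] FX _ F0])
   fix e :: real assume "e > 0"
   then obtain A where A: "!!x b \<xi>. \<bar>F x \<xi> - F x b\<bar> \<le> A * F x (\<lambda>i. \<xi> i - b i) + e * F x b" using F_diff_small by blast
   show "\<exists>A. \<forall>k x. \<bar>F x (\<lambda>i. partial i (g k) x) - F x (X x)\<bar> \<le> A * F x (\<lambda>i. partial i (g k) x - X x i) + e * F x (X x)"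
    using A by blast
  qed
 qed
 have l2: "(\<lambda>k. LINT x:K|leb n. V x * \<bar>g k x\<bar> powr p) \<longlonglongrightarrow> (LINT x:K|leb n. V x * \<bar>f x\<bar> powr p)"
 proof (rule set_integral_product_tendsto[OF leb_compactin[OF K(1)] _ _ _ L1_locD[OF V K(1,2)] L1_locD[OF V K(1,2)]])
  show "(\<lambda>x. indicator K x * \<bar>g k x\<bar> powr p) \<in> borel_measurable (leb n)" for k
   by (rule continuous_ind_measurable[OF borel_compact_Rn[OF K(1)] continuous_on_subset[OF abs_powr_continuous[OF cg] K(2)]])
  show "\<bar>\<bar>g k x\<bar> powr p\<bar> \<le> B powr p" if "x \<in> K" for k x using B[OF that, of k] p by (auto intro: powr_mono2)
  show "(\<lambda>k. \<bar>g k x\<bar> powr p) \<longlonglongrightarrow> \<bar>f x\<bar> powr p" if "x \<in> K" for x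
   using lim[of x] that K p by (intro tendsto_powr' tendsto_rabs tendsto_const) auto
 qed simp
 have "(\<lambda>k. Q (g k)) \<longlonglongrightarrow> Q f"
  using tendsto_add[OF l1 l2] unfolding Q_eq(2)[OF adm] Q_eq(2)[OF aK] set_integral_add(2)[OF FX Vf] set_integral_add(2)[OF Fg Vg] .
 from that[OF g lim this] show thesis .
qed

lemma mass_measurable:
 assumes g: "g \<in> L1_loc n U" and f: "continuous_on U f" and A: "A \<in> sets (leb n)" "A \<subseteq> U"
 shows "(\<lambda>x. ennreal (\<bar>g x\<bar> * \<bar>f x\<bar> powr p) * indicator A x) \<in> borel_measurable (leb n)"
proof -
 have "(\<lambda>x. \<bar>indicator U x * g x\<bar> * \<bar>indicator U x * f x\<bar> powr p) \<in> borel_measurable (leb n)"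
  by (rule borel_measurable_times[OF borel_measurable_abs[OF L1_loc_measurable[OF U g]]
   abs_powr_measurable[OF continuous_ind_measurable[OF borel_open_Rn[OF U] f]]])
 hence "(\<lambda>x. ennreal (\<bar>indicator U x * g x\<bar> * \<bar>indicator U x * f x\<bar> powr p) * indicator A x) \<in> borel_measurable (leb n)"
  using A(1) by (intro borel_measurable_times_ennreal measurable_compose[OF _ measurable_ennreal] borel_measurable_indicator)
 moreover have "(\<lambda>x. ennreal (\<bar>indicator U x * g x\<bar> * \<bar>indicator U x * f x\<bar> powr p) * indicator A x) =
   (\<lambda>x. ennreal (\<bar>g x\<bar> * \<bar>f x\<bar> powr p) * indicator A x)"
  using A(2) by (auto simp: fun_eq_iff indicator_def)
 ultimately show ?thesis by simp
qed

text \<open>Fatou's lemma along smooth approximations whose energies converge.\<close>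

lemma mass_extend:
 assumes g: "g \<in> L1_loc n U"
  and le: "!!\<phi>. \<phi> \<in> Cc_smooth n U ==> (\<integral>\<^sup>+x\<in>U. ennreal (\<bar>g x\<bar> * \<bar>\<phi> x\<bar> powr p) \<partial>leb n) \<le> ennreal (L * Q \<phi>)"
  and a: "admissible f X K"
 shows "(\<integral>\<^sup>+x\<in>U. ennreal (\<bar>g x\<bar> * \<bar>f x\<bar> powr p) \<partial>leb n) \<le> ennreal (L * Q f)"
proof (rule Q_approximation[OF a])
 fix h assume h: "!!k. h k \<in> Cc_smooth n U" "!!x. x \<in> U ==> (\<lambda>k. h k x) \<longlonglongrightarrow> f x" "(\<lambda>k. Q (h k)) \<longlonglongrightarrow> Q f"
 define w where "w \<phi> x = ennreal (\<bar>g x\<bar> * \<bar>\<phi> x\<bar> powr p) * indicator U x" for \<phi> :: "vec => real" and x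
 have m: "w (h k) \<in> borel_measurable (leb n)" for k
  unfolding w_def by (rule mass_measurable[OF g Cc_smooth_continuous(1)[OF U h(1)] leb_openin[OF U] order_refl])
 have l: "(\<lambda>k. w (h k) x) \<longlonglongrightarrow> w f x" for x
 proof (cases "x \<in> U")
  case True
  have "(\<lambda>k. \<bar>g x\<bar> * \<bar>h k x\<bar> powr p) \<longlonglongrightarrow> \<bar>g x\<bar> * \<bar>f x\<bar> powr p"
   using h(2)[OF True] p by (intro tendsto_mult_left tendsto_powr' tendsto_rabs tendsto_const) auto
  thus ?thesis using True unfolding w_def by (simp add: tendsto_ennrealI)
 qed (simp add: w_def)
 have "(\<integral>\<^sup>+x. w f x \<partial>leb n) = (\<integral>\<^sup>+x. liminf (\<lambda>k. w (h k) x) \<partial>leb n)"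
  using lim_imp_Liminf[OF sequentially_bot l] by simp
 also have "\<dots> \<le> liminf (\<lambda>k. \<integral>\<^sup>+x. w (h k) x \<partial>leb n)" by (rule nn_integral_liminf[OF m])
 also have "\<dots> \<le> liminf (\<lambda>k. ennreal (L * Q (h k)))" using le[OF h(1)] unfolding w_def by (intro Liminf_mono always_eventually allI)
 also have "\<dots> = ennreal (L * Q f)"
  by (intro lim_imp_Liminf sequentially_bot tendsto_ennrealI tendsto_mult_left h(3))
 finally show ?thesis unfolding w_def .
qed

end

section \<open>Picone's identity and truncation\<close>

text \<open>The function is the difference of the q-th powers of the positive and the negative
  part.\<close>

lemma continuous_on_signed_powr: "q > 0 ==> continuous_on X (\<lambda>a. \<bar>a\<bar> powr q * sgn a :: real)"
proof -
 assume q: "q > 0"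
 have "(\<lambda>a. \<bar>a\<bar> powr q * sgn a) = (\<lambda>a::real. max 0 a powr q - max 0 (- a) powr q)"
  by (auto simp: fun_eq_iff sgn_if max_def)
 moreover have "continuous_on X (\<lambda>a::real. max 0 a powr q - max 0 (- a) powr q)"
  using q by (intro continuous_on_diff continuous_on_powr' continuous_on_max continuous_on_const continuous_on_id continuous_on_minus) auto
 ultimately show ?thesis by (simp only:)
qed

lemma dyadic_strip:
 fixes y \<tau> :: real
 shows "\<tau> \<le> y ==> y < 2 ^ J * \<tau> ==> \<exists>j<J. 2 ^ j * \<tau> \<le> y \<and> y < 2 ^ Suc j * \<tau>"
proof (induction J)
 case (Suc J)
 thus ?case by (cases "y < 2 ^ J * \<tau>") (auto intro: less_SucI)
qed simp

context energy_form
begin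

text \<open>Serves two functions of \<open>f\<close> and \<open>u\<close>: Picone's test function
  and the truncation. Vanishing at \<open>0\<close> in the first variable preserves the
  support.\<close>

lemma admissible_compose:
 fixes \<Phi> \<Phi>1 \<Phi>2 :: "real => real => real"
 assumes a: "admissible f X K" and z: "!!b. b > 0 ==> \<Phi> 0 b = 0"
  and c: "cont2 \<Phi>"
   "cont2 \<Phi>1" "cont2 \<Phi>2"
  and d: "!!a b a' b' t. (a has_real_derivative a') (at t) ==> (b has_real_derivative b') (at t) ==> b t > 0 ==>
   ((\<lambda>t. \<Phi> (a t) (b t)) has_real_derivative \<Phi>1 (a t) (b t) * a' + \<Phi>2 (a t) (b t) * b') (at t)"
 shows "admissible (\<lambda>x. \<Phi> (f x) (u x)) (\<lambda>x i. \<Phi>1 (f x) (u x) * X x i + \<Phi>2 (f x) (u x) * G x i) K"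
proof -
 have f: "continuous_on U f" "has_weak_grad n U f X" "!!C. compactin (Rn n) C ==> C \<subseteq> U ==> LpK n p C X"
  using a unfolding admissible_def by auto
 have p1: "p \<ge> 1" "p > 0" using p by auto
 have L: "LpK n p C (\<lambda>x i. \<Phi>1 (f x) (u x) * X x i + \<Phi>2 (f x) (u x) * G x i)" if C: "compactin (Rn n) C" "C \<subseteq> U" for C
 proof -
  have up: "0 < u x" if "x \<in> C" for x using u(2) C(2) that by blast
  note 1 = continuous_on_comp2[OF c(2) continuous_on_subset[OF f(1) C(2)] continuous_on_subset[OF u(1) C(2)] up]
   continuous_on_comp2[OF c(3) continuous_on_subset[OF f(1) C(2)] continuous_on_subset[OF u(1) C(2)] up]
  show ?thesis by (rule LpK_add[OF p1(1) LpK_mult_continuous[OF C(1) 1(1) f(3)[OF C] p1(2)] LpK_mult_continuous[OF C(1) 1(2) G(2)[OF C] p1(2)] C(1)])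
 qed
 have w: "has_weak_grad n U (\<lambda>x. \<Phi> (f x) (u x)) (\<lambda>x i. \<Phi>1 (f x) (u x) * X x i + \<Phi>2 (f x) (u x) * G x i)"
  by (rule weak_chain_rule[OF U f(1,2) u(1) G(1) u(2) c d])
 have zero: "\<Phi> (f x) (u x) = 0" if "x \<in> U" "x \<notin> K" for x
  using a that z[OF u(2)[OF that(1)]] unfolding admissible_def by simp
 have K: "compactin (Rn n) K" "K \<subseteq> U" using a unfolding admissible_def by auto
 show ?thesis unfolding admissible_def
  using L w continuous_on_comp2[OF c(1) f(1) u(1) u(2)] K zero by blast
qed

text \<open>The potential terms cancel because \<open>u powr (p - 1)\<close> times the test function
  \<open>\<bar>f\<bar> powr p * u powr (1 - p)\<close> is \<open>\<bar>f\<bar> powr p\<close>. What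
  is left is a pointwise identity for the energy density.\<close>

theorem picone:
 assumes a: "admissible f X K"
 shows "set_integrable (leb n) K (\<lambda>x. D x (X x) (\<lambda>i. f x / u x * G x i))"
  "Q f = (LINT x:K|leb n. D x (X x) (\<lambda>i. f x / u x * G x i))"
proof -
 define \<Phi> where "\<Phi> a b = \<bar>a\<bar> powr p * b powr (1 - p)" for a b :: real
 define \<Phi>1 where "\<Phi>1 a b = p * (\<bar>a\<bar> powr (p - 1) * sgn a) * b powr (1 - p)" for a b :: real
 define \<Phi>2 where "\<Phi>2 a b = \<bar>a\<bar> powr p * ((1 - p) * b powr (- p))" for a b :: real
 define Y where "Y x i = \<Phi>1 (f x) (u x) * X x i + \<Phi>2 (f x) (u x) * G x i" for x i
 have b: "admissible (\<lambda>x. \<Phi> (f x) (u x)) Y K"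
  unfolding Y_def
 proof (rule admissible_compose[OF a])
  have cs: "continuous_on (UNIV \<times> {0<..}) (\<lambda>z. \<bar>fst z\<bar> powr (p - 1) * sgn (fst z) :: real)"
   by (rule continuous_on_compose2[OF continuous_on_signed_powr[of "p - 1" UNIV] continuous_on_fst[OF continuous_on_id]]) (use p in auto)
  have ca: "continuous_on (UNIV \<times> {0<..}) (\<lambda>z. \<bar>fst z\<bar> powr p :: real)"
   using p by (intro continuous_on_powr' continuous_on_rabs continuous_on_fst continuous_on_id continuous_on_const) auto
  have cb: "continuous_on (UNIV \<times> {0<..}) (\<lambda>z. snd z powr q :: real)" for q
   by (intro continuous_on_powr continuous_on_snd continuous_on_id continuous_on_const) auto
  show "cont2 \<Phi>" unfolding \<Phi>_def by (intro continuous_on_mult ca cb)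
  show "cont2 \<Phi>1" unfolding \<Phi>1_def by (intro continuous_on_mult[OF continuous_on_mult[OF continuous_on_const cs] cb])
  show "cont2 \<Phi>2" unfolding \<Phi>2_def by (intro continuous_on_mult ca cb continuous_on_const)
  show "\<Phi> 0 b = 0" for b unfolding \<Phi>_def using p by simp
  fix a b :: "real => real" and a' b' t
  assume d: "(a has_real_derivative a') (at t)" "(b has_real_derivative b') (at t)" and pos: "b t > 0"
  have "((\<lambda>t. b t powr (1 - p)) has_real_derivative (1 - p) * b t powr (1 - p - 1) * b') (at t)"
   using DERIV_fun_powr[OF d(2) pos, of "1 - p"] by simp
  from DERIV_mult[OF DERIV_chain2[OF abs_powr_deriv[OF p] d(1)] this]
  show "((\<lambda>t. \<Phi> (a t) (b t)) has_real_derivative \<Phi>1 (a t) (b t) * a' + \<Phi>2 (a t) (b t) * b') (at t)"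
   unfolding \<Phi>_def \<Phi>1_def \<Phi>2_def by (simp add: algebra_simps)
 qed
 have K: "compactin (Rn n) K" "K \<subseteq> U" and LX: "LpK n p K X" and cf: "continuous_on U f" using a unfolding admissible_def by auto
 have LY: "LpK n p K Y" using b K unfolding admissible_def by blast
 note FX = F_integrable(1)[OF K LX] and EY = E_integrable[OF K G(2)[OF K] LY] and Vf = V_term_integrable[OF abs_powr_continuous[OF cf] K]
 have eq: "D x (X x) (\<lambda>i. f x / u x * G x i) = F x (X x) - E x (G x) (Y x)" if "x \<in> U" for x
 proof -
  have ux: "u x > 0" by (rule u(2)[OF that])
  define v where "v = f x / u x"
  have fx: "f x = v * u x" using ux by (simp add: v_def)
  have 1: "\<Phi>1 (f x) (u x) = p * (\<bar>v\<bar> powr (p - 1) * sgn v)"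
  proof -
   have "u x powr (p - 1) * u x powr (1 - p) = 1" using ux by (simp add: powr_add[symmetric])
   thus ?thesis unfolding \<Phi>1_def fx using ux by (simp add: abs_mult powr_mult sgn_mult)
  qed
  have 2: "\<Phi>2 (f x) (u x) = (1 - p) * \<bar>v\<bar> powr p"
  proof -
   have "u x powr p * u x powr (- p) = 1" using ux by (simp add: powr_add[symmetric])
   thus ?thesis unfolding \<Phi>2_def fx using ux by (simp add: abs_mult powr_mult)
  qed
  have "E x (G x) (Y x) = \<Phi>1 (f x) (u x) * E x (G x) (X x) + \<Phi>2 (f x) (u x) * F x (G x)"
   unfolding Y_def E_add E_cmult by (simp add: E_self)
  thus ?thesis unfolding D_def v_def[symmetric] F_hom E_scale 1 2 by (simp add: algebra_simps)
 qed
 have eqK: "indicator K x * D x (X x) (\<lambda>i. f x / u x * G x i) = indicator K x * (F x (X x) - E x (G x) (Y x))" for x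
  using eq[of x] K(2) by (cases "x \<in> K") auto
 show "set_integrable (leb n) K (\<lambda>x. D x (X x) (\<lambda>i. f x / u x * G x i))"
  using set_integral_diff(1)[OF FX EY] unfolding set_integrable_alt eqK .
 have Vt: "(LINT x:K|leb n. V x * u x powr (p - 1) * \<Phi> (f x) (u x)) = (LINT x:K|leb n. V x * \<bar>f x\<bar> powr p)"
 proof -
  have "u x powr (p - 1) * u x powr (1 - p) = 1" if "x \<in> K" for x
   using u(2)[of x] K(2) that by (simp add: powr_add[symmetric] subset_iff)
  hence "indicator K x * (V x * u x powr (p - 1) * \<Phi> (f x) (u x)) = indicator K x * (V x * \<bar>f x\<bar> powr p)" for x
   unfolding \<Phi>_def by (cases "x \<in> K") (auto simp: mult_ac)
  thus ?thesis unfolding set_integral_alt by (rule Bochner_Integration.integral_cong[OF refl])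
 qed
 have "(LINT x:K|leb n. E x (G x) (Y x)) + (LINT x:K|leb n. V x * \<bar>f x\<bar> powr p) = 0"
  using weak_eq_admissible[OF b] unfolding Vt .
 hence "Q f = (LINT x:K|leb n. F x (X x)) - (LINT x:K|leb n. E x (G x) (Y x))"
  unfolding Q_eq(2)[OF a] set_integral_add(2)[OF FX Vf] by linarith
 also have "\<dots> = (LINT x:K|leb n. F x (X x) - E x (G x) (Y x))" by (rule set_integral_diff(2)[OF FX EY, symmetric])
 also have "\<dots> = (LINT x:K|leb n. D x (X x) (\<lambda>i. f x / u x * G x i))" unfolding set_integral_alt eqK ..
 finally show "Q f = (LINT x:K|leb n. D x (X x) (\<lambda>i. f x / u x * G x i))" .
qed

lemma Q_nonneg: "f \<in> W1p n p U \<inter> Cc n U ==> Q f \<ge> 0"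
proof -
 assume "f \<in> W1p n p U \<inter> Cc n U"
 then obtain K where "admissible f (weak_grad n U f) K" by (rule W1p_Cc_admissible)
 from picone(2)[OF this] show ?thesis
  using D_nonneg by (auto simp: set_integral_alt intro!: integral_nonneg_AE)
qed

text \<open>Picone's identity is applied to the truncation itself. Its integrand is zero off the
  strip: below, the truncation and its gradient vanish; above, the truncation is \<open>u\<close>,
  and the distance of the gradient of \<open>u\<close> from itself is zero.\<close>

lemma truncation:
 assumes a: "admissible f X K" and N: "N \<ge> 2" "N \<ge> m" and T: "T > 0"
 shows "(\<lambda>x. u x * psi N T (f x / u x)) \<in> W1p n p U \<inter> Cc n U"
  "set_integrable (leb n) K (\<lambda>x. indicator {x \<in> U. T < (f x / u x)\<^sup>2 \<and> (f x / u x)\<^sup>2 < 2 * T} x * D x (X x) (\<lambda>i. f x / u x * G x i))"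
  "Q (\<lambda>x. u x * psi N T (f x / u x)) \<le> (16 * real N) ^ m * T powr (- p / 2) *
   (LINT x:K|leb n. indicator {x \<in> U. T < (f x / u x)\<^sup>2 \<and> (f x / u x)\<^sup>2 < 2 * T} x * D x (X x) (\<lambda>i. f x / u x * G x i))"
proof -
 define v where "v x = f x / u x" for x
 define S where "S = {x \<in> U. T < (v x)\<^sup>2 \<and> (v x)\<^sup>2 < 2 * T}"
 define w where "w x = u x * psi N T (v x)" for x
 define W where "W x i = dpsi N T (v x) * X x i + (psi N T (v x) - v x * dpsi N T (v x)) * G x i" for x i
 have b: "admissible w W K"
  unfolding w_def W_def v_def
 proof (rule admissible_compose[OF a, of "\<lambda>a b. b * psi N T (a / b)" "\<lambda>a b. dpsi N T (a / b)" "\<lambda>a b. psi N T (a / b) - a / b * dpsi N T (a / b)"])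
  have q: "continuous_on (UNIV \<times> {0<..}) (\<lambda>z. fst z / snd z :: real)"
   by (intro continuous_on_divide continuous_on_fst continuous_on_snd continuous_on_id) auto
  have c1: "continuous_on (UNIV \<times> {0<..}) (\<lambda>z::real\<times>real. psi N T (fst z / snd z))"
   by (rule continuous_on_compose2[OF continuous_on_psi[of UNIV] q]) simp
  have c2: "continuous_on (UNIV \<times> {0<..}) (\<lambda>z::real\<times>real. dpsi N T (fst z / snd z))"
   by (rule continuous_on_compose2[OF continuous_on_dpsi[of UNIV] q]) simp
  show "continuous_on (UNIV \<times> {0<..}) (\<lambda>z::real\<times>real. snd z * psi N T (fst z / snd z))"
   by (intro continuous_on_mult c1 continuous_on_snd continuous_on_id)
  show "continuous_on (UNIV \<times> {0<..}) (\<lambda>z::real\<times>real. dpsi N T (fst z / snd z))" by (rule c2)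
  show "continuous_on (UNIV \<times> {0<..}) (\<lambda>z::real\<times>real. psi N T (fst z / snd z) - fst z / snd z * dpsi N T (fst z / snd z))"
   by (intro continuous_on_diff continuous_on_mult c1 c2 q)
  show "b * psi N T (0 / b) = 0" for b using psi_low[OF N(1) T, of 0] T by simp
  fix a b :: "real => real" and a' b' t
  assume d: "(a has_real_derivative a') (at t)" "(b has_real_derivative b') (at t)" and pos: "b t > 0"
  have "((\<lambda>t. a t / b t) has_real_derivative (a' * b t - a t * b') / (b t * b t)) (at t)"
   by (rule DERIV_divide[OF d]) (use pos in simp)
  from DERIV_mult[OF d(2) DERIV_chain2[OF psi_deriv[OF N(1) T] this]]
  show "((\<lambda>t. b t * psi N T (a t / b t)) has_real_derivative
   dpsi N T (a t / b t) * a' + (psi N T (a t / b t) - a t / b t * dpsi N T (a t / b t)) * b') (at t)"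
   by (rule DERIV_cong) (use pos in \<open>simp add: field_simps\<close>)
 qed
 have K: "compactin (Rn n) K" "K \<subseteq> U" and cf: "continuous_on U f" using a unfolding admissible_def by auto
 show "(\<lambda>x. u x * psi N T (f x / u x)) \<in> W1p n p U \<inter> Cc n U" using admissible_W1p_Cc[OF b] unfolding w_def v_def .
 have v2: "continuous_on U (\<lambda>x. (v x)\<^sup>2)" "continuous_on U (\<lambda>x. - (v x)\<^sup>2)"
  unfolding v_def using cf u by (intro continuous_intros; force)+
 have S: "S \<in> sets (leb n)"
 proof -
  have "S = {x \<in> U. (v x)\<^sup>2 > T} \<inter> {x \<in> U. - (v x)\<^sup>2 > - (2 * T)}" unfolding S_def by auto
  thus ?thesis using sets.Int[OF leb_openin[OF openin_superlevel[OF U v2(1)]] leb_openin[OF openin_superlevel[OF U v2(2)]]] by (simp only:)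
 qed
 define I where "I x = indicator S x * D x (X x) (\<lambda>i. v x * G x i)" for x
 have Iint: "set_integrable (leb n) K I"
 proof -
  have "integrable (leb n) (\<lambda>x. indicator S x *\<^sub>R (indicator K x * D x (X x) (\<lambda>i. v x * G x i)))"
   using picone(1)[OF a] unfolding set_integrable_alt v_def by (rule integrable_mult_indicator[OF S])
  thus ?thesis unfolding set_integrable_alt I_def by (simp only: real_scaleR_def mult.left_commute)
 qed
 thus "set_integrable (leb n) K (\<lambda>x. indicator {x \<in> U. T < (f x / u x)\<^sup>2 \<and> (f x / u x)\<^sup>2 < 2 * T} x * D x (X x) (\<lambda>i. f x / u x * G x i))"
  unfolding I_def S_def v_def .
 have pt: "D x (W x) (\<lambda>i. w x / u x * G x i) \<le> (16 * real N) ^ m * T powr (- p / 2) * I x" if x: "x \<in> U" for x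
 proof -
  have wx: "w x / u x = psi N T (v x)" using u(2)[OF x] by (simp add: w_def)
  \<comment> \<open>Regrouped so that the gradient is the base point \<open>psi G\<close> plus a
    multiple of the increment from \<open>v G\<close> to \<open>X\<close>, the form treated by
    \<open>truncation_bound\<close>.\<close>
  have We: "W x = (\<lambda>i. psi N T (v x) * G x i + dpsi N T (v x) * (X x i - v x * G x i))"
   by (auto simp: W_def fun_eq_iff algebra_simps)
  have Inn: "0 \<le> (16 * real N) ^ m * T powr (- p / 2) * I x" unfolding I_def using D_nonneg by simp
  consider "(v x)\<^sup>2 \<le> T" | "(v x)\<^sup>2 \<ge> 2 * T" | "T < (v x)\<^sup>2" "(v x)\<^sup>2 < 2 * T" by linarith
  thus ?thesis
  proof cases
   case 1
   thus ?thesis using psi_low[OF N(1) T 1] D_diag[of x "\<lambda>i. 0"] Inn unfolding wx We by simp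
  next
   case 2
   thus ?thesis using psi_high[OF T 2] D_diag[of x "G x"] Inn unfolding wx We by simp
  next
   case 3
   have "D x (W x) (\<lambda>i. psi N T (v x) * G x i) \<le> (16 * real N) ^ m * T powr (- p / 2) * D x (X x) (\<lambda>i. v x * G x i)"
    unfolding We
   proof (rule truncation_bound[where D="D x" and m=m, OF D_hom _ _ D_nonneg p N T 3])
    show "D x (\<lambda>i. b i + k * e i) b \<le> D x (\<lambda>i. b i + e i) b" if "0 \<le> k" "k \<le> 1" for k b e
     unfolding D_def by (rule D_mono'[OF that])
    show "D x (\<lambda>i. b i + 2 * e i) b \<le> 2 ^ m * D x (\<lambda>i. b i + e i) b" for b e
     unfolding D_def by (rule D_doubling')
   qed
   thus ?thesis unfolding wx I_def S_def using 3 x by simp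
  qed
 qed
 have "Q w = (LINT x:K|leb n. D x (W x) (\<lambda>i. w x / u x * G x i))" by (rule picone(2)[OF b])
 also have "\<dots> \<le> (LINT x:K|leb n. (16 * real N) ^ m * T powr (- p / 2) * I x)"
  using K(2) by (intro set_integral_mono picone(1)[OF b] set_integrable_mult_right Iint pt) auto
 also have "\<dots> = (16 * real N) ^ m * T powr (- p / 2) * (LINT x:K|leb n. I x)" by simp
 finally show "Q (\<lambda>x. u x * psi N T (f x / u x)) \<le> (16 * real N) ^ m * T powr (- p / 2) *
   (LINT x:K|leb n. indicator {x \<in> U. T < (f x / u x)\<^sup>2 \<and> (f x / u x)\<^sup>2 < 2 * T} x * D x (X x) (\<lambda>i. f x / u x * G x i))"
  unfolding w_def v_def I_def S_def .
qed

end

context energy_form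
begin

text \<open>\<open>2 powr p\<close> is the product of \<open>(4 T) powr (p / 2)\<close>, from
  \<open>v\<^sup>2 < 4 T\<close> on the strip that carries the mass, and
  \<open>T powr (- p / 2)\<close> from the truncation; the rest is the constant of
  \<open>truncation_bound\<close> with its exponent \<open>N = max 2 m\<close>.\<close>

definition mazya_const :: real where
 "mazya_const = 2 powr p * (16 * real (max 2 m)) ^ m"

text \<open>Maz'ya's truncation argument: on the strip \<open>T < v\<^sup>2 < 2 T\<close> the truncation at level \<open>T\<close> pays for
 the mass of \<open>f\<close> on the next dyadic strip, and the strips are disjoint.\<close>

lemma mazya:
 assumes a: "admissible f X K" and g: "g \<in> L1_loc n U" and L: "L \<ge> 0"
  and cap: "!!C w. compactin (Rn n) C ==> C \<subseteq> U ==> w \<in> W1p n p U \<inter> Cc n U ==> (!!x. x \<in> C ==> w x \<ge> u x) ==>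
   (\<integral>\<^sup>+x\<in>C. ennreal (\<bar>g x\<bar> * \<bar>u x\<bar> powr p) \<partial>leb n) \<le> ennreal (L * Q w)"
 shows "(\<integral>\<^sup>+x\<in>U. ennreal (\<bar>g x\<bar> * \<bar>f x\<bar> powr p) \<partial>leb n) \<le> ennreal (mazya_const * L * Q f)"
proof -
 define v where "v x = f x / u x" for x
 \<comment> \<open>The 2 makes the cut-off C1, and \<open>m\<close> is the order required by the
   doubling constant.\<close>
 define N where "N = max 2 m"
 have N: "N \<ge> 2" "N \<ge> m" unfolding N_def by auto
 have K: "compactin (Rn n) K" "K \<subseteq> U" and z: "!!x. x \<in> U ==> x \<notin> K ==> f x = 0"
  and cf: "continuous_on U f" using a unfolding admissible_def by auto
 have cv: "continuous_on U v" unfolding v_def using cf u by (intro continuous_on_divide) force+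
 have cv2: "continuous_on U (\<lambda>x. (v x)\<^sup>2)" "continuous_on U (\<lambda>x. - (v x)\<^sup>2)" by (intro continuous_intros cv)+
 define d where "d x = D x (X x) (\<lambda>i. v x * G x i)" for x
 have dnn: "d x \<ge> 0" for x unfolding d_def by (rule D_nonneg)
 have dint: "set_integrable (leb n) K d" and Qd: "Q f = (LINT x:K|leb n. d x)"
  using picone[OF a] unfolding d_def v_def by auto
 define S where "S T = {x \<in> U. T < (v x)\<^sup>2 \<and> (v x)\<^sup>2 < 2 * T}" for T
 define I where "I T = (LINT x:K|leb n. indicator (S T) x * d x)" for T
 have Iint: "set_integrable (leb n) K (\<lambda>x. indicator (S T) x * d x)" if "T > 0" for T
  using truncation(2)[OF a N that] unfolding S_def d_def v_def .
 have Inn: "I T \<ge> 0" for T unfolding I_def set_integral_alt using dnn by (intro integral_nonneg_AE) auto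
 \<comment> \<open>Half-open, so that dyadic strips leave no level out; the open strips
   \<open>S\<close> that carry the energy need only be disjoint.\<close>
 define R where "R \<tau> = {x \<in> U. \<tau> \<le> (v x)\<^sup>2 \<and> (v x)\<^sup>2 < 2 * \<tau>}" for \<tau>
 have RK: "R \<tau> \<subseteq> K" if "\<tau> > 0" for \<tau> unfolding R_def v_def using z that by (auto, metis div_0 not_le power_zero_numeral)
 have sub: "U \<subseteq> En n" by (rule openin_Rn_subset[OF U])
 have ge_compact: "compactin (Rn n) {x \<in> K. \<tau> \<le> (v x)\<^sup>2}" for \<tau>
 proof -
  have "closedin (top_of_set K) {x \<in> K. \<tau> \<le> (v x)\<^sup>2}"
  proof -
   have "{x \<in> K. \<tau> \<le> (v x)\<^sup>2} = K \<inter> (\<lambda>x. (v x)\<^sup>2) -` {\<tau>..}" by auto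
   thus ?thesis by (simp only:) (rule continuous_closedin_preimage[OF continuous_on_subset[OF cv2(1) K(2)] closed_atLeast])
  qed
  thus ?thesis using K(1) closedin_compact[of K] unfolding compactin_Rn by auto
 qed
 have gt: "{x \<in> U. \<tau> \<le> (v x)\<^sup>2} \<in> sets (leb n)" for \<tau>
 proof -
  have "{x \<in> U. \<tau> \<le> (v x)\<^sup>2} = U - {x \<in> U. - (v x)\<^sup>2 > - \<tau>}" by auto
  thus ?thesis using sets.Diff[OF leb_openin[OF U] leb_openin[OF openin_superlevel[OF U cv2(2), of "- \<tau>"]]] by (simp only:)
 qed
 have Rm: "R \<tau> \<in> sets (leb n)" for \<tau>
 proof -
  have "R \<tau> = {x \<in> U. \<tau> \<le> (v x)\<^sup>2} - {x \<in> U. 2 * \<tau> \<le> (v x)\<^sup>2}" unfolding R_def by auto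
  thus ?thesis using sets.Diff[OF gt gt] by (simp only:)
 qed
 define C1 where "C1 = mazya_const * L"
 have C1: "C1 \<ge> 0" unfolding C1_def mazya_const_def using L by simp
 have strip: "(\<integral>\<^sup>+x\<in>R (2 * T). ennreal (\<bar>g x\<bar> * \<bar>f x\<bar> powr p) \<partial>leb n) \<le> ennreal (C1 * I T)" if T: "T > 0" for T
 proof -
  define w where "w x = u x * psi N T (f x / u x)" for x
  define C where "C = {x \<in> K. 2 * T \<le> (v x)\<^sup>2}"
  have C: "compactin (Rn n) C" "C \<subseteq> U" unfolding C_def using ge_compact K by auto
  have wu: "w x \<ge> u x" if "x \<in> C" for x using psi_high[OF T, of "f x / u x" N] that unfolding C_def w_def v_def by simp
  have w: "w \<in> W1p n p U \<inter> Cc n U" unfolding w_def by (rule truncation(1)[OF a N T])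
  have Qw: "Q w \<le> (16 * real N) ^ m * T powr (- p / 2) * I T"
   using truncation(3)[OF a N T] unfolding w_def I_def S_def d_def v_def .
  have pt: "ennreal (\<bar>g x\<bar> * \<bar>f x\<bar> powr p) * indicator (R (2 * T)) x
    \<le> ennreal ((4 * T) powr (p / 2)) * (ennreal (\<bar>g x\<bar> * \<bar>u x\<bar> powr p) * indicator C x)" for x
  proof (cases "x \<in> R (2 * T)")
   case True
   hence x: "x \<in> U" "(v x)\<^sup>2 < 4 * T" "x \<in> C" using RK[of "2 * T"] T unfolding R_def C_def by auto
   have ux: "u x > 0" by (rule u(2)[OF x(1)])
   have "\<bar>f x\<bar> = \<bar>v x\<bar> * \<bar>u x\<bar>" using ux by (simp add: v_def abs_divide)
   hence "\<bar>f x\<bar> powr p = \<bar>v x\<bar> powr p * \<bar>u x\<bar> powr p" by (simp add: powr_mult)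
   moreover have "\<bar>v x\<bar> powr p = ((v x)\<^sup>2) powr (p / 2)"
   proof -
    have "(v x)\<^sup>2 = \<bar>v x\<bar> powr 2" by simp
    thus ?thesis by (simp only: powr_powr) simp
   qed
   moreover have "((v x)\<^sup>2) powr (p / 2) \<le> (4 * T) powr (p / 2)" using x(2) p by (intro powr_mono2) auto
   ultimately have "\<bar>f x\<bar> powr p \<le> (4 * T) powr (p / 2) * \<bar>u x\<bar> powr p" by (simp add: mult_right_mono)
   hence "\<bar>g x\<bar> * \<bar>f x\<bar> powr p \<le> \<bar>g x\<bar> * ((4 * T) powr (p / 2) * \<bar>u x\<bar> powr p)" by (intro mult_left_mono) auto
   hence "\<bar>g x\<bar> * \<bar>f x\<bar> powr p \<le> (4 * T) powr (p / 2) * (\<bar>g x\<bar> * \<bar>u x\<bar> powr p)" by (simp only: mult.left_commute)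
   thus ?thesis using True x(3) by (simp add: ennreal_mult'[symmetric] ennreal_leI)
  qed simp
  have "(\<integral>\<^sup>+x\<in>R (2 * T). ennreal (\<bar>g x\<bar> * \<bar>f x\<bar> powr p) \<partial>leb n)
    \<le> (\<integral>\<^sup>+x. ennreal ((4 * T) powr (p / 2)) * (ennreal (\<bar>g x\<bar> * \<bar>u x\<bar> powr p) * indicator C x) \<partial>leb n)"
   by (intro nn_integral_mono pt)
  also have "\<dots> = ennreal ((4 * T) powr (p / 2)) * (\<integral>\<^sup>+x\<in>C. ennreal (\<bar>g x\<bar> * \<bar>u x\<bar> powr p) \<partial>leb n)"
   by (rule nn_integral_cmult[OF mass_measurable[OF g u(1) leb_compactin[OF C(1)] C(2)]])
  also have "\<dots> \<le> ennreal ((4 * T) powr (p / 2)) * ennreal (L * Q w)"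
   by (intro mult_left_mono cap[OF C w wu]) auto
  also have "\<dots> = ennreal ((4 * T) powr (p / 2) * (L * Q w))"
   by (rule ennreal_mult'[symmetric]) simp
  also have "\<dots> \<le> ennreal ((4 * T) powr (p / 2) * (L * ((16 * real N) ^ m * T powr (- p / 2) * I T)))"
   using Qw L by (intro ennreal_leI mult_left_mono) auto
  also have "(4 * T) powr (p / 2) * (L * ((16 * real N) ^ m * T powr (- p / 2) * I T)) = C1 * I T"
  proof -
   have "(4 * T) powr (p / 2) = 2 powr p * T powr (p / 2)"
   proof -
    have "(4::real) powr (p / 2) = (2 powr 2) powr (p / 2)" by simp
    also have "\<dots> = 2 powr p" by (simp only: powr_powr) simp
    finally show ?thesis using T by (simp add: powr_mult)
   qed
   moreover have "T powr (p / 2) * T powr (- p / 2) = 1" using T by (simp add: powr_add[symmetric])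
   ultimately show ?thesis unfolding C1_def mazya_const_def N_def by (simp add: mult_ac)
  qed
  finally show ?thesis .
 qed
 \<comment> \<open>Away from \<open>v = 0\<close> finitely many strips suffice, since
   \<open>v\<close> is bounded on \<open>K\<close>. The bound does not depend on
   \<open>\<tau>\<close>, so Fatou's lemma lets \<open>\<tau>\<close> tend to 0 afterwards.\<close>
 have level: "(\<integral>\<^sup>+x\<in>{x \<in> U. \<tau> \<le> (v x)\<^sup>2}. ennreal (\<bar>g x\<bar> * \<bar>f x\<bar> powr p) \<partial>leb n) \<le> ennreal (C1 * Q f)" if \<tau>: "\<tau> > 0" for \<tau>
 proof -
  obtain B where B: "B > 0" "!!x. x \<in> K ==> \<bar>(v x)\<^sup>2\<bar> \<le> B"
   using compact_bounded_real[OF K(1) continuous_on_subset[OF cv2(1) K(2)]] by metis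
  obtain J where J: "B / \<tau> < 2 ^ J" using real_arch_pow[of 2 "B / \<tau>"] by auto
  have ltJ: "(v x)\<^sup>2 < 2 ^ J * \<tau>" if "x \<in> K" for x using B(2)[OF that] J \<tau> by (simp add: field_simps)
  \<comment> \<open>Half of the lower end of the j-th strip of mass, because the truncation at level
    \<open>t j\<close> reaches \<open>u\<close> only at \<open>2 * t j\<close>.\<close>
  define t where "t j = 2 ^ j * \<tau> / 2" for j :: nat
  have t: "t j > 0" "2 * t j = 2 ^ j * \<tau>" "2 * t j = t (Suc j)" for j unfolding t_def using \<tau> by auto
  define q where "q x = ennreal (\<bar>g x\<bar> * \<bar>f x\<bar> powr p)" for x
  have pt: "q x * indicator {x \<in> U. \<tau> \<le> (v x)\<^sup>2} x \<le> (\<Sum>j<J. q x * indicator (R (2 * t j)) x)" for x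
  proof (cases "x \<in> U \<and> \<tau> \<le> (v x)\<^sup>2")
   case True
   have "x \<in> K" using True z[of x] \<tau> unfolding v_def by (cases "x \<in> K") auto
   from dyadic_strip[OF conjunct2[OF True] ltJ[OF this]] obtain j where j: "j < J" "x \<in> R (2 * t j)"
    using True t(2) unfolding R_def by auto
   have "q x * indicator (R (2 * t j)) x \<le> (\<Sum>j<J. q x * indicator (R (2 * t j)) x)"
    by (rule member_le_sum) (use j in auto)
   thus ?thesis using j True by simp
  qed auto
  have "(\<integral>\<^sup>+x. q x * indicator {x \<in> U. \<tau> \<le> (v x)\<^sup>2} x \<partial>leb n) \<le> (\<integral>\<^sup>+x. (\<Sum>j<J. q x * indicator (R (2 * t j)) x) \<partial>leb n)"
   by (intro nn_integral_mono pt)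
  also have "\<dots> = (\<Sum>j<J. \<integral>\<^sup>+x. q x * indicator (R (2 * t j)) x \<partial>leb n)"
   unfolding q_def by (intro nn_integral_sum mass_measurable[OF g cf Rm]) (auto simp: R_def)
  also have "\<dots> \<le> (\<Sum>j<J. ennreal (C1 * I (t j)))" unfolding q_def by (intro sum_mono strip t)
  also have "\<dots> = ennreal (\<Sum>j<J. C1 * I (t j))" using C1 Inn by (intro sum_ennreal) auto
  also have "\<dots> \<le> ennreal (C1 * Q f)"
  proof (rule ennreal_leI)
   have disj: "disjoint_family_on (\<lambda>j. S (t j)) {..<J}"
   proof -
    have *: "S (t i) \<inter> S (t j) = {}" if "i < j" for i j
    proof -
     have "2 * t i = t (Suc i)" by (rule t(3))
     also have "\<dots> \<le> t j" unfolding t_def using that \<tau> by (intro divide_right_mono mult_right_mono power_increasing) auto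
     finally show ?thesis unfolding S_def by auto
    qed
    show ?thesis unfolding disjoint_family_on_def
    proof (intro ballI impI)
     fix i j :: nat assume "i \<noteq> j"
     thus "S (t i) \<inter> S (t j) = {}" using *[of i j] *[of j i] by (cases "i < j") auto
    qed
   qed
   have "(\<Sum>j<J. I (t j)) = (\<integral>x. (\<Sum>j<J. indicator K x * (indicator (S (t j)) x * d x)) \<partial>leb n)"
    unfolding I_def set_integral_alt using Iint t(1) by (intro Bochner_Integration.integral_sum[symmetric]) (auto simp: set_integrable_alt)
   also have "\<dots> \<le> (\<integral>x. indicator K x * d x \<partial>leb n)"
   proof (rule integral_mono)
    show "integrable (leb n) (\<lambda>x. \<Sum>j<J. indicator K x * (indicator (S (t j)) x * d x))"
     using Iint t(1) unfolding set_integrable_alt by (intro Bochner_Integration.integrable_sum) auto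
    show "integrable (leb n) (\<lambda>x. indicator K x * d x)" using dint unfolding set_integrable_alt .
    fix x
    have "(\<Sum>j<J. indicator K x * (indicator (S (t j)) x * d x)) = (\<Sum>j<J. indicator (S (t j)) x) * (indicator K x * d x)"
     by (simp add: sum_distrib_left mult_ac)
    also have "(\<Sum>j<J. indicator (S (t j)) x :: real) = indicator (\<Union>j<J. S (t j)) x"
     by (rule indicator_UN_disjoint[OF _ disj, symmetric]) simp
    also have "\<dots> * (indicator K x * d x) \<le> 1 * (indicator K x * d x)"
     by (rule mult_right_mono) (auto simp: indicator_def dnn)
    finally show "(\<Sum>j<J. indicator K x * (indicator (S (t j)) x * d x)) \<le> indicator K x * d x" by simp
   qed
   finally have "(\<Sum>j<J. I (t j)) \<le> Q f" unfolding Qd set_integral_alt .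
   thus "(\<Sum>j<J. C1 * I (t j)) \<le> C1 * Q f" using C1 by (simp add: sum_distrib_left[symmetric] mult_left_mono)
  qed
  finally show ?thesis unfolding q_def .
 qed
 define q where "q x = ennreal (\<bar>g x\<bar> * \<bar>f x\<bar> powr p)" for x
 define A where "A k = {x \<in> U. 1 / real (Suc k) \<le> (v x)\<^sup>2}" for k
 have l: "(\<lambda>k. q x * indicator (A k) x) \<longlonglongrightarrow> q x * indicator U x" for x
 proof (cases "x \<in> U \<and> v x \<noteq> 0")
  case True
  then obtain k0 where k0: "1 / real (Suc k0) < (v x)\<^sup>2" using nat_approx_posE[of "(v x)\<^sup>2"] by auto
  have "q x * indicator (A k) x = q x * indicator U x" if "k \<ge> k0" for k
  proof -
   have "1 / real (Suc k) \<le> 1 / real (Suc k0)" using that by (intro divide_left_mono) auto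
   thus ?thesis using True k0 unfolding A_def by simp
  qed
  thus ?thesis by (intro tendsto_eventually) (auto simp: eventually_sequentially)
 next
  case False
  hence "q x = 0 \<or> x \<notin> U" using u(2)[of x] p unfolding q_def v_def by auto
  thus ?thesis unfolding A_def by auto
 qed
 have "(\<integral>\<^sup>+x. q x * indicator U x \<partial>leb n) = (\<integral>\<^sup>+x. liminf (\<lambda>k. q x * indicator (A k) x) \<partial>leb n)"
  using lim_imp_Liminf[OF sequentially_bot l] by simp
 also have "\<dots> \<le> liminf (\<lambda>k. \<integral>\<^sup>+x. q x * indicator (A k) x \<partial>leb n)"
  unfolding q_def A_def by (intro nn_integral_liminf mass_measurable[OF g cf gt]) auto
 also have "\<dots> \<le> liminf (\<lambda>k. ennreal (C1 * Q f))"
  unfolding q_def A_def by (intro Liminf_mono always_eventually allI level) simp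
 also have "\<dots> = ennreal (C1 * Q f)" by (simp add: Liminf_const)
 finally show ?thesis unfolding q_def C1_def .
qed

end

section \<open>Hardy weights\<close>

lemma enn2ereal_le_iff: "r \<ge> 0 ==> enn2ereal x \<le> ereal r \<longleftrightarrow> x \<le> ennreal r"
 by (simp add: less_eq_ennreal.rep_eq)

context energy_form
begin

abbreviation W :: "(vec => real) set" where
 "W \<equiv> W1p n p U \<inter> Cc n U"

abbreviation X_space :: "(vec => real) set" where
 "X_space \<equiv> hardy_space n p H V U"

abbreviation N_u :: "(vec => real) => ereal" where
 "N_u \<equiv> u_norm n p H V U u"

definition umass :: "vec set => (vec => real) => ennreal" where
 "umass K g = (\<integral>\<^sup>+x\<in>K. ennreal (\<bar>g x\<bar> * \<bar>u x\<bar> powr p) \<partial>leb n)"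

text \<open>\<open>hardy_bound\<close> and \<open>capacity_bound\<close> restate, without quotients
  and infima in \<open>ereal\<close>, that the Hardy norm or the norm by capacities is at most
  \<open>L\<close>.\<close>

definition hardy_bound :: "(vec => real) => real => bool" where
 "hardy_bound g L \<longleftrightarrow> (\<forall>\<phi>\<in>W. (\<integral>\<^sup>+x\<in>U. ennreal (\<bar>g x\<bar> * \<bar>\<phi> x\<bar> powr p) \<partial>leb n) \<le> ennreal (L * Q \<phi>))"

definition capacity_bound :: "(vec => real) => real => bool" where
 "capacity_bound g L \<longleftrightarrow> (\<forall>K w. compactin (Rn n) K --> K \<subseteq> U --> w \<in> W --> (\<forall>x\<in>K. w x \<ge> u x) --> umass K g \<le> ennreal (L * Q w))"

lemma capacity_boundD:
 "capacity_bound g L ==> compactin (Rn n) K ==> K \<subseteq> U ==> w \<in> W ==> (!!x. x \<in> K ==> w x \<ge> u x) ==> umass K g \<le> ennreal (L * Q w)"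
 unfolding capacity_bound_def by blast

text \<open>Capacities of compact sets are finite: a cut-off times the maximum of \<open>u\<close>
  on \<open>K\<close> competes. The later local integrability and completeness arguments rest on
  such a competitor.\<close>

lemma ex_capacity_function:
 assumes K: "compactin (Rn n) K" "K \<subseteq> U"
 obtains w where "w \<in> W" "!!x. x \<in> K ==> w x \<ge> u x"
proof -
 obtain \<eta> where \<eta>: "\<eta> \<in> Cc_smooth n U" "!!x. x \<in> K ==> \<eta> x = 1" by (rule ex_cutoff[OF U K]) (rule that)
 obtain B where B: "!!x. x \<in> K ==> \<bar>u x\<bar> \<le> B"
  using compact_bounded_real[OF K(1) continuous_on_subset[OF u(1) K(2)]] by metis
 have p0: "p > 0" using p by simp
 show thesis
  by (rule that[OF Cc_smooth_W1p_Cc[OF U Cc_smooth_cmult[OF U \<eta>(1), of B] p0]]) (use \<eta>(2) B in \<open>force simp: abs_le_iff\<close>)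
qed

text \<open>A competitor \<open>w\<close> satisfies \<open>w \<ge> u > 0\<close> on
  \<open>K\<close>, so the mass of \<open>u\<close> on \<open>K\<close> is at most the full mass of
  \<open>w\<close>.\<close>

lemma hardy_imp_capacity_bound: "hardy_bound g L ==> capacity_bound g L"
 unfolding capacity_bound_def
proof (intro allI impI)
 fix K w assume h: "hardy_bound g L" and K: "K \<subseteq> U" and w: "w \<in> W" "\<forall>x\<in>K. w x \<ge> u x"
 have "umass K g \<le> (\<integral>\<^sup>+x\<in>U. ennreal (\<bar>g x\<bar> * \<bar>w x\<bar> powr p) \<partial>leb n)"
  unfolding umass_def
 proof (rule nn_integral_mono)
  fix x
  show "ennreal (\<bar>g x\<bar> * \<bar>u x\<bar> powr p) * indicator K x \<le> ennreal (\<bar>g x\<bar> * \<bar>w x\<bar> powr p) * indicator U x"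
  proof (cases "x \<in> K")
   case True
   hence "\<bar>u x\<bar> \<le> \<bar>w x\<bar>" using u(2)[of x] w(2) K by force
   hence "\<bar>u x\<bar> powr p \<le> \<bar>w x\<bar> powr p" using p by (intro powr_mono2) auto
   hence "ennreal (\<bar>g x\<bar> * \<bar>u x\<bar> powr p) \<le> ennreal (\<bar>g x\<bar> * \<bar>w x\<bar> powr p)" by (intro ennreal_leI mult_left_mono) auto
   moreover have "x \<in> U" using True K by blast
   ultimately show ?thesis using True by simp
  qed simp
 qed
 thus "umass K g \<le> ennreal (L * Q w)" using h w unfolding hardy_bound_def by (blast intro: order_trans)
qed

lemma capacity_imp_hardy_bound:
 assumes g: "g \<in> L1_loc n U" and L: "L \<ge> 0" and c: "capacity_bound g L"
 shows "hardy_bound g (mazya_const * L)"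
 unfolding hardy_bound_def
proof
 fix \<phi> assume "\<phi> \<in> W"
 then obtain K where a: "admissible \<phi> (weak_grad n U \<phi>) K" by (rule W1p_Cc_admissible)
 show "(\<integral>\<^sup>+x\<in>U. ennreal (\<bar>g x\<bar> * \<bar>\<phi> x\<bar> powr p) \<partial>leb n) \<le> ennreal (mazya_const * L * Q \<phi>)"
  by (rule mazya[OF a g L]) (use c in \<open>auto simp: capacity_bound_def umass_def\<close>)
qed

text \<open>The Hardy constants correspond by \<open>L = 1 / C\<close>; the passage from smooth
  functions to \<open>W\<close> is \<open>mass_extend\<close>.\<close>

lemma hardy_space_iff_hardy_bound:
 assumes g: "g \<in> L1_loc n U"
 shows "g \<in> X_space \<longleftrightarrow> (\<exists>L>0. hardy_bound g L)"
proof -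
 have p0: "p > 0" using p by simp
 have sub: "Cc_smooth n U \<subseteq> W" using Cc_smooth_W1p_Cc[OF U _ p0] by blast
 have conv: "ereal C * mass n p U g \<phi> \<le> ereal (Q \<phi>) \<longleftrightarrow>
   (\<integral>\<^sup>+x\<in>U. ennreal (\<bar>g x\<bar> * \<bar>\<phi> x\<bar> powr p) \<partial>leb n) \<le> ennreal (1 / C * Q \<phi>)" if C: "C > 0" and \<phi>: "\<phi> \<in> W" for C \<phi>
 proof -
  have "ereal C * mass n p U g \<phi> \<le> ereal (Q \<phi>) \<longleftrightarrow> mass n p U g \<phi> \<le> ereal (1 / C * Q \<phi>)"
   using C by (cases "mass n p U g \<phi>") (auto simp: field_simps)
  also have "\<dots> \<longleftrightarrow> (\<integral>\<^sup>+x\<in>U. ennreal (\<bar>g x\<bar> * \<bar>\<phi> x\<bar> powr p) \<partial>leb n) \<le> ennreal (1 / C * Q \<phi>)"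
   unfolding mass_def using C Q_nonneg[OF \<phi>] by (intro enn2ereal_le_iff) auto
  finally show ?thesis .
 qed
 show ?thesis
 proof
  assume "g \<in> X_space"
  then obtain C where C: "C > 0" "!!\<phi>. \<phi> \<in> Cc_smooth n U ==> ereal C * mass n p U g \<phi> \<le> ereal (Q \<phi>)"
   unfolding hardy_space_def by blast
  have "hardy_bound g (1 / C)" unfolding hardy_bound_def
  proof
   fix \<phi> assume "\<phi> \<in> W"
   then obtain K where a: "admissible \<phi> (weak_grad n U \<phi>) K" by (rule W1p_Cc_admissible)
   show "(\<integral>\<^sup>+x\<in>U. ennreal (\<bar>g x\<bar> * \<bar>\<phi> x\<bar> powr p) \<partial>leb n) \<le> ennreal (1 / C * Q \<phi>)"
    by (rule mass_extend[OF g _ a]) (use conv[OF C(1)] C(2) sub in blast)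
  qed
  thus "\<exists>L>0. hardy_bound g L" using C(1) by (intro exI[of _ "1 / C"]) simp
 next
  assume "\<exists>L>0. hardy_bound g L"
  then obtain L where L: "L > 0" "hardy_bound g L" by blast
  have "ereal (1 / L) * mass n p U g \<phi> \<le> ereal (Q \<phi>)" if "\<phi> \<in> Cc_smooth n U" for \<phi>
   using conv[of "1 / L" \<phi>] L sub that unfolding hardy_bound_def by auto
  thus "g \<in> X_space" unfolding hardy_space_def using g L(1) by (auto intro!: exI[of _ "1 / L"])
 qed
qed

lemma capacity_bound_mono: "capacity_bound g L ==> L \<le> L' ==> capacity_bound g L'"
 unfolding capacity_bound_def
 by (meson Q_nonneg ennreal_leI mult_right_mono order_trans)

lemma capacity_bound_iff:
 assumes L: "L \<ge> 0"
 shows "(\<forall>K. compactin (Rn n) K \<and> K \<subseteq> U --> mass n p K g u \<le> ereal L * Cap n p H V U K u) \<longleftrightarrow> capacity_bound g L"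
proof -
 have "mass n p K g u \<le> ereal L * Cap n p H V U K u \<longleftrightarrow> (\<forall>w\<in>W. (\<forall>x\<in>K. w x \<ge> u x) --> umass K g \<le> ennreal (L * Q w))"
  if K: "compactin (Rn n) K" "K \<subseteq> U" for K
 proof -
  have m: "mass n p K g u = enn2ereal (umass K g)" unfolding mass_def umass_def ..
  have le: "umass K g \<le> ennreal (L * Q w) \<longleftrightarrow> mass n p K g u \<le> ereal (L * Q w)" if "w \<in> W" for w
   unfolding m using L Q_nonneg[OF that] by (simp add: enn2ereal_le_iff)
  show ?thesis
  proof
   assume *: "mass n p K g u \<le> ereal L * Cap n p H V U K u"
   show "\<forall>w\<in>W. (\<forall>x\<in>K. w x \<ge> u x) --> umass K g \<le> ennreal (L * Q w)"
   proof (intro ballI impI)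
    fix w assume w: "w \<in> W" "\<forall>x\<in>K. w x \<ge> u x"
    have "Cap n p H V U K u \<le> ereal (Q w)" unfolding Cap_def using w by (intro INF_lower) auto
    hence "ereal L * Cap n p H V U K u \<le> ereal L * ereal (Q w)" using L by (intro ereal_mult_left_mono) auto
    thus "umass K g \<le> ennreal (L * Q w)" unfolding le[OF w(1)] using * by (simp add: order_trans)
   qed
  next
   assume *: "\<forall>w\<in>W. (\<forall>x\<in>K. w x \<ge> u x) --> umass K g \<le> ennreal (L * Q w)"
   show "mass n p K g u \<le> ereal L * Cap n p H V U K u"
   \<comment> \<open>For \<open>L = 0\<close> the right-hand side is 0 whatever the capacity, and
     the mass is seen to vanish only through a competitor, which therefore has to exist.\<close>
   proof (cases "L = 0")
    case True
    obtain w where "w \<in> W" "!!x. x \<in> K ==> w x \<ge> u x" using ex_capacity_function[OF K] by metis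
    hence "umass K g \<le> ennreal (L * Q w)" using * by blast
    thus ?thesis unfolding m True by (simp add: zero_ennreal.rep_eq zero_ereal_def[symmetric])
   next
    case False
    hence L0: "L > 0" using L by simp
    have "mass n p K g u / ereal L \<le> Cap n p H V U K u"
     unfolding Cap_def
    proof (rule INF_greatest)
     fix w assume w: "w \<in> {\<phi> \<in> W. \<forall>x\<in>K. u x \<le> \<phi> x}"
     hence "mass n p K g u \<le> ereal (L * Q w)" using * le[of w] by auto
     thus "mass n p K g u / ereal L \<le> ereal (Q w)" using L0 by (simp add: ereal_divide_le_pos)
    qed
    thus ?thesis using L0 by (simp add: ereal_divide_le_pos)
   qed
  qed
 qed
 thus ?thesis unfolding capacity_bound_def by blast
qed

lemma N_u_eq: "N_u g = Inf {ereal L | L. 0 \<le> L \<and> capacity_bound g L}"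
 unfolding u_norm_def using capacity_bound_iff by (metis (no_types, lifting))

lemma N_u_nonneg: "0 \<le> N_u g"
 unfolding N_u_eq by (rule Inf_greatest) auto

text \<open>The infimum is attained: the bounds for all \<open>L' > L\<close> pass to the limit
  because each competitor has finite energy.\<close>

lemma N_u_le_iff:
 assumes L: "L \<ge> 0"
 shows "N_u g \<le> ereal L \<longleftrightarrow> capacity_bound g L"
proof
 assume "capacity_bound g L"
 thus "N_u g \<le> ereal L" unfolding N_u_eq using L by (intro Inf_lower) auto
next
 assume le: "N_u g \<le> ereal L"
 have gt: "capacity_bound g L'" if "L < L'" for L'
 proof -
  have "N_u g < ereal L'" using le that by (meson ereal_less_eq(3) le_less_trans less_ereal.simps(1))
  then obtain M where "capacity_bound g M" "M < L'" unfolding N_u_eq Inf_less_iff by auto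
  thus ?thesis using capacity_bound_mono by (meson less_imp_le)
 qed
 show "capacity_bound g L" unfolding capacity_bound_def
 proof (intro allI impI)
  fix K w assume K: "compactin (Rn n) K" "K \<subseteq> U" and w: "w \<in> W" "\<forall>x\<in>K. w x \<ge> u x"
  have "(\<lambda>k. ennreal ((L + 1 / real (Suc k)) * Q w)) \<longlonglongrightarrow> ennreal ((L + 0) * Q w)"
   by (intro tendsto_ennrealI tendsto_mult_right tendsto_add tendsto_const LIMSEQ_Suc[OF lim_1_over_n])
  moreover have "umass K g \<le> ennreal ((L + 1 / real (Suc k)) * Q w)" for k
   by (rule capacity_boundD[OF gt K w(1)]) (use w(2) in auto)
  ultimately show "umass K g \<le> ennreal (L * Q w)" by (intro LIMSEQ_le_const) auto
 qed
qed

lemma hardy_space_L1_loc: "g \<in> X_space ==> g \<in> L1_loc n U"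
 unfolding hardy_space_def by blast

lemma mazya_const_pos: "mazya_const > 0"
 unfolding mazya_const_def by (intro mult_pos_pos zero_less_power) auto

theorem hardy_space_iff:
 assumes g: "g \<in> L1_loc n U"
 shows "g \<in> X_space \<longleftrightarrow> (\<exists>L\<ge>0. capacity_bound g L)"
proof
 assume "g \<in> X_space"
 thus "\<exists>L\<ge>0. capacity_bound g L"
  using hardy_space_iff_hardy_bound[OF g] hardy_imp_capacity_bound by (meson less_imp_le)
next
 assume "\<exists>L\<ge>0. capacity_bound g L"
 then obtain L where "L \<ge> 0" "capacity_bound g L" by blast
 \<comment> \<open>A Hardy constant must be positive, while \<open>L\<close> may be 0.\<close>
 hence "capacity_bound g (L + 1)" "L + 1 > 0" using capacity_bound_mono by auto
 hence "hardy_bound g (mazya_const * (L + 1))" "mazya_const * (L + 1) > 0"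
  using capacity_imp_hardy_bound[OF g] mazya_const_pos by auto
 thus "g \<in> X_space" unfolding hardy_space_iff_hardy_bound[OF g] by blast
qed

lemma N_u_finite_iff: "N_u g < \<infinity> \<longleftrightarrow> (\<exists>L\<ge>0. capacity_bound g L)"
proof
 assume "N_u g < \<infinity>"
 then obtain r where r: "N_u g = ereal r" using N_u_nonneg[of g] by (cases "N_u g") auto
 hence "r \<ge> 0" using N_u_nonneg[of g] by simp
 thus "\<exists>L\<ge>0. capacity_bound g L" using N_u_le_iff[of r g] r by auto
next
 assume "\<exists>L\<ge>0. capacity_bound g L"
 then obtain L where "N_u g \<le> ereal L" using N_u_le_iff by blast
 thus "N_u g < \<infinity>" by (rule le_less_trans) simp
qed

lemma hardy_space_N_u:
 assumes "g \<in> X_space"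
 obtains r where "r \<ge> 0" "N_u g = ereal r" "capacity_bound g r"
proof -
 have "N_u g < \<infinity>" unfolding N_u_finite_iff using hardy_space_iff[OF hardy_space_L1_loc[OF assms]] assms by blast
 then obtain r where r: "N_u g = ereal r" using N_u_nonneg[of g] by (cases "N_u g") auto
 hence "r \<ge> 0" using N_u_nonneg[of g] by simp
 thus thesis using that[of r] r N_u_le_iff[of r g] by auto
qed

lemma S_const_ge_iff:
 assumes L: "L > 0"
 shows "S_const n p H V U g \<ge> ereal (1 / L) \<longleftrightarrow> hardy_bound g L"
proof -
 have le: "(\<integral>\<^sup>+x\<in>U. ennreal (\<bar>g x\<bar> * \<bar>\<phi> x\<bar> powr p) \<partial>leb n) \<le> ennreal (L * Q \<phi>) \<longleftrightarrow> mass n p U g \<phi> \<le> ereal (L * Q \<phi>)" if "\<phi> \<in> W" for \<phi>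
  unfolding mass_def using L Q_nonneg[OF that] by (simp add: enn2ereal_le_iff)
 have nn: "mass n p U g \<phi> \<ge> 0" for \<phi> unfolding mass_def by simp
 have eq: "ereal (1 / L) \<le> ereal (Q \<phi>) / mass n p U g \<phi> \<longleftrightarrow> mass n p U g \<phi> \<le> ereal (L * Q \<phi>)" if "mass n p U g \<phi> > 0" for \<phi>
  using that L by (cases "mass n p U g \<phi>") (auto simp: field_simps)
 show ?thesis
 proof
  assume *: "S_const n p H V U g \<ge> ereal (1 / L)"
  show "hardy_bound g L" unfolding hardy_bound_def
  proof
   fix \<phi> assume \<phi>: "\<phi> \<in> W"
   have "mass n p U g \<phi> \<le> ereal (L * Q \<phi>)"
   proof (cases "mass n p U g \<phi> > 0")
    case True
    have "S_const n p H V U g \<le> ereal (Q \<phi>) / mass n p U g \<phi>" unfolding S_const_def using \<phi> True by (intro INF_lower) auto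
    thus ?thesis using * eq[OF True] by (blast intro: order_trans)
   next
    case False
    thus ?thesis using nn[of \<phi>] L Q_nonneg[OF \<phi>] by (metis antisym_conv2 ereal_less_eq(5) less_imp_le mult_nonneg_nonneg)
   qed
   thus "(\<integral>\<^sup>+x\<in>U. ennreal (\<bar>g x\<bar> * \<bar>\<phi> x\<bar> powr p) \<partial>leb n) \<le> ennreal (L * Q \<phi>)" using le[OF \<phi>] by blast
  qed
 next
  assume *: "hardy_bound g L"
  show "S_const n p H V U g \<ge> ereal (1 / L)"
   unfolding S_const_def
  proof (rule INF_greatest)
   fix \<phi> assume \<phi>: "\<phi> \<in> {\<phi> \<in> W. mass n p U g \<phi> > 0}"
   hence "mass n p U g \<phi> \<le> ereal (L * Q \<phi>)" using * le[of \<phi>] unfolding hardy_bound_def by blast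
   thus "ereal (1 / L) \<le> ereal (Q \<phi>) / mass n p U g \<phi>" using eq[of \<phi>] \<phi> by blast
  qed
 qed
qed

lemma S_const_nonneg: "S_const n p H V U g \<ge> 0"
 unfolding S_const_def divide_ereal_def
 by (rule INF_greatest) (auto intro!: Q_nonneg ereal_0_le_mult simp: less_imp_le ereal_inverse_nonneg_iff)

lemma hardy_norm_le_iff:
 assumes L: "L > 0"
 shows "hardy_norm n p H V U g \<le> ereal L \<longleftrightarrow> hardy_bound g L"
proof -
 have "S_const n p H V U g \<ge> 0" by (rule S_const_nonneg)
 hence "1 / S_const n p H V U g \<le> ereal L \<longleftrightarrow> ereal (1 / L) \<le> S_const n p H V U g"
  using L by (cases "S_const n p H V U g") (auto simp: one_ereal_def field_simps)
 thus ?thesis unfolding hardy_norm_def S_const_ge_iff[OF L] .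
qed

lemma hardy_norm_nonneg: "hardy_norm n p H V U g \<ge> 0"
proof -
 show ?thesis unfolding hardy_norm_def divide_ereal_def using S_const_nonneg[of g] by (simp add: ereal_inverse_nonneg_iff)
qed

theorem norm_equivalence:
 assumes g: "g \<in> X_space"
 shows "N_u g \<le> hardy_norm n p H V U g" "hardy_norm n p H V U g \<le> ereal mazya_const * N_u g"
proof -
 define h where "h = hardy_norm n p H V U g"
 obtain r where r: "r \<ge> 0" "N_u g = ereal r" "capacity_bound g r" by (rule hardy_space_N_u[OF g])
 \<comment> \<open>\<open>hardy_norm_le_iff\<close> speaks of positive bounds only and
   \<open>r\<close> may be 0, so both inequalities are shown for larger numbers and then closed by
   density.\<close>
 have up: "h \<le> ereal (mazya_const * L)" if "L > r" for L
 proof -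
  have "L > 0" using that r(1) by simp
  hence "hardy_bound g (mazya_const * L)" "mazya_const * L > 0"
   using capacity_imp_hardy_bound[OF hardy_space_L1_loc[OF g] _ capacity_bound_mono[OF r(3)]] that mazya_const_pos by auto
  thus ?thesis unfolding h_def using hardy_norm_le_iff by blast
 qed
 have "h \<noteq> \<infinity>" using up[of "r + 1"] by auto
 then obtain c where c: "h = ereal c" using hardy_norm_nonneg[of g] unfolding h_def by (cases "hardy_norm n p H V U g") auto
 have c0: "c \<ge> 0" using hardy_norm_nonneg[of g] c unfolding h_def by simp
 have "c / mazya_const \<le> r"
 proof (rule dense_ge)
  fix L assume "r < L"
  thus "c / mazya_const \<le> L" using up[of L] mazya_const_pos unfolding c by (simp add: field_simps)
 qed
 thus "hardy_norm n p H V U g \<le> ereal mazya_const * N_u g"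
  using mazya_const_pos unfolding h_def[symmetric] c r(2) by (simp add: field_simps)
 have "r \<le> c"
 proof (rule dense_ge)
  fix L assume L: "c < L"
  hence "hardy_bound g L" using hardy_norm_le_iff[of L g] c0 c unfolding h_def by auto
  hence "N_u g \<le> ereal L" using N_u_le_iff[of L g] hardy_imp_capacity_bound c0 L by auto
  thus "r \<le> L" unfolding r(2) by simp
 qed
 thus "N_u g \<le> hardy_norm n p H V U g" unfolding h_def[symmetric] c r(2) by simp
qed

end

section \<open>The Banach space of Hardy weights\<close>

lemma L1_loc_add: "f \<in> L1_loc n U ==> g \<in> L1_loc n U ==> (\<lambda>x. f x + g x) \<in> L1_loc n U"
 unfolding L1_loc_def by (auto intro: set_integral_add(1))

lemma L1_loc_cmult: "f \<in> L1_loc n U ==> (\<lambda>x. c * f x) \<in> L1_loc n U"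
 unfolding L1_loc_def by (auto intro: set_integrable_mult_right)

lemma Cauchy_of_summable_increments:
 fixes a :: "nat => real"
 assumes "summable (\<lambda>l. \<bar>a (Suc l) - a l\<bar>)"
 shows "convergent a"
proof -
 have "summable (\<lambda>l. a (Suc l) - a l)" using assms by (rule summable_rabs_cancel)
 hence "convergent (\<lambda>m. a m - a 0)" unfolding summable_iff_convergent sum_lessThan_telescope .
 thus ?thesis using convergent_diff_const_right_iff by blast
qed

context energy_form
begin

lemma umass_measurable:
 "g \<in> L1_loc n U ==> compactin (Rn n) K ==> K \<subseteq> U ==>
  (\<lambda>x. ennreal (\<bar>g x\<bar> * \<bar>u x\<bar> powr p) * indicator K x) \<in> borel_measurable (leb n)"
 by (rule mass_measurable[OF _ u(1) leb_compactin])

lemma capacity_bound_add: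
 assumes "f \<in> L1_loc n U" "g \<in> L1_loc n U" "capacity_bound f L" "capacity_bound g M" "L \<ge> 0" "M \<ge> 0"
 shows "capacity_bound (\<lambda>x. f x + g x) (L + M)"
 unfolding capacity_bound_def
proof (intro allI impI)
 fix K w assume K: "compactin (Rn n) K" "K \<subseteq> U" and w: "w \<in> W" "\<forall>x\<in>K. w x \<ge> u x"
 have "umass K (\<lambda>x. f x + g x) \<le> (\<integral>\<^sup>+x. ennreal (\<bar>f x\<bar> * \<bar>u x\<bar> powr p) * indicator K x + ennreal (\<bar>g x\<bar> * \<bar>u x\<bar> powr p) * indicator K x \<partial>leb n)"
  unfolding umass_def
 proof (rule nn_integral_mono)
  fix x
  have "\<bar>f x + g x\<bar> * \<bar>u x\<bar> powr p \<le> \<bar>f x\<bar> * \<bar>u x\<bar> powr p + \<bar>g x\<bar> * \<bar>u x\<bar> powr p"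
   unfolding distrib_right[symmetric] by (intro mult_right_mono abs_triangle_ineq) auto
  hence "ennreal (\<bar>f x + g x\<bar> * \<bar>u x\<bar> powr p) \<le> ennreal (\<bar>f x\<bar> * \<bar>u x\<bar> powr p) + ennreal (\<bar>g x\<bar> * \<bar>u x\<bar> powr p)"
   by (simp add: ennreal_plus[symmetric] ennreal_leI del: ennreal_plus)
  thus "ennreal (\<bar>f x + g x\<bar> * \<bar>u x\<bar> powr p) * indicator K x \<le> ennreal (\<bar>f x\<bar> * \<bar>u x\<bar> powr p) * indicator K x + ennreal (\<bar>g x\<bar> * \<bar>u x\<bar> powr p) * indicator K x"
   by (simp add: indicator_def)
 qed
 also have "\<dots> = umass K f + umass K g"
  unfolding umass_def by (intro nn_integral_add umass_measurable assms K)
 also have "\<dots> \<le> ennreal (L * Q w) + ennreal (M * Q w)"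
  by (intro add_mono capacity_boundD[OF assms(3) K w(1)] capacity_boundD[OF assms(4) K w(1)]) (use w(2) in auto)
 also have "\<dots> = ennreal ((L + M) * Q w)" using assms(5,6) Q_nonneg[OF w(1)] by (simp add: distrib_right)
 finally show "umass K (\<lambda>x. f x + g x) \<le> ennreal ((L + M) * Q w)" .
qed

lemma capacity_bound_cmult:
 assumes f: "f \<in> L1_loc n U" "capacity_bound f L"
 shows "capacity_bound (\<lambda>x. c * f x) (\<bar>c\<bar> * L)"
 unfolding capacity_bound_def
proof (intro allI impI)
 fix K w assume K: "compactin (Rn n) K" "K \<subseteq> U" and w: "w \<in> W" "\<forall>x\<in>K. w x \<ge> u x"
 have "umass K (\<lambda>x. c * f x) = (\<integral>\<^sup>+x. ennreal \<bar>c\<bar> * (ennreal (\<bar>f x\<bar> * \<bar>u x\<bar> powr p) * indicator K x) \<partial>leb n)"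
  unfolding umass_def by (simp add: abs_mult ennreal_mult' mult.assoc)
 also have "\<dots> = ennreal \<bar>c\<bar> * umass K f" unfolding umass_def by (intro nn_integral_cmult umass_measurable f K)
 also have "\<dots> \<le> ennreal \<bar>c\<bar> * ennreal (L * Q w)"
  by (intro mult_left_mono capacity_boundD[OF f(2) K w(1)]) (use w(2) in auto)
 also have "\<dots> = ennreal (\<bar>c\<bar> * L * Q w)" by (simp add: ennreal_mult'[symmetric] mult.assoc)
 finally show "umass K (\<lambda>x. c * f x) \<le> ennreal (\<bar>c\<bar> * L * Q w)" .
qed

lemma umass_AE_cong:
 assumes "AE x in leb n. x \<in> U --> f x = g x" "K \<subseteq> U"
 shows "umass K f = umass K g"
 unfolding umass_def
 by (rule nn_integral_cong_AE) (use assms in \<open>auto elim!: eventually_mono simp: indicator_def\<close>)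

lemma capacity_bound_AE_cong:
 assumes "AE x in leb n. x \<in> U --> f x = g x"
 shows "capacity_bound f L = capacity_bound g L"
 unfolding capacity_bound_def using umass_AE_cong[OF assms] by auto

text \<open>Definiteness of the norm: tested with a competitor on each compact set, the bound makes
  \<open>\<bar>f\<bar> * \<bar>u\<bar> powr p\<close> vanish almost everywhere, and \<open>u\<close>
  is positive.\<close>

lemma capacity_bound_zero_iff:
 assumes f: "f \<in> L1_loc n U"
 shows "capacity_bound f 0 \<longleftrightarrow> (AE x in leb n. x \<in> U --> f x = 0)"
proof
 assume c: "capacity_bound f 0"
 show "AE x in leb n. x \<in> U --> f x = 0"
 proof (rule AE_on_exhaustion[OF U])
  fix K assume K: "compactin (Rn n) K" "K \<subseteq> U"
  obtain w where w: "w \<in> W" "!!x. x \<in> K ==> w x \<ge> u x" using ex_capacity_function[OF K] by metis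
  have "umass K f \<le> ennreal (0 * Q w)" by (rule capacity_boundD[OF c K w])
  hence "AE x in leb n. ennreal (\<bar>f x\<bar> * \<bar>u x\<bar> powr p) * indicator K x = 0"
   unfolding umass_def by (subst nn_integral_0_iff_AE[symmetric]) (use umass_measurable[OF f K] in auto)
  thus "AE x in leb n. x \<in> K --> f x = 0"
  proof eventually_elim
   case (elim x)
   thus ?case using u(2)[of x] K(2) by (auto simp: ennreal_eq_0_iff mult_le_0_iff)
  qed
 qed
next
 assume "AE x in leb n. x \<in> U --> f x = 0"
 hence eq: "umass K f = umass K (\<lambda>x. 0)" if "K \<subseteq> U" for K by (rule umass_AE_cong[OF _ that])
 show "capacity_bound f 0" unfolding capacity_bound_def using eq by (simp add: umass_def)
qed

lemma X_add: "f \<in> X_space ==> g \<in> X_space ==> (\<lambda>x. f x + g x) \<in> X_space \<and> N_u (\<lambda>x. f x + g x) \<le> N_u f + N_u g"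
proof -
 assume fg: "f \<in> X_space" "g \<in> X_space"
 note l = hardy_space_L1_loc[OF fg(1)] hardy_space_L1_loc[OF fg(2)]
 obtain r where r: "r \<ge> 0" "N_u f = ereal r" "capacity_bound f r" by (rule hardy_space_N_u[OF fg(1)])
 obtain t where t: "t \<ge> 0" "N_u g = ereal t" "capacity_bound g t" by (rule hardy_space_N_u[OF fg(2)])
 note c = capacity_bound_add[OF l r(3) t(3) r(1) t(1)]
 have rt: "r + t \<ge> 0" using r t by simp
 show ?thesis using hardy_space_iff[OF L1_loc_add[OF l]] c rt N_u_le_iff[OF rt, of "\<lambda>x. f x + g x"] r(2) t(2) by auto
qed

lemma X_cmult: "f \<in> X_space ==> (\<lambda>x. c * f x) \<in> X_space \<and> N_u (\<lambda>x. c * f x) = ereal \<bar>c\<bar> * N_u f"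
proof -
 have 1: "(\<lambda>x. c * f x) \<in> X_space \<and> N_u (\<lambda>x. c * f x) \<le> ereal \<bar>c\<bar> * N_u f" if f: "f \<in> X_space" for f c
 proof -
  note l = hardy_space_L1_loc[OF f]
  obtain r where r: "r \<ge> 0" "N_u f = ereal r" "capacity_bound f r" by (rule hardy_space_N_u[OF f])
  note c = capacity_bound_cmult[OF l r(3), of c]
  have cr: "\<bar>c\<bar> * r \<ge> 0" using r by simp
  show ?thesis using hardy_space_iff[OF L1_loc_cmult[OF l]] c cr N_u_le_iff[OF cr, of "\<lambda>x. c * f x"] r(2) by auto
 qed
 assume f: "f \<in> X_space"
 have "ereal \<bar>c\<bar> * N_u f \<le> N_u (\<lambda>x. c * f x)"
 proof (cases "c = 0")
  case True
  thus ?thesis using N_u_nonneg by (simp add: zero_ereal_def[symmetric])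
 next
  case False
  obtain r where r: "r \<ge> 0" "N_u f = ereal r" by (rule hardy_space_N_u[OF f])
  obtain t where t: "t \<ge> 0" "N_u (\<lambda>x. c * f x) = ereal t" by (rule hardy_space_N_u[OF conjunct1[OF 1[OF f, of c]]])
  have "N_u (\<lambda>x. 1 / c * (c * f x)) \<le> ereal \<bar>1 / c\<bar> * N_u (\<lambda>x. c * f x)" using 1[OF conjunct1[OF 1[OF f, of c]], of "1 / c"] by blast
  hence "r \<le> \<bar>1 / c\<bar> * t" using False r t by simp
  thus ?thesis using False r t by (simp add: field_simps abs_divide)
 qed
 thus ?thesis using 1[OF f, of c] by (auto intro: antisym)
qed

lemma X_AE:
 assumes f: "f \<in> X_space" and ae: "AE x in leb n. x \<in> U --> f x = g x"
 shows "g \<in> X_space \<and> N_u g = N_u f"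
proof -
 have "g \<in> L1_loc n U" unfolding L1_loc_def
 proof (intro CollectI allI impI)
  fix K assume K: "compactin (Rn n) K \<and> K \<subseteq> U"
  have "AE x in leb n. x \<in> K --> f x = g x" using ae K by (auto elim!: eventually_mono)
  thus "set_integrable (leb n) K g"
   using L1_locD[OF hardy_space_L1_loc[OF f], of K] K by (blast intro: set_integrable_AE(1))
 qed
 thus ?thesis
  using f hardy_space_iff[OF hardy_space_L1_loc[OF f]] capacity_bound_AE_cong[OF ae] hardy_space_iff unfolding N_u_eq by auto
qed

text \<open>The mass on \<open>K\<close> is at most \<open>L\<close> times the energy of a
  competitor, and the weight is removed by multiplying with \<open>\<bar>u\<bar> powr (- p)\<close>,
  which is continuous and hence bounded on \<open>K\<close>.\<close>

lemma capacity_bound_L1_loc: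
 assumes m: "(\<lambda>x. indicator U x * h x) \<in> borel_measurable (leb n)" and c: "capacity_bound h L"
 shows "h \<in> L1_loc n U"
 unfolding L1_loc_def
proof (intro CollectI allI impI)
 fix K assume "compactin (Rn n) K \<and> K \<subseteq> U"
 hence K: "compactin (Rn n) K" "K \<subseteq> U" by auto
 obtain w where w: "w \<in> W" "!!x. x \<in> K ==> w x \<ge> u x" using ex_capacity_function[OF K] by metis
 have "umass K h \<le> ennreal (L * Q w)" by (rule capacity_boundD[OF c K w])
 hence fin: "umass K h < \<infinity>" by (rule le_less_trans) simp
 have cu: "continuous_on K (\<lambda>x. \<bar>u x\<bar> powr q)" for q
  using u(2) K(2) by (intro continuous_on_powr continuous_on_rabs continuous_on_subset[OF u(1) K(2)] continuous_on_const) force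
 have "set_integrable (leb n) K (\<lambda>x. h x * \<bar>u x\<bar> powr p)"
  unfolding set_integrable_alt
 proof (rule integrableI_bounded)
  have "(\<lambda>x. (indicator U x * h x) * (indicator K x * \<bar>u x\<bar> powr p)) \<in> borel_measurable (leb n)"
   by (rule borel_measurable_times[OF m continuous_ind_measurable[OF borel_compact_Rn[OF K(1)] cu]])
  moreover have "(\<lambda>x. (indicator U x * h x) * (indicator K x * \<bar>u x\<bar> powr p)) = (\<lambda>x. indicator K x * (h x * \<bar>u x\<bar> powr p))"
   using K(2) by (auto simp: fun_eq_iff indicator_def)
  ultimately show "(\<lambda>x. indicator K x * (h x * \<bar>u x\<bar> powr p)) \<in> borel_measurable (leb n)" by simp
  have "(\<integral>\<^sup>+x. ennreal (norm (indicator K x * (h x * \<bar>u x\<bar> powr p))) \<partial>leb n) = umass K h"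
   unfolding umass_def by (intro nn_integral_cong) (simp add: indicator_def abs_mult)
  thus "(\<integral>\<^sup>+x. ennreal (norm (indicator K x * (h x * \<bar>u x\<bar> powr p))) \<partial>leb n) < \<infinity>" using fin by simp
 qed
 from set_integrable_times_continuous[OF this K(1) cu[of "- p"]]
 have i: "set_integrable (leb n) K (\<lambda>x. h x * \<bar>u x\<bar> powr p * \<bar>u x\<bar> powr (- p))" .
 have "h x * \<bar>u x\<bar> powr p * \<bar>u x\<bar> powr (- p) = h x" if "x \<in> K" for x
  using u(2)[of x] K(2) that by (auto simp: mult.assoc powr_add[symmetric])
 thus "set_integrable (leb n) K h" using i by (subst (asm) set_integrable_cong[OF refl refl, of K _ h]) auto
qed

text \<open>Fatou's lemma: capacity bounds survive almost everywhere limits.\<close>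

lemma capacity_bound_limit:
 assumes h: "!!j. h j \<in> L1_loc n U" and c: "!!j. j \<ge> N ==> capacity_bound (h j) L"
  and lim: "AE x in leb n. x \<in> U --> (\<lambda>j. h j x) \<longlonglongrightarrow> f x"
 shows "capacity_bound f L"
 unfolding capacity_bound_def
proof (intro allI impI)
 fix K w assume K: "compactin (Rn n) K" "K \<subseteq> U" and w: "w \<in> W" "\<forall>x\<in>K. w x \<ge> u x"
 define q where "q g x = ennreal (\<bar>g x\<bar> * \<bar>u x\<bar> powr p) * indicator K x" for g and x
 have "AE x in leb n. q f x = liminf (\<lambda>j. q (h j) x)"
  using lim
 proof eventually_elim
  case (elim x)
  show ?case
  proof (cases "x \<in> K")
   case True
   hence "(\<lambda>j. q (h j) x) \<longlonglongrightarrow> q f x"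
    using elim K(2) unfolding q_def by (auto intro!: tendsto_ennrealI tendsto_mult_right tendsto_rabs)
   thus ?thesis by (rule lim_imp_Liminf[OF sequentially_bot, symmetric])
  qed (simp add: q_def Liminf_const)
 qed
 hence "umass K f = (\<integral>\<^sup>+x. liminf (\<lambda>j. q (h j) x) \<partial>leb n)"
  unfolding umass_def q_def[symmetric] by (rule nn_integral_cong_AE)
 also have "\<dots> \<le> liminf (\<lambda>j. \<integral>\<^sup>+x. q (h j) x \<partial>leb n)"
  unfolding q_def by (rule nn_integral_liminf[OF umass_measurable[OF h K]])
 also have "\<dots> \<le> liminf (\<lambda>j. ennreal (L * Q w))"
 proof (rule Liminf_mono)
  show "\<forall>\<^sub>F j in sequentially. (\<integral>\<^sup>+x. q (h j) x \<partial>leb n) \<le> ennreal (L * Q w)"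
   unfolding eventually_sequentially
  proof (intro exI[of _ N] allI impI)
   fix j assume "N \<le> j"
   from capacity_boundD[OF c[OF this] K w(1)] w(2) show "(\<integral>\<^sup>+x. q (h j) x \<partial>leb n) \<le> ennreal (L * Q w)"
    unfolding umass_def q_def by blast
  qed
 qed
 also have "\<dots> = ennreal (L * Q w)" by (simp add: Liminf_const)
 finally show "umass K f \<le> ennreal (L * Q w)" .
qed

text \<open>The weighted L1 norms of the increments on \<open>K\<close> are summable, with sum
  controlled by the energy of one competitor, so almost everywhere the increments themselves are
  absolutely summable.\<close>

lemma AE_convergent_subsequence:
 assumes h: "!!l. h l \<in> L1_loc n U" and c: "!!l. capacity_bound (\<lambda>x. h (Suc l) x - h l x) ((1/2) ^ l)"
 shows "AE x in leb n. x \<in> U --> convergent (\<lambda>l. h l x)"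
proof (rule AE_on_exhaustion[OF U])
 fix K assume K: "compactin (Rn n) K" "K \<subseteq> U"
 obtain w where w: "w \<in> W" "!!x. x \<in> K ==> w x \<ge> u x" using ex_capacity_function[OF K] by metis
 define q where "q l x = ennreal (\<bar>h (Suc l) x - h l x\<bar> * \<bar>u x\<bar> powr p) * indicator K x" for l x
 have dl: "(\<lambda>x. h (Suc l) x - h l x) \<in> L1_loc n U" for l
  using L1_loc_add[OF h[of "Suc l"] L1_loc_cmult[OF h[of l], of "- 1"]] by simp
 have qm: "q l \<in> borel_measurable (leb n)" for l unfolding q_def by (rule umass_measurable[OF dl K])
 have "(\<integral>\<^sup>+x. (\<Sum>l. q l x) \<partial>leb n) = (\<Sum>l. \<integral>\<^sup>+x. q l x \<partial>leb n)" by (rule nn_integral_suminf[OF qm])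
 also have "\<dots> \<le> (\<Sum>l. ennreal ((1/2) ^ l * Q w))"
 proof (rule suminf_le)
  show "(\<integral>\<^sup>+x. q l x \<partial>leb n) \<le> ennreal ((1/2) ^ l * Q w)" for l
   using capacity_boundD[OF c K w] unfolding umass_def q_def .
 qed auto
 also have "\<dots> = ennreal (\<Sum>l. (1/2) ^ l * Q w)"
  using Q_nonneg[OF w(1)] by (intro suminf_ennreal2 summable_mult2 summable_geometric) auto
 also have "\<dots> < \<infinity>" by simp
 finally have fin: "(\<integral>\<^sup>+x. (\<Sum>l. q l x) \<partial>leb n) \<noteq> \<infinity>" by simp
 have "AE x in leb n. (\<Sum>l. q l x) \<noteq> \<infinity>"
  by (rule nn_integral_PInf_AE[OF borel_measurable_suminf_order[OF qm] fin])
 thus "AE x in leb n. x \<in> K --> convergent (\<lambda>l. h l x)"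
 proof eventually_elim
  case (elim x)
  show ?case
  proof
   assume x: "x \<in> K"
   hence ux: "u x > 0" using u(2) K(2) by blast
   have "(\<Sum>l. ennreal (\<bar>h (Suc l) x - h l x\<bar> * \<bar>u x\<bar> powr p)) \<noteq> \<infinity>" using elim x unfolding q_def by simp
   hence "summable (\<lambda>l. \<bar>h (Suc l) x - h l x\<bar> * \<bar>u x\<bar> powr p)"
    by (intro summable_suminf_not_top) (auto simp: infinity_ennreal_def)
   from summable_mult2[OF this, of "inverse (\<bar>u x\<bar> powr p)"]
   have "summable (\<lambda>l. \<bar>h (Suc l) x - h l x\<bar>)" using ux by (simp add: mult.assoc)
   thus "convergent (\<lambda>l. h l x)" by (rule Cauchy_of_summable_increments)
  qed
 qed
qed

text \<open>A fast subsequence converges almost everywhere. The Cauchy estimate between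
  \<open>h k\<close> and the subsequence passes to its limit by Fatou's lemma, which gives
  membership and convergence in norm together.\<close>

theorem X_complete:
 assumes h: "!!k. h k \<in> X_space"
  and Cauchy: "!!e. e > 0 ==> \<exists>k0. \<forall>j\<ge>k0. \<forall>k\<ge>k0. N_u (\<lambda>x. h j x - h k x) < ereal e"
 shows "\<exists>f\<in>X_space. (\<lambda>k. N_u (\<lambda>x. h k x - f x)) \<longlonglongrightarrow> 0"
proof -
 note FL = hardy_space_L1_loc[OF h]
 have "\<forall>l::nat. \<exists>k0. \<forall>j\<ge>k0. \<forall>k\<ge>k0. N_u (\<lambda>x. h j x - h k x) < ereal ((1/2) ^ l)" by (intro allI Cauchy) simp
 from choice[OF this] obtain k0 where k0: "!!l j k. j \<ge> k0 l ==> k \<ge> k0 l ==> N_u (\<lambda>x. h j x - h k x) < ereal ((1/2) ^ l)" by blast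
 \<comment> \<open>The partial sums dominate all \<open>k0 i\<close> with \<open>i \<le> l\<close>
   at once; the indices need not be strictly increasing.\<close>
 define r where "r l = (\<Sum>i\<le>l. k0 i)" for l :: nat
 have r: "r j \<ge> k0 l" if "l \<le> j" for l j unfolding r_def using that by (intro member_le_sum) auto
 have cb: "capacity_bound (\<lambda>x. h j x - h k x) ((1/2) ^ l)" if "j \<ge> k0 l" "k \<ge> k0 l" for j k l
  by (rule N_u_le_iff[THEN iffD1, OF _ less_imp_le[OF k0[OF that]]]) simp
 define f where "f x = lim (\<lambda>l. indicator U x * h (r l) x)" for x
 have fm: "f \<in> borel_measurable (leb n)"
  unfolding f_def by (rule borel_measurable_lim_metric[OF L1_loc_measurable[OF U FL]])
 have "AE x in leb n. x \<in> U --> convergent (\<lambda>l. h (r l) x)"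
  by (rule AE_convergent_subsequence[OF FL]) (rule cb, auto intro: r)
 hence lim: "AE x in leb n. x \<in> U --> (\<lambda>l. h (r l) x) \<longlonglongrightarrow> f x"
 proof eventually_elim
  case (elim x)
  thus ?case unfolding f_def by (auto simp: convergent_LIMSEQ_iff)
 qed
 have dl: "(\<lambda>x. h j x - h k x) \<in> L1_loc n U" for j k
  using L1_loc_add[OF FL[of j] L1_loc_cmult[OF FL[of k], of "- 1"]] by simp
 have c: "capacity_bound (\<lambda>x. h k x - f x) ((1/2) ^ l)" if k: "k \<ge> k0 l" for k l
 proof (rule capacity_bound_limit[of "\<lambda>j x. h k x - h (r j) x" l])
  show "(\<lambda>x. h k x - h (r j) x) \<in> L1_loc n U" for j by (rule dl)
  show "capacity_bound (\<lambda>x. h k x - h (r j) x) ((1/2) ^ l)" if "l \<le> j" for j by (rule cb[OF k r[OF that]])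
  show "AE x in leb n. x \<in> U --> (\<lambda>j. h k x - h (r j) x) \<longlonglongrightarrow> h k x - f x"
   using lim by eventually_elim (auto intro: tendsto_diff)
 qed
 have hX: "(\<lambda>x. h k x - f x) \<in> X_space" if "k \<ge> k0 0" for k
 proof -
  have "(\<lambda>x. indicator U x * h k x - indicator U x * f x) \<in> borel_measurable (leb n)"
   by (rule borel_measurable_diff[OF L1_loc_measurable[OF U FL]
    borel_measurable_times[OF borel_measurable_indicator[OF leb_openin[OF U]] fm]])
  hence "(\<lambda>x. indicator U x * (h k x - f x)) \<in> borel_measurable (leb n)" by (simp add: right_diff_distrib)
  from capacity_bound_L1_loc[OF this c[OF that]] have "(\<lambda>x. h k x - f x) \<in> L1_loc n U" .
  from hardy_space_iff[OF this] c[OF that] show ?thesis by (auto intro!: exI[of _ 1])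
 qed
 \<comment> \<open>The limit is a member of the sequence minus a difference whose capacity bound is
   already known.\<close>
 have "(\<lambda>x. h (k0 0) x + - 1 * (h (k0 0) x - f x)) \<in> X_space"
  using X_add[OF h[of "k0 0"] conjunct1[OF X_cmult[OF hX[of "k0 0"], of "- 1"]]] by simp
 hence fX: "f \<in> X_space" by simp
 have "(\<lambda>k. N_u (\<lambda>x. h k x - f x)) \<longlonglongrightarrow> 0"
 proof (rule order_tendstoI)
  fix a :: ereal assume "a < 0"
  thus "\<forall>\<^sub>F k in sequentially. a < N_u (\<lambda>x. h k x - f x)" using N_u_nonneg by (intro always_eventually allI) (rule less_le_trans)
 next
  fix a :: ereal assume "0 < a"
  then obtain e where e: "e > 0" "ereal e < a" using ereal_dense2[of 0 a] by (auto simp: zero_ereal_def)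
  obtain l :: nat where l: "(1/2 :: real) ^ l < e" using real_arch_pow_inv[OF e(1), of "1/2"] by auto
  have "N_u (\<lambda>x. h k x - f x) < a" if "k \<ge> k0 l" for k
  proof -
   have "N_u (\<lambda>x. h k x - f x) \<le> ereal ((1/2) ^ l)" using N_u_le_iff[of "(1/2) ^ l"] c[OF that] by simp
   also have "\<dots> < ereal e" using l by simp
   finally show ?thesis using e(2) by simp
  qed
  thus "\<forall>\<^sub>F k in sequentially. N_u (\<lambda>x. h k x - f x) < a" unfolding eventually_sequentially by blast
 qed
 thus ?thesis using fX by blast
qed

theorem hardy_space_banach: "is_banach_space (leb n) U X_space N_u"
 unfolding is_banach_space_def
proof (intro conjI)
 have L0: "(\<lambda>x. 0) \<in> L1_loc n U" unfolding L1_loc_def set_integrable_def by simp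
 thus 0: "(\<lambda>x. 0) \<in> X_space" using hardy_space_iff[OF L0] capacity_bound_zero_iff[OF L0] by auto
 show "\<forall>f\<in>X_space. \<forall>g\<in>X_space. (\<lambda>x. f x + g x) \<in> X_space" using X_add by blast
 show "\<forall>c. \<forall>f\<in>X_space. (\<lambda>x. c * f x) \<in> X_space" using X_cmult by blast
 show "\<forall>f\<in>X_space. \<forall>g. (AE x in leb n. x \<in> U --> f x = g x) --> g \<in> X_space \<and> N_u g = N_u f" using X_AE by blast
 show "\<forall>f\<in>X_space. 0 \<le> N_u f \<and> N_u f < \<infinity>" using N_u_nonneg hardy_space_N_u by (metis less_ereal.simps(4) infinity_ereal_def ereal_less(1))
 show "\<forall>f\<in>X_space. (N_u f = 0) = (AE x in leb n. x \<in> U --> f x = 0)"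
 proof
  fix f assume f: "f \<in> X_space"
  have "N_u f = 0 \<longleftrightarrow> N_u f \<le> ereal 0" using N_u_nonneg[of f] by (auto simp: zero_ereal_def[symmetric])
  thus "(N_u f = 0) = (AE x in leb n. x \<in> U --> f x = 0)"
   using N_u_le_iff[of 0 f] capacity_bound_zero_iff[OF hardy_space_L1_loc[OF f]] by simp
 qed
 show "\<forall>c. \<forall>f\<in>X_space. N_u (\<lambda>x. c * f x) = ereal \<bar>c\<bar> * N_u f" using X_cmult by blast
 show "\<forall>f\<in>X_space. \<forall>g\<in>X_space. N_u (\<lambda>x. f x + g x) \<le> N_u f + N_u g" using X_add by blast
 show "\<forall>F :: nat => vec => real. (\<forall>k. F k \<in> X_space) \<and> (\<forall>\<epsilon>>0. \<exists>k0. \<forall>j\<ge>k0. \<forall>k\<ge>k0. N_u (\<lambda>x. F j x - F k x) < ereal \<epsilon>) -->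
   (\<exists>f\<in>X_space. (\<lambda>k. N_u (\<lambda>x. F k x - f x)) \<longlonglongrightarrow> 0)"
 proof (intro allI impI)
  fix F :: "nat => vec => real"
  assume "(\<forall>k. F k \<in> X_space) \<and> (\<forall>\<epsilon>>0. \<exists>k0. \<forall>j\<ge>k0. \<forall>k\<ge>k0. N_u (\<lambda>x. F j x - F k x) < ereal \<epsilon>)"
  thus "\<exists>f\<in>X_space. (\<lambda>k. N_u (\<lambda>x. F k x - f x)) \<longlonglongrightarrow> 0" by (intro X_complete) blast+
 qed
qed

end

section \<open>The anisotropic energy\<close>

text \<open>Both branches of \<open>morrey\<close> contain local integrability on a domain compactly
  inside \<open>U\<close>, and every compact set lies in one such domain.\<close>

lemma morrey_loc_L1_loc:
 assumes U: "is_domain n U" and V: "V \<in> morrey_loc n p q U"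
 shows "V \<in> L1_loc n U"
 unfolding L1_loc_def
proof (intro CollectI allI impI)
 fix K assume "compactin (Rn n) K \<and> K \<subseteq> U"
 hence K: "compactin (Rn n) K" "K \<subseteq> U" by auto
 obtain S where S: "is_domain n S" "compactly_inside n S U" "K \<subseteq> S" by (rule domain_containing_compact[OF U K])
 hence m: "V \<in> morrey n p q S" using V unfolding morrey_loc_def by blast
 show "set_integrable (leb n) K V"
 proof (cases "p > real n")
  case True
  hence "set_integrable (leb n) S V" using m unfolding morrey_def by simp
  thus ?thesis by (rule set_integrable_subset[OF _ leb_compactin[OF K(1)] S(3)])
 next
  case False
  hence "V \<in> L1_loc n S" using m unfolding morrey_def by simp
  thus ?thesis by (rule L1_locD[OF _ K(1) S(3)])
 qed
qed

text \<open>By completeness the two functions are measurable together or not at all; in the latter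
  case both integrals have the default value 0.\<close>

lemma leb_integral_cong_AE:
 fixes f g :: "vec => real"
 assumes ae: "AE x in leb n. f x = g x"
 shows "integral\<^sup>L (leb n) f = integral\<^sup>L (leb n) g"
proof (cases "f \<in> borel_measurable (leb n)")
 case True
 thus ?thesis by (rule integral_cong_AE[OF _ leb_measurable_AE[OF True ae] ae])
next
 case False
 have ae': "AE x in leb n. g x = f x" using ae by eventually_elim simp
 hence "g \<notin> borel_measurable (leb n)" using False leb_measurable_AE by blast
 thus ?thesis using False by (metis borel_measurable_integrable not_integrable_integral_eq)
qed

text \<open>The pointwise conditions under which \<open>norm_A\<close> is an instance of
  \<open>hnorm\<close>.\<close>

definition good_point :: "nat => (vec => nat => nat => real) => vec => bool" where
 "good_point n A x \<longleftrightarrow> (\<forall>i<n. \<forall>j<n. A x i j = A x j i) \<and> (\<forall>\<xi>. 0 \<le> (\<Sum>i<n. (\<Sum>j<n. A x i j * \<xi> j) * \<xi> i))"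

locale anisotropic_point =
 fixes n :: nat and p s :: real and a :: "nat => vec => real" and A :: "vec => nat => nat => real" and x :: vec
 assumes p: "p > 1" and s: "s > 1" and a: "i < n ==> a i x > 0" and A: "good_point n A x"
begin

sublocale S: hnorm n s "dblc s 2 4" "norm_sa n s a x" "\<lambda>b i. a i x * (\<bar>b i\<bar> powr (s - 1) * sgn (b i))"
 by (rule hnorm_sa[where a=a and x=x]) (use s a in auto)

sublocale M: hnorm n 2 4 "norm_A n A x" "\<lambda>b i. \<Sum>j<n. A x i j * b j"
 by (rule hnorm_A[where A=A and x=x]) (use A in \<open>auto simp: good_point_def\<close>)

definition F :: "vec => real" where
 "F \<xi> = norm_sa n s a x \<xi> powr p + norm_A n A x \<xi> powr p"

definition E :: "vec => vec => real" where
 "E b \<xi> = (\<Sum>i<n. A_field p (H_fun n p s a A) x b i * \<xi> i)"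

lemma A_field: "i < n ==> A_field p (H_fun n p s a A) x b i = norm_sa n s a x b powr (p - s) * (a i x * (\<bar>b i\<bar> powr (s - 1) * sgn (b i)))
  + norm_A n A x b powr (p - 2) * (\<Sum>j<n. A x i j * b j)"
 by (rule A_field_eq) (use p s a A in \<open>auto simp: good_point_def\<close>)

lemma E_eq: "E b \<xi> = S.ep p b \<xi> + M.ep p b \<xi>"
proof -
 have "E b \<xi> = (\<Sum>i<n. norm_sa n s a x b powr (p - s) * (a i x * (\<bar>b i\<bar> powr (s - 1) * sgn (b i)) * \<xi> i)
  + norm_A n A x b powr (p - 2) * ((\<Sum>j<n. A x i j * b j) * \<xi> i))"
  unfolding E_def by (rule sum.cong[OF refl]) (simp add: A_field distrib_right mult.assoc)
 thus ?thesis unfolding S.ep_def M.ep_def sum.distrib sum_distrib_left .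
qed

text \<open>\<open>H powr p\<close> is the sum of the p-th powers of two norms, so its Bregman
  distance is the sum of theirs; one exponent \<open>m\<close> that serves both norms serves the
  sum.\<close>

lemma D_eq: "F \<xi> + (p - 1) * F b - p * E b \<xi> = S.Dp p \<xi> b + M.Dp p \<xi> b"
 unfolding S.Dp_def M.Dp_def F_def E_eq by (simp add: algebra_simps)

lemma energy_point:
 assumes m: "dblc p s (dblc s 2 4) \<le> 2 ^ m" "dblc p 2 4 \<le> 2 ^ m"
 shows "energy_point n p m F E"
proof (standard, unfold D_eq)
 show "F \<xi> \<ge> 0" for \<xi> unfolding F_def by simp
 show "F (\<lambda>i. t * \<xi> i) = \<bar>t\<bar> powr p * F \<xi>" for t \<xi>
  unfolding F_def S.scale M.scale by (simp add: powr_mult S.nonneg M.nonneg distrib_left)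
 show "F \<xi> = F q" if "!!i. i < n ==> \<xi> i = q i" for \<xi> q
  unfolding F_def using S.local[OF that] M.local[OF that] by simp
 show "E b \<xi> = E b q" if "!!i. i < n ==> \<xi> i = q i" for b \<xi> q unfolding E_def using that by simp
 show "E b (\<lambda>i. \<xi> i + q i) = E b \<xi> + E b q" for b \<xi> q unfolding E_def by (simp add: distrib_left sum.distrib)
 show "E b (\<lambda>i. t * \<xi> i) = t * E b \<xi>" for b t \<xi> unfolding E_def by (simp add: sum_distrib_left mult.left_commute)
 show "E (\<lambda>i. t * b i) \<xi> = \<bar>t\<bar> powr (p - 1) * sgn t * E b \<xi>" for t b \<xi>
  unfolding E_eq S.ep_scale M.ep_scale by (simp add: distrib_left)
 show "E b b = F b" for b unfolding E_eq S.ep_self M.ep_self F_def ..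
 show "S.Dp p \<xi> b + M.Dp p \<xi> b \<ge> 0" for \<xi> b by (intro add_nonneg_nonneg S.Dp_nonneg M.Dp_nonneg p)
 show "S.Dp p (\<lambda>i. b i + k * e i) b + M.Dp p (\<lambda>i. b i + k * e i) b \<le> S.Dp p (\<lambda>i. b i + e i) b + M.Dp p (\<lambda>i. b i + e i) b"
  if "0 \<le> k" "k \<le> 1" for k b e by (intro add_mono S.Dp_mono[OF p that] M.Dp_mono[OF p that])
 fix b e
 have "S.Dp p (\<lambda>i. b i + 2 * e i) b \<le> 2 ^ m * S.Dp p (\<lambda>i. b i + e i) b"
  using S.Dp_doubling[OF p, of b e] mult_right_mono[OF m(1) S.Dp_nonneg[OF p, of "\<lambda>i. b i + e i" b]] by linarith
 moreover have "M.Dp p (\<lambda>i. b i + 2 * e i) b \<le> 2 ^ m * M.Dp p (\<lambda>i. b i + e i) b"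
  using M.Dp_doubling[OF p, of b e] mult_right_mono[OF m(2) M.Dp_nonneg[OF p, of "\<lambda>i. b i + e i" b]] by linarith
 ultimately show "S.Dp p (\<lambda>i. b i + 2 * e i) b + M.Dp p (\<lambda>i. b i + 2 * e i) b
   \<le> 2 ^ m * (S.Dp p (\<lambda>i. b i + e i) b + M.Dp p (\<lambda>i. b i + e i) b)" by (simp add: distrib_left)
qed

end

text \<open>Every component of \<open>\<xi>\<close> is at most its l^p norm \<open>B\<close>. The
  factor depends on the dimension, which is harmless: it yields local integrability and does not
  enter the final constant.\<close>

lemma energy_upper_bound:
 assumes p: "p > 1" and s: "s > 1" and C: "C > 0" "!!i. i < n ==> 0 < a i x \<and> a i x \<le> C"
  and \<theta>: "\<theta> > 0" "0 \<le> norm_A n A x \<xi>" "norm_A n A x \<xi> \<le> \<theta> * enorm n \<xi>"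
 shows "norm_sa n s a x \<xi> powr p + norm_A n A x \<xi> powr p
  \<le> ((C * real n) powr (p / s) + (\<theta> * real n) powr p) * (\<Sum>i<n. \<bar>\<xi> i\<bar> powr p)"
proof -
 define Z where "Z = (\<Sum>i<n. \<bar>\<xi> i\<bar> powr p)"
 define B where "B = Z powr (1 / p)"
 have Z: "Z \<ge> 0" unfolding Z_def by (intro sum_nonneg) auto
 have B: "B \<ge> 0" "B powr p = Z" unfolding B_def using Z p by (auto simp: powr_powr)
 have le: "\<bar>\<xi> i\<bar> \<le> B" if "i < n" for i
 proof -
  have "\<bar>\<xi> i\<bar> powr p \<le> Z" unfolding Z_def using that by (intro member_le_sum) auto
  hence "(\<bar>\<xi> i\<bar> powr p) powr (1 / p) \<le> B" unfolding B_def using p by (intro powr_mono2) auto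
  thus ?thesis using p by (simp add: powr_powr)
 qed
 have "(\<Sum>i<n. a i x * \<bar>\<xi> i\<bar> powr s) \<le> (\<Sum>i<n. C * B powr s)"
  using C le s by (intro sum_mono mult_mono powr_mono2) (auto simp: less_imp_le)
 hence 1: "(\<Sum>i<n. a i x * \<bar>\<xi> i\<bar> powr s) \<le> C * real n * B powr s" by (simp add: mult_ac)
 have nn: "0 \<le> (\<Sum>i<n. a i x * \<bar>\<xi> i\<bar> powr s)" using C by (intro sum_nonneg mult_nonneg_nonneg) (auto simp: less_imp_le)
 have "norm_sa n s a x \<xi> powr p = (\<Sum>i<n. a i x * \<bar>\<xi> i\<bar> powr s) powr (p / s)"
  unfolding norm_sa_def by (simp add: powr_powr)
 also have "\<dots> \<le> (C * real n * B powr s) powr (p / s)" using 1 nn p s by (intro powr_mono2) auto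
 also have "\<dots> = (C * real n) powr (p / s) * Z" using C(1) B s p by (simp add: powr_mult powr_powr)
 finally have S: "norm_sa n s a x \<xi> powr p \<le> (C * real n) powr (p / s) * Z" .
 have "enorm n \<xi> \<le> (\<Sum>i<n. \<bar>\<xi> i\<bar>)" unfolding enorm_def by (rule L2_set_le_sum_abs)
 also have "\<dots> \<le> real n * B" using sum_bounded_above[of "{..<n}" "\<lambda>i. \<bar>\<xi> i\<bar>" B] le by simp
 finally have "\<theta> * enorm n \<xi> \<le> \<theta> * (real n * B)" using \<theta>(1) by (intro mult_left_mono) auto
 hence "norm_A n A x \<xi> \<le> \<theta> * real n * B" using \<theta>(3) by simp
 hence "norm_A n A x \<xi> powr p \<le> (\<theta> * real n * B) powr p" using \<theta>(2) p by (intro powr_mono2) auto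
 also have "\<dots> = (\<theta> * real n) powr p * Z" using \<theta>(1) B p by (simp add: powr_mult)
 finally show ?thesis using S unfolding Z_def[symmetric] by (simp add: distrib_right)
qed

lemma good_point_AE:
 assumes U: "is_domain n U" and A: "elliptic_matrix n U A"
 shows "AE x in leb n. x \<in> U --> good_point n A x"
proof -
 have "AE x in leb n. x \<in> U --> (\<forall>\<xi>. 0 \<le> (\<Sum>i<n. (\<Sum>j<n. A x i j * \<xi> j) * \<xi> i))"
 proof (rule AE_on_exhaustion[OF is_domain_open[OF U]])
  fix K assume K: "compactin (Rn n) K" "K \<subseteq> U"
  obtain S where S: "is_domain n S" "compactly_inside n S U" "K \<subseteq> S" by (rule domain_containing_compact[OF U K])
  obtain \<theta>1 \<theta>2 where \<theta>: "0 < \<theta>1"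
   "AE x in leb n. x \<in> S --> (\<forall>\<xi>. \<theta>1 * enorm n \<xi> \<le> norm_A n A x \<xi> \<and> norm_A n A x \<xi> \<le> \<theta>2 * enorm n \<xi>)"
   using A S(1,2) unfolding elliptic_matrix_def by blast
  show "AE x in leb n. x \<in> K --> (\<forall>\<xi>. 0 \<le> (\<Sum>i<n. (\<Sum>j<n. A x i j * \<xi> j) * \<xi> i))"
   using \<theta>(2)
  proof eventually_elim
   case (elim x)
   show ?case
   proof (intro impI allI)
    fix \<xi> assume "x \<in> K"
    hence "\<theta>1 * enorm n \<xi> \<le> norm_A n A x \<xi>" using elim S(3) by blast
    moreover have "0 \<le> \<theta>1 * enorm n \<xi>" using \<theta>(1) by (simp add: enorm_def)
    ultimately have "0 \<le> norm_A n A x \<xi>" by linarith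
    \<comment> \<open>\<open>sqrt\<close> is negative on negative numbers, so a nonnegative
      \<open>norm_A\<close> forces the form to be nonnegative.\<close>
    thus "0 \<le> (\<Sum>i<n. (\<Sum>j<n. A x i j * \<xi> j) * \<xi> i)" unfolding norm_A_def by simp
   qed
  qed
 qed
 moreover have "AE x in leb n. x \<in> U --> (\<forall>i<n. \<forall>j<n. A x i j = A x j i)" using A unfolding elliptic_matrix_def by blast
 ultimately show ?thesis by eventually_elim (auto simp: good_point_def)
qed

lemma norm_sa_measurable:
 assumes "!!i. i < n ==> (\<lambda>x. a i x) \<in> borel_measurable M" "!!i. i < n ==> (\<lambda>x. X x i) \<in> borel_measurable M"
 shows "(\<lambda>x. norm_sa n s a x (X x)) \<in> borel_measurable M"
 unfolding norm_sa_def
 by (intro powr_real_measurable borel_measurable_sum borel_measurable_times abs_powr_measurable borel_measurable_const) (use assms in auto)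

lemma norm_A_measurable:
 assumes "!!i j. i < n ==> j < n ==> (\<lambda>x. A x i j) \<in> borel_measurable M" "!!i. i < n ==> (\<lambda>x. X x i) \<in> borel_measurable M"
 shows "(\<lambda>x. norm_A n A x (X x)) \<in> borel_measurable M"
 unfolding norm_A_def
 by (rule measurable_compose[OF _ borel_measurable_sqrt], intro borel_measurable_sum borel_measurable_times) (use assms in auto)

text \<open>The value is 0 on the null set of bad points, so that the pointwise inequalities hold everywhere.\<close>

definition energy :: "nat => real => real => (nat => vec => real) => (vec => nat => nat => real) => vec set => vec => vec => real" where
 "energy n p s a A U x \<xi> = (if x \<in> U \<and> good_point n A x then norm_sa n s a x \<xi> powr p + norm_A n A x \<xi> powr p else 0)"

definition energy_deriv :: "nat => real => real => (nat => vec => real) => (vec => nat => nat => real) => vec set => vec => vec => vec => real" where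
 "energy_deriv n p s a A U x b \<xi> = (if x \<in> U \<and> good_point n A x then \<Sum>i<n. A_field p (H_fun n p s a A) x b i * \<xi> i else 0)"

locale anisotropic =
 fixes n :: nat and p s :: real and U :: "vec set" and a :: "nat => vec => real" and A :: "vec => nat => nat => real"
 assumes p: "p > 1" and s: "s > 1" and U: "is_domain n U" and a: "weight_vector n U a" and A: "elliptic_matrix n U A"
begin

lemma point: "x \<in> U ==> good_point n A x ==> anisotropic_point n p s a A x"
 using p s a unfolding weight_vector_def by unfold_locales auto

lemma energy_pointwise:
 assumes "x \<in> U" "good_point n A x"
 shows "energy n p s a A U x = anisotropic_point.F n p s a A x"
  "energy_deriv n p s a A U x = anisotropic_point.E n p s a A x"
proof -
 interpret anisotropic_point n p s a A x by (rule point[OF assms])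
 show "energy n p s a A U x = F" "energy_deriv n p s a A U x = E"
  unfolding energy_def energy_deriv_def F_def E_def fun_eq_iff using assms by auto
qed

lemma energy_outside:
 "\<not> (x \<in> U \<and> good_point n A x) ==> energy n p s a A U x = (\<lambda>\<xi>. 0)"
 "\<not> (x \<in> U \<and> good_point n A x) ==> energy_deriv n p s a A U x = (\<lambda>b \<xi>. 0)"
 unfolding energy_def energy_deriv_def fun_eq_iff by auto

lemma energy_bound:
 assumes K: "compactin (Rn n) K" "K \<subseteq> U"
 shows "\<exists>C. AE x in leb n. x \<in> K --> (\<forall>\<xi>. energy n p s a A U x \<xi> \<le> C * (\<Sum>i<n. \<bar>\<xi> i\<bar> powr p))"
proof -
 obtain S where S: "is_domain n S" "compactly_inside n S U" "K \<subseteq> S" by (rule domain_containing_compact[OF U K])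
 obtain \<theta>1 \<theta> where \<theta>: "0 < \<theta>1" "0 < \<theta>"
  "AE x in leb n. x \<in> S --> (\<forall>\<xi>. \<theta>1 * enorm n \<xi> \<le> norm_A n A x \<xi> \<and> norm_A n A x \<xi> \<le> \<theta> * enorm n \<xi>)"
  using A S(1,2) unfolding elliptic_matrix_def by blast
 obtain c C where C: "0 < c" "c \<le> C" "!!i. i < n ==> AE x in leb n. x \<in> S --> c \<le> a i x \<and> a i x \<le> C"
  using a S(1,2) unfolding weight_vector_def by blast
 have "AE x in leb n. \<forall>i\<in>{..<n}. x \<in> S --> c \<le> a i x \<and> a i x \<le> C"
  by (intro AE_finite_allI finite_lessThan) (use C(3) in auto)
 hence "AE x in leb n. x \<in> K --> (\<forall>\<xi>. energy n p s a A U x \<xi> \<le> ((C * real n) powr (p / s) + (\<theta> * real n) powr p) * (\<Sum>i<n. \<bar>\<xi> i\<bar> powr p))"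
  using \<theta>(3)
 proof eventually_elim
  case (elim x)
  show ?case
  proof (intro impI allI)
   fix \<xi> assume x: "x \<in> K"
   have "\<theta>1 * enorm n \<xi> \<le> norm_A n A x \<xi>" and nA: "norm_A n A x \<xi> \<le> \<theta> * enorm n \<xi>"
    using elim(2) x S(3) by auto
   moreover have "0 \<le> \<theta>1 * enorm n \<xi>" using \<theta>(1) by (simp add: enorm_def)
   ultimately have nA0: "0 \<le> norm_A n A x \<xi>" by linarith
   have aC: "0 < a i x \<and> a i x \<le> C" if "i < n" for i
    using elim(1) x S(3) C(1) that by (force simp: subset_iff)
   have C0: "C > 0" using C by simp
   have le: "norm_sa n s a x \<xi> powr p + norm_A n A x \<xi> powr p
    \<le> ((C * real n) powr (p / s) + (\<theta> * real n) powr p) * (\<Sum>i<n. \<bar>\<xi> i\<bar> powr p)"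
    by (rule energy_upper_bound[where a=a and x=x, OF p s C0 aC \<theta>(2) nA0 nA])
   have "0 \<le> norm_sa n s a x \<xi> powr p + norm_A n A x \<xi> powr p" by simp
   hence ge: "0 \<le> ((C * real n) powr (p / s) + (\<theta> * real n) powr p) * (\<Sum>i<n. \<bar>\<xi> i\<bar> powr p)" using le by linarith
   show "energy n p s a A U x \<xi> \<le> ((C * real n) powr (p / s) + (\<theta> * real n) powr p) * (\<Sum>i<n. \<bar>\<xi> i\<bar> powr p)"
    unfolding energy_def by (split if_split) (use le ge in blast)
  qed
 qed
 thus ?thesis by blast
qed

lemma coefficient_measurable:
 "i < n ==> (\<lambda>x. indicator U x * a i x) \<in> borel_measurable (leb n)"
 "i < n ==> j < n ==> (\<lambda>x. indicator U x * A x i j) \<in> borel_measurable (leb n)"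
 using a A unfolding weight_vector_def elliptic_matrix_def set_borel_measurable_def by auto

text \<open>The coefficients are measurable on \<open>U\<close> only. Extended by zero, and with the
  field cut off to \<open>K\<close>, they give an explicitly measurable function that agrees almost
  everywhere with the energy cut off to \<open>K\<close>.\<close>

lemma energy_measurable:
 assumes K: "compactin (Rn n) K" "K \<subseteq> U"
  and X: "!!i. i < n ==> (\<lambda>x. indicator K x * X x i) \<in> borel_measurable (leb n)"
 shows "(\<lambda>x. indicator K x * energy n p s a A U x (X x)) \<in> borel_measurable (leb n)"
proof (rule leb_measurable_AE)
 show "(\<lambda>x. indicator K x * (norm_sa n s (\<lambda>i x. indicator U x * a i x) x (\<lambda>i. indicator K x * X x i) powr p
   + norm_A n (\<lambda>x i j. indicator U x * A x i j) x (\<lambda>i. indicator K x * X x i) powr p)) \<in> borel_measurable (leb n)"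
  by (intro borel_measurable_times borel_measurable_add powr_real_measurable borel_measurable_const
    borel_measurable_indicator leb_compactin[OF K(1)]
    norm_sa_measurable norm_A_measurable coefficient_measurable X)
 show "AE x in leb n. indicator K x * (norm_sa n s (\<lambda>i x. indicator U x * a i x) x (\<lambda>i. indicator K x * X x i) powr p
   + norm_A n (\<lambda>x i j. indicator U x * A x i j) x (\<lambda>i. indicator K x * X x i) powr p) = indicator K x * energy n p s a A U x (X x)"
  using good_point_AE[OF U A]
 proof eventually_elim
  case (elim x)
  thus ?case using K(2) by (cases "x \<in> K") (auto simp: energy_def norm_sa_def norm_A_def)
 qed
qed

lemma energy_deriv_measurable:
 assumes K: "compactin (Rn n) K" "K \<subseteq> U"
  and X: "!!i. i < n ==> (\<lambda>x. indicator K x * X x i) \<in> borel_measurable (leb n)"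
  and Y: "!!i. i < n ==> (\<lambda>x. indicator K x * Y x i) \<in> borel_measurable (leb n)"
 shows "(\<lambda>x. indicator K x * energy_deriv n p s a A U x (X x) (Y x)) \<in> borel_measurable (leb n)"
proof (rule leb_measurable_AE)
 define a' where "a' i x = indicator U x * a i x" for i x
 define A' where "A' x i j = indicator U x * A x i j" for x i j
 define X' where "X' x i = indicator K x * X x i" for x i
 define Y' where "Y' x i = indicator K x * Y x i" for x i
 have m: "i < n ==> a' i \<in> borel_measurable (leb n)" "i < n ==> j < n ==> (\<lambda>x. A' x i j) \<in> borel_measurable (leb n)"
  "i < n ==> (\<lambda>x. X' x i) \<in> borel_measurable (leb n)" "i < n ==> (\<lambda>x. Y' x i) \<in> borel_measurable (leb n)" for i j
  unfolding a'_def A'_def X'_def Y'_def using coefficient_measurable X Y by auto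
 have sgn: "(\<lambda>x. sgn (f x) :: real) \<in> borel_measurable (leb n)" if "f \<in> borel_measurable (leb n)" for f
  by (rule measurable_compose[OF that borel_measurable_sgn])
 show "(\<lambda>x. indicator K x * (\<Sum>i<n. (norm_sa n s a' x (X' x) powr (p - s) * (a' i x * (\<bar>X' x i\<bar> powr (s - 1) * sgn (X' x i)))
   + norm_A n A' x (X' x) powr (p - 2) * (\<Sum>j<n. A' x i j * X' x j)) * Y' x i)) \<in> borel_measurable (leb n)"
  by (intro borel_measurable_times borel_measurable_add borel_measurable_sum abs_powr_measurable powr_real_measurable borel_measurable_const
    borel_measurable_indicator leb_compactin[OF K(1)] sgn
    norm_sa_measurable norm_A_measurable m) auto
 show "AE x in leb n. indicator K x * (\<Sum>i<n. (norm_sa n s a' x (X' x) powr (p - s) * (a' i x * (\<bar>X' x i\<bar> powr (s - 1) * sgn (X' x i)))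
   + norm_A n A' x (X' x) powr (p - 2) * (\<Sum>j<n. A' x i j * X' x j)) * Y' x i) = indicator K x * energy_deriv n p s a A U x (X x) (Y x)"
  using good_point_AE[OF U A]
 proof eventually_elim
  case (elim x)
  show ?case
  proof (cases "x \<in> K")
   case True
   hence x: "x \<in> U" "good_point n A x" using K(2) elim by auto
   interpret anisotropic_point n p s a A x by (rule point[OF x])
   have "norm_sa n s a' x (X' x) = norm_sa n s a x (X x)" "norm_A n A' x (X' x) = norm_A n A x (X x)"
    using True x(1) by (simp_all add: norm_sa_def norm_A_def a'_def A'_def X'_def)
   thus ?thesis using True x A_field unfolding energy_deriv_def by (simp add: a'_def A'_def X'_def Y'_def)
  qed simp
 qed
qed

text \<open>\<open>weak_grad n U u\<close> is a genuine gradient because the local gradients of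
  \<open>u\<close> can be glued; positivity of \<open>u\<close> turns
  \<open>\<bar>u\<bar> powr (p - 2) * u\<close> into \<open>u powr (p - 1)\<close>.\<close>

lemma energy_form_instance:
 assumes m: "dblc p s (dblc s 2 4) \<le> 2 ^ m" "dblc p 2 4 \<le> 2 ^ m"
  and V: "V \<in> L1_loc n U" and sol: "positive_solution n p (H_fun n p s a A) V U u" and cu: "cont n U u"
 shows "energy_form n U p m (energy n p s a A U) (energy_deriv n p s a A U) V u (weak_grad n U u) (H_fun n p s a A)"
proof (rule energy_form.intro)
 note o = is_domain_open[OF U]
 note sub = openin_Rn_subset[OF o]
 show "p > 1" by (rule p)
 show "openin (Rn n) U" by (rule o)
 show "energy_point n p m (energy n p s a A U x) (energy_deriv n p s a A U x)" for x
 proof (cases "x \<in> U \<and> good_point n A x")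
  case True
  thus ?thesis using energy_pointwise[of x] anisotropic_point.energy_point[OF point m, of x] by simp
 next
  case False
  thus ?thesis unfolding energy_outside[OF False] by (intro energy_point_zero)
 qed
 show "\<exists>C. AE x in leb n. x \<in> K --> (\<forall>\<xi>. energy n p s a A U x \<xi> \<le> C * (\<Sum>i<n. \<bar>\<xi> i\<bar> powr p))"
  if "compactin (Rn n) K" "K \<subseteq> U" for K by (rule energy_bound[OF that])
 show "(\<lambda>x. indicator K x * energy n p s a A U x (X x)) \<in> borel_measurable (leb n)"
  if "compactin (Rn n) K" "K \<subseteq> U" "!!i. i < n ==> (\<lambda>x. indicator K x * X x i) \<in> borel_measurable (leb n)" for K X
  by (rule energy_measurable[OF that])
 show "(\<lambda>x. indicator K x * energy_deriv n p s a A U x (X x) (Y x)) \<in> borel_measurable (leb n)"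
  if "compactin (Rn n) K" "K \<subseteq> U" "!!i. i < n ==> (\<lambda>x. indicator K x * X x i) \<in> borel_measurable (leb n)"
   "!!i. i < n ==> (\<lambda>x. indicator K x * Y x i) \<in> borel_measurable (leb n)" for K X Y
  by (rule energy_deriv_measurable[OF that])
 show "AE x in leb n. x \<in> U --> (\<forall>\<xi>. H_fun n p s a A x \<xi> powr p = energy n p s a A U x \<xi>)"
  using good_point_AE[OF U A]
 proof eventually_elim
  case (elim x)
  thus ?case using H_fun_powr[of p] p unfolding energy_def by simp
 qed
 show "V \<in> L1_loc n U" by (rule V)
 show "continuous_on U u" using cu cont_iff[OF sub] by blast
 show u0: "u x > 0" if "x \<in> U" for x using sol that unfolding positive_solution_def by blast
 have uW: "u \<in> W1p_loc n p U" using sol unfolding positive_solution_def by blast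
 obtain G where G: "has_weak_grad n U u G"
  "!!i C. i < n ==> compactin (Rn n) C ==> C \<subseteq> U ==> set_integrable (leb n) C (\<lambda>x. \<bar>G x i\<bar> powr p)"
 proof (rule W1p_loc_weak_grad[OF U uW], goal_cases)
  case (1 G)
  show ?case by (rule 1(1)[OF 1(2,3)])
 qed
 show w: "has_weak_grad n U u (weak_grad n U u)" by (rule has_weak_grad_weak_grad[OF G(1)])
 show "LpK n p K (weak_grad n U u)" if K: "compactin (Rn n) K" "K \<subseteq> U" for K
 proof (rule has_weak_grad_LpK[OF w K])
  fix i assume i: "i < n"
  have "AE x in leb n. x \<in> K --> \<bar>G x i\<bar> powr p = \<bar>weak_grad n U u x i\<bar> powr p"
   using weak_grad_AE_eq[OF o G(1)] K(2) i by (auto elim!: eventually_mono)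
  thus "set_integrable (leb n) K (\<lambda>x. \<bar>weak_grad n U u x i\<bar> powr p)" by (rule set_integrable_AE(1)[OF G(2)[OF i K]])
 qed
 fix \<phi> assume \<phi>: "\<phi> \<in> Cc_smooth n U"
 have "(LINT x:U|leb n. energy_deriv n p s a A U x (weak_grad n U u x) (\<lambda>i. partial i \<phi> x))
   = (LINT x:U|leb n. \<Sum>i<n. A_field p (H_fun n p s a A) x (weak_grad n U u x) i * partial i \<phi> x)"
  unfolding set_integral_alt
 proof (rule leb_integral_cong_AE)
  show "AE x in leb n. indicator U x * energy_deriv n p s a A U x (weak_grad n U u x) (\<lambda>i. partial i \<phi> x)
    = indicator U x * (\<Sum>i<n. A_field p (H_fun n p s a A) x (weak_grad n U u x) i * partial i \<phi> x)"
   using good_point_AE[OF U A]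
  proof eventually_elim
   case (elim x)
   thus ?case unfolding energy_deriv_def by (cases "x \<in> U") auto
  qed
 qed
 moreover have "(LINT x:U|leb n. V x * u x powr (p - 1) * \<phi> x) = (LINT x:U|leb n. V x * \<bar>u x\<bar> powr (p - 2) * u x * \<phi> x)"
 proof -
  have "indicator U x * (V x * u x powr (p - 1) * \<phi> x) = indicator U x * (V x * \<bar>u x\<bar> powr (p - 2) * u x * \<phi> x)" for x
  proof (cases "x \<in> U")
   case True
   have "u x powr (p - 2) * u x = u x powr (p - 2) * u x powr 1" using u0[OF True] by simp
   also have "\<dots> = u x powr (p - 1)" unfolding powr_add[symmetric] by simp
   finally show ?thesis using u0[OF True] by (simp add: mult.assoc)
  qed simp
  thus ?thesis unfolding set_integral_alt by (rule Bochner_Integration.integral_cong[OF refl])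
 qed
 ultimately show "(LINT x:U|leb n. energy_deriv n p s a A U x (weak_grad n U u x) (\<lambda>i. partial i \<phi> x))
   + (LINT x:U|leb n. V x * u x powr (p - 1) * \<phi> x) = 0"
  using sol \<phi> unfolding positive_solution_def by simp
qed

end

theorem theorem3p22:
  fixes p s :: real
  assumes "1 < p" and "1 < s"
  shows "\<exists>C :: nat \<Rightarrow> real.
    (\<forall>n\<ge>2. 0 < C n) \<and>
    (p \<le> s \<longrightarrow> (\<forall>m\<ge>2. \<forall>n\<ge>2. C m = C n)) \<and>
    (\<forall>n \<Omega> a q V A u.
      (let H = H_fun n p s a A in
        n \<ge> 2 \<and>
        is_domain n \<Omega> \<and>
        weight_vector n \<Omega> a \<and>
        morrey_exponent n p q \<and> V \<in> morrey_loc n p q \<Omega> \<and>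
        elliptic_matrix n \<Omega> A \<and>
        (\<forall>\<phi> \<in> Cc_smooth n \<Omega>. Q_fun n p H V \<Omega> \<phi> \<ge> 0) \<and>
        positive_solution n p H V \<Omega> u \<and> cont n \<Omega> u
        \<longrightarrow>
        (\<forall>g \<in> L1_loc n \<Omega>. g \<in> hardy_space n p H V \<Omega> \<longleftrightarrow> u_norm n p H V \<Omega> u g < \<infinity>) \<and>
        (\<forall>g \<in> hardy_space n p H V \<Omega>.
           u_norm n p H V \<Omega> u g \<le> hardy_norm n p H V \<Omega> g \<and>
           hardy_norm n p H V \<Omega> g \<le> ereal (C n) * u_norm n p H V \<Omega> u g) \<and>
        is_banach_space (leb n) \<Omega> (hardy_space n p H V \<Omega>) (u_norm n p H V \<Omega> u)))"
proof -
  \<comment> \<open>The nested constant belongs to the s-norm: from the square to the s-th power in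
    each coordinate, then from \<open>s\<close> to \<open>p\<close>. It is fixed before the
    dimension and the coefficients appear.\<close>
  obtain m1 :: nat where m1: "dblc p s (dblc s 2 4) < 2 ^ m1" using real_arch_pow[of 2] by auto
  obtain m2 :: nat where m2: "dblc p 2 4 < 2 ^ m2" using real_arch_pow[of 2] by auto
  define m where "m = max m1 m2"
  have "(2::real) ^ m1 \<le> 2 ^ m" "(2::real) ^ m2 \<le> 2 ^ m" unfolding m_def by (rule power_increasing; simp)+
  then have m: "dblc p s (dblc s 2 4) \<le> 2 ^ m" "dblc p 2 4 \<le> 2 ^ m" using m1 m2 by linarith+
  define C :: real where "C = 2 powr p * (16 * real (max 2 m)) ^ m"
  have C0: "0 < C" unfolding C_def by (intro mult_pos_pos zero_less_power) auto
  show ?thesis unfolding Let_def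
  \<comment> \<open>One number for all dimensions covers both relations between \<open>p\<close> and
    \<open>s\<close>.\<close>
  proof (rule exI[of _ "\<lambda>_. C"], rule conjI[OF _ conjI], goal_cases)
    case 3
    show ?case
    proof (intro allI impI, goal_cases)
      case (1 n \<Omega> a q V A u)
      then have an: "anisotropic n p s \<Omega> a A" using assms by unfold_locales blast+
      have V: "V \<in> L1_loc n \<Omega>" by (rule morrey_loc_L1_loc[of n \<Omega> V p q]) (use 1 in blast)+
      interpret energy_form n \<Omega> p m "energy n p s a A \<Omega>" "energy_deriv n p s a A \<Omega>" V u "weak_grad n \<Omega> u" "H_fun n p s a A"
        by (rule anisotropic.energy_form_instance[OF an m V]) (use 1 in blast)+
      have "C = mazya_const" unfolding C_def mazya_const_def ..
      then have ne: "hardy_norm n p (H_fun n p s a A) V \<Omega> g \<le> ereal C * N_u g" if "g \<in> X_space" for g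
        using norm_equivalence(2)[OF that] by (simp only:)
      have iff: "g \<in> X_space \<longleftrightarrow> N_u g < \<infinity>" if "g \<in> L1_loc n \<Omega>" for g
        unfolding N_u_finite_iff by (rule hardy_space_iff[OF that])
      show ?case by (intro conjI ballI iff norm_equivalence(1) ne hardy_space_banach)
    qed
  qed (use C0 in auto)
qed

end
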